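(* Let $0<\beta<1$ and let $f$ be a $C^{1+\beta}$ diffeomorphism of a compact manifold $X$. Let $\mathcal{W}$ and $\mathcal{W}^s$ be transverse $f$-invariant topological foliations of $X$ with uniformly $C^{1+\beta}$ leaves which integrate to a joint topological foliation $\mathcal{V}$. Suppose that there are continuous Riemannian metrics on $\mathcal{E}=T\mathcal{W}$ and $\mathcal{E}^s=T\mathcal{W}^s$ and constants $\nu$, $\gamma$, $\hat\gamma$ such that $$\|Df_x(v^s)\|<\nu<1<\gamma^{-1}<\|Df_x(v)\|<\hat\gamma$$ for any $x\in X$ and any unit vectors $v^s\in\mathcal{E}^s_x$ and $v\in\mathcal{E}_x$. Suppose that $\mathcal{E}$ is $\beta$-Hölder and $f$ satisfies the bunching assumptions $$\hat\gamma\,\gamma\,\nu^{\beta/(1+\beta)}<1\quad\text{and}\quad\hat\gamma\,\gamma^{1+\beta}<1.$$ Then for any $x\in X$ and $y\in\mathcal{W}^s(x)$, the local $\mathcal{W}^s$ holonomy $\mathcal{H}_{x,y}:\mathcal{W}(x)\to\mathcal{W}(y)$ is differentiable and $D_x\mathcal{H}_{x,y}=H_{x,y}$, where $H_{x,y}=H^{s,\mathcal{A}}_{x,y}:\mathcal{E}_x\to\mathcal{E}_y$ is the $\mathcal{W}^s$ holonomy of the cocycle $\mathcal{A}=Df|_{\mathcal{E}}$.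
   Context: **Uniformly $C^{1+\beta}$ leaves.** A topological foliation of $X$ has uniformly $C^{1+\beta}$ leaves if its leaves are $C^{1+\beta}$ submanifolds which vary continuously in the $C^1$ topology and its tangent bundle is $\beta$-Hölder on $X$. **Joint foliation.** $\mathcal{W}$ and $\mathcal{W}^s$ integrate to $\mathcal{V}$ if the leaves of $\mathcal{V}$ are subfoliated by those of $\mathcal{W}$ and of $\mathcal{W}^s$, which form locally a product structure in each leaf of $\mathcal{V}$. **Local $\mathcal{W}^s$ holonomy.** For $y\in\mathcal{W}^s(x)$, $\mathcal{H}_{x,y}$ is the map from a neighborhood of $x$ in the leaf $\mathcal{W}(x)$ to the leaf $\mathcal{W}(y)$ obtained by sliding along the leaves of $\mathcal{W}^s$ inside the leaf of $\mathcal{V}$ containing $x$ and $y$: $\mathcal{H}_{x,y}(x)=y$ and $\mathcal{H}_{x,y}(z)$ is the (locally unique) intersection point of the $\mathcal{W}^s$-leaf of $z$ with $\mathcal{W}(y)$, chosen continuously from $y$. **Cocycle holonomy.** Let $\mathcal{A}_x=Df|_{\mathcal{E}_x}:\mathcal{E}_x\to\mathcal{E}_{fx}$ and $\mathcal{A}^n_x=\mathcal{A}_{f^{n-1}x}\circ\cdots\circ\mathcal{A}_x$. For $y\in\mathcal{W}^s(x)$, $$H^{s,\mathcal{A}}_{x,y}=\lim_{n\to\infty}(\mathcal{A}^n_y)^{-1}\circ I_{f^nx,f^ny}\circ\mathcal{A}^n_x,$$ where $I_{z,w}:\mathcal{E}_z\to\mathcal{E}_w$ are $\beta$-Hölder identifications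 of fibers at nearby points (e.g. coming from local coordinates), $I_{z,z}=\mathrm{Id}$; when $f$ is $C^{1+\beta}$, $\mathcal{E}$ is $\beta$-Hölder, $\|Df_x(v^s)\|<\nu<1<\gamma^{-1}<\|Df_x(v)\|<\hat\gamma$ for all $x\in X$ and all unit vectors $v^s\in\mathcal{E}^s_x$, $v\in\mathcal{E}_x$, and $\hat\gamma\,\gamma\,\nu^{\beta/(1+\beta)}<1$ (which implies $\hat\gamma\,\gamma\,\nu^{\beta}<1$, i.e. the $\beta$-Hölder cocycle $\mathcal{A}$ is bunched along $\mathcal{W}^s$), the limit exists and does not depend on the choice of identifications. It satisfies $\mathcal{A}_x=H_{fy,fx}\circ\mathcal{A}_y\circ H_{x,y}$ and $\|H_{x,y}-\mathrm{Id}\|\le K\,\mathrm{dist}(x,y)^\beta$ for $y$ in the local $\mathcal{W}^s$-leaf of $x$ (with fibers identified). *)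

theory Defs
  imports "HOL-Analysis.Analysis"
begin

section \<open>Regularity classes on open subsets of Euclidean space\<close>

primrec Ck_on :: "nat \<Rightarrow> ('e::euclidean_space \<Rightarrow> 'f::euclidean_space) \<Rightarrow> 'e set \<Rightarrow> bool" where
  "Ck_on 0 g S \<longleftrightarrow> continuous_on S g"
| "Ck_on (Suc k) g S \<longleftrightarrow>
     (\<exists>g'. (\<forall>u\<in>S. (g has_derivative g' u) (at u)) \<and> (\<forall>v. Ck_on k (\<lambda>u. g' u v) S))"

definition smooth_on :: "('e::euclidean_space \<Rightarrow> 'f::euclidean_space) \<Rightarrow> 'e set \<Rightarrow> bool" where
  "smooth_on g S \<longleftrightarrow> (\<forall>k. Ck_on k g S)"

definition C1_holder_on ::
  "real \<Rightarrow> ('e::euclidean_space \<Rightarrow> 'f::euclidean_space) \<Rightarrow> 'e set \<Rightarrow> bool" where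
  "C1_holder_on \<beta> g S \<longleftrightarrow>
     (\<exists>g'. (\<forall>u\<in>S. (g has_derivative g' u) (at u)) \<and>
       (\<forall>u\<in>S. \<exists>\<delta>>0. \<exists>K. \<forall>p\<in>S \<inter> ball u \<delta>. \<forall>q\<in>S \<inter> ball u \<delta>.
          onorm (\<lambda>v. g' p v - g' q v) \<le> K * dist p q powr \<beta>))"


section \<open>Compact manifolds\<close>

text \<open>
  A manifold is a set \<open>X\<close> in a Hausdorff space with a smooth atlas of charts into a Euclidean
  space. All sets of charts and boxes below are relative to the subspace topology of \<open>X\<close>.
\<close>

record ('a, 'e) chart =
  cdom :: "'a set"
  cmap :: "'a \<Rightarrow> 'e"

definition cinv :: "('a, 'e) chart \<Rightarrow> 'e \<Rightarrow> 'a" where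
  "cinv c = inv_into (cdom c) (cmap c)"

definition smooth_atlas ::
  "'a::t2_space set \<Rightarrow> ('a, 'e::euclidean_space) chart set \<Rightarrow> bool" where
  "smooth_atlas X \<A> \<longleftrightarrow>
     (\<forall>c\<in>\<A>. openin (top_of_set X) (cdom c) \<and> open (cmap c ` cdom c) \<and>
        homeomorphism (cdom c) (cmap c ` cdom c) (cmap c) (cinv c)) \<and>
     (\<Union>c\<in>\<A>. cdom c) = X \<and>
     (\<forall>c\<in>\<A>. \<forall>c'\<in>\<A>. smooth_on (cmap c' \<circ> cinv c) (cmap c ` (cdom c \<inter> cdom c')))"

definition compact_manifold ::
  "'a::t2_space set \<Rightarrow> ('a, 'e::euclidean_space) chart set \<Rightarrow> bool" where
  "compact_manifold X \<A> \<longleftrightarrow> compact X \<and> smooth_atlas X \<A>"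

text \<open>
  A tangent vector at \<open>x\<close> is represented by its coordinates in a preferred chart at \<open>x\<close>,
  so that \<open>T\<^sub>x X\<close> is a copy of the model space \<open>'e\<close> and derivatives are linear maps of \<open>'e\<close>.
  The map \<open>tcoord \<A> c x\<close> passes from these coordinates to those in a chart \<open>c\<close> around \<open>x\<close>.
\<close>

definition chart_at :: "('a, 'e) chart set \<Rightarrow> 'a \<Rightarrow> ('a, 'e) chart" where
  "chart_at \<A> x = (SOME c. c \<in> \<A> \<and> x \<in> cdom c)"

definition tcoord ::
  "('a, 'e::euclidean_space) chart set \<Rightarrow> ('a, 'e) chart \<Rightarrow> 'a \<Rightarrow> 'e \<Rightarrow> 'e" where
  "tcoord \<A> c x =
     frechet_derivative (cmap c \<circ> cinv (chart_at \<A> x)) (at (cmap (chart_at \<A> x) x))"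

definition mderiv ::
  "('a, 'e::euclidean_space) chart set \<Rightarrow> ('a \<Rightarrow> 'a) \<Rightarrow> 'a \<Rightarrow> 'e \<Rightarrow> 'e" where
  "mderiv \<A> f x =
     frechet_derivative (cmap (chart_at \<A> (f x)) \<circ> f \<circ> cinv (chart_at \<A> x))
       (at (cmap (chart_at \<A> x) x))"

definition C1_holder_map ::
  "real \<Rightarrow> 'a::t2_space set \<Rightarrow> ('a, 'e::euclidean_space) chart set \<Rightarrow> ('a \<Rightarrow> 'a) \<Rightarrow> bool" where
  "C1_holder_map \<beta> X \<A> f \<longleftrightarrow>
     f \<in> X \<rightarrow> X \<and> continuous_on X f \<and>
     (\<forall>c\<in>\<A>. \<forall>c'\<in>\<A>.
        C1_holder_on \<beta> (cmap c' \<circ> f \<circ> cinv c) (cmap c ` {x \<in> cdom c. f x \<in> cdom c'}))"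

definition C1_holder_diffeo ::
  "real \<Rightarrow> 'a::t2_space set \<Rightarrow> ('a, 'e::euclidean_space) chart set \<Rightarrow> ('a \<Rightarrow> 'a) \<Rightarrow> bool" where
  "C1_holder_diffeo \<beta> X \<A> f \<longleftrightarrow>
     bij_betw f X X \<and> C1_holder_map \<beta> X \<A> f \<and> C1_holder_map \<beta> X \<A> (inv_into X f)"


section \<open>Topological foliations\<close>

text \<open>
  A foliation is given by a foliated atlas. A foliation box maps an open set homeomorphically to a
  product of unit balls in a subspace \<open>L\<close> (the leaf direction) and in its orthogonal complement;
  plaques are the preimages of the slices parallel to \<open>L\<close>. Using subspaces of the model space,
  rather than two separate factors, also covers the foliation whose leaves are open in \<open>X\<close>.
\<close>

record ('a, 'e) fbox =
  bdom :: "'a set"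
  bmap :: "'a \<Rightarrow> 'e"
  bdir :: "'e set"

definition binv :: "('a, 'e) fbox \<Rightarrow> 'e \<Rightarrow> 'a" where
  "binv B = inv_into (bdom B) (bmap B)"

definition plaque :: "('a, 'e::euclidean_space) fbox \<Rightarrow> 'a \<Rightarrow> 'a set" where
  "plaque B x = {y \<in> bdom B. bmap B y - bmap B x \<in> bdir B}"

definition foliation_box ::
  "'a::t2_space set \<Rightarrow> nat \<Rightarrow> ('a, 'e::euclidean_space) fbox \<Rightarrow> bool" where
  "foliation_box X k B \<longleftrightarrow>
     openin (top_of_set X) (bdom B) \<and>
     subspace (bdir B) \<and> dim (bdir B) = k \<and>
     bmap B ` bdom B =
       {a + b | a b. a \<in> bdir B \<and> norm a < 1 \<and> (\<forall>v\<in>bdir B. orthogonal v b) \<and> norm b < 1} \<and>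
     homeomorphism (bdom B) (bmap B ` bdom B) (bmap B) (binv B)"

text \<open>Overlapping boxes are required to have the same plaques locally.\<close>

definition foliated_atlas ::
  "'a::t2_space set \<Rightarrow> nat \<Rightarrow> ('a, 'e::euclidean_space) fbox set \<Rightarrow> bool" where
  "foliated_atlas X k \<F> \<longleftrightarrow>
     (\<forall>B\<in>\<F>. foliation_box X k B) \<and> (\<Union>B\<in>\<F>. bdom B) = X \<and>
     (\<forall>B\<in>\<F>. \<forall>B'\<in>\<F>. \<forall>x\<in>bdom B \<inter> bdom B'.
        \<exists>N. openin (top_of_set X) N \<and> x \<in> N \<and> N \<subseteq> bdom B \<inter> bdom B' \<and>
          (\<forall>p\<in>N. \<forall>q\<in>N. q \<in> plaque B p \<longleftrightarrow> q \<in> plaque B' p))"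

definition leaf :: "('a, 'e::euclidean_space) fbox set \<Rightarrow> 'a \<Rightarrow> 'a set" where
  "leaf \<F> x = {y. (x, y) \<in> {(p, q). \<exists>B\<in>\<F>. p \<in> bdom B \<and> q \<in> plaque B p}\<^sup>*}"

text \<open>
  The leaf topology on \<open>X\<close>, finer than the given one; each leaf is open in it, and its subspace
  topology on a leaf is the intrinsic manifold topology of that leaf.
\<close>

definition leaf_topology ::
  "('a::t2_space, 'e::euclidean_space) fbox set \<Rightarrow> 'a topology" where
  "leaf_topology \<F> =
     topology_generated_by {plaque B x \<inter> N | B x N. B \<in> \<F> \<and> x \<in> bdom B \<and> open N}"

definition invariant_foliation ::
  "'a::t2_space set \<Rightarrow> ('a \<Rightarrow> 'a) \<Rightarrow> ('a, 'e::euclidean_space) fbox set \<Rightarrow> bool" where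
  "invariant_foliation X f \<F> \<longleftrightarrow> (\<forall>x\<in>X. f ` leaf \<F> x = leaf \<F> (f x))"


section \<open>Uniformly \<open>C\<^sup>1\<^sup>+\<^sup>\<beta>\<close> leaves\<close>

text \<open>
  \<open>leaf_tangent \<A> B x a\<close> is the tangent vector at \<open>x\<close> whose coordinate in the leaf chart
  given by \<open>B\<close> is \<open>a \<in> bdir B\<close>.
\<close>

definition leaf_tangent ::
  "('a, 'e::euclidean_space) chart set \<Rightarrow> ('a, 'e) fbox \<Rightarrow> 'a \<Rightarrow> 'e \<Rightarrow> 'e" where
  "leaf_tangent \<A> B x a =
     vector_derivative (\<lambda>t. cmap (chart_at \<A> x) (binv B (bmap B x + t *\<^sub>R a))) (at 0)"

definition tangent_bundle ::
  "('a, 'e::euclidean_space) chart set \<Rightarrow> ('a, 'e) fbox set \<Rightarrow> 'a \<Rightarrow> 'e set" where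
  "tangent_bundle \<A> \<F> x = {leaf_tangent \<A> B x a | B a. B \<in> \<F> \<and> x \<in> bdom B \<and> a \<in> bdir B}"

text \<open>
  Hoelder dependence of a field of subspaces, in local coordinates; the condition is symmetric in
  \<open>y\<close> and \<open>z\<close>, so it bounds the gap (the usual distance in the Grassmannian).
\<close>

definition holder_subbundle ::
  "real \<Rightarrow> 'a::t2_space set \<Rightarrow> ('a, 'e::euclidean_space) chart set \<Rightarrow> ('a \<Rightarrow> 'e set) \<Rightarrow> bool" where
  "holder_subbundle \<beta> X \<A> E \<longleftrightarrow>
     (\<forall>x\<in>X. subspace (E x)) \<and>
     (\<forall>c\<in>\<A>. \<forall>x\<in>cdom c. \<exists>N K. openin (top_of_set X) N \<and> x \<in> N \<and> N \<subseteq> cdom c \<and>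
        (\<forall>y\<in>N. \<forall>z\<in>N. \<forall>v\<in>tcoord \<A> c y ` E y.
           infdist v (tcoord \<A> c z ` E z) \<le> K * dist (cmap c y) (cmap c z) powr \<beta> * norm v))"

text \<open>
  The inverses of the boxes parametrize the plaques. In every chart of \<open>X\<close> these parametrizations
  are \<open>C\<^sup>1\<^sup>+\<^sup>\<beta>\<close> immersions of each plaque whose derivatives along the plaques
  are continuous on the whole box. (For leaves that are locally graphs over a common disc varying
  continuously in \<open>C\<^sup>1\<close>, the graph coordinates give boxes of this kind.)
\<close>

definition uniformly_C1_holder_leaves ::
  "real \<Rightarrow> 'a::t2_space set \<Rightarrow> ('a, 'e::euclidean_space) chart set \<Rightarrow> ('a, 'e) fbox set \<Rightarrow> bool" where
  "uniformly_C1_holder_leaves \<beta> X \<A> \<F> \<longleftrightarrow>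
     (\<forall>B\<in>\<F>. \<forall>c\<in>\<A>. \<exists>D. let S = bmap B ` (bdom B \<inter> cdom c); L = bdir B in
        (\<forall>u\<in>S. ((\<lambda>a. cmap c (binv B (u + a))) has_derivative D u) (at 0 within L) \<and>
                inj_on (D u) L) \<and>
        (\<forall>a\<in>L. continuous_on S (\<lambda>u. D u a)) \<and>
        (\<forall>u\<in>S. \<exists>\<delta>>0. \<exists>K. \<forall>p\<in>S \<inter> ball u \<delta>. \<forall>q\<in>S \<inter> ball u \<delta>.
           p - u \<in> L \<and> q - u \<in> L \<longrightarrow>
           (\<forall>a\<in>L. norm (D p a - D q a) \<le> K * dist p q powr \<beta> * norm a))) \<and>
     holder_subbundle \<beta> X \<A> (tangent_bundle \<A> \<F>)"


section \<open>Transversality and joint foliations\<close>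

definition transverse ::
  "'a::t2_space set \<Rightarrow> ('a, 'e::euclidean_space) chart set \<Rightarrow>
     ('a, 'e) fbox set \<Rightarrow> ('a, 'e) fbox set \<Rightarrow> bool" where
  "transverse X \<A> \<W> \<W>s \<longleftrightarrow> (\<forall>x\<in>X. tangent_bundle \<A> \<W> x \<inter> tangent_bundle \<A> \<W>s x = {0})"

text \<open>
  Near \<open>x\<close> the leaf of \<open>\<V>\<close> is the product, via \<open>\<Phi>\<close>, of neighbourhoods \<open>P\<close> and \<open>Q\<close> of \<open>x\<close>
  in its \<open>\<W>\<close>- and \<open>\<W>s\<close>-leaves: the slices \<open>P \<times> {q}\<close> and \<open>{p} \<times> Q\<close> go to open pieces of
  the \<open>\<W>\<close>-leaf of \<open>q\<close> and of the \<open>\<W>s\<close>-leaf of \<open>p\<close>. All topologies are leaf topologies.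
\<close>

definition local_product_at ::
  "('a::t2_space, 'e::euclidean_space) fbox set \<Rightarrow> ('a, 'e) fbox set \<Rightarrow> ('a, 'e) fbox set \<Rightarrow>
     'a \<Rightarrow> bool" where
  "local_product_at \<W> \<W>s \<V> x \<longleftrightarrow>
     (\<exists>P Q R \<Phi>.
        openin (leaf_topology \<W>) P \<and> x \<in> P \<and> P \<subseteq> leaf \<W> x \<and>
        openin (leaf_topology \<W>s) Q \<and> x \<in> Q \<and> Q \<subseteq> leaf \<W>s x \<and>
        openin (leaf_topology \<V>) R \<and> R \<subseteq> leaf \<V> x \<and>
        homeomorphic_map
          (prod_topology (subtopology (leaf_topology \<W>) P) (subtopology (leaf_topology \<W>s) Q))
          (subtopology (leaf_topology \<V>) R) \<Phi> \<and>
        (\<forall>p\<in>P. \<Phi> (p, x) = p) \<and> (\<forall>q\<in>Q. \<Phi> (x, q) = q) \<and>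
        (\<forall>p\<in>P. \<forall>q\<in>Q. \<Phi> (p, q) \<in> leaf \<W> q \<inter> leaf \<W>s p) \<and>
        (\<forall>q\<in>Q. continuous_map (subtopology (leaf_topology \<W>) P) (leaf_topology \<W>)
                   (\<lambda>p. \<Phi> (p, q)) \<and>
                open_map (subtopology (leaf_topology \<W>) P) (leaf_topology \<W>)
                   (\<lambda>p. \<Phi> (p, q))) \<and>
        (\<forall>p\<in>P. continuous_map (subtopology (leaf_topology \<W>s) Q) (leaf_topology \<W>s)
                   (\<lambda>q. \<Phi> (p, q)) \<and>
                open_map (subtopology (leaf_topology \<W>s) Q) (leaf_topology \<W>s)
                   (\<lambda>q. \<Phi> (p, q))))"

definition integrate_to ::
  "'a::t2_space set \<Rightarrow> ('a, 'e::euclidean_space) fbox set \<Rightarrow> ('a, 'e) fbox set \<Rightarrow>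
     ('a, 'e) fbox set \<Rightarrow> bool" where
  "integrate_to X \<W> \<W>s \<V> \<longleftrightarrow>
     (\<forall>x\<in>X. leaf \<W> x \<subseteq> leaf \<V> x \<and> leaf \<W>s x \<subseteq> leaf \<V> x \<and> local_product_at \<W> \<W>s \<V> x)"


section \<open>Riemannian metrics on subbundles\<close>

definition inner_product_on :: "'e::euclidean_space set \<Rightarrow> ('e \<Rightarrow> 'e \<Rightarrow> real) \<Rightarrow> bool" where
  "inner_product_on V g \<longleftrightarrow>
     (\<forall>u\<in>V. \<forall>v\<in>V. g u v = g v u) \<and>
     (\<forall>u\<in>V. \<forall>v\<in>V. \<forall>w\<in>V. \<forall>r s. g (r *\<^sub>R u + s *\<^sub>R v) w = r * g u w + s * g v w) \<and>
     (\<forall>v\<in>V. v \<noteq> 0 \<longrightarrow> 0 < g v v)"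

text \<open>Continuity is that of the local coordinate expression \<open>(x, v, w) \<mapsto> g\<^sub>x(v, w)\<close>.\<close>

definition continuous_metric ::
  "'a::t2_space set \<Rightarrow> ('a, 'e::euclidean_space) chart set \<Rightarrow> ('a \<Rightarrow> 'e set) \<Rightarrow>
     ('a \<Rightarrow> 'e \<Rightarrow> 'e \<Rightarrow> real) \<Rightarrow> bool" where
  "continuous_metric X \<A> E g \<longleftrightarrow>
     (\<forall>x\<in>X. inner_product_on (E x) (g x)) \<and>
     (\<forall>c\<in>\<A>. continuous_on
        {(x, v, w). x \<in> cdom c \<and> v \<in> tcoord \<A> c x ` E x \<and> w \<in> tcoord \<A> c x ` E x}
        (\<lambda>(x, v, w). g x (inv (tcoord \<A> c x) v) (inv (tcoord \<A> c x) w)))"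

definition metric_norm :: "('a \<Rightarrow> 'e \<Rightarrow> 'e \<Rightarrow> real) \<Rightarrow> 'a \<Rightarrow> 'e \<Rightarrow> real" where
  "metric_norm g x v = sqrt (g x v v)"


section \<open>Holonomy of the foliation and of the cocycle\<close>

text \<open>
  \<open>H\<close>, defined on the neighbourhood \<open>N\<close> of \<open>x\<close> in \<open>leaf \<W> x\<close>, is obtained by sliding along
  \<open>\<W>s\<close>: the motion \<open>\<sigma>\<close> moves every \<open>z \<in> N\<close> within its \<open>\<W>s\<close>-leaf, keeps the moving
  points in a common \<open>\<W>\<close>-leaf, is continuous in the leaf of \<open>\<V>\<close>, and takes \<open>x\<close> to \<open>y\<close>.
  Without the motion, continuity of \<open>z \<mapsto> H z \<in> leaf \<W>s z \<inter> leaf \<W> y\<close> alone would not obviously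
  single out a germ, as this intersection may be dense in \<open>leaf \<W> y\<close>.
\<close>

definition local_holonomy ::
  "('a::t2_space, 'e::euclidean_space) fbox set \<Rightarrow> ('a, 'e) fbox set \<Rightarrow> ('a, 'e) fbox set \<Rightarrow>
     'a \<Rightarrow> 'a \<Rightarrow> 'a set \<Rightarrow> ('a \<Rightarrow> 'a) \<Rightarrow> bool" where
  "local_holonomy \<W> \<W>s \<V> x y N H \<longleftrightarrow>
     openin (leaf_topology \<W>) N \<and> x \<in> N \<and> N \<subseteq> leaf \<W> x \<and> H x = y \<and>
     (\<exists>\<sigma> :: real \<Rightarrow> 'a \<Rightarrow> 'a.
        (\<forall>z\<in>N. \<sigma> 0 z = z \<and> \<sigma> 1 z = H z) \<and>
        (\<forall>t\<in>{0..1}. \<forall>z\<in>N. \<sigma> t z \<in> leaf \<W>s z \<inter> leaf \<W> (\<sigma> t x)) \<and>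
        (\<forall>z\<in>N. continuous_map (top_of_set {0..1}) (leaf_topology \<W>s) (\<lambda>t. \<sigma> t z)) \<and>
        (\<forall>t\<in>{0..1}. continuous_map (subtopology (leaf_topology \<W>) N) (leaf_topology \<W>) (\<sigma> t)) \<and>
        continuous_map
          (prod_topology (top_of_set {0..1}) (subtopology (leaf_topology \<W>) N))
          (leaf_topology \<V>) (\<lambda>(t, z). \<sigma> t z))"

text \<open>
  Derivative at \<open>x\<close> of a map \<open>H\<close> between leaves of \<open>\<F>\<close>: its expression in the leaf charts
  given by boxes \<open>B\<close> at \<open>x\<close> and \<open>B'\<close> at \<open>H x\<close> has derivative \<open>M\<close>, and \<open>T\<close> is the
  corresponding map of the tangent spaces of the leaves; only \<open>T\<close> on the tangent space matters.
\<close>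

definition leaf_has_derivative ::
  "('a, 'e::euclidean_space) chart set \<Rightarrow> ('a, 'e) fbox set \<Rightarrow> ('a \<Rightarrow> 'a) \<Rightarrow> 'a \<Rightarrow>
     ('e \<Rightarrow> 'e) \<Rightarrow> bool" where
  "leaf_has_derivative \<A> \<F> H x T \<longleftrightarrow>
     (\<forall>B\<in>\<F>. \<forall>B'\<in>\<F>. x \<in> bdom B \<and> H x \<in> bdom B' \<longrightarrow>
        (\<exists>M. ((\<lambda>a. bmap B' (H (binv B (bmap B x + a)))) has_derivative M) (at 0 within bdir B) \<and>
             (\<forall>a\<in>bdir B. M a \<in> bdir B' \<and>
                T (leaf_tangent \<A> B x a) = leaf_tangent \<A> B' (H x) (M a))))"

text \<open>
  Identifications \<open>I z w\<close> of the fibres at nearby points (the neighbourhoods \<open>N\<close> say which);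
  values at distant points, and outside the fibres, are irrelevant.
\<close>

definition holder_identifications ::
  "real \<Rightarrow> 'a::t2_space set \<Rightarrow> ('a, 'e::euclidean_space) chart set \<Rightarrow> ('a \<Rightarrow> 'e set) \<Rightarrow>
     ('a \<Rightarrow> 'a \<Rightarrow> 'e \<Rightarrow> 'e) \<Rightarrow> bool" where
  "holder_identifications \<beta> X \<A> E I \<longleftrightarrow>
     (\<forall>x\<in>X. \<forall>v\<in>E x. I x x v = v) \<and>
     (\<forall>c\<in>\<A>. \<forall>x\<in>cdom c. \<exists>N K. openin (top_of_set X) N \<and> x \<in> N \<and> N \<subseteq> cdom c \<and>
        (\<forall>z\<in>N. \<forall>w\<in>N. linear (I z w) \<and> bij_betw (I z w) (E z) (E w) \<and>
           (\<forall>v\<in>E z. norm (tcoord \<A> c w (I z w v) - tcoord \<A> c z v)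
              \<le> K * dist (cmap c z) (cmap c w) powr \<beta> * norm (tcoord \<A> c z v))))"

primrec cocycle_iter ::
  "('a, 'e::euclidean_space) chart set \<Rightarrow> ('a \<Rightarrow> 'a) \<Rightarrow> nat \<Rightarrow> 'a \<Rightarrow> 'e \<Rightarrow> 'e" where
  "cocycle_iter \<A> f 0 x = id"
| "cocycle_iter \<A> f (Suc n) x = mderiv \<A> f ((f ^^ n) x) \<circ> cocycle_iter \<A> f n x"

definition cocycle_holonomy_seq ::
  "('a, 'e::euclidean_space) chart set \<Rightarrow> ('a \<Rightarrow> 'e set) \<Rightarrow> ('a \<Rightarrow> 'a) \<Rightarrow>
     ('a \<Rightarrow> 'a \<Rightarrow> 'e \<Rightarrow> 'e) \<Rightarrow> 'a \<Rightarrow> 'a \<Rightarrow> 'e \<Rightarrow> nat \<Rightarrow> 'e" where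
  "cocycle_holonomy_seq \<A> E f I x y v n =
     inv_into (E y) (cocycle_iter \<A> f n y)
       (I ((f ^^ n) x) ((f ^^ n) y) (cocycle_iter \<A> f n x v))"

definition cocycle_holonomy ::
  "('a, 'e::euclidean_space) chart set \<Rightarrow> ('a \<Rightarrow> 'e set) \<Rightarrow> ('a \<Rightarrow> 'a) \<Rightarrow>
     ('a \<Rightarrow> 'a \<Rightarrow> 'e \<Rightarrow> 'e) \<Rightarrow> 'a \<Rightarrow> 'a \<Rightarrow> 'e \<Rightarrow> 'e" where
  "cocycle_holonomy \<A> E f I x y v = lim (cocycle_holonomy_seq \<A> E f I x y v)"

end

theory Submission imports Defs begin

text \<open>
  The foliation holonomy \<open>H\<close> commutes with \<open>f\<close>, and so does the cocycle holonomy with \<open>Df\<close>. To compare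
  them at \<open>x\<close>, take a point \<open>z\<close> near \<open>x\<close> in its \<open>\<W>\<close>-leaf, let \<open>y = H x\<close> and \<open>z' = H z\<close>, and iterate.
  The displacements from \<open>f\<^sup>n x\<close> to \<open>f\<^sup>n z\<close> and from \<open>f\<^sup>n y\<close> to \<open>f\<^sup>n z'\<close> grow exponentially, while \<open>f\<^sup>n x\<close>
  and \<open>f\<^sup>n y\<close>, and \<open>f\<^sup>n z\<close> and \<open>f\<^sup>n z'\<close>, approach each other like \<open>\<nu>\<^sup>n\<close>. Hence, in a common chart, the two
  displacements at time \<open>n\<close> differ by \<open>O(\<nu>\<^sup>n)\<close> only. Pulling both back to time \<open>0\<close> by the derivative
  cocycle, along the orbits of \<open>x\<close> and \<open>y\<close>, shows that the tangent vector at \<open>y\<close> which represents \<open>z'\<close> is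
  the image, under the \<open>n\<close>-th approximation of the cocycle holonomy, of the one at \<open>x\<close> which represents
  \<open>z\<close>, up to an error.

  The number \<open>n\<close> is chosen such that the displacement at time \<open>n\<close> has the size \<open>s = \<nu>\<^bsup>n/(1+\<beta>)\<^esup>\<close>. Then
  all errors are of the same order at time \<open>n\<close>: the distance \<open>\<nu>\<^sup>n = s\<^bsup>1+\<beta>\<^esup>\<close> of the orbits, the
  nonlinearity \<open>s\<^bsup>1+\<beta>\<^esup>\<close> of \<open>f\<close> along the leaves, and the identifications of fibres, which contribute
  \<open>\<nu>\<^bsup>n\<beta>\<^esup> s\<close> at most. At time \<open>0\<close> the error is at most a multiple of \<open>\<gamma>\<^sup>n s\<^bsup>1+\<beta>\<^esup>\<close>, whereas the
  displacement from \<open>x\<close> to \<open>z\<close> is at least a multiple of \<open>s\<close> divided by the \<open>n\<close>-th power of the upper rate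
  of expansion. So the relative error is at most a multiple of the \<open>n\<close>-th power of the quantity that is
  less than \<open>1\<close> by the first bunching condition, and \<open>n\<close> tends to infinity as \<open>z\<close> tends to \<open>x\<close>. This is
  \<open>main_estimate\<close> and \<open>holonomy_derivative\<close>; they are proved for maps in abstract charts, from the
  estimates \<open>contraction\<close> and \<open>expansion\<close> for nearby points of a leaf.

  Three further facts connect this with the foliations. Locally \<open>f\<close> maps plaques into plaques
  (\<open>plaque_image_local\<close>), which is not part of the definition of an invariant foliation and follows
  from a countability argument. A plaque deviates from its tangent plane only to order \<open>1 + \<beta>\<close>, with a
  constant that is uniform across the leaves (\<open>leaf_taylor_local\<close>); this comes from the Hoelder
  condition on the tangent bundle. Finally, a holonomy moves all points near \<open>x\<close> to their images by
  chains of the same number of short steps within plaques of \<open>\<W>s\<close> (\<open>sliding_chain\<close>), so that the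
  contraction estimate applies to \<open>z\<close> and \<open>z'\<close> uniformly in \<open>z\<close>. Holonomies exist because they do so
  in the local products, and they can be composed (\<open>local_holonomy_exists\<close>).
\<close>

section \<open>Orthogonal projections\<close>

definition proj :: "'e::euclidean_space set \<Rightarrow> 'e \<Rightarrow> 'e" where
  "proj L = (SOME P. linear P \<and> (\<forall>w. P w \<in> L \<and> (\<forall>v\<in>L. orthogonal v (w - P w))))"

lemma proj_exists:
  fixes L :: "'e::euclidean_space set"
  assumes L: "subspace L"
  shows "\<exists>P. linear P \<and> (\<forall>w. P w \<in> L \<and> (\<forall>v\<in>L. orthogonal v (w - P w)))"
proof -
  obtain B where B: "B \<subseteq> L" "pairwise orthogonal B" "\<And>x. x \<in> B \<Longrightarrow> norm x = 1"
      "independent B" "card B = dim L" "span B = L"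
    by (metis orthonormal_basis_subspace [OF L])
  have fin: "finite B" using B(4) independent_imp_finite by blast
  define P where "P w = (\<Sum>b\<in>B. (w \<bullet> b) *\<^sub>R b)" for w
  have "linear P"
    by (intro linearI) (auto simp: P_def algebra_simps sum.distrib scaleR_sum_right)
  moreover have "P w \<in> L" for w
    unfolding P_def using B(1) L by (intro subspace_sum subspace_scale) auto
  moreover have "orthogonal v (w - P w)" if "v \<in> L" for v w
  proof -
    have b: "b \<bullet> (w - P w) = 0" if "b \<in> B" for b
    proof -
      have "b \<bullet> P w = (\<Sum>c\<in>B. (w \<bullet> c) * (b \<bullet> c))"
        by (simp add: P_def inner_sum_right)
      also have "\<dots> = (\<Sum>c\<in>B. if c = b then w \<bullet> b else 0)"
        using B(2,3) that
        by (intro sum.cong) (auto simp: pairwise_def orthogonal_def norm_eq_1)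
      finally show ?thesis using fin that by (simp add: algebra_simps inner_commute)
    qed
    have "orthogonal (w - P w) v"
      by (rule orthogonal_to_span [of v B]) (use b that B(6) in \<open>auto simp: orthogonal_def inner_commute\<close>)
    then show ?thesis by (simp add: orthogonal_commute)
  qed
  ultimately show ?thesis by blast
qed

context
  fixes L :: "'e::euclidean_space set"
  assumes L: "subspace L"
begin

lemma proj_props: "linear (proj L)" "proj L w \<in> L" "v \<in> L \<Longrightarrow> orthogonal v (w - proj L w)"
  using someI_ex [OF proj_exists [OF L]] unfolding proj_def by blast+

lemma proj_unique:
  assumes "a \<in> L" "\<And>v. v \<in> L \<Longrightarrow> orthogonal v b" shows "proj L (a + b) = a"
proof -
  let ?d = "proj L (a + b) - a"
  have d: "?d \<in> L" using assms(1) proj_props(2) L by (simp add: subspace_diff)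
  have "?d \<bullet> (a + b - proj L (a + b)) = 0" "?d \<bullet> b = 0"
    using proj_props(3)[OF d] assms(2)[OF d] by (auto simp: orthogonal_def)
  then have "?d \<bullet> ?d = 0" by (simp add: algebra_simps inner_commute)
  then show ?thesis by simp
qed

lemma proj_id: "a \<in> L \<Longrightarrow> proj L a = a"
  using proj_unique [of a 0] by (simp add: orthogonal_def)

lemma proj_pythagoras: "(norm w)\<^sup>2 = (norm (proj L w))\<^sup>2 + (norm (w - proj L w))\<^sup>2"
  using norm_add_Pythagorean [OF proj_props(3)[OF proj_props(2), of w w]] by simp

lemma norm_proj_le: "norm (proj L w) \<le> norm w" "norm (w - proj L w) \<le> norm w"
proof -
  have "(norm (proj L w))\<^sup>2 \<le> (norm w)\<^sup>2" "(norm (w - proj L w))\<^sup>2 \<le> (norm w)\<^sup>2"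
    using proj_pythagoras [of w] by simp_all
  then show "norm (proj L w) \<le> norm w" "norm (w - proj L w) \<le> norm w"
    by (simp_all add: power2_le_iff_abs_le)
qed

lemma norm_diff_proj_le:
  assumes "v \<in> L" shows "norm (w - proj L w) \<le> dist w v"
proof -
  have "w - v - proj L (w - v) = w - proj L w"
    using linear_diff [OF proj_props(1)] proj_id [OF assms] by simp
  then show ?thesis using norm_proj_le(2) [of "w - v"] by (metis dist_norm)
qed

lemma infdist_subspace: "infdist w L = norm (w - proj L w)"
proof (rule antisym)
  show "infdist w L \<le> norm (w - proj L w)"
    using infdist_le [OF proj_props(2)] by (metis dist_norm)
  have "L \<noteq> {}" using proj_props(2) by blast
  then show "norm (w - proj L w) \<le> infdist w L"
    unfolding infdist_def using norm_diff_proj_le by (auto intro!: cINF_greatest)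
qed

lemma box_image_eq:
  "{a + b | a b. a \<in> L \<and> norm a < 1 \<and> (\<forall>v\<in>L. orthogonal v b) \<and> norm b < 1} =
   {w. proj L w \<in> ball 0 1} \<inter> {w. w - proj L w \<in> ball 0 1}" (is "?A = ?B")
proof
  show "?A \<subseteq> ?B" using proj_unique by fastforce
  show "?B \<subseteq> ?A"
  proof
    fix w assume "w \<in> ?B"
    then show "w \<in> ?A"
      using proj_props by (intro CollectI exI [of _ "proj L w"] exI [of _ "w - proj L w"]) auto
  qed
qed

lemma open_convex_box:
  "open ({w. proj L w \<in> ball 0 1} \<inter> {w. w - proj L w \<in> ball 0 1})" (is "open (?A \<inter> ?B)")
  "convex ({w. proj L w \<in> ball 0 1} \<inter> {w. w - proj L w \<in> ball 0 1})"
proof -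
  have lin: "linear (\<lambda>w. w - proj L w)" by (intro linear_compose_sub linear_ident proj_props)
  have eq: "?A = proj L -` ball 0 1" "?B = (\<lambda>w. w - proj L w) -` ball 0 1" by auto
  show "open (?A \<inter> ?B)"
    unfolding eq using proj_props(1) lin
    by (intro open_Int continuous_open_vimage linear_continuous_on continuous_at_imp_continuous_on ballI
          linear_continuous_at) (auto simp: linear_conv_bounded_linear)
  show "convex (?A \<inter> ?B)"
    unfolding eq by (intro convex_Int convex_linear_vimage proj_props lin convex_ball)
qed

end

text \<open>A second countable space has only countably many disjoint nonempty open sets; the empty set
  is one further member. The sets need to be open only relative to \<open>U\<close>, which will be a slice of a
  box.\<close>

lemma countable_disjoint_openin:
  fixes \<S> :: "'b::second_countable_topology set set"
  assumes op: "\<And>S. S \<in> \<S> \<Longrightarrow> openin (top_of_set U) S"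
    and dj: "\<And>S T. S \<in> \<S> \<Longrightarrow> T \<in> \<S> \<Longrightarrow> S \<inter> T \<noteq> {} \<Longrightarrow> S = T"
  shows "countable \<S>"
proof -
  obtain \<S>' where S': "\<S>' \<subseteq> \<S>" "countable \<S>'" "\<Union>\<S>' = \<Union>\<S>"
    using Lindelof_openin [of \<S> U] op by metis
  have "\<S> \<subseteq> insert {} \<S>'"
  proof
    fix S assume S: "S \<in> \<S>"
    show "S \<in> insert {} \<S>'"
    proof (cases "S = {}")
      case False
      then obtain s where "s \<in> S" by blast
      then obtain T where T: "T \<in> \<S>'" "s \<in> T" using S S'(3) by blast
      then have "S = T" using dj S S'(1) \<open>s \<in> S\<close> by blast
      then show ?thesis using T by simp
    qed simp
  qed
  then show ?thesis by (rule countable_subset) (simp add: S'(2))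
qed

section \<open>Foliations and their leaf topologies\<close>

locale foliation =
  fixes X :: "'a::t2_space set" and k :: nat and \<F> :: "('a, 'e::euclidean_space) fbox set"
  assumes foliated: "foliated_atlas X k \<F>"
begin

lemma box: "B \<in> \<F> \<Longrightarrow> foliation_box X k B"
  using foliated by (simp add: foliated_atlas_def)

lemma cover: "p \<in> X \<Longrightarrow> \<exists>B\<in>\<F>. p \<in> bdom B"
  using foliated by (auto simp: foliated_atlas_def)

lemma openin_bdom: "B \<in> \<F> \<Longrightarrow> openin (top_of_set X) (bdom B)"
  using box [of B] by (simp add: foliation_box_def)

lemma bdom_subset: "B \<in> \<F> \<Longrightarrow> bdom B \<subseteq> X"
  by (rule openin_imp_subset [OF openin_bdom])

lemma subspace_bdir: "B \<in> \<F> \<Longrightarrow> subspace (bdir B)" and dim_bdir: "B \<in> \<F> \<Longrightarrow> dim (bdir B) = k"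
  using box [of B] by (simp_all add: foliation_box_def)

lemma hom: "B \<in> \<F> \<Longrightarrow> homeomorphism (bdom B) (bmap B ` bdom B) (bmap B) (binv B)"
  using box [of B] unfolding foliation_box_def by blast

lemma binv_bmap [simp]: "B \<in> \<F> \<Longrightarrow> p \<in> bdom B \<Longrightarrow> binv B (bmap B p) = p"
  using hom by (auto simp: homeomorphism_def)

lemma bmap_binv: "B \<in> \<F> \<Longrightarrow> u \<in> bmap B ` bdom B \<Longrightarrow> bmap B (binv B u) = u"
  and binv_in: "B \<in> \<F> \<Longrightarrow> u \<in> bmap B ` bdom B \<Longrightarrow> binv B u \<in> bdom B"
  by (elim imageE, simp)+

lemma image_bdom:
  assumes "B \<in> \<F>"
  shows "bmap B ` bdom B =
    {w. proj (bdir B) w \<in> ball 0 1} \<inter> {w. w - proj (bdir B) w \<in> ball 0 1}"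
  using box [OF assms] box_image_eq [OF subspace_bdir [OF assms]]
  unfolding foliation_box_def by (elim conjE) (rule trans)

lemma open_image: "B \<in> \<F> \<Longrightarrow> open (bmap B ` bdom B)"
  and convex_image: "B \<in> \<F> \<Longrightarrow> convex (bmap B ` bdom B)"
  using open_convex_box [OF subspace_bdir] by (simp_all only: image_bdom)

lemma open_image_Int:
  assumes "B \<in> \<F>" "openin (top_of_set X) N" shows "open (bmap B ` (bdom B \<inter> N))"
proof -
  have "openin (top_of_set (bdom B)) (bdom B \<inter> N)"
    using assms(2) bdom_subset [OF assms(1)] by (auto simp: openin_open)
  then have "openin (top_of_set (bmap B ` bdom B)) (bmap B ` (bdom B \<inter> N))"
    using hom [OF assms(1)] homeomorphism_imp_open_map by blast
  then show ?thesis using open_image [OF assms(1)] openin_open_trans by blast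
qed

lemma openin_binv_image:
  assumes "B \<in> \<F>" "open O'" "O' \<subseteq> bmap B ` bdom B"
  shows "openin (top_of_set X) (binv B ` O')"
proof -
  have "openin (top_of_set (bmap B ` bdom B)) O'" using assms(2,3) by (simp add: open_subset)
  then have "openin (top_of_set (bdom B)) (binv B ` O')"
    using hom [OF assms(1)] homeomorphism_imp_open_map homeomorphism_sym by blast
  then show ?thesis using openin_bdom [OF assms(1)] openin_trans by blast
qed

lemma plaque_iff: "q \<in> plaque B p \<longleftrightarrow> q \<in> bdom B \<and> bmap B q - bmap B p \<in> bdir B"
  by (simp add: plaque_def)

lemma plaque_refl: "B \<in> \<F> \<Longrightarrow> p \<in> bdom B \<Longrightarrow> p \<in> plaque B p"
  by (simp add: plaque_iff subspace_0 subspace_bdir)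

lemma plaque_sym: "B \<in> \<F> \<Longrightarrow> p \<in> bdom B \<Longrightarrow> q \<in> plaque B p \<Longrightarrow> p \<in> plaque B q"
  using subspace_neg [OF subspace_bdir, of B "bmap B q - bmap B p"] by (auto simp: plaque_iff)

lemma plaque_trans: "B \<in> \<F> \<Longrightarrow> q \<in> plaque B p \<Longrightarrow> s \<in> plaque B q \<Longrightarrow> s \<in> plaque B p"
  using subspace_add [OF subspace_bdir, of B "bmap B s - bmap B q" "bmap B q - bmap B p"]
  by (auto simp: plaque_iff)

lemma plaque_eq: "B \<in> \<F> \<Longrightarrow> p \<in> bdom B \<Longrightarrow> q \<in> plaque B p \<Longrightarrow> plaque B q = plaque B p"
  using plaque_sym plaque_trans by blast

lemma plaque_subset: "plaque B p \<subseteq> bdom B" by (auto simp: plaque_iff)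

lemma coherent:
  assumes "B \<in> \<F>" "B' \<in> \<F>" "p \<in> bdom B" "p \<in> bdom B'"
  shows "\<exists>N. openin (top_of_set X) N \<and> p \<in> N \<and> N \<subseteq> bdom B \<inter> bdom B' \<and>
          (\<forall>q\<in>N. \<forall>r\<in>N. r \<in> plaque B q \<longleftrightarrow> r \<in> plaque B' q)"
proof -
  have *: "\<forall>B\<in>\<F>. \<forall>B'\<in>\<F>. \<forall>x\<in>bdom B \<inter> bdom B'.
        \<exists>N. openin (top_of_set X) N \<and> x \<in> N \<and> N \<subseteq> bdom B \<inter> bdom B' \<and>
          (\<forall>p\<in>N. \<forall>q\<in>N. q \<in> plaque B p \<longleftrightarrow> q \<in> plaque B' p)"
    using foliated unfolding foliated_atlas_def by blast
  show ?thesis using bspec [OF bspec [OF bspec [OF * assms(1)] assms(2)], of p] assms(3,4) by blast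
qed

definition step :: "('a \<times> 'a) set" where
  "step = {(p, q). \<exists>B\<in>\<F>. p \<in> bdom B \<and> q \<in> plaque B p}"

lemma leaf_step: "leaf \<F> p = {q. (p, q) \<in> step\<^sup>*}"
  by (simp add: leaf_def step_def)

lemma sym_step: "sym step"
proof (rule symI)
  fix p q assume "(p, q) \<in> step"
  then obtain B where "B \<in> \<F>" "p \<in> bdom B" "q \<in> plaque B p" by (auto simp: step_def)
  then show "(q, p) \<in> step"
    using plaque_sym [of B p q] plaque_subset [of B p] by (auto simp: step_def)
qed

lemma leaf_refl [simp]: "p \<in> leaf \<F> p" by (simp add: leaf_step)

lemma leaf_eq: "q \<in> leaf \<F> p \<Longrightarrow> leaf \<F> q = leaf \<F> p"
  unfolding leaf_step using sym_rtrancl [OF sym_step] by (auto dest: symD intro: rtrancl_trans)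

lemma plaque_leaf:
  assumes "B \<in> \<F>" "p \<in> bdom B" shows "plaque B p \<subseteq> leaf \<F> p"
proof
  fix q assume "q \<in> plaque B p"
  then have "(p, q) \<in> step" using assms by (auto simp: step_def)
  then show "q \<in> leaf \<F> p" by (auto simp: leaf_step)
qed

lemma plaque_subset_X: "B \<in> \<F> \<Longrightarrow> plaque B p \<subseteq> X"
  by (rule order_trans [OF plaque_subset bdom_subset])

lemma leaf_subset: "p \<in> X \<Longrightarrow> leaf \<F> p \<subseteq> X"
proof
  fix q assume "p \<in> X" "q \<in> leaf \<F> p"
  then have "(p, q) \<in> step\<^sup>*" by (simp add: leaf_step)
  then show "q \<in> X" using \<open>p \<in> X\<close>
  proof induction
    case (step y z)
    then obtain B where "B \<in> \<F>" "z \<in> plaque B y" by (auto simp: step_def)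
    then show ?case using plaque_subset_X [of B y] by auto
  qed
qed

text \<open>Openness along the leaves, tested in one plaque at a time. Unlike the generating family of
  \<open>leaf_topology\<close>, this description can be checked pointwise.\<close>

definition leaf_open :: "'a set \<Rightarrow> bool" where
  "leaf_open U \<longleftrightarrow>
    (\<forall>p\<in>U. \<forall>B\<in>\<F>. p \<in> bdom B \<longrightarrow> (\<exists>N. open N \<and> p \<in> N \<and> plaque B p \<inter> N \<subseteq> U))"

lemma leaf_openD:
  assumes "leaf_open U" "p \<in> U" "B \<in> \<F>" "p \<in> bdom B"
  obtains N where "open N" "p \<in> N" "plaque B p \<inter> N \<subseteq> U"
  using bspec [OF bspec [OF assms(1) [unfolded leaf_open_def] assms(2)] assms(3)] assms(4) that by meson

lemma istopology_leaf_open: "istopology (\<lambda>U. U \<subseteq> X \<and> leaf_open U)"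
  unfolding istopology_def
proof (intro conjI allI impI)
  fix S T assume S: "S \<subseteq> X \<and> leaf_open S" and T: "T \<subseteq> X \<and> leaf_open T"
  show "S \<inter> T \<subseteq> X" using S by (auto simp only:)
  show "leaf_open (S \<inter> T)"
    unfolding leaf_open_def
  proof (intro ballI impI)
    fix p B assume *: "p \<in> S \<inter> T" "B \<in> \<F>" "p \<in> bdom B"
    obtain M where "open M" "p \<in> M" "plaque B p \<inter> M \<subseteq> S"
      using leaf_openD [OF conjunct2 [OF S] _ *(2,3)] *(1) by (metis IntD1)
    moreover obtain N where "open N" "p \<in> N" "plaque B p \<inter> N \<subseteq> T"
      using leaf_openD [OF conjunct2 [OF T] _ *(2,3)] *(1) by (metis IntD2)
    ultimately show "\<exists>N. open N \<and> p \<in> N \<and> plaque B p \<inter> N \<subseteq> S \<inter> T"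
      by (intro exI [of _ "M \<inter> N"]) (auto intro: open_Int)
  qed
next
  fix \<K> assume K: "\<forall>K\<in>\<K>. K \<subseteq> X \<and> leaf_open K"
  show "\<Union>\<K> \<subseteq> X" using K by (simp add: Sup_le_iff)
  show "leaf_open (\<Union>\<K>)"
    unfolding leaf_open_def
  proof (intro ballI impI)
    fix p B assume *: "p \<in> \<Union>\<K>" "B \<in> \<F>" "p \<in> bdom B"
    then obtain U where U: "U \<in> \<K>" "p \<in> U" by (elim UnionE)
    obtain N where "open N" "p \<in> N" "plaque B p \<inter> N \<subseteq> U"
      using leaf_openD [OF conjunct2 [OF bspec [OF K U(1)]] U(2) *(2,3)] .
    then show "\<exists>N. open N \<and> p \<in> N \<and> plaque B p \<inter> N \<subseteq> \<Union>\<K>"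
      using U(1) by (intro exI [of _ N]) auto
  qed
qed

text \<open>Near each of its points the plaque is also a plaque of any other box, by the coherence of
  overlapping boxes.\<close>

lemma leaf_open_plaque:
  assumes B: "B \<in> \<F>" "x \<in> bdom B" "open N"
  shows "leaf_open (plaque B x \<inter> N)"
  unfolding leaf_open_def
proof (intro ballI impI)
  fix p B' assume p: "p \<in> plaque B x \<inter> N" and B': "B' \<in> \<F>" "p \<in> bdom B'"
  have pB: "p \<in> bdom B" using p by (simp add: plaque_iff)
  obtain M where M: "openin (top_of_set X) M" "p \<in> M" "M \<subseteq> bdom B \<inter> bdom B'"
      "\<forall>q\<in>M. \<forall>r\<in>M. r \<in> plaque B q \<longleftrightarrow> r \<in> plaque B' q"
    using coherent [OF B(1) B'(1) pB B'(2)] by (elim exE conjE)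
  obtain M' where M': "open M'" "M = X \<inter> M'" using M(1) by (auto simp: openin_open)
  have "plaque B' p \<inter> (M' \<inter> N) \<subseteq> plaque B x \<inter> N"
  proof
    fix q assume q: "q \<in> plaque B' p \<inter> (M' \<inter> N)"
    then have "q \<in> M" using M' plaque_subset_X [OF B'(1), of p] by auto
    then have "q \<in> plaque B p" using M(2,4) q by auto
    then show "q \<in> plaque B x \<inter> N" using q p plaque_trans [OF B(1), of p x q] by auto
  qed
  then show "\<exists>M. open M \<and> p \<in> M \<and> plaque B' p \<inter> M \<subseteq> plaque B x \<inter> N"
    using M' M(2) B(3) p by (intro exI [of _ "M' \<inter> N"]) (auto intro: open_Int)
qed

text \<open>The sets that are open along the leaves form a topology; it contains the generating sets by
  \<open>leaf_open_plaque\<close>, and each of its members is the union of the generating sets inside it.\<close>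

lemma openin_leaf_topology: "openin (leaf_topology \<F>) U \<longleftrightarrow> U \<subseteq> X \<and> leaf_open U"
proof
  let ?S = "{plaque B x \<inter> N | B x N. B \<in> \<F> \<and> x \<in> bdom B \<and> open N}"
  assume "openin (leaf_topology \<F>) U"
  then have gen: "generate_topology_on ?S U"
    by (simp add: leaf_topology_def openin_topology_generated_by_iff)
  show "U \<subseteq> X \<and> leaf_open U"
  proof (rule generate_topology_on_coarsest [OF istopology_leaf_open _ gen])
    fix S assume "S \<in> ?S"
    then obtain B x N where S: "S = plaque B x \<inter> N" and B: "B \<in> \<F>" "x \<in> bdom B" "open N"
      by blast
    then show "S \<subseteq> X \<and> leaf_open S"
      using leaf_open_plaque plaque_subset_X [of B x] by auto
  qed
next
  assume R: "U \<subseteq> X \<and> leaf_open U"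
  show "openin (leaf_topology \<F>) U"
  proof (subst openin_subopen, intro ballI)
    fix p assume p: "p \<in> U"
    then have "p \<in> X" using R by auto
    then obtain B where B: "B \<in> \<F>" "p \<in> bdom B" using cover by auto
    obtain N where N: "open N" "p \<in> N" "plaque B p \<inter> N \<subseteq> U"
      by (rule leaf_openD [OF conjunct2 [OF R] p B])
    have "openin (leaf_topology \<F>) (plaque B p \<inter> N)"
      unfolding leaf_topology_def by (rule topology_generated_by_Basis) (use B N in blast)
    then show "\<exists>T. openin (leaf_topology \<F>) T \<and> p \<in> T \<and> T \<subseteq> U"
      using N plaque_refl [OF B] by (intro exI [of _ "plaque B p \<inter> N"]) auto
  qed
qed

lemma openin_leaf_finer:
  assumes "openin (top_of_set X) U" shows "openin (leaf_topology \<F>) U"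
proof -
  obtain T where T: "open T" "U = X \<inter> T" using assms by (auto simp: openin_open)
  have "plaque B p \<inter> T \<subseteq> U" if "B \<in> \<F>" for B p using plaque_subset_X [OF that] T(2) by auto
  then have "leaf_open U" unfolding leaf_open_def using T by auto
  then show ?thesis using T by (simp add: openin_leaf_topology)
qed

lemma topspace_leaf [simp]: "topspace (leaf_topology \<F>) = X"
proof
  show "topspace (leaf_topology \<F>) \<subseteq> X"
    using openin_leaf_topology [of "topspace (leaf_topology \<F>)"] by simp
  show "X \<subseteq> topspace (leaf_topology \<F>)"
    by (intro openin_subset openin_leaf_finer) simp
qed

lemma continuous_map_leaf_finer:
  "continuous_map T (leaf_topology \<F>) h \<Longrightarrow> continuous_map T (top_of_set X) h"
  unfolding continuous_map using openin_leaf_finer by simp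

lemma openin_plaque_Int:
  "B \<in> \<F> \<Longrightarrow> p \<in> bdom B \<Longrightarrow> open N \<Longrightarrow> openin (leaf_topology \<F>) (plaque B p \<inter> N)"
  using leaf_open_plaque plaque_subset_X [of B p] by (auto simp: openin_leaf_topology)

lemma openin_plaque: "B \<in> \<F> \<Longrightarrow> p \<in> bdom B \<Longrightarrow> openin (leaf_topology \<F>) (plaque B p)"
  using openin_plaque_Int [of B p UNIV] by simp

text \<open>The coordinates, relative to \<open>p\<close>, of the plaque of \<open>p\<close>: a convex set that parametrizes
  the plaque with its leaf topology, so that plaques are connected and second countable.\<close>

definition slice :: "('a, 'e) fbox \<Rightarrow> 'a \<Rightarrow> 'e set" where
  "slice B p = {a \<in> bdir B. bmap B p + a \<in> bmap B ` bdom B}"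

lemma convex_slice: "B \<in> \<F> \<Longrightarrow> convex (slice B p)"
proof -
  assume B: "B \<in> \<F>"
  have "slice B p = bdir B \<inter> (+) (- bmap B p) ` (bmap B ` bdom B)"
    unfolding slice_def by (auto simp: image_iff) (metis add.commute add_diff_cancel_left' uminus_add_conv_diff)+
  then show ?thesis
    using convex_image [OF B] subspace_bdir [OF B] by (metis convex_Int convex_translation subspace_imp_convex)
qed

lemma zero_in_slice: "B \<in> \<F> \<Longrightarrow> p \<in> bdom B \<Longrightarrow> 0 \<in> slice B p"
  by (simp add: slice_def subspace_0 subspace_bdir)

lemma binv_slice: "B \<in> \<F> \<Longrightarrow> a \<in> slice B p \<Longrightarrow> binv B (bmap B p + a) \<in> plaque B p"
  by (simp add: slice_def plaque_iff bmap_binv binv_in)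

lemma plaque_slice: "B \<in> \<F> \<Longrightarrow> plaque B p = (\<lambda>a. binv B (bmap B p + a)) ` slice B p"
proof
  assume B: "B \<in> \<F>"
  show "(\<lambda>a. binv B (bmap B p + a)) ` slice B p \<subseteq> plaque B p" using binv_slice [OF B] by blast
  show "plaque B p \<subseteq> (\<lambda>a. binv B (bmap B p + a)) ` slice B p"
  proof
    fix q assume "q \<in> plaque B p"
    then show "q \<in> (\<lambda>a. binv B (bmap B p + a)) ` slice B p"
      using B by (intro image_eqI [of _ _ "bmap B q - bmap B p"]) (auto simp: plaque_iff slice_def)
  qed
qed

lemma slice_continuous:
  assumes B: "B \<in> \<F>" and p: "p \<in> bdom B"
  shows "continuous_map (top_of_set (slice B p)) (leaf_topology \<F>) (\<lambda>a. binv B (bmap B p + a))"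
  unfolding continuous_map
proof (intro conjI allI impI)
  let ?g = "\<lambda>a. binv B (bmap B p + a)"
  show "?g ` topspace (top_of_set (slice B p)) \<subseteq> topspace (leaf_topology \<F>)"
    using binv_slice [OF B] plaque_subset bdom_subset [OF B] by fastforce
  fix U assume U: "openin (leaf_topology \<F>) U"
  have cont: "continuous_on (slice B p) ?g"
    by (rule continuous_on_compose2 [OF homeomorphism_cont2 [OF hom [OF B]]])
      (auto simp: slice_def intro!: continuous_intros)
  have eq: "{a \<in> topspace (top_of_set (slice B p)). ?g a \<in> U} = {a \<in> slice B p. ?g a \<in> U}" by simp
  show "openin (top_of_set (slice B p)) {a \<in> topspace (top_of_set (slice B p)). ?g a \<in> U}"
    unfolding eq
  proof (subst openin_subopen, intro ballI)
    fix a assume a: "a \<in> {a \<in> slice B p. ?g a \<in> U}"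
    then have ga: "?g a \<in> U" "?g a \<in> plaque B p" "?g a \<in> bdom B"
      using binv_slice [OF B, of a p] by (auto simp: plaque_iff)
    obtain N where N: "open N" "?g a \<in> N" "plaque B (?g a) \<inter> N \<subseteq> U"
      using leaf_openD [of U "?g a" B] U B ga by (auto simp: openin_leaf_topology)
    have "openin (top_of_set (slice B p)) (slice B p \<inter> ?g -` N)"
      using cont N(1) continuous_openin_preimage_gen by blast
    moreover have "slice B p \<inter> ?g -` N \<subseteq> {a \<in> slice B p. ?g a \<in> U}"
      using N(3) plaque_eq [OF B p ga(2)] binv_slice [OF B, of _ p] by auto
    ultimately show "\<exists>T. openin (top_of_set (slice B p)) T \<and> a \<in> T \<and> T \<subseteq> {a \<in> slice B p. ?g a \<in> U}"
      using a N(2) by blast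
  qed
qed

lemma connectedin_plaque: "B \<in> \<F> \<Longrightarrow> p \<in> bdom B \<Longrightarrow> connectedin (leaf_topology \<F>) (plaque B p)"
  unfolding plaque_slice
  by (rule connectedin_continuous_map_image [OF slice_continuous])
    (auto simp: connectedin_subtopology convex_connected convex_slice)

text \<open>The classes of an equivalence relation with open classes cannot split a connected set.\<close>

lemma connected_in_open_class:
  assumes C: "connectedin T C" and p: "p \<in> C"
    and op: "\<And>q. q \<in> C \<Longrightarrow> openin T (cl q)" and refl: "\<And>q. q \<in> C \<Longrightarrow> q \<in> cl q"
    and dj: "\<And>q r. q \<in> C \<Longrightarrow> r \<in> C \<Longrightarrow> cl q \<inter> cl r \<noteq> {} \<Longrightarrow> cl q = cl r"
  shows "C \<subseteq> cl p"
proof (rule ccontr)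
  assume "\<not> C \<subseteq> cl p"
  then obtain q where q: "q \<in> C" "q \<notin> cl p" by blast
  let ?V = "\<Union>r\<in>C - cl p. cl r"
  have "openin T ?V" using op by blast
  moreover have "C \<subseteq> cl p \<union> ?V" using refl by blast
  moreover have "cl p \<inter> ?V \<inter> C = {}" using dj p refl by blast
  ultimately show False
    using connectedinD [OF C op [OF p]] p refl q by blast
qed

text \<open>The plaques of one box are disjoint and open in the leaf topology, so a set that is connected
  in the leaf topology and stays in the box cannot jump from one plaque to another, as it could in
  the topology of \<open>X\<close>.\<close>

lemma connected_in_plaque:
  assumes "connectedin (leaf_topology \<F>) C" "C \<subseteq> bdom B" "B \<in> \<F>" "p \<in> C"
  shows "C \<subseteq> plaque B p"
proof (rule connected_in_open_class [OF assms(1,4)])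
  fix q assume q: "q \<in> C"
  then show "openin (leaf_topology \<F>) (plaque B q)" "q \<in> plaque B q"
    using assms(2,3) openin_plaque plaque_refl by auto
  fix r assume r: "r \<in> C" and "plaque B q \<inter> plaque B r \<noteq> {}"
  then obtain t where "t \<in> plaque B q" "t \<in> plaque B r" by auto
  moreover have "q \<in> bdom B" "r \<in> bdom B" using q r assms(2) by auto
  ultimately show "plaque B q = plaque B r" using plaque_eq [OF assms(3)] by metis
qed

text \<open>The leaves of a smaller atlas that still covers are open in the leaf topology of the larger
  one. They partition each plaque of the larger atlas into open sets, and a plaque is connected, so
  fewer boxes give the same leaves.\<close>

lemma subatlas_leaf:
  assumes sub: "\<G> \<subseteq> \<F>" and cov: "X \<subseteq> (\<Union>B\<in>\<G>. bdom B)" and p: "p \<in> X"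
  shows "foliated_atlas X k \<G>" "leaf \<F> p \<subseteq> leaf \<G> p"
proof -
  show fol: "foliated_atlas X k \<G>"
    unfolding foliated_atlas_def
  proof (intro conjI ballI)
    show "foliation_box X k B" if "B \<in> \<G>" for B using that sub box by auto
    show "(\<Union>B\<in>\<G>. bdom B) = X" using cov sub bdom_subset by (auto simp: subset_iff)
    fix B B' x assume "B \<in> \<G>" "B' \<in> \<G>" "x \<in> bdom B \<inter> bdom B'"
    then show "\<exists>N. openin (top_of_set X) N \<and> x \<in> N \<and> N \<subseteq> bdom B \<inter> bdom B' \<and>
          (\<forall>p\<in>N. \<forall>q\<in>N. q \<in> plaque B p \<longleftrightarrow> q \<in> plaque B' p)"
      using foliated sub unfolding foliated_atlas_def by (meson subsetD)
  qed
  then interpret G: foliation X k \<G> by unfold_locales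
  have op: "openin (leaf_topology \<F>) (leaf \<G> q)" if q: "q \<in> X" for q
  proof -
    have "leaf_open (leaf \<G> q)"
      unfolding leaf_open_def
    proof (intro ballI impI)
      fix r B assume r: "r \<in> leaf \<G> q" and B: "B \<in> \<F>" "r \<in> bdom B"
      have "r \<in> X" using bdom_subset [OF B(1)] B(2) by auto
      then obtain B' where B': "B' \<in> \<G>" "r \<in> bdom B'" using cov by auto
      obtain M where M: "openin (top_of_set X) M" "r \<in> M" "M \<subseteq> bdom B \<inter> bdom B'"
          "\<forall>q\<in>M. \<forall>r\<in>M. r \<in> plaque B q \<longleftrightarrow> r \<in> plaque B' q"
        using coherent [OF B(1) subsetD [OF sub B'(1)] B(2) B'(2)] by (elim exE conjE)
      obtain M' where M': "open M'" "M = X \<inter> M'" using M(1) by (auto simp: openin_open)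
      have "plaque B r \<inter> M' \<subseteq> leaf \<G> q"
      proof
        fix s assume s: "s \<in> plaque B r \<inter> M'"
        then have "s \<in> M" using M' plaque_subset_X [OF B(1)] by auto
        then have "s \<in> plaque B' r" using M(2,4) s by auto
        then show "s \<in> leaf \<G> q" using G.plaque_leaf [OF B'] G.leaf_eq [OF r] by auto
      qed
      then show "\<exists>N. open N \<and> r \<in> N \<and> plaque B r \<inter> N \<subseteq> leaf \<G> q" using M' M(2) by auto
    qed
    then show ?thesis using G.leaf_subset [OF q] by (simp add: openin_leaf_topology)
  qed
  have plq: "plaque B q \<subseteq> leaf \<G> q" if "B \<in> \<F>" "q \<in> bdom B" for B q
  proof (rule connected_in_open_class [OF connectedin_plaque [OF that] plaque_refl [OF that]])
    fix r assume "r \<in> plaque B q"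
    then show "openin (leaf_topology \<F>) (leaf \<G> r)" using op plaque_subset_X [OF that(1)] by auto
    show "r \<in> leaf \<G> r" by simp
  next
    fix r r' assume "leaf \<G> r \<inter> leaf \<G> r' \<noteq> {}"
    then obtain t where "t \<in> leaf \<G> r" "t \<in> leaf \<G> r'" by auto
    then show "leaf \<G> r = leaf \<G> r'" using G.leaf_eq by metis
  qed
  show "leaf \<F> p \<subseteq> leaf \<G> p"
  proof
    fix q assume "q \<in> leaf \<F> p"
    then have "(p, q) \<in> step\<^sup>*" by (simp add: leaf_step)
    then show "q \<in> leaf \<G> p"
    proof induction
      case (step y z)
      then have "z \<in> leaf \<G> y" using plq by (auto simp: step_def)
      then show ?case using step(3) G.leaf_eq by blast
    qed simp
  qed
qed

lemma countable_plaques_meeting_plaque: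
  assumes B: "B \<in> \<F>" "p \<in> bdom B" and B': "B' \<in> \<F>"
  shows "countable {plaque B' q | q. q \<in> plaque B p \<inter> bdom B'}"
proof -
  let ?g = "\<lambda>a. binv B (bmap B p + a)"
  let ?O = "\<lambda>P. slice B p \<inter> ?g -` P"
  let ?P = "{plaque B' q | q. q \<in> plaque B p \<inter> bdom B'}"
  have disj: "P1 = P2" if "P1 \<in> ?P" "P2 \<in> ?P" "P1 \<inter> P2 \<noteq> {}" for P1 P2
    using that plaque_eq [OF B'] by blast
  have "countable (?O ` ?P)"
  proof (rule countable_disjoint_openin [where U = "slice B p"])
    fix S assume "S \<in> ?O ` ?P"
    then obtain q where q: "q \<in> bdom B'" "S = ?O (plaque B' q)" by blast
    show "openin (top_of_set (slice B p)) S"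
      using slice_continuous [OF B] openin_plaque [OF B' q(1)] q(2)
      by (simp add: continuous_map vimage_def Int_def)
  next
    fix S T assume "S \<in> ?O ` ?P" "T \<in> ?O ` ?P" "S \<inter> T \<noteq> {}"
    then show "S = T" using disj by blast
  qed
  moreover have "inj_on ?O ?P"
  proof (rule inj_onI)
    fix P1 P2 assume P: "P1 \<in> ?P" "P2 \<in> ?P" and eq: "?O P1 = ?O P2"
    obtain q where q: "q \<in> plaque B p" "q \<in> bdom B'" "P1 = plaque B' q" using P by blast
    then obtain a where a: "a \<in> slice B p" "q = ?g a" using plaque_slice [OF B(1)] by blast
    then have "a \<in> ?O P1" using q plaque_refl [OF B'] by auto
    then show "P1 = P2" using eq disj [OF P] by blast
  qed
  ultimately show ?thesis by (rule countable_image_inj_on)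
qed

text \<open>A leaf meets a box in countably many plaques: finitely many boxes suffice for chains of
  plaques, and each plaque, being separable, meets only countably many plaques of another box.\<close>

lemma countable_plaques_of_leaf:
  assumes X: "compact X" and p: "p \<in> X" and B: "B \<in> \<F>"
  shows "countable {plaque B q | q. q \<in> leaf \<F> p \<inter> bdom B}"
proof -
  obtain \<G>0 where G0: "\<G>0 \<subseteq> \<F>" "finite \<G>0" "X \<subseteq> (\<Union>B\<in>\<G>0. bdom B)"
  proof -
    have "\<forall>B\<in>\<F>. \<exists>T. open T \<and> bdom B = X \<inter> T" using openin_bdom by (simp add: openin_open)
    then obtain T where T: "\<And>B. B \<in> \<F> \<Longrightarrow> open (T B) \<and> bdom B = X \<inter> T B" by metis
    have "X \<subseteq> (\<Union>B\<in>\<F>. T B)" using T cover by blast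
    then obtain \<G>0 where "\<G>0 \<subseteq> \<F>" "finite \<G>0" "X \<subseteq> (\<Union>B\<in>\<G>0. T B)"
      using compactE_image [OF X, of \<F> T] T by metis
    then show ?thesis using T by (intro that [of \<G>0]) blast+
  qed
  define \<G> where "\<G> = insert B \<G>0"
  have G: "\<G> \<subseteq> \<F>" "finite \<G>" "X \<subseteq> (\<Union>B\<in>\<G>. bdom B)" "B \<in> \<G>" using G0 B by (auto simp: \<G>_def)
  interpret G: foliation X k \<G> using subatlas_leaf(1) [OF G(1,3) p] by unfold_locales
  \<comment> \<open>\<open>R n\<close> are the plaques, with their boxes, that chains of \<open>n\<close> steps from \<open>p\<close> reach.\<close>
  define R where "R n = {(C, plaque C q) | C q. C \<in> \<G> \<and> q \<in> bdom C \<and> (p, q) \<in> G.step ^^ n}" for n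
  have "countable (R n)" for n
  proof (induction n)
    case 0
    have "R 0 \<subseteq> (\<lambda>C. (C, plaque C p)) ` \<G>" by (auto simp: R_def)
    then show ?case using G(2) by (meson countable_finite countable_subset finite_imageI)
  next
    case (Suc n)
    let ?M = "\<lambda>(C, P) C'. if \<exists>q. q \<in> bdom C \<and> P = plaque C q
      then Pair C' ` {plaque C' r | r. r \<in> P \<inter> bdom C'} else {}"
    have "R (Suc n) \<subseteq> (\<Union>z\<in>R n. \<Union>C'\<in>\<G>. ?M z C')"
    proof
      fix z assume "z \<in> R (Suc n)"
      then obtain C' r q where z: "z = (C', plaque C' r)" "C' \<in> \<G>" "r \<in> bdom C'"
          and q: "(p, q) \<in> G.step ^^ n" "(q, r) \<in> G.step" by (auto simp: R_def)
      then obtain C where C: "C \<in> \<G>" "q \<in> bdom C" "r \<in> plaque C q" by (auto simp: G.step_def)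
      then have "(C, plaque C q) \<in> R n" using q by (auto simp: R_def)
      moreover have "z \<in> ?M (C, plaque C q) C'" using C z by auto
      ultimately show "z \<in> (\<Union>z\<in>R n. \<Union>C'\<in>\<G>. ?M z C')" using z(2) by blast
    qed
    moreover have "countable (?M z C')" if z: "z \<in> R n" and C': "C' \<in> \<G>" for z C'
    proof -
      obtain C q where "z = (C, plaque C q)" "C \<in> \<G>" "q \<in> bdom C" using z by (auto simp: R_def)
      moreover have "C' \<in> \<F>" "C \<in> \<F>" using G(1) C' calculation(2) by auto
      ultimately have "countable (Pair C' ` {plaque C' r | r. r \<in> plaque C q \<inter> bdom C'})"
        using countable_plaques_meeting_plaque [of C q C'] by (intro countable_image) simp
      then show ?thesis using \<open>z = _\<close> by (simp split: if_split)
    qed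
    ultimately show ?case
      using Suc G(2) by (meson countable_UN countable_finite countable_subset)
  qed
  then have "countable (\<Union>n. snd ` R n)" by auto
  moreover have "{plaque B q | q. q \<in> leaf \<F> p \<inter> bdom B} \<subseteq> (\<Union>n. snd ` R n)"
  proof
    fix P assume "P \<in> {plaque B q | q. q \<in> leaf \<F> p \<inter> bdom B}"
    then obtain q where q: "P = plaque B q" "q \<in> leaf \<F> p" "q \<in> bdom B" by blast
    then have "(p, q) \<in> G.step\<^sup>*" using subatlas_leaf(2) [OF G(1,3) p] G.leaf_step by blast
    then obtain n where "(p, q) \<in> G.step ^^ n" using rtrancl_imp_relpow by blast
    then have "(B, P) \<in> R n" using q G(4) by (auto simp: R_def)
    then show "P \<in> (\<Union>n. snd ` R n)" by force
  qed
  ultimately show ?thesis by (rule countable_subset [rotated])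
qed

text \<open>A continuous map that sends leaves into leaves sends plaques into plaques locally: along a
  segment in a plaque the transverse coordinate of the image varies continuously, but it takes only
  countably many values, as a leaf meets a box in countably many plaques. Hence it is constant.\<close>

lemma plaque_image_local:
  assumes X: "compact X" and h: "continuous_on X h" "h ` X \<subseteq> X"
    and inv: "\<And>p. p \<in> X \<Longrightarrow> h ` leaf \<F> p \<subseteq> leaf \<F> (h p)"
    and B: "B \<in> \<F>" "p \<in> bdom B" and B': "B' \<in> \<F>" "h p \<in> bdom B'"
  obtains N where "openin (top_of_set X) N" "p \<in> N" "N \<subseteq> bdom B" "h ` N \<subseteq> bdom B'"
    "\<And>q r. q \<in> N \<Longrightarrow> r \<in> N \<Longrightarrow> r \<in> plaque B q \<Longrightarrow> h r \<in> plaque B' (h q)"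
proof -
  let ?L = "bdir B'"
  let ?t = "\<lambda>q. bmap B' (h q) - proj ?L (bmap B' (h q))"
  have L: "subspace ?L" by (rule subspace_bdir [OF B'(1)])
  have "openin (top_of_set X) (X \<inter> h -` bdom B')"
    using continuous_openin_preimage [OF h(1) _ openin_bdom [OF B'(1)]] h(2) by blast
  then have "open (bmap B ` (bdom B \<inter> (X \<inter> h -` bdom B')))" by (rule open_image_Int [OF B(1)])
  moreover have "bmap B p \<in> bmap B ` (bdom B \<inter> (X \<inter> h -` bdom B'))"
    using B B' bdom_subset by auto
  ultimately obtain e where e: "e > 0" "ball (bmap B p) e \<subseteq> bmap B ` (bdom B \<inter> (X \<inter> h -` bdom B'))"
    by (meson open_contains_ball)
  define b where "b = ball (bmap B p) e"
  define N where "N = binv B ` b"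
  have bsub: "b \<subseteq> bmap B ` bdom B" using e(2) by (auto simp: b_def)
  have hb: "h (binv B u) \<in> bdom B'" "binv B u \<in> bdom B" if "u \<in> b" for u
    using e(2) that B(1) by (auto simp: b_def)
  have "openin (top_of_set X) N"
    unfolding N_def by (rule openin_binv_image [OF B(1) _ bsub]) (simp add: b_def)
  moreover have "p \<in> N" unfolding N_def b_def using B e(1) by (intro image_eqI [of _ _ "bmap B p"]) auto
  moreover have "N \<subseteq> bdom B" "h ` N \<subseteq> bdom B'" using hb by (auto simp: N_def)
  moreover have "h r \<in> plaque B' (h q)" if q: "q \<in> N" and r: "r \<in> N" and qr: "r \<in> plaque B q" for q r
  proof -
    obtain u v where u: "u \<in> b" "q = binv B u" and v: "v \<in> b" "r = binv B v"
      using q r by (auto simp: N_def)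
    have uv: "bmap B q = u" "bmap B r = v" using u v bsub bmap_binv B(1) by auto
    have vu: "v - u \<in> bdir B" using qr uv by (simp add: plaque_iff)
    define S where "S = closed_segment u v"
    have Sb: "S \<subseteq> b" unfolding S_def b_def using u v by (intro closed_segment_subset) (auto simp: b_def)
    have qX: "q \<in> X" "q \<in> bdom B" using hb u bdom_subset B(1) by auto
    have leaf: "h (binv B w) \<in> leaf \<F> (h q) \<inter> bdom B'" if w: "w \<in> S" for w
    proof -
      obtain s where s: "w = (1 - s) *\<^sub>R u + s *\<^sub>R v" using w by (auto simp: S_def in_segment)
      have "w - u = s *\<^sub>R (v - u)" by (simp add: s algebra_simps)
      then have "w - u \<in> bdir B" using vu subspace_bdir [OF B(1)] by (simp add: subspace_scale)
      moreover have "bmap B (binv B w) = w" using w Sb bsub B(1) bmap_binv by blast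
      ultimately have "binv B w \<in> plaque B q" using w Sb hb uv by (auto simp: plaque_iff)
      then show ?thesis
        using plaque_leaf [OF B(1) qX(2)] inv [OF qX(1)] w Sb hb by blast
    qed
    have "continuous_on S (\<lambda>w. ?t (binv B w))"
    proof -
      have 1: "continuous_on S (binv B)"
        using homeomorphism_cont2 [OF hom [OF B(1)]] continuous_on_subset Sb bsub by blast
      have 2: "continuous_on S (\<lambda>w. h (binv B w))"
        by (rule continuous_on_compose2 [OF h(1) 1]) (use Sb hb bdom_subset B(1) in blast)
      have 3: "continuous_on S (\<lambda>w. bmap B' (h (binv B w)))"
        by (rule continuous_on_compose2 [OF homeomorphism_cont1 [OF hom [OF B'(1)]] 2]) (use Sb hb in blast)
      have "continuous_on UNIV (proj ?L)"
        using proj_props(1) [OF L] by (simp add: linear_continuous_on linear_conv_bounded_linear)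
      then show ?thesis by (intro continuous_intros 3 continuous_on_compose2 [OF _ 3]) auto
    qed
    then have conn: "connected ((\<lambda>w. ?t (binv B w)) ` S)"
      by (intro connected_continuous_image) (auto simp: S_def)
    have tconst: "?t a = ?t b'" if "h b' \<in> plaque B' (h a)" for a b'
    proof -
      have "bmap B' (h b') - bmap B' (h a) \<in> ?L" using that by (simp add: plaque_iff)
      then have "proj ?L (bmap B' (h b') - bmap B' (h a)) = bmap B' (h b') - bmap B' (h a)"
        by (rule proj_id [OF L])
      then show ?thesis using linear_diff [OF proj_props(1) [OF L]] by (simp add: algebra_simps)
    qed
    have "countable ((\<lambda>w. ?t (binv B w)) ` S)"
    proof -
      let ?P = "{plaque B' q' | q'. q' \<in> leaf \<F> (h q) \<inter> bdom B'}"
      \<comment> \<open>\<open>?c P\<close> is the transverse coordinate of the plaque \<open>P\<close>.\<close>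
      let ?c = "\<lambda>P. SOME z. \<exists>y\<in>P. z = bmap B' y - proj ?L (bmap B' y)"
      have "(\<lambda>w. ?t (binv B w)) ` S \<subseteq> ?c ` ?P"
      proof
        fix z assume "z \<in> (\<lambda>w. ?t (binv B w)) ` S"
        then obtain w where w: "w \<in> S" "z = ?t (binv B w)" by blast
        let ?y = "h (binv B w)"
        have yB: "?y \<in> bdom B'" using leaf w by blast
        have "?c (plaque B' ?y) = z"
        proof (rule some_equality)
          show "\<exists>y\<in>plaque B' ?y. z = bmap B' y - proj ?L (bmap B' y)"
            using plaque_refl [OF B'(1) yB] w(2) by blast
          fix z' assume "\<exists>y\<in>plaque B' ?y. z' = bmap B' y - proj ?L (bmap B' y)"
          then obtain y where y: "y \<in> plaque B' ?y" "z' = bmap B' y - proj ?L (bmap B' y)" by blast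
          have "bmap B' y - bmap B' ?y \<in> ?L" using y(1) by (simp add: plaque_iff)
          then have "proj ?L (bmap B' y - bmap B' ?y) = bmap B' y - bmap B' ?y" by (rule proj_id [OF L])
          then have "proj ?L (bmap B' y) - proj ?L (bmap B' ?y) = bmap B' y - bmap B' ?y"
            by (simp only: linear_diff [OF proj_props(1) [OF L]])
          then show "z' = z" unfolding w(2) y(2) by (simp only: algebra_simps)
        qed
        then show "z \<in> ?c ` ?P" using leaf w(1) by blast
      qed
      moreover have "countable ?P"
        by (rule countable_plaques_of_leaf [OF X _ B'(1)]) (use h(2) qX in blast)
      ultimately show ?thesis by (meson countable_image countable_subset)
    qed
    then have "?t (binv B u) = ?t (binv B v)"
      using connected_uncountable [OF conn] by (auto simp: S_def)
    then have "bmap B' (h r) - bmap B' (h q) = proj ?L (bmap B' (h r)) - proj ?L (bmap B' (h q))"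
      using u v by (simp add: algebra_simps)
    then have "bmap B' (h r) - bmap B' (h q) \<in> ?L"
      using subspace_diff [OF L] proj_props(2) [OF L] by metis
    then show ?thesis using hb v by (simp add: plaque_iff)
  qed
  ultimately show ?thesis by (rule that)
qed

end

section \<open>Existence of local holonomies\<close>

locale joint_foliation =
  W: foliation X k \<W> + Ws: foliation X l \<W>s + V: foliation X m \<V>
  for X :: "'a::t2_space set" and k l m
    and \<W> \<W>s \<V> :: "('a, 'e::euclidean_space) fbox set" +
  assumes integrate: "integrate_to X \<W> \<W>s \<V>"
begin

abbreviation "TW \<equiv> leaf_topology \<W>"
abbreviation "TWs \<equiv> leaf_topology \<W>s"
abbreviation "TV \<equiv> leaf_topology \<V>"
abbreviation "TI \<equiv> top_of_set {0..1::real}"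

definition holonomic :: "'a \<Rightarrow> 'a \<Rightarrow> bool" where
  "holonomic x y \<longleftrightarrow> (\<exists>N H. local_holonomy \<W> \<W>s \<V> x y N H)"

text \<open>In a local product \<open>\<Phi>\<close>, moving the second factor along a path is a holonomy. The
  neighbourhood \<open>N\<close> of the initial point is a slice \<open>\<Phi> (P \<times> {\<tau> 0})\<close>, and \<open>g'\<close> recovers the first
  factor of its points.\<close>

lemma local_slide:
  assumes x: "x \<in> X"
  shows "\<exists>Q. openin TWs Q \<and> x \<in> Q \<and>
    (\<forall>\<tau>. continuous_map TI TWs \<tau> \<and> \<tau> ` {0..1} \<subseteq> Q \<longrightarrow> holonomic (\<tau> 0) (\<tau> 1))"
proof -
  have "local_product_at \<W> \<W>s \<V> x" using integrate x by (simp add: integrate_to_def)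
  then obtain P Q R \<Phi> where P: "openin TW P" "x \<in> P" "P \<subseteq> leaf \<W> x"
      and Q: "openin TWs Q" "x \<in> Q" "Q \<subseteq> leaf \<W>s x"
      and R: "openin TV R" "R \<subseteq> leaf \<V> x"
      and hom: "homeomorphic_map (prod_topology (subtopology TW P) (subtopology TWs Q)) (subtopology TV R) \<Phi>"
      and \<Phi>x: "\<forall>p\<in>P. \<Phi> (p, x) = p" "\<forall>q\<in>Q. \<Phi> (x, q) = q"
      and \<Phi>leaf: "\<forall>p\<in>P. \<forall>q\<in>Q. \<Phi> (p, q) \<in> leaf \<W> q \<inter> leaf \<W>s p"
      and \<Phi>W: "\<forall>q\<in>Q. continuous_map (subtopology TW P) TW (\<lambda>p. \<Phi> (p, q)) \<and>
                open_map (subtopology TW P) TW (\<lambda>p. \<Phi> (p, q))"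
      and \<Phi>Ws: "\<forall>p\<in>P. continuous_map (subtopology TWs Q) TWs (\<lambda>q. \<Phi> (p, q)) \<and>
                open_map (subtopology TWs Q) TWs (\<lambda>q. \<Phi> (p, q))"
    unfolding local_product_at_def by (elim exE conjE)
  have PX: "P \<subseteq> X" "Q \<subseteq> X" using openin_subset [OF P(1)] openin_subset [OF Q(1)] by auto
  have \<Phi>c: "continuous_map (prod_topology (subtopology TW P) (subtopology TWs Q)) TV \<Phi>"
    using homeomorphic_imp_continuous_map [OF hom] continuous_map_in_subtopology by metis
  have "inj_on \<Phi> (topspace (prod_topology (subtopology TW P) (subtopology TWs Q)))"
    using homeomorphic_imp_injective_map [OF hom] .
  then have \<Phi>inj: "inj_on \<Phi> (P \<times> Q)" using PX by (simp add: Int_absorb1)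
  have "holonomic (\<tau> 0) (\<tau> 1)" if \<tau>: "continuous_map TI TWs \<tau>" "\<tau> ` {0..1} \<subseteq> Q" for \<tau>
  proof -
    have \<tau>Q: "\<tau> t \<in> Q" if "t \<in> {0..1}" for t using \<tau>(2) that by auto
    have \<tau>c: "continuous_map TI (subtopology TWs Q) \<tau>"
      using \<tau> by (auto simp: continuous_map_in_subtopology)
    define g where "g = (\<lambda>p. \<Phi> (p, \<tau> 0))"
    define N where "N = g ` P"
    have gc: "continuous_map (subtopology TW P) TW g" and go: "open_map (subtopology TW P) TW g"
      using \<Phi>W \<tau>Q [of 0] by (auto simp: g_def)
    have N: "openin TW N"
      using go PX unfolding N_def open_map_def by (simp add: openin_subtopology_refl)
    have NX: "N \<subseteq> X" using openin_subset [OF N] by simp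
    have "homeomorphic_map (subtopology TW P) (subtopology TW N) g"
    proof (rule bijective_open_imp_homeomorphic_map)
      show "continuous_map (subtopology TW P) (subtopology TW N) g"
        using gc PX by (auto simp: continuous_map_in_subtopology N_def)
      show "open_map (subtopology TW P) (subtopology TW N) g"
        using go PX by (intro open_map_into_subtopology) (auto simp: N_def)
      show "g ` topspace (subtopology TW P) = topspace (subtopology TW N)"
        using PX NX by (simp add: N_def Int_absorb1)
      show "inj_on g (topspace (subtopology TW P))"
        using \<Phi>inj \<tau>Q [of 0] PX by (auto simp: inj_on_def g_def)
    qed
    then obtain g' where "homeomorphic_maps (subtopology TW P) (subtopology TW N) g g'"
      using homeomorphic_map_maps by blast
    then have g': "continuous_map (subtopology TW N) (subtopology TW P) g'"
        "\<And>p. p \<in> P \<Longrightarrow> g' (g p) = p" "\<And>z. z \<in> N \<Longrightarrow> g (g' z) = z"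
      using PX NX by (auto simp: homeomorphic_maps_def)
    have g'P: "g' z \<in> P" if "z \<in> N" for z using that g'(2) by (auto simp: N_def)
    define \<sigma> where "\<sigma> t z = \<Phi> (g' z, \<tau> t)" for t z
    have g0: "g x = \<tau> 0" using \<Phi>x \<tau>Q [of 0] by (simp add: g_def)
    have \<sigma>x: "\<sigma> t (\<tau> 0) = \<tau> t" if "t \<in> {0..1}" for t
      using g'(2) [OF P(2)] g0 \<Phi>x \<tau>Q [OF that] by (simp add: \<sigma>_def)
    have "local_holonomy \<W> \<W>s \<V> (\<tau> 0) (\<tau> 1) N (\<sigma> 1)"
      unfolding local_holonomy_def
    proof (intro conjI exI [of _ \<sigma>] ballI)
      show "openin TW N" by (rule N)
      show "\<tau> 0 \<in> N" using g0 P(2) unfolding N_def by (metis imageI)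
      show "N \<subseteq> leaf \<W> (\<tau> 0)" using \<Phi>leaf \<tau>Q [of 0] by (auto simp: N_def g_def)
      show "\<sigma> 1 (\<tau> 0) = \<tau> 1" using \<sigma>x [of 1] by simp
      fix z assume z: "z \<in> N"
      show "\<sigma> 0 z = z" using g'(3) [OF z] by (simp add: \<sigma>_def g_def)
      show "\<sigma> 1 z = \<sigma> 1 z" ..
      show "continuous_map TI TWs (\<lambda>t. \<sigma> t z)"
      proof -
        have "continuous_map (subtopology TWs Q) TWs (\<lambda>q. \<Phi> (g' z, q))" using \<Phi>Ws g'P [OF z] by blast
        then show ?thesis unfolding \<sigma>_def using continuous_map_compose [OF \<tau>c] by (simp add: o_def)
      qed
    next
      fix t z assume t: "t \<in> {0..1::real}" and z: "z \<in> N"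
      have "z \<in> leaf \<W>s (g' z)" using \<Phi>leaf g'P [OF z] \<tau>Q [of 0] g'(3) [OF z] by (force simp: g_def)
      then have "leaf \<W>s z = leaf \<W>s (g' z)" by (rule Ws.leaf_eq)
      then show "\<sigma> t z \<in> leaf \<W>s z \<inter> leaf \<W> (\<sigma> t (\<tau> 0))"
        using \<Phi>leaf g'P [OF z] \<tau>Q [OF t] unfolding \<sigma>x [OF t] by (auto simp: \<sigma>_def)
    next
      fix t assume t: "t \<in> {0..1::real}"
      have "continuous_map (subtopology TW P) TW (\<lambda>p. \<Phi> (p, \<tau> t))" using \<Phi>W \<tau>Q [OF t] by blast
      then show "continuous_map (subtopology TW N) TW (\<sigma> t)"
        using continuous_map_compose [OF g'(1)] by (simp add: o_def \<sigma>_def [abs_def])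
    next
      have "continuous_map (prod_topology TI (subtopology TW N)) (subtopology TW P) (\<lambda>x. g' (snd x))"
        using continuous_map_compose [OF continuous_map_snd g'(1)] by (simp add: o_def)
      moreover have "continuous_map (prod_topology TI (subtopology TW N)) (subtopology TWs Q) (\<lambda>x. \<tau> (fst x))"
        using continuous_map_compose [OF continuous_map_fst \<tau>c] by (simp add: o_def)
      ultimately have "continuous_map (prod_topology TI (subtopology TW N))
          (prod_topology (subtopology TW P) (subtopology TWs Q)) (\<lambda>x. (g' (snd x), \<tau> (fst x)))"
        by (simp add: continuous_map_paired)
      then have "continuous_map (prod_topology TI (subtopology TW N)) TV (\<Phi> \<circ> (\<lambda>x. (g' (snd x), \<tau> (fst x))))"
        using \<Phi>c by (rule continuous_map_compose)
      then show "continuous_map (prod_topology TI (subtopology TW N)) TV (\<lambda>(t, z). \<sigma> t z)"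
        by (simp add: \<sigma>_def o_def split_def)
    qed
    then show ?thesis unfolding holonomic_def by blast
  qed
  then show ?thesis using Q by blast
qed

lemma holonomic_refl: assumes "x \<in> X" shows "holonomic x x"
proof -
  obtain Q where Q: "openin TWs Q" "x \<in> Q"
      "\<And>\<tau>. continuous_map TI TWs \<tau> \<and> \<tau> ` {0..1} \<subseteq> Q \<Longrightarrow> holonomic (\<tau> 0) (\<tau> 1)"
    using local_slide [OF assms] by metis
  show ?thesis using Q(3) [of "\<lambda>_. x"] Q(2) assms by auto
qed

text \<open>Two holonomies are composed by concatenating their motions, on the points that the first one
  moves into the domain of the second one.\<close>

lemma holonomic_trans:
  assumes 1: "holonomic x y" and 2: "holonomic y w" shows "holonomic x w"
proof -
  obtain N1 H1 \<sigma>1 where N1: "openin TW N1" "x \<in> N1" "N1 \<subseteq> leaf \<W> x" "H1 x = y"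
      and s1: "\<forall>z\<in>N1. \<sigma>1 0 z = z \<and> \<sigma>1 1 z = H1 z"
        "\<forall>t\<in>{0..1}. \<forall>z\<in>N1. \<sigma>1 t z \<in> leaf \<W>s z \<inter> leaf \<W> (\<sigma>1 t x)"
        "\<forall>z\<in>N1. continuous_map TI TWs (\<lambda>t. \<sigma>1 t z)"
        "\<forall>t\<in>{0..1}. continuous_map (subtopology TW N1) TW (\<sigma>1 t)"
        "continuous_map (prod_topology TI (subtopology TW N1)) TV (\<lambda>(t, z). \<sigma>1 t z)"
    using 1 unfolding holonomic_def local_holonomy_def by (elim exE conjE)
  obtain N2 H2 \<sigma>2 where N2: "openin TW N2" "y \<in> N2" "N2 \<subseteq> leaf \<W> y" "H2 y = w"
      and s2: "\<forall>z\<in>N2. \<sigma>2 0 z = z \<and> \<sigma>2 1 z = H2 z"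
        "\<forall>t\<in>{0..1}. \<forall>z\<in>N2. \<sigma>2 t z \<in> leaf \<W>s z \<inter> leaf \<W> (\<sigma>2 t y)"
        "\<forall>z\<in>N2. continuous_map TI TWs (\<lambda>t. \<sigma>2 t z)"
        "\<forall>t\<in>{0..1}. continuous_map (subtopology TW N2) TW (\<sigma>2 t)"
        "continuous_map (prod_topology TI (subtopology TW N2)) TV (\<lambda>(t, z). \<sigma>2 t z)"
    using 2 unfolding holonomic_def local_holonomy_def by (elim exE conjE)
  have N1X: "N1 \<subseteq> X" "N2 \<subseteq> X" using openin_subset [OF N1(1)] openin_subset [OF N2(1)] by auto
  define h where "h = \<sigma>1 1"
  have hH: "h z = H1 z" if "z \<in> N1" for z using s1(1) that by (simp add: h_def)
  have hx: "h x = y" using hH N1 by simp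
  have hc: "continuous_map (subtopology TW N1) TW h" using s1(4) by (simp add: h_def)
  define N where "N = {z \<in> N1. h z \<in> N2}"
  have "openin (subtopology TW N1) N"
    using openin_continuous_map_preimage [OF hc N2(1)] N1X by (simp add: N_def Int_absorb1)
  then have N: "openin TW N" using N1(1) openin_trans_full by blast
  have NN1: "N \<subseteq> N1" by (auto simp: N_def)
  have NX: "N \<subseteq> X" using NN1 N1X by auto
  have id1: "continuous_map (subtopology TW N) (subtopology TW N1) id"
    using NN1 NX N1X by (auto simp: continuous_map_in_subtopology continuous_map_from_subtopology)
  have hN: "continuous_map (subtopology TW N) (subtopology TW N2) h"
    using continuous_map_from_subtopology_mono [OF hc NN1] by (auto simp: continuous_map_in_subtopology N_def)
  define \<sigma> where "\<sigma> t z = (if t \<le> 1/2 then \<sigma>1 (2 * t) z else \<sigma>2 (2 * t - 1) (h z))" for t z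
  have match: "\<sigma>1 (2 * t) z = \<sigma>2 (2 * t - 1) (h z)" if "t = 1/2" "z \<in> N" for t z
  proof -
    have "2 * t = 1" "2 * t - 1 = 0" using that(1) by auto
    then show ?thesis using that(2) s2(1) unfolding N_def h_def by simp
  qed
  have T1: "continuous_map (subtopology TI {t \<in> topspace TI. t \<le> 1/2}) TI (\<lambda>t. 2 * t)"
    and T2: "continuous_map (subtopology TI {t \<in> topspace TI. 1/2 \<le> t}) TI (\<lambda>t. 2 * t - 1)"
    by (auto simp: continuous_map_in_subtopology continuous_map_from_subtopology intro!: continuous_intros)
  let ?P = "prod_topology TI (subtopology TW N)"
  have "local_holonomy \<W> \<W>s \<V> x w N (\<lambda>z. H2 (H1 z))"
    unfolding local_holonomy_def
  proof (intro conjI exI [of _ \<sigma>] ballI)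
    show "openin TW N" by (rule N)
    show "x \<in> N" using N1(2) hx N2(2) by (simp add: N_def)
    show "N \<subseteq> leaf \<W> x" using N1(3) NN1 by auto
    show "H2 (H1 x) = w" using N1(4) N2(4) by simp
    fix z assume z: "z \<in> N"
    show "\<sigma> 0 z = z" using s1(1) z NN1 by (auto simp: \<sigma>_def)
    show "\<sigma> 1 z = H2 (H1 z)" using s2(1) hH z by (auto simp: \<sigma>_def N_def)
    show "continuous_map TI TWs (\<lambda>t. \<sigma> t z)"
      unfolding \<sigma>_def
    proof (rule continuous_map_cases_le)
      show "continuous_map TI euclideanreal (\<lambda>t. t)" "continuous_map TI euclideanreal (\<lambda>t. 1/2)"
        by (auto simp: continuous_map_from_subtopology)
      show "continuous_map (subtopology TI {t \<in> topspace TI. t \<le> 1/2}) TWs (\<lambda>t. \<sigma>1 (2 * t) z)"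
        using continuous_map_compose [OF T1, of TWs "\<lambda>t. \<sigma>1 t z"] s1(3) z NN1 by (auto simp: o_def)
      show "continuous_map (subtopology TI {t \<in> topspace TI. 1/2 \<le> t}) TWs (\<lambda>t. \<sigma>2 (2 * t - 1) (h z))"
        using continuous_map_compose [OF T2, of TWs "\<lambda>t. \<sigma>2 t (h z)"] s2(3) z by (auto simp: o_def N_def)
    qed (use match z in auto)
  next
    fix t z assume t: "t \<in> {0..1::real}" and z: "z \<in> N"
    have zx: "z \<in> N1" "h z \<in> N2" using z by (auto simp: N_def)
    show "\<sigma> t z \<in> leaf \<W>s z \<inter> leaf \<W> (\<sigma> t x)"
    proof (cases "t \<le> 1/2")
      case True
      then have "2 * t \<in> {0..1}" using t by auto
      then have "\<sigma>1 (2 * t) z \<in> leaf \<W>s z \<inter> leaf \<W> (\<sigma>1 (2 * t) x)" using s1(2) zx by blast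
      then show ?thesis using True by (simp add: \<sigma>_def)
    next
      case False
      then have "2 * t - 1 \<in> {0..1}" using t by auto
      then have "\<sigma>2 (2 * t - 1) (h z) \<in> leaf \<W>s (h z) \<inter> leaf \<W> (\<sigma>2 (2 * t - 1) y)"
        using s2(2) zx by blast
      moreover have "h z \<in> leaf \<W>s z" using s1(2) zx by (auto simp: h_def)
      ultimately show ?thesis using False hx Ws.leaf_eq [of "h z" z] by (simp add: \<sigma>_def)
    qed
  next
    fix t assume t: "t \<in> {0..1::real}"
    show "continuous_map (subtopology TW N) TW (\<sigma> t)"
    proof (cases "t \<le> 1/2")
      case True
      then have "continuous_map (subtopology TW N1) TW (\<sigma>1 (2 * t))" using s1(4) t by auto
      then show ?thesis using continuous_map_from_subtopology_mono NN1 True by (fastforce simp: \<sigma>_def [abs_def])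
    next
      case False
      then have "continuous_map (subtopology TW N2) TW (\<sigma>2 (2 * t - 1))" using s2(4) t by auto
      then show ?thesis using continuous_map_compose [OF hN] False by (simp add: \<sigma>_def [abs_def] o_def)
    qed
  next
    have "continuous_map ?P TV (\<lambda>x. if fst x \<le> 1/2 then \<sigma>1 (2 * fst x) (snd x)
        else \<sigma>2 (2 * fst x - 1) (h (snd x)))"
    proof (rule continuous_map_cases_le)
      show "continuous_map ?P euclideanreal fst"
        using continuous_map_fst continuous_map_in_subtopology by blast
      show "continuous_map ?P euclideanreal (\<lambda>x. 1/2)" by simp
      have f: "continuous_map ?P TI fst" and s: "continuous_map ?P (subtopology TW N) snd"
        by (simp_all add: continuous_map_fst continuous_map_snd)
      let ?A = "subtopology ?P {x \<in> topspace ?P. fst x \<le> 1/2}"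
      let ?B = "subtopology ?P {x \<in> topspace ?P. 1/2 \<le> fst x}"
      have "continuous_map ?A (subtopology TI {t \<in> topspace TI. t \<le> 1/2}) fst"
        using continuous_map_from_subtopology [OF f] by (auto simp: continuous_map_in_subtopology)
      then have "continuous_map ?A TI (\<lambda>x. 2 * fst x)"
        using continuous_map_compose [OF _ T1] by (fastforce simp: o_def)
      moreover have "continuous_map ?A (subtopology TW N1) snd"
        using continuous_map_compose [OF continuous_map_from_subtopology [OF s] id1] by simp
      ultimately have "continuous_map ?A (prod_topology TI (subtopology TW N1)) (\<lambda>x. (2 * fst x, snd x))"
        by (simp add: continuous_map_paired)
      from continuous_map_compose [OF this s1(5)]
      show "continuous_map ?A TV (\<lambda>x. \<sigma>1 (2 * fst x) (snd x))" by (simp add: o_def)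
      have "continuous_map ?B (subtopology TI {t \<in> topspace TI. 1/2 \<le> t}) fst"
        using continuous_map_from_subtopology [OF f] by (auto simp: continuous_map_in_subtopology)
      then have "continuous_map ?B TI (\<lambda>x. 2 * fst x - 1)"
        using continuous_map_compose [OF _ T2] by (fastforce simp: o_def)
      moreover have "continuous_map ?B (subtopology TW N2) (\<lambda>x. h (snd x))"
        using continuous_map_compose [OF continuous_map_from_subtopology [OF s] hN] by (simp add: o_def)
      ultimately have "continuous_map ?B (prod_topology TI (subtopology TW N2)) (\<lambda>x. (2 * fst x - 1, h (snd x)))"
        by (simp add: continuous_map_paired)
      from continuous_map_compose [OF this s2(5)]
      show "continuous_map ?B TV (\<lambda>x. \<sigma>2 (2 * fst x - 1) (h (snd x)))" by (simp add: o_def)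
    qed (use match NX in auto)
    then show "continuous_map ?P TV (\<lambda>(t, z). \<sigma> t z)"
      by (simp add: \<sigma>_def split_def)
  qed
  then show ?thesis unfolding holonomic_def by blast
qed

text \<open>By \<open>local_slide\<close> nearby points of a plaque are joined by a holonomy in both directions, and a
  plaque is connected.\<close>

lemma holonomic_plaque:
  assumes B: "B \<in> \<W>s" "p \<in> bdom B" and q: "q \<in> plaque B p"
  shows "holonomic p q"
proof -
  let ?g = "\<lambda>a. binv B (bmap B p + a)"
  let ?S = "Ws.slice B p"
  have S: "convex ?S" "0 \<in> ?S" using Ws.convex_slice Ws.zero_in_slice B by auto
  obtain b where b: "b \<in> ?S" "q = ?g b" using q Ws.plaque_slice [OF B(1)] by blast
  have gX: "?g a \<in> X" if "a \<in> ?S" for a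
    using Ws.binv_slice [OF B(1) that] Ws.plaque_subset_X [OF B(1), of p] by auto
  have "holonomic (?g 0) (?g b)"
  proof (rule connected_equivalence_relation_gen [OF convex_connected [OF S(1)] S(2) b(1),
        where P = "\<lambda>_. True" and R = "\<lambda>a b. holonomic (?g a) (?g b)"])
    show "holonomic (?g u) (?g w)" if "holonomic (?g u) (?g v)" "holonomic (?g v) (?g w)" for u v w
      using that by (rule holonomic_trans)
    show "\<exists>z. z \<in> T \<and> True" if "a \<in> T" for T and a :: 'e using that by blast
    fix a assume a: "a \<in> ?S"
    obtain Q where Q: "openin TWs Q" "?g a \<in> Q"
        "\<And>\<tau>. continuous_map TI TWs \<tau> \<and> \<tau> ` {0..1} \<subseteq> Q \<Longrightarrow> holonomic (\<tau> 0) (\<tau> 1)"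
      using local_slide [OF gX [OF a]] by metis
    have "openin (top_of_set ?S) {a \<in> ?S. ?g a \<in> Q}"
      using openin_continuous_map_preimage [OF Ws.slice_continuous [OF B] Q(1)] by simp
    then obtain e where e: "e > 0" "ball a e \<inter> ?S \<subseteq> {a \<in> ?S. ?g a \<in> Q}"
      using a Q(2) by (auto simp: openin_contains_ball)
    show "\<exists>T. openin (top_of_set ?S) T \<and> a \<in> T \<and>
        (\<forall>x\<in>T. \<forall>y\<in>T. True \<and> True \<longrightarrow> holonomic (?g x) (?g y))"
    proof (intro exI [of _ "ball a e \<inter> ?S"] conjI ballI impI)
      show "openin (top_of_set ?S) (ball a e \<inter> ?S)" by (subst Int_commute) (intro openin_open_Int open_ball)
      show "a \<in> ball a e \<inter> ?S" using e(1) a by simp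
      fix u v assume uv: "u \<in> ball a e \<inter> ?S" "v \<in> ball a e \<inter> ?S"
      let ?\<gamma> = "\<lambda>t. (1 - t) *\<^sub>R u + t *\<^sub>R v"
      have \<gamma>: "?\<gamma> t \<in> ball a e \<inter> ?S" if "t \<in> {0..1}" for t
      proof -
        have "convex (ball a e \<inter> ?S)" using S(1) by (intro convex_Int convex_ball)
        then show ?thesis using uv that by (intro convexD_alt) auto
      qed
      have "continuous_map TI (top_of_set ?S) ?\<gamma>"
        using \<gamma> by (auto simp: continuous_map_in_subtopology intro!: continuous_intros)
      from continuous_map_compose [OF this Ws.slice_continuous [OF B]]
      have "continuous_map TI TWs (\<lambda>t. ?g (?\<gamma> t))" by (simp add: o_def)
      moreover have "(\<lambda>t. ?g (?\<gamma> t)) ` {0..1} \<subseteq> Q" using \<gamma> e(2) by blast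
      ultimately have "holonomic (?g (?\<gamma> 0)) (?g (?\<gamma> 1))" using Q(3) [of "\<lambda>t. ?g (?\<gamma> t)"] by blast
      then show "holonomic (?g u) (?g v)" by simp
    qed
  qed auto
  then show ?thesis using B b by simp
qed

text \<open>A leaf is a chain of plaques, along which the holonomies are composed.\<close>

lemma local_holonomy_exists:
  assumes x: "x \<in> X" and y: "y \<in> leaf \<W>s x"
  shows "\<exists>N H. local_holonomy \<W> \<W>s \<V> x y N H"
proof -
  have "(x, y) \<in> Ws.step\<^sup>*" using y by (simp add: Ws.leaf_step)
  then have "holonomic x y"
  proof induction
    case base
    show ?case by (rule holonomic_refl [OF x])
  next
    case (step u v)
    then have "holonomic u v" using holonomic_plaque by (auto simp: Ws.step_def)
    then show ?case using step.IH holonomic_trans by blast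
  qed
  then show ?thesis by (simp add: holonomic_def)
qed

end

section \<open>Orbits in charts\<close>

primrec iterate_along :: "('a \<Rightarrow> 'b \<Rightarrow> 'b) \<Rightarrow> ('a \<Rightarrow> 'a) \<Rightarrow> nat \<Rightarrow> 'a \<Rightarrow> 'b \<Rightarrow> 'b" where
  "iterate_along A f 0 p = id"
| "iterate_along A f (Suc n) p = A ((f ^^ n) p) \<circ> iterate_along A f n p"

lemma powr_one_plus: "0 \<le> t \<Longrightarrow> t powr (1 + b) = t * t powr b" for t b :: real
  by (simp add: powr_mult_base)

lemma powr_one_plus_scale:
  fixes t c b :: real
  assumes "0 \<le> t" "1 \<le> c" "0 < b" "b \<le> 1"
  shows "(c * t) powr (1 + b) \<le> c\<^sup>2 * t powr (1 + b)"
proof -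
  have "c powr (1 + b) \<le> c powr 2" using assms by (intro powr_mono) auto
  also have "\<dots> = c\<^sup>2" using assms by (simp add: powr_numeral)
  finally show ?thesis using assms by (simp add: powr_mult mult_right_mono)
qed

text \<open>A differentiable map seen in finitely many charts \<open>\<phi> i\<close>, with constants that hold for all of
  them. The sets \<open>K1 i\<close> cover \<open>X\<close>, and a point of \<open>K1 i\<close> may be moved by \<open>\<rho>\<close> without leaving \<open>K2 i\<close>,
  where the estimates hold; the second point of an estimate is only required to lie in the chart
  domain. The map \<open>\<tau> i q\<close> passes from the tangent vectors at \<open>q\<close> to coordinates in the chart \<open>i\<close>,
  \<open>A\<close> is the derivative of \<open>f\<close> on tangent vectors and \<open>D i j\<close> its expression in charts.\<close>

locale chart_dynamics =
  fixes X :: "'a set" and f :: "'a \<Rightarrow> 'a"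
    and J :: "'i set" and dom K1 K2 :: "'i \<Rightarrow> 'a set"
    and \<phi> :: "'i \<Rightarrow> 'a \<Rightarrow> 'e::euclidean_space"
    and \<tau> :: "'i \<Rightarrow> 'a \<Rightarrow> 'e \<Rightarrow> 'e" and A :: "'a \<Rightarrow> 'e \<Rightarrow> 'e" and D :: "'i \<Rightarrow> 'i \<Rightarrow> 'a \<Rightarrow> 'e \<Rightarrow> 'e"
    and \<rho> K \<beta> :: real
  assumes const: "0 < \<rho>" "1 \<le> K" "0 < \<beta>" "\<beta> \<le> 1"
    and fX: "p \<in> X \<Longrightarrow> f p \<in> X"
    and core: "p \<in> X \<Longrightarrow> \<exists>i\<in>J. p \<in> K1 i"
    and core_sub: "i \<in> J \<Longrightarrow> K1 i \<subseteq> K2 i" "i \<in> J \<Longrightarrow> K2 i \<subseteq> dom i" "i \<in> J \<Longrightarrow> dom i \<subseteq> X"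
    and margin: "i \<in> J \<Longrightarrow> p \<in> K1 i \<Longrightarrow> q \<in> dom i \<Longrightarrow> norm (\<phi> i q - \<phi> i p) \<le> \<rho> \<Longrightarrow> q \<in> K2 i"
    and step: "i \<in> J \<Longrightarrow> j \<in> J \<Longrightarrow> q \<in> K2 i \<Longrightarrow> f q \<in> K2 j \<Longrightarrow> q' \<in> dom i \<Longrightarrow>
      norm (\<phi> i q' - \<phi> i q) < \<rho> \<Longrightarrow>
      f q' \<in> dom j \<and>
      norm (\<phi> j (f q') - \<phi> j (f q)) \<le> K * norm (\<phi> i q' - \<phi> i q) \<and>
      norm (\<phi> j (f q') - \<phi> j (f q) - D i j q (\<phi> i q' - \<phi> i q))
        \<le> K * norm (\<phi> i q' - \<phi> i q) powr (1 + \<beta>) \<and>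
      (\<forall>v. norm (D i j q' v - D i j q v) \<le> K * norm (\<phi> i q' - \<phi> i q) powr \<beta> * norm v) \<and>
      (\<forall>v. norm (D i j q v) \<le> K * norm v)"
    and linear_D: "i \<in> J \<Longrightarrow> j \<in> J \<Longrightarrow> q \<in> dom i \<Longrightarrow> f q \<in> dom j \<Longrightarrow> linear (D i j q)"
    and linear_\<tau>: "i \<in> J \<Longrightarrow> q \<in> dom i \<Longrightarrow> linear (\<tau> i q)"
    and inj_\<tau>: "i \<in> J \<Longrightarrow> q \<in> dom i \<Longrightarrow> inj (\<tau> i q)"
    and linear_A: "p \<in> X \<Longrightarrow> linear (A p)"
    and intertwine: "i \<in> J \<Longrightarrow> j \<in> J \<Longrightarrow> q \<in> dom i \<Longrightarrow> f q \<in> dom j \<Longrightarrow>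
      D i j q (\<tau> i q v) = \<tau> j (f q) (A q v)"
begin

lemma K2_dom: "i \<in> J \<Longrightarrow> p \<in> K2 i \<Longrightarrow> p \<in> dom i" and K2_X: "i \<in> J \<Longrightarrow> p \<in> K2 i \<Longrightarrow> p \<in> X"
  and K1_K2: "i \<in> J \<Longrightarrow> p \<in> K1 i \<Longrightarrow> p \<in> K2 i" and dom_X: "i \<in> J \<Longrightarrow> p \<in> dom i \<Longrightarrow> p \<in> X"
  using core_sub by blast+

lemma orbit_X: "p \<in> X \<Longrightarrow> (f ^^ n) p \<in> X"
  by (induction n) (simp_all add: fX)

abbreviation "iter \<equiv> iterate_along A f"

lemma linear_iter: "p \<in> X \<Longrightarrow> linear (iter n p)"
proof (induction n)
  case 0 then show ?case by (simp add: id_def linear_ident)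
next
  case (Suc n)
  then show ?case by (simp del: o_apply add: linear_compose linear_A orbit_X)
qed

text \<open>\<open>j\<close> chooses a chart at every time along the orbit of \<open>p\<close>; displacements from that orbit are
  measured in these charts.\<close>

definition charts :: "(nat \<Rightarrow> 'i) \<Rightarrow> 'a \<Rightarrow> nat \<Rightarrow> bool" where
  "charts j p n \<longleftrightarrow> (\<forall>i\<le>n. j i \<in> J \<and> (f ^^ i) p \<in> K2 (j i))"

definition disp :: "(nat \<Rightarrow> 'i) \<Rightarrow> 'a \<Rightarrow> 'a \<Rightarrow> nat \<Rightarrow> 'e" where
  "disp j p p' i = \<phi> (j i) ((f ^^ i) p') - \<phi> (j i) ((f ^^ i) p)"

text \<open>The first bound on \<open>r powr \<beta>\<close> makes tangent vectors and displacements of size at most \<open>r\<close>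
  comparable, and the second one makes the relative error of the linearization at most \<open>\<kappa>\<close>; see
  \<open>approx_bounds\<close> and \<open>one_step_relative\<close>.\<close>

definition small :: "real \<Rightarrow> real \<Rightarrow> bool" where
  "small \<kappa> r \<longleftrightarrow> 0 < r \<and> r < \<rho> \<and> r \<le> 1 \<and> K * r powr \<beta> \<le> 1/2 \<and> 6 * K ^ 5 * r powr \<beta> \<le> \<kappa>"

lemma small_exists:
  assumes "0 < \<kappa>" shows "\<exists>r. small \<kappa> r"
proof -
  have t: "((\<lambda>r. c * r powr \<beta>) \<longlongrightarrow> c * 0) (at_right 0)" for c
  proof -
    have "\<forall>\<^sub>F r::real in at_right 0. 0 \<le> r"
      using eventually_at_right_less [of "0::real"] by eventually_elim simp
    then have "((\<lambda>r::real. r powr \<beta>) \<longlongrightarrow> 0 powr \<beta>) (at_right 0)"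
      using const by (intro tendsto_powr') auto
    then show ?thesis using const by (intro tendsto_intros) simp
  qed
  have "\<forall>\<^sub>F r in at_right 0. K * r powr \<beta> < 1/2"
    using order_tendstoD(2) [OF t, of K "1/2"] by simp
  moreover have "\<forall>\<^sub>F r in at_right 0. 6 * K ^ 5 * r powr \<beta> < \<kappa>"
    using order_tendstoD(2) [OF t, of "6 * K^5" \<kappa>] assms by simp
  moreover have "\<forall>\<^sub>F r in at_right 0. r < min \<rho> 1" 
    by (rule order_tendstoD(2) [OF tendsto_ident_at]) (use const in auto)
  moreover have "\<forall>\<^sub>F r::real in at_right 0. 0 < r" by (simp add: eventually_at_right_less)
  ultimately have "\<forall>\<^sub>F r in at_right 0. small \<kappa> r"
    by eventually_elim (auto simp: small_def)
  then show ?thesis using eventually_happens' [OF trivial_limit_at_right_real] by blast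
qed

end

text \<open>An invariant bundle \<open>E\<close>, with norms comparable to those of the charts, that is tangent to the
  plaques: \<open>P i q q'\<close> says that \<open>q'\<close> lies in the plaque of \<open>q\<close>, and then the displacement from \<open>q\<close> to
  \<open>q'\<close> is a vector of \<open>E q\<close> up to an error of order \<open>1 + \<beta>\<close>.\<close>

locale leafwise = chart_dynamics X f J dom K1 K2 \<phi> \<tau> A D \<rho> K \<beta>
  for X :: "'a set" and f :: "'a \<Rightarrow> 'a"
    and J :: "'i set" and dom K1 K2 :: "'i \<Rightarrow> 'a set"
    and \<phi> :: "'i \<Rightarrow> 'a \<Rightarrow> 'e::euclidean_space"
    and \<tau> :: "'i \<Rightarrow> 'a \<Rightarrow> 'e \<Rightarrow> 'e" and A :: "'a \<Rightarrow> 'e \<Rightarrow> 'e" and D :: "'i \<Rightarrow> 'i \<Rightarrow> 'a \<Rightarrow> 'e \<Rightarrow> 'e"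
    and \<rho> K \<beta> :: real +
  fixes E :: "'a \<Rightarrow> 'e set" and nrm :: "'a \<Rightarrow> 'e \<Rightarrow> real" and P :: "'i \<Rightarrow> 'a \<Rightarrow> 'a \<Rightarrow> bool"
  assumes subspace_E: "p \<in> X \<Longrightarrow> subspace (E p)"
    and A_E: "p \<in> X \<Longrightarrow> v \<in> E p \<Longrightarrow> A p v \<in> E (f p)"
    and nrm_triangle: "p \<in> X \<Longrightarrow> u \<in> E p \<Longrightarrow> v \<in> E p \<Longrightarrow> nrm p (u + v) \<le> nrm p u + nrm p v"
    and nrm_minus: "p \<in> X \<Longrightarrow> v \<in> E p \<Longrightarrow> nrm p (- v) = nrm p v"
    and nrm_equiv: "i \<in> J \<Longrightarrow> q \<in> K2 i \<Longrightarrow> v \<in> E q \<Longrightarrow>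
      norm (\<tau> i q v) \<le> K * nrm q v \<and> nrm q v \<le> K * norm (\<tau> i q v)"
    and plaque_step: "i \<in> J \<Longrightarrow> j \<in> J \<Longrightarrow> q \<in> K2 i \<Longrightarrow> f q \<in> K2 j \<Longrightarrow> q' \<in> dom i \<Longrightarrow>
      norm (\<phi> i q' - \<phi> i q) < \<rho> \<Longrightarrow> P i q q' \<Longrightarrow> P j (f q) (f q')"
    and plaque_taylor: "i \<in> J \<Longrightarrow> q \<in> K2 i \<Longrightarrow> q' \<in> dom i \<Longrightarrow>
      norm (\<phi> i q' - \<phi> i q) < \<rho> \<Longrightarrow> P i q q' \<Longrightarrow>
      \<exists>v\<in>E q. norm (\<phi> i q' - \<phi> i q - \<tau> i q v) \<le> K * norm (\<phi> i q' - \<phi> i q) powr (1 + \<beta>)"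
begin

lemma E_diff: "p \<in> X \<Longrightarrow> u \<in> E p \<Longrightarrow> v \<in> E p \<Longrightarrow> u - v \<in> E p"
  and E_add: "p \<in> X \<Longrightarrow> u \<in> E p \<Longrightarrow> v \<in> E p \<Longrightarrow> u + v \<in> E p"
  and E_zero: "p \<in> X \<Longrightarrow> 0 \<in> E p"
  and E_scale: "p \<in> X \<Longrightarrow> v \<in> E p \<Longrightarrow> c *\<^sub>R v \<in> E p"
  using subspace_E by (auto simp: subspace_diff subspace_add subspace_0 subspace_scale)

lemma iter_E: "p \<in> X \<Longrightarrow> v \<in> E p \<Longrightarrow> iter n p v \<in> E ((f ^^ n) p)"
  by (induction n) (simp_all add: A_E orbit_X)

lemma nrm_commute: "p \<in> X \<Longrightarrow> u \<in> E p \<Longrightarrow> v \<in> E p \<Longrightarrow> nrm p (u - v) = nrm p (v - u)"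
  using nrm_minus [of p "u - v"] E_diff by simp

lemma nrm_diff_triangle:
  "p \<in> X \<Longrightarrow> u \<in> E p \<Longrightarrow> v \<in> E p \<Longrightarrow> w \<in> E p \<Longrightarrow> nrm p (u - w) \<le> nrm p (u - v) + nrm p (v - w)"
  using nrm_triangle [of p "u - v" "v - w"] E_diff by simp

lemma nrm_le_diff: "p \<in> X \<Longrightarrow> u \<in> E p \<Longrightarrow> v \<in> E p \<Longrightarrow> nrm p u \<le> nrm p v + nrm p (u - v)"
  using nrm_triangle [of p v "u - v"] E_diff by simp

lemma nrm_pos: assumes "p \<in> X" "v \<in> E p" shows "0 \<le> nrm p v"
proof -
  obtain i where "i \<in> J" "p \<in> K2 i" using core [OF assms(1)] K1_K2 by blast
  then have "norm (\<tau> i p v) \<le> K * nrm p v" using nrm_equiv assms by blast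
  then have "0 \<le> K * nrm p v" using norm_ge_zero order_trans by blast
  then show ?thesis using const by (simp add: zero_le_mult_iff)
qed

lemma nrm_zero: assumes "p \<in> X" shows "nrm p 0 = 0"
proof -
  obtain i where i: "i \<in> J" "p \<in> K2 i" using core [OF assms(1)] K1_K2 by blast
  then have "nrm p 0 \<le> K * norm (\<tau> i p 0)" using nrm_equiv E_zero assms by blast
  then show ?thesis using linear_0 [OF linear_\<tau>] i K2_dom nrm_pos [OF assms E_zero [OF assms]] by simp
qed

lemma nrm_eq_0: assumes "p \<in> X" "v \<in> E p" "nrm p v \<le> 0" shows "v = 0"
proof -
  obtain i where i: "i \<in> J" "p \<in> K2 i" using core [OF assms(1)] K1_K2 by blast
  have "norm (\<tau> i p v) \<le> K * nrm p v" using nrm_equiv i assms by blast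
  also have "\<dots> \<le> 0" using const assms(3) by (simp add: mult_le_0_iff)
  finally have "\<tau> i p v = \<tau> i p 0" using linear_0 [OF linear_\<tau>] i K2_dom by simp
  then show ?thesis using inj_\<tau> i K2_dom by (auto dest: injD)
qed

text \<open>\<open>v\<close> is a tangent vector at \<open>q\<close> that represents the displacement from \<open>q\<close> to \<open>q'\<close> up to an
  error of order \<open>1 + \<beta>\<close>.\<close>

definition approx :: "'i \<Rightarrow> 'a \<Rightarrow> 'a \<Rightarrow> 'e \<Rightarrow> bool" where
  "approx i q q' v \<longleftrightarrow> v \<in> E q \<and>
    norm (\<phi> i q' - \<phi> i q - \<tau> i q v) \<le> K * norm (\<phi> i q' - \<phi> i q) powr (1 + \<beta>)"

lemma approx_bounds:
  assumes i: "i \<in> J" "q \<in> K2 i" and v: "approx i q q' v" and sm: "small \<kappa> r"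
    and le: "norm (\<phi> i q' - \<phi> i q) \<le> r"
  shows "norm (\<tau> i q v) \<le> 2 * norm (\<phi> i q' - \<phi> i q)"
    "norm (\<phi> i q' - \<phi> i q) \<le> 2 * K * nrm q v" "nrm q v \<le> 2 * K * norm (\<phi> i q' - \<phi> i q)"
proof -
  let ?d = "\<phi> i q' - \<phi> i q"
  have vE: "v \<in> E q" using v by (simp add: approx_def)
  have "K * norm ?d powr (1 + \<beta>) = norm ?d * (K * norm ?d powr \<beta>)"
    by (simp add: powr_one_plus)
  also have "\<dots> \<le> norm ?d * (1/2)"
  proof (rule mult_left_mono)
    have "K * norm ?d powr \<beta> \<le> K * r powr \<beta>"
      using const le by (intro mult_left_mono powr_mono2) auto
    then show "K * norm ?d powr \<beta> \<le> 1/2" using sm by (simp add: small_def)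
  qed simp
  finally have *: "norm (?d - \<tau> i q v) \<le> norm ?d / 2" using v by (simp add: approx_def)
  have 1: "norm (\<tau> i q v) \<le> norm ?d + norm (?d - \<tau> i q v)" by (metis norm_minus_commute norm_triangle_sub)
  then show a: "norm (\<tau> i q v) \<le> 2 * norm ?d" using * norm_ge_zero [of ?d] by linarith
  have "norm ?d \<le> norm (\<tau> i q v) + norm (?d - \<tau> i q v)" by (rule norm_triangle_sub)
  then have "norm ?d \<le> 2 * norm (\<tau> i q v)" using * by linarith
  then show "norm ?d \<le> 2 * K * nrm q v" using nrm_equiv [OF i vE] by linarith
  have "nrm q v \<le> K * norm (\<tau> i q v)" using nrm_equiv [OF i vE] by blast
  also have "\<dots> \<le> K * (2 * norm ?d)" using a const by (intro mult_left_mono) auto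
  finally show "nrm q v \<le> 2 * K * norm ?d" by simp
qed

text \<open>Three errors of order \<open>1 + \<beta>\<close> add up: the linearization of \<open>f\<close> at \<open>q\<close>, and the deviation of
  the plaques from their tangent spaces at \<open>q\<close>, transported by the derivative, and at \<open>f q\<close>.\<close>

lemma one_step:
  assumes i: "i \<in> J" "q \<in> K2 i" and j: "j \<in> J" "f q \<in> K2 j" and q': "q' \<in> dom i"
    and lt: "norm (\<phi> i q' - \<phi> i q) < \<rho>"
    and v: "approx i q q' v" and v': "approx j (f q) (f q') v'"
  shows "nrm (f q) (v' - A q v) \<le> 3 * K ^ 4 * norm (\<phi> i q' - \<phi> i q) powr (1 + \<beta>)"
proof -
  let ?d = "\<phi> i q' - \<phi> i q" and ?d' = "\<phi> j (f q') - \<phi> j (f q)"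
  let ?t = "norm ?d powr (1 + \<beta>)"
  have qX: "q \<in> X" using i K2_X by blast
  have dm: "q \<in> dom i" "f q \<in> dom j" using i j K2_dom by auto
  have E: "v \<in> E q" "v' \<in> E (f q)" "A q v \<in> E (f q)" using v v' A_E qX by (auto simp: approx_def)
  have s: "norm ?d' \<le> K * norm ?d" "norm (?d' - D i j q ?d) \<le> K * ?t"
      "\<And>v. norm (D i j q v) \<le> K * norm v"
    using step [OF i(1) j(1) i(2) j(2) q' lt] by blast+
  have "norm (?d' - \<tau> j (f q) v') \<le> K * norm ?d' powr (1 + \<beta>)" using v' by (simp add: approx_def)
  also have "\<dots> \<le> K * (K * norm ?d) powr (1 + \<beta>)"
    using s(1) const by (intro mult_left_mono powr_mono2) auto
  also have "\<dots> \<le> K * (K\<^sup>2 * ?t)"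
    using const by (intro mult_left_mono powr_one_plus_scale) auto
  finally have 1: "norm (?d' - \<tau> j (f q) v') \<le> K ^ 3 * ?t"
    by (simp add: power2_eq_square power3_eq_cube mult.assoc)
  have "norm (D i j q (?d - \<tau> i q v)) \<le> K * (K * ?t)"
    using s(3) [of "?d - \<tau> i q v"] v const unfolding approx_def
    by (meson order_trans mult_left_mono zero_le_one)
  then have 2: "norm (D i j q ?d - D i j q (\<tau> i q v)) \<le> K\<^sup>2 * ?t"
    using linear_diff [OF linear_D [OF i(1) j(1) dm]] by (simp add: power2_eq_square)
  have "\<tau> j (f q) (v' - A q v) = \<tau> j (f q) v' - D i j q (\<tau> i q v)"
    using linear_diff [OF linear_\<tau> [OF j(1) dm(2)]] intertwine [OF i(1) j(1) dm] by simp
  also have "\<dots> = (?d' - D i j q ?d) + (D i j q ?d - D i j q (\<tau> i q v)) - (?d' - \<tau> j (f q) v')"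
    by simp
  finally have eq: "\<tau> j (f q) (v' - A q v) =
      (?d' - D i j q ?d) + (D i j q ?d - D i j q (\<tau> i q v)) - (?d' - \<tau> j (f q) v')" .
  have "norm (\<tau> j (f q) (v' - A q v)) \<le> norm (?d' - D i j q ?d)
      + norm (D i j q ?d - D i j q (\<tau> i q v)) + norm (?d' - \<tau> j (f q) v')"
    unfolding eq by (rule order_trans [OF norm_triangle_ineq4 add_right_mono [OF norm_triangle_ineq]])
  also have "\<dots> \<le> K * ?t + K\<^sup>2 * ?t + K ^ 3 * ?t" using 1 2 s(2) by linarith
  also have "\<dots> \<le> K ^ 3 * ?t + K ^ 3 * ?t + K ^ 3 * ?t"
    using const power_increasing [of 1 3 K] power_increasing [of 2 3 K]
    by (intro add_mono mult_right_mono) auto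
  finally have 3: "norm (\<tau> j (f q) (v' - A q v)) \<le> 3 * K ^ 3 * ?t" by simp
  have "v' - A q v \<in> E (f q)" using E E_diff fX qX by blast
  then have "nrm (f q) (v' - A q v) \<le> K * norm (\<tau> j (f q) (v' - A q v))" using nrm_equiv j by blast
  also have "\<dots> \<le> K * (3 * K ^ 3 * ?t)" using 3 const by (intro mult_left_mono) auto
  finally show ?thesis by (simp add: power_numeral_reduce mult.assoc mult.left_commute)
qed

lemma one_step_relative:
  assumes i: "i \<in> J" "q \<in> K2 i" and j: "j \<in> J" "f q \<in> K2 j" and q': "q' \<in> dom i"
    and sm: "small \<kappa> r" and le: "norm (\<phi> i q' - \<phi> i q) \<le> r"
    and v: "approx i q q' v" and v': "approx j (f q) (f q') v'"
  shows "nrm (f q) (v' - A q v) \<le> \<kappa> * nrm q v"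
proof -
  let ?d = "norm (\<phi> i q' - \<phi> i q)"
  have n: "0 \<le> nrm q v" using nrm_pos K2_X i v by (auto simp: approx_def)
  have "nrm (f q) (v' - A q v) \<le> 3 * K ^ 4 * ?d powr (1 + \<beta>)"
    by (rule one_step [OF i j q' _ v v']) (use sm le in \<open>auto simp: small_def\<close>)
  also have "\<dots> = 3 * K ^ 4 * ?d powr \<beta> * ?d" by (simp add: powr_one_plus)
  also have "\<dots> \<le> 3 * K ^ 4 * r powr \<beta> * (2 * K * nrm q v)"
    using approx_bounds(2) [OF i v sm le] le const by (intro mult_mono powr_mono2) auto
  also have "\<dots> = (6 * K ^ 5 * r powr \<beta>) * nrm q v" by (simp add: power_numeral_reduce)
  also have "\<dots> \<le> \<kappa> * nrm q v" using sm n by (intro mult_right_mono) (auto simp: small_def)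
  finally show ?thesis .
qed

text \<open>As long as the orbit of \<open>p'\<close> stays close to that of \<open>p\<close>, it stays in the charts and in the
  plaques along the orbit of \<open>p\<close>.\<close>

lemma follow:
  assumes ch: "charts j p n" and p': "p' \<in> dom (j 0)" "P (j 0) p p'"
    and lt: "\<And>i. i < n \<Longrightarrow> norm (disp j p p' i) < \<rho>" and "i \<le> n"
  shows "(f ^^ i) p' \<in> dom (j i) \<and> P (j i) ((f ^^ i) p) ((f ^^ i) p')"
  using \<open>i \<le> n\<close>
proof (induction i)
  case (Suc i)
  have "j i \<in> J" "j (Suc i) \<in> J" "(f ^^ i) p \<in> K2 (j i)" "f ((f ^^ i) p) \<in> K2 (j (Suc i))"
    using ch Suc.prems unfolding charts_def by (auto dest: spec [of _ "Suc i"])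
  moreover have "norm (\<phi> (j i) ((f ^^ i) p') - \<phi> (j i) ((f ^^ i) p)) < \<rho>"
    using lt [of i] Suc.prems by (simp add: disp_def)
  ultimately show ?case using step plaque_step Suc by simp
qed (use p' in auto)

lemma disp_Suc:
  assumes ch: "charts j p (Suc i)" and "(f ^^ i) p' \<in> dom (j i)" "norm (disp j p p' i) < \<rho>"
  shows "norm (disp j p p' (Suc i)) \<le> K * norm (disp j p p' i)"
proof -
  have "j i \<in> J" "j (Suc i) \<in> J" "(f ^^ i) p \<in> K2 (j i)" "f ((f ^^ i) p) \<in> K2 (j (Suc i))"
    using ch unfolding charts_def by (auto dest: spec [of _ "Suc i"])
  then show ?thesis using step assms(2,3) by (simp add: disp_def)
qed

lemma approx_exists:
  assumes "charts j p n" "i \<le> n" "(f ^^ i) p' \<in> dom (j i)" "P (j i) ((f ^^ i) p) ((f ^^ i) p')"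
    "norm (disp j p p' i) < \<rho>"
  shows "\<exists>v. approx (j i) ((f ^^ i) p) ((f ^^ i) p') v"
  using assms plaque_taylor unfolding charts_def approx_def disp_def by blast

text \<open>Where \<open>Df\<close> contracts the tangent bundle, nearby points of a leaf approach each other
  exponentially fast: the displacement is represented by tangent vectors at the points of one orbit,
  to which the rate applies step by step, and the error of each step is absorbed by \<open>\<kappa>\<close>.\<close>

lemma contraction:
  assumes rate: "\<And>p v. p \<in> X \<Longrightarrow> v \<in> E p \<Longrightarrow> nrm (f p) (A p v) \<le> \<nu> * nrm p v"
    and sm: "small \<kappa> r" and \<nu>': "\<nu> + \<kappa> \<le> \<nu>'" "0 \<le> \<nu>'" "\<nu>' \<le> 1"
    and ch: "charts j p n" and p': "p' \<in> dom (j 0)" "P (j 0) p p'"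
    and init: "4 * K ^ 3 * norm (disp j p p' 0) \<le> r" and "i \<le> n"
  shows "(f ^^ i) p' \<in> dom (j i) \<and> norm (disp j p p' i) \<le> 4 * K\<^sup>2 * \<nu>' ^ i * norm (disp j p p' 0)"
proof -
  let ?d = "\<lambda>i. norm (disp j p p' i)"
  have Kd: "?d 0 \<le> r"
  proof -
    have "1 \<le> K ^ 3" using const by simp
    then have "1 * ?d 0 \<le> 4 * K ^ 3 * ?d 0" by (intro mult_right_mono) auto
    then show ?thesis using init by simp
  qed
  have r: "r < \<rho>" using sm by (simp add: small_def)
  have j: "j i \<in> J" "(f ^^ i) p \<in> K2 (j i)" if "i \<le> n" for i using ch that by (auto simp: charts_def)
  have pX: "p \<in> X" using j [of 0] K2_X by auto
  obtain v0 where v0: "approx (j 0) p p' v0"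
    using approx_exists [OF ch, of 0 p'] p' Kd r by auto
  have n0: "nrm p v0 \<le> 2 * K * ?d 0"
    using approx_bounds(3) [OF j(1) [of 0] _ v0 sm] Kd j [of 0] by (simp add: disp_def)
  \<comment> \<open>The factor \<open>1 / K\<close> leaves room for one application of \<open>f\<close>, so that the next displacement is
    at most \<open>r\<close> before its better bound is known.\<close>
  have bound: "4 * K\<^sup>2 * \<nu>' ^ i * ?d 0 \<le> r / K" for i
  proof -
    have "4 * K\<^sup>2 * \<nu>' ^ i * ?d 0 \<le> 4 * K\<^sup>2 * 1 * ?d 0"
      using \<nu>' const by (intro mult_right_mono mult_left_mono power_le_one) auto
    also have "\<dots> \<le> r / K" using init const by (simp add: field_simps power3_eq_cube power2_eq_square)
    finally show ?thesis .
  qed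
  have rK: "r / K \<le> r" using const sm by (simp add: divide_le_eq small_def)
  have "(f ^^ i) p' \<in> dom (j i) \<and> P (j i) ((f ^^ i) p) ((f ^^ i) p') \<and>
      ?d i \<le> 4 * K\<^sup>2 * \<nu>' ^ i * ?d 0 \<and>
      (\<exists>v. approx (j i) ((f ^^ i) p) ((f ^^ i) p') v \<and> nrm ((f ^^ i) p) v \<le> \<nu>' ^ i * nrm p v0)"
    if "i \<le> n" for i
    using that
  proof (induction i)
    case 0
    have "1 * ?d 0 \<le> 4 * K\<^sup>2 * ?d 0" using one_le_power [OF const(2), of 2] by (intro mult_right_mono) auto
    then show ?case using p' v0 by auto
  next
    case (Suc i)
    let ?q = "(f ^^ i) p" and ?q' = "(f ^^ i) p'"
    obtain v where IH: "?q' \<in> dom (j i)" "P (j i) ?q ?q'" "?d i \<le> 4 * K\<^sup>2 * \<nu>' ^ i * ?d 0"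
        and v: "approx (j i) ?q ?q' v" "nrm ?q v \<le> \<nu>' ^ i * nrm p v0"
      using Suc by auto
    have di: "?d i \<le> r / K" using IH(3) bound [of i] by linarith
    then have dr: "?d i \<le> r" "?d i < \<rho>" using rK r by auto
    have qX: "?q \<in> X" by (rule orbit_X [OF pX])
    have jj: "j i \<in> J" "j (Suc i) \<in> J" "?q \<in> K2 (j i)" "f ?q \<in> K2 (j (Suc i))"
      using j [of i] j [of "Suc i"] Suc.prems by auto
    have dom: "f ?q' \<in> dom (j (Suc i))" "P (j (Suc i)) (f ?q) (f ?q')"
      using step [OF jj IH(1)] plaque_step [OF jj IH(1)] dr(2) IH(2) by (auto simp: disp_def)
    have chS: "charts j p (Suc i)" using ch Suc.prems by (auto simp: charts_def)
    have dS: "?d (Suc i) \<le> r"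
    proof -
      have "?d (Suc i) \<le> K * ?d i" by (rule disp_Suc [OF chS IH(1) dr(2)])
      also have "\<dots> \<le> K * (r / K)" using di const by (intro mult_left_mono) auto
      finally show ?thesis using const by simp
    qed
    obtain v' where v': "approx (j (Suc i)) (f ?q) (f ?q') v'"
      using approx_exists [OF ch Suc.prems, of p'] dom dS r by auto
    have E: "v \<in> E ?q" "v' \<in> E (f ?q)" "A ?q v \<in> E (f ?q)" "f ?q \<in> X"
      using v v' A_E qX fX by (auto simp: approx_def)
    have "nrm (f ?q) (v' - A ?q v) \<le> \<kappa> * nrm ?q v"
      by (rule one_step_relative [OF jj(1,3) jj(2,4) IH(1) sm _ v(1) v']) (use dr in \<open>simp add: disp_def\<close>)
    then have "nrm (f ?q) v' \<le> \<nu> * nrm ?q v + \<kappa> * nrm ?q v"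
      using nrm_le_diff [OF E(4,2,3)] rate [OF qX E(1)] by linarith
    also have "\<dots> = (\<nu> + \<kappa>) * nrm ?q v" by (simp add: algebra_simps)
    also have "\<dots> \<le> \<nu>' * nrm ?q v" using \<nu>' nrm_pos [OF qX E(1)] by (intro mult_right_mono)
    also have "\<dots> \<le> \<nu>' * (\<nu>' ^ i * nrm p v0)" using v(2) \<nu>' by (intro mult_left_mono)
    finally have n': "nrm (f ?q) v' \<le> \<nu>' ^ Suc i * nrm p v0" by (simp add: mult.assoc)
    have "?d (Suc i) \<le> 2 * K * nrm (f ?q) v'"
      using approx_bounds(2) [OF jj(2,4) v' sm] dS by (simp add: disp_def)
    also have "\<dots> \<le> 2 * K * (\<nu>' ^ Suc i * (2 * K * ?d 0))"
      using const \<nu>' n' n0 by (intro mult_left_mono order_trans [OF n' mult_left_mono]) auto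
    also have "\<dots> = 4 * K\<^sup>2 * \<nu>' ^ Suc i * ?d 0" by (simp add: power2_eq_square)
    finally show ?case using dom n' v' by auto
  qed
  then show ?thesis using \<open>i \<le> n\<close> by blast
qed

text \<open>Where \<open>Df\<close> expands, small displacements along an orbit segment grow like the cocycle, and
  pulling the last one back by the cocycle recovers the first one up to an error of order \<open>1 + \<beta>\<close>.
  The error made at time \<open>n - m\<close> is of the order of the displacement there, raised to \<open>1 + \<beta>\<close>, hence
  at most \<open>\<gamma>'\<^bsup>m(1+\<beta>)\<^esup>\<close> times the same power of the last one, up to a constant, and pulling it back to
  time \<open>0\<close> contributes the factor \<open>\<gamma>'\<^bsup>n-m\<^esup>\<close>. So the sum of these errors is \<open>\<gamma>'\<^sup>n\<close> times a geometric
  series with ratio \<open>\<gamma>' powr \<beta>\<close>.\<close>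

lemma expansion:
  assumes rate: "\<And>p v. p \<in> X \<Longrightarrow> v \<in> E p \<Longrightarrow> nrm p v \<le> \<gamma> * nrm (f p) (A p v)"
      "\<And>p v. p \<in> X \<Longrightarrow> v \<in> E p \<Longrightarrow> nrm (f p) (A p v) \<le> g * nrm p v"
    and sm: "small \<kappa> r" and \<gamma>': "0 < \<gamma>" "\<gamma> \<le> \<gamma>' * (1 - \<gamma> * \<kappa>)" "\<gamma> \<le> \<gamma>'" "\<gamma>' < 1" and g': "g + \<kappa> \<le> g'" "0 \<le> g'"
    and \<kappa>: "0 < \<kappa>"
    and ch: "charts j p n" and p': "p' \<in> dom (j 0)" "P (j 0) p p'" and n: "0 < n"
    and le: "\<And>i. i \<le> n \<Longrightarrow> norm (disp j p p' i) \<le> r"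
    and v0: "approx (j 0) p p' v0" and vn: "approx (j n) ((f ^^ n) p) ((f ^^ n) p') vn"
  shows "norm (disp j p p' 0) \<le> 4 * K\<^sup>2 * \<gamma>' ^ n * norm (disp j p p' n)"
    "norm (disp j p p' n) \<le> 4 * K\<^sup>2 * g' ^ n * norm (disp j p p' 0)"
    "\<And>w. w \<in> E p \<Longrightarrow> iter n p w = vn \<Longrightarrow>
      nrm p (v0 - w) \<le> 48 * K ^ 8 / (1 - \<gamma>' powr \<beta>) * \<gamma>' ^ n * norm (disp j p p' n) powr (1 + \<beta>)"
proof -
  let ?d = "\<lambda>i. norm (disp j p p' i)"
  let ?q = "\<lambda>i. (f ^^ i) p" and ?q' = "\<lambda>i. (f ^^ i) p'"
  have r: "r < \<rho>" using sm by (simp add: small_def)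
  have j: "j i \<in> J" "?q i \<in> K2 (j i)" if "i \<le> n" for i using ch that by (auto simp: charts_def)
  have pX: "p \<in> X" using j [of 0] K2_X by auto
  have qX: "?q i \<in> X" for i by (rule orbit_X [OF pX])
  have fol: "?q' i \<in> dom (j i)" "P (j i) (?q i) (?q' i)" if "i \<le> n" for i
    using follow [OF ch p' _ that] le r by (meson less_imp_le_nat order_le_less_trans)+
  have "\<forall>i. \<exists>v. i \<le> n \<longrightarrow> approx (j i) (?q i) (?q' i) v"
    using approx_exists [OF ch] fol le r by (meson order_le_less_trans)
  then obtain V where V: "\<And>i. i \<le> n \<Longrightarrow> approx (j i) (?q i) (?q' i) (V i)" by metis
  define v where "v i = (if i = 0 then v0 else if i = n then vn else V i)" for i
  have v: "approx (j i) (?q i) (?q' i) (v i)" if "i \<le> n" for i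
    using that V v0 vn by (simp add: v_def)
  have vE: "v i \<in> E (?q i)" if "i \<le> n" for i using v [OF that] by (simp add: approx_def)
  have one: "nrm (?q (Suc i)) (v (Suc i) - A (?q i) (v i)) \<le> \<kappa> * nrm (?q i) (v i)"
      "nrm (?q (Suc i)) (v (Suc i) - A (?q i) (v i)) \<le> 3 * K ^ 4 * ?d i powr (1 + \<beta>)" if "i < n" for i
  proof -
    have *: "j i \<in> J" "?q i \<in> K2 (j i)" "j (Suc i) \<in> J" "f (?q i) \<in> K2 (j (Suc i))" "?q' i \<in> dom (j i)"
        "approx (j i) (?q i) (?q' i) (v i)" "approx (j (Suc i)) (f (?q i)) (f (?q' i)) (v (Suc i))"
        "norm (\<phi> (j i) (?q' i) - \<phi> (j i) (?q i)) \<le> r"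
      using j [of i] j [of "Suc i"] that fol [of i] v [of i] v [of "Suc i"] le [of i] by (auto simp: disp_def)
    show "nrm (?q (Suc i)) (v (Suc i) - A (?q i) (v i)) \<le> \<kappa> * nrm (?q i) (v i)"
      using one_step_relative [OF *(1-5) sm *(8) *(6,7)] by simp
    show "nrm (?q (Suc i)) (v (Suc i) - A (?q i) (v i)) \<le> 3 * K ^ 4 * ?d i powr (1 + \<beta>)"
      using one_step [OF *(1-5) _ *(6,7)] *(8) r by (simp add: disp_def)
  qed
  have AE: "A (?q i) (v i) \<in> E (?q (Suc i))" if "i < n" for i using A_E qX vE that by simp
  have up: "nrm (?q (Suc i)) (v (Suc i)) \<le> g' * nrm (?q i) (v i)" if "i < n" for i
  proof -
    have "nrm (?q (Suc i)) (v (Suc i)) \<le> g * nrm (?q i) (v i) + \<kappa> * nrm (?q i) (v i)"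
      using nrm_le_diff [OF qX [of "Suc i"] vE [of "Suc i"] AE [of i]] one(1) [OF that] rate(2) [OF qX [of i] vE [of i]] that by simp
    also have "\<dots> \<le> g' * nrm (?q i) (v i)"
      using mult_right_mono [OF g'(1) nrm_pos [OF qX [of i] vE [of i]]] that by (simp add: algebra_simps)
    finally show ?thesis .
  qed
  have down: "nrm (?q i) (v i) \<le> \<gamma>' * nrm (?q (Suc i)) (v (Suc i))" if "i < n" for i
  proof -
    let ?a = "nrm (?q i) (v i)" and ?b = "nrm (?q (Suc i)) (v (Suc i))"
    have "nrm (?q (Suc i)) (A (?q i) (v i)) \<le> ?b + \<kappa> * ?a"
      using nrm_le_diff [OF qX [of "Suc i"] AE [of i] vE [of "Suc i"]] one(1) [OF that]
        nrm_commute [OF qX [of "Suc i"] AE [of i] vE [of "Suc i"]] that by simp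
    then have "\<gamma> * nrm (?q (Suc i)) (A (?q i) (v i)) \<le> \<gamma> * (?b + \<kappa> * ?a)"
      using \<gamma>'(1) by (intro mult_left_mono) auto
    then have "?a \<le> \<gamma> * (?b + \<kappa> * ?a)"
      using rate(1) [OF qX [of i] vE [of i]] that by simp
    then have 1: "(1 - \<gamma> * \<kappa>) * ?a \<le> \<gamma> * ?b" by (simp add: algebra_simps)
    have "0 < \<gamma>'" "0 < \<gamma>' * (1 - \<gamma> * \<kappa>)" using \<gamma>' by linarith+
    then have g1: "0 < 1 - \<gamma> * \<kappa>" by (rule zero_less_mult_pos [rotated])
    have "\<gamma> * ?b \<le> \<gamma>' * (1 - \<gamma> * \<kappa>) * ?b" using \<gamma>'(2) nrm_pos [OF qX [of "Suc i"] vE [of "Suc i"]] that by (intro mult_right_mono) auto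
    then have "(1 - \<gamma> * \<kappa>) * ?a \<le> (1 - \<gamma> * \<kappa>) * (\<gamma>' * ?b)" using 1 by (simp add: algebra_simps)
    then show ?thesis using g1 by (simp add: mult_le_cancel_left)
  qed
  have \<gamma>0: "0 < \<gamma>'" using \<gamma>' by linarith
  have downs: "nrm (?q (n - m)) (v (n - m)) \<le> \<gamma>' ^ m * nrm (?q n) (v n)" if "m \<le> n" for m
    using that
  proof (induction m)
    case (Suc m)
    then have "nrm (?q (n - Suc m)) (v (n - Suc m)) \<le> \<gamma>' * nrm (?q (n - m)) (v (n - m))"
      using down [of "n - Suc m"] by (simp add: Suc_diff_Suc)
    also have "\<dots> \<le> \<gamma>' * (\<gamma>' ^ m * nrm (?q n) (v n))" using Suc \<gamma>0 by (intro mult_left_mono) auto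
    finally show ?case by simp
  qed simp
  have ups: "nrm (?q m) (v m) \<le> g' ^ m * nrm p v0" if "m \<le> n" for m
    using that
  proof (induction m)
    case (Suc m)
    then have "nrm (?q (Suc m)) (v (Suc m)) \<le> g' * nrm (?q m) (v m)" using up by simp
    also have "\<dots> \<le> g' * (g' ^ m * nrm p v0)" using Suc g' by (intro mult_left_mono) auto
    finally show ?case by simp
  qed (simp add: v_def)
  have bd: "?d i \<le> 2 * K * nrm (?q i) (v i)" "nrm (?q i) (v i) \<le> 2 * K * ?d i" if "i \<le> n" for i
    using approx_bounds(2) [OF j [OF that] v [OF that] sm] approx_bounds(3) [OF j [OF that] v [OF that] sm]
      le [OF that] by (auto simp: disp_def)
  have dd: "?d (n - m) \<le> 4 * K\<^sup>2 * \<gamma>' ^ m * ?d n" if "m \<le> n" for m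
  proof -
    have "nrm (?q (n - m)) (v (n - m)) \<le> \<gamma>' ^ m * (2 * K * ?d n)"
      using bd(2) [of n] \<gamma>0 by (intro order_trans [OF downs [OF that] mult_left_mono]) auto
    then have "2 * K * nrm (?q (n - m)) (v (n - m)) \<le> 2 * K * (\<gamma>' ^ m * (2 * K * ?d n))"
      using const by (intro mult_left_mono) auto
    with bd(1) [of "n - m"] have "?d (n - m) \<le> 2 * K * (\<gamma>' ^ m * (2 * K * ?d n))"
      by (rule order_trans) simp
    then show ?thesis by (simp add: power2_eq_square algebra_simps)
  qed
  show "?d 0 \<le> 4 * K\<^sup>2 * \<gamma>' ^ n * ?d n" using dd [of n] by simp
  show "?d n \<le> 4 * K\<^sup>2 * g' ^ n * ?d 0"
  proof -
    have "nrm (?q n) (v n) \<le> g' ^ n * (2 * K * ?d 0)"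
      using bd(2) [of 0] g' by (intro order_trans [OF ups mult_left_mono]) (auto simp: v_def)
    then have "2 * K * nrm (?q n) (v n) \<le> 2 * K * (g' ^ n * (2 * K * ?d 0))"
      using const by (intro mult_left_mono) auto
    with bd(1) [of n] have "?d n \<le> 2 * K * (g' ^ n * (2 * K * ?d 0))"
      by (rule order_trans) simp
    then show ?thesis by (simp add: power2_eq_square algebra_simps)
  qed
  fix w assume w: "w \<in> E p" "iter n p w = vn"
  let ?w = "\<lambda>i. iter i p w"
  let ?\<theta> = "\<gamma>' powr \<beta>" and ?M = "48 * K ^ 8" and ?D = "?d n powr (1 + \<beta>)"
  have \<theta>: "0 \<le> ?\<theta>" "?\<theta> < 1" using \<gamma>0 \<gamma>'(4) const powr_less_mono2 [of \<beta> \<gamma>' 1] by auto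
  have M: "0 \<le> ?M" using const by simp
  have K2: "1 \<le> 4 * K\<^sup>2" using one_le_power [OF const(2), of 2] by linarith
  have err: "3 * K ^ 4 * ?d (n - m) powr (1 + \<beta>) \<le> ?M * \<gamma>' ^ m * ?\<theta> ^ m * ?D" if "m \<le> n" for m
  proof -
    have "?d (n - m) powr (1 + \<beta>) \<le> ((4 * K\<^sup>2) * (\<gamma>' ^ m * ?d n)) powr (1 + \<beta>)"
      using dd [OF that] const by (intro powr_mono2) (auto simp: algebra_simps)
    also have "\<dots> \<le> (4 * K\<^sup>2)\<^sup>2 * (\<gamma>' ^ m * ?d n) powr (1 + \<beta>)"
      using const \<gamma>0 K2 by (intro powr_one_plus_scale) auto
    also have "(\<gamma>' ^ m * ?d n) powr (1 + \<beta>) = (\<gamma>' ^ m) powr (1 + \<beta>) * ?D"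
      using \<gamma>0 by (simp add: powr_mult)
    also have "(\<gamma>' ^ m) powr (1 + \<beta>) = \<gamma>' ^ m * ?\<theta> ^ m"
      using \<gamma>0 by (simp add: powr_add powr_powr powr_realpow [symmetric] mult.commute)
    finally have "3 * K ^ 4 * ?d (n - m) powr (1 + \<beta>) \<le> 3 * K ^ 4 * ((4 * K\<^sup>2)\<^sup>2 * (\<gamma>' ^ m * ?\<theta> ^ m * ?D))"
      using const by (intro mult_left_mono) auto
    also have "\<dots> = ?M * \<gamma>' ^ m * ?\<theta> ^ m * ?D" by (simp add: power_mult_distrib flip: power_mult power_add)
    finally show ?thesis .
  qed
  have wE: "?w i \<in> E (?q i)" for i by (rule iter_E [OF pX w(1)])
  have "nrm (?q (n - m)) (v (n - m) - ?w (n - m)) \<le> ?M * \<gamma>' ^ m * ?D * (\<Sum>k<Suc m. ?\<theta> ^ k)" if "m \<le> n" for m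
    using that
  proof (induction m)
    case 0
    have "v n = ?w n" using w n by (simp add: v_def)
    then show ?case using nrm_zero [OF qX] M by simp
  next
    case (Suc m)
    let ?i = "n - Suc m"
    have i: "?i < n" "Suc ?i = n - m" using Suc.prems by auto
    let ?S = "\<Sum>k<Suc m. ?\<theta> ^ k"
    have lin: "A (?q ?i) (v ?i - ?w ?i) = A (?q ?i) (v ?i) - ?w (n - m)"
      using linear_diff [OF linear_A [OF qX]] by (simp flip: i(2))
    have Ei: "v ?i - ?w ?i \<in> E (?q ?i)" using E_diff [OF qX [of ?i] vE [of ?i] wE [of ?i]] i by auto
    have "nrm (?q ?i) (v ?i - ?w ?i) \<le> \<gamma> * nrm (?q (n - m)) (A (?q ?i) (v ?i) - ?w (n - m))"
      using rate(1) [OF qX Ei] lin by (simp flip: i(2))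
    also have "\<dots> \<le> \<gamma> * (3 * K ^ 4 * ?d ?i powr (1 + \<beta>) + ?M * \<gamma>' ^ m * ?D * ?S)"
    proof (intro mult_left_mono)
      have "nrm (?q (n - m)) (A (?q ?i) (v ?i) - v (n - m)) \<le> 3 * K ^ 4 * ?d ?i powr (1 + \<beta>)"
        using one(2) [OF i(1)] nrm_commute [OF qX [of "Suc ?i"] AE [OF i(1)], of "v (n - m)"] vE [of "n - m"] i by simp
      moreover have "nrm (?q (n - m)) (v (n - m) - ?w (n - m)) \<le> ?M * \<gamma>' ^ m * ?D * ?S"
        using Suc by simp
      ultimately show "nrm (?q (n - m)) (A (?q ?i) (v ?i) - ?w (n - m))
          \<le> 3 * K ^ 4 * ?d ?i powr (1 + \<beta>) + ?M * \<gamma>' ^ m * ?D * ?S"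
        using nrm_diff_triangle [OF qX [of "Suc ?i"] AE [OF i(1)], of "v (n - m)" "?w (n - m)"]
            vE [of "n - m"] wE [of "n - m"] i by simp
    qed (use \<gamma>' in auto)
    also have "\<dots> \<le> \<gamma>' * (?M * \<gamma>' ^ Suc m * ?\<theta> ^ Suc m * ?D + ?M * \<gamma>' ^ m * ?D * ?S)"
    proof (rule mult_mono [OF \<gamma>'(3) add_right_mono [OF err [OF Suc.prems]]])
      have "0 \<le> ?S" using \<theta> by (intro sum_nonneg) auto
      then have "0 \<le> ?M * \<gamma>' ^ m * ?D * ?S" using M \<gamma>0 by simp
      moreover have "0 \<le> 3 * K ^ 4 * ?d ?i powr (1 + \<beta>)" using const by simp
      ultimately show "0 \<le> 3 * K ^ 4 * ?d ?i powr (1 + \<beta>) + ?M * \<gamma>' ^ m * ?D * ?S" by linarith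
    qed (use \<gamma>0 in simp)
    also have "\<dots> \<le> ?M * \<gamma>' ^ Suc m * ?\<theta> ^ Suc m * ?D + \<gamma>' * (?M * \<gamma>' ^ m * ?D * ?S)"
    proof -
      have "\<gamma>' * (?M * \<gamma>' ^ Suc m * ?\<theta> ^ Suc m * ?D) \<le> 1 * (?M * \<gamma>' ^ Suc m * ?\<theta> ^ Suc m * ?D)"
        using \<gamma>'(4) \<gamma>0 M \<theta> by (intro mult_right_mono) auto
      then show ?thesis by (simp add: distrib_left)
    qed
    also have "\<dots> = ?M * \<gamma>' ^ Suc m * ?D * (\<Sum>k<Suc (Suc m). ?\<theta> ^ k)" by (simp add: algebra_simps)
    finally show ?case .
  qed
  from this [of n] have "nrm p (v0 - w) \<le> ?M * \<gamma>' ^ n * ?D * (\<Sum>k<Suc n. ?\<theta> ^ k)" by (simp add: v_def)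
  also have "\<dots> \<le> ?M * \<gamma>' ^ n * ?D * (1 / (1 - ?\<theta>))"
  proof (intro mult_left_mono mult_nonneg_nonneg)
    have "(\<Sum>k<Suc n. ?\<theta> ^ k) = (1 - ?\<theta> ^ Suc n) / (1 - ?\<theta>)"
      using \<theta> by (subst sum_gp_strict) auto
    also have "\<dots> \<le> 1 / (1 - ?\<theta>)" using \<theta> by (intro divide_right_mono) auto
    finally show "(\<Sum>k<Suc n. ?\<theta> ^ k) \<le> 1 / (1 - ?\<theta>)" .
  qed (use M \<gamma>0 in auto)
  finally show "nrm p (v0 - w) \<le> 48 * K ^ 8 / (1 - ?\<theta>) * \<gamma>' ^ n * ?D" by simp
qed

end

section \<open>Holonomy along a contracting foliation\<close>

lemma powr_scale_le:
  fixes t c b :: real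
  assumes "0 \<le> t" "0 \<le> c" "0 < b" "b \<le> 1"
  shows "(c * t) powr b \<le> (1 + c) * t powr b"
proof -
  have "(c * t) powr b \<le> ((1 + c) * t) powr b"
    using assms by (intro powr_mono2 mult_right_mono) auto
  also have "\<dots> = (1 + c) powr b * t powr b" using assms by (simp add: powr_mult)
  also have "(1 + c) powr b \<le> (1 + c) powr 1" using assms by (intro powr_mono) auto
  finally show ?thesis using assms by (simp add: mult_right_mono)
qed

text \<open>Two bundles with their plaques, \<open>E\<close> expanded and \<open>Es\<close> contracted by \<open>f\<close>. The rates
  \<open>\<nu>', \<gamma>', g'\<close> are worse than \<open>\<nu>, \<gamma>, g\<close> by \<open>\<kappa>\<close>, so that they hold for small displacements
  and not only for tangent vectors, and still satisfy the bunching condition.\<close>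

locale bunched =
  u: leafwise X f J dom K1 K2 \<phi> \<tau> A D \<rho> K \<beta> E nrm P +
  s: leafwise X f J dom K1 K2 \<phi> \<tau> A D \<rho> K \<beta> Es nrms Ps
  for X :: "'a set" and f :: "'a \<Rightarrow> 'a"
    and J :: "'i set" and dom K1 K2 :: "'i \<Rightarrow> 'a set"
    and \<phi> :: "'i \<Rightarrow> 'a \<Rightarrow> 'e::euclidean_space"
    and \<tau> :: "'i \<Rightarrow> 'a \<Rightarrow> 'e \<Rightarrow> 'e" and A :: "'a \<Rightarrow> 'e \<Rightarrow> 'e" and D :: "'i \<Rightarrow> 'i \<Rightarrow> 'a \<Rightarrow> 'e \<Rightarrow> 'e"
    and \<rho> K \<beta> :: real
    and E :: "'a \<Rightarrow> 'e set" and nrm :: "'a \<Rightarrow> 'e \<Rightarrow> real" and P :: "'i \<Rightarrow> 'a \<Rightarrow> 'a \<Rightarrow> bool"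
    and Es :: "'a \<Rightarrow> 'e set" and nrms :: "'a \<Rightarrow> 'e \<Rightarrow> real" and Ps :: "'i \<Rightarrow> 'a \<Rightarrow> 'a \<Rightarrow> bool" +
  fixes Id :: "'a \<Rightarrow> 'a \<Rightarrow> 'e \<Rightarrow> 'e" and \<nu> \<gamma> g \<nu>' \<gamma>' g' \<kappa> r :: real
  assumes A_onto: "p \<in> X \<Longrightarrow> E (f p) \<subseteq> A p ` E p"
    and rate_s: "p \<in> X \<Longrightarrow> v \<in> Es p \<Longrightarrow> nrms (f p) (A p v) \<le> \<nu> * nrms p v"
    and rate_low: "p \<in> X \<Longrightarrow> v \<in> E p \<Longrightarrow> nrm p v \<le> \<gamma> * nrm (f p) (A p v)"
    and rate_up: "p \<in> X \<Longrightarrow> v \<in> E p \<Longrightarrow> nrm (f p) (A p v) \<le> g * nrm p v"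
    and nu: "\<nu> + \<kappa> \<le> \<nu>'" "0 < \<nu>'" "\<nu>' < 1"
    and gam: "0 < \<gamma>" "\<gamma> \<le> \<gamma>' * (1 - \<gamma> * \<kappa>)" "\<gamma> \<le> \<gamma>'" "\<gamma>' < 1"
    and gup: "0 \<le> g" "g + \<kappa> \<le> g'"
    and slack: "0 < \<kappa>" "u.small \<kappa> r"
    and bunch: "g' * \<gamma>' * \<nu>' powr (\<beta> / (1 + \<beta>)) < 1"
    and ident: "i \<in> J \<Longrightarrow> q \<in> K2 i \<Longrightarrow> q' \<in> dom i \<Longrightarrow> norm (\<phi> i q' - \<phi> i q) < \<rho> \<Longrightarrow>
      linear (Id q q') \<and> Id q q' ` E q = E q' \<and>
      (\<forall>v\<in>E q. norm (\<tau> i q' (Id q q' v) - \<tau> i q v)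
        \<le> K * norm (\<phi> i q' - \<phi> i q) powr \<beta> * norm (\<tau> i q v))"
begin

lemma K1': "1 \<le> K" and K0: "0 < K" and \<beta>0: "0 < \<beta>" and \<beta>1: "\<beta> \<le> 1" and \<rho>0: "0 < \<rho>" and r0: "0 < r" and r1: "r \<le> 1" and r\<rho>: "r < \<rho>"
  and \<gamma>'0: "0 < \<gamma>'" and g'0: "0 < g'"
  using u.const slack gam gup by (auto simp: u.small_def)

text \<open>Pairs of points in one plaque of the contracted foliation that are close enough for
  \<open>contraction\<close>. Points of one leaf of that foliation are joined by chains of such pairs; \<open>L\<close> will be
  the length of a chain.\<close>

definition near :: "('a \<times> 'a) set" where
  "near = {(p, p'). \<exists>i\<in>J. p \<in> K2 i \<and> p' \<in> K2 i \<and> Ps i p p' \<and> Ps i p' p \<and>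
    4 * K ^ 3 * norm (\<phi> i p' - \<phi> i p) \<le> r}"

lemma sym_near: "sym near"
  by (rule symI) (auto simp: near_def norm_minus_commute)

lemma near_X: "(x, y) \<in> near ^^ L \<Longrightarrow> x \<in> X \<Longrightarrow> y \<in> X"
  by (induction L arbitrary: y) (auto simp: near_def u.K2_X)

lemma near_contract:
  assumes pp: "(p, p') \<in> near" and n: "0 < n" and i: "i \<in> J" "(f ^^ n) p \<in> K2 i"
  shows "(f ^^ n) p' \<in> dom i \<and> norm (\<phi> i ((f ^^ n) p') - \<phi> i ((f ^^ n) p)) \<le> \<nu>' ^ n"
proof -
  obtain i0 where i0: "i0 \<in> J" "p \<in> K2 i0" "p' \<in> K2 i0" "Ps i0 p p'"
      and le: "4 * K ^ 3 * norm (\<phi> i0 p' - \<phi> i0 p) \<le> r"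
    using pp by (auto simp: near_def)
  have pX: "p \<in> X" using i0 u.K2_X by blast
  have "\<forall>k. \<exists>c. c \<in> J \<and> (f ^^ k) p \<in> K2 c" using u.core [OF u.orbit_X [OF pX]] u.K1_K2 by blast
  then obtain c where c: "\<And>k. c k \<in> J \<and> (f ^^ k) p \<in> K2 (c k)" by metis
  define j where "j k = (if k = 0 then i0 else if k = n then i else c k)" for k
  have ch: "u.charts j p n" using c i i0 by (auto simp: u.charts_def j_def)
  have j0: "j 0 = i0" "j n = i" using n by (auto simp: j_def)
  have d0: "u.disp j p p' 0 = \<phi> i0 p' - \<phi> i0 p" "u.disp j p p' n = \<phi> i ((f ^^ n) p') - \<phi> i ((f ^^ n) p)"
    by (simp_all add: u.disp_def j0)
  have *: "(f ^^ n) p' \<in> dom (j n) \<and> norm (u.disp j p p' n) \<le> 4 * K\<^sup>2 * \<nu>' ^ n * norm (u.disp j p p' 0)"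
    by (rule s.contraction [OF rate_s slack(2) nu(1) _ _ ch])
      (use nu i0 u.K2_dom le in \<open>auto simp: j0 d0\<close>)
  have "4 * K\<^sup>2 * norm (\<phi> i0 p' - \<phi> i0 p) \<le> 4 * K ^ 3 * norm (\<phi> i0 p' - \<phi> i0 p)"
    using K1' by (intro mult_right_mono mult_left_mono power_increasing) auto
  then have "4 * K\<^sup>2 * norm (\<phi> i0 p' - \<phi> i0 p) \<le> 1" using le r1 by linarith
  then have "\<nu>' ^ n * (4 * K\<^sup>2 * norm (\<phi> i0 p' - \<phi> i0 p)) \<le> \<nu>' ^ n * 1"
    using nu by (intro mult_left_mono) auto
  then show ?thesis using * by (auto simp: d0 j0 mult_ac)
qed

text \<open>The links of a chain are contracted separately. A common chart at time \<open>n\<close> exists once the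
  sum of their lengths is at most half of the margin \<open>\<rho>\<close>.\<close>

lemma near_chain:
  assumes "(p, p') \<in> near ^^ L" and n: "0 < n" and i: "i \<in> J" "x \<in> K1 i"
    and p: "(f ^^ n) p \<in> dom i" "norm (\<phi> i ((f ^^ n) p) - \<phi> i x) \<le> \<rho> / 2"
    and L: "L * \<nu>' ^ n \<le> \<rho> / 2"
  shows "(f ^^ n) p' \<in> K2 i \<and> norm (\<phi> i ((f ^^ n) p') - \<phi> i ((f ^^ n) p)) \<le> L * \<nu>' ^ n"
  using assms(1) L
proof (induction L arbitrary: p')
  case 0
  then show ?case using u.margin [OF i p(1)] p(2) \<rho>0 by simp
next
  case (Suc L)
  obtain q where q: "(p, q) \<in> near ^^ L" "(q, p') \<in> near" using Suc.prems(1) by auto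
  have le: "L * \<nu>' ^ n \<le> Suc L * \<nu>' ^ n" using nu by (intro mult_right_mono) auto
  then have IH: "(f ^^ n) q \<in> K2 i" "norm (\<phi> i ((f ^^ n) q) - \<phi> i ((f ^^ n) p)) \<le> L * \<nu>' ^ n"
    using Suc.IH [OF q(1)] Suc.prems(2) by auto
  have c: "(f ^^ n) p' \<in> dom i" "norm (\<phi> i ((f ^^ n) p') - \<phi> i ((f ^^ n) q)) \<le> \<nu>' ^ n"
    using near_contract [OF q(2) n i(1) IH(1)] by auto
  have "norm (\<phi> i ((f ^^ n) p') - \<phi> i ((f ^^ n) p)) \<le> \<nu>' ^ n + L * \<nu>' ^ n"
    using norm_triangle_le [OF add_mono [OF c(2) IH(2)]] by simp
  then have 1: "norm (\<phi> i ((f ^^ n) p') - \<phi> i ((f ^^ n) p)) \<le> Suc L * \<nu>' ^ n" by (simp add: algebra_simps)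
  have "norm ((\<phi> i ((f ^^ n) p') - \<phi> i ((f ^^ n) p)) + (\<phi> i ((f ^^ n) p) - \<phi> i x)) \<le> \<rho>"
    by (rule order_trans [OF norm_triangle_ineq]) (use 1 p(2) Suc.prems(2) in linarith)
  then have "(f ^^ n) p' \<in> K2 i" using u.margin [OF i c(1)] by simp
  then show ?case using 1 by blast
qed

lemma iter_growth:
  assumes "p \<in> X" "v \<in> E p"
  shows "nrm p v \<le> \<gamma> ^ n * nrm ((f ^^ n) p) (u.iter n p v)"
    "nrm ((f ^^ n) p) (u.iter n p v) \<le> g ^ n * nrm p v"
proof (induction n)
  case (Suc n)
  let ?w = "u.iter n p v" and ?q = "(f ^^ n) p"
  have w: "?w \<in> E ?q" "?q \<in> X" using u.iter_E u.orbit_X assms by auto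
  { case 1
    have "nrm p v \<le> \<gamma> ^ n * nrm ?q ?w" by (rule Suc)
    also have "\<dots> \<le> \<gamma> ^ n * (\<gamma> * nrm (f ?q) (A ?q ?w))"
      using rate_low [OF w(2,1)] gam by (intro mult_left_mono) auto
    finally show ?case by (simp add: mult_ac)
  next
    case 2
    have "nrm (f ?q) (A ?q ?w) \<le> g * nrm ?q ?w" by (rule rate_up [OF w(2,1)])
    also have "\<dots> \<le> g * (g ^ n * nrm p v)" using Suc gup by (intro mult_left_mono) auto
    finally show ?case by (simp add: mult_ac)
  }
qed auto

lemma iter_onto: "p \<in> X \<Longrightarrow> u.iter n p ` E p = E ((f ^^ n) p)"
proof (induction n)
  case (Suc n)
  have "u.iter (Suc n) p ` E p = A ((f ^^ n) p) ` E ((f ^^ n) p)"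
    unfolding Suc.IH [OF Suc.prems, symmetric] by (simp add: image_image)
  moreover have "A ((f ^^ n) p) ` E ((f ^^ n) p) = E (f ((f ^^ n) p))"
    using A_onto [OF u.orbit_X [OF Suc.prems, of n]] u.A_E [OF u.orbit_X [OF Suc.prems, of n]]
    by (intro equalityI image_subsetI)
  ultimately show ?case by simp
qed simp

lemma iter_inj: assumes p: "p \<in> X" shows "inj_on (u.iter n p) (E p)"
proof (rule inj_onI)
  fix v w assume vw: "v \<in> E p" "w \<in> E p" "u.iter n p v = u.iter n p w"
  then have "u.iter n p (v - w) = 0" using linear_diff [OF u.linear_iter [OF p]] by simp
  then have "nrm p (v - w) \<le> 0"
    using iter_growth(1) [OF p u.E_diff [OF p vw(1,2)], of n] u.nrm_zero [OF u.orbit_X [OF p]] by simp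
  then show "v = w" using u.nrm_eq_0 [OF p u.E_diff [OF p vw(1,2)]] by simp
qed

text \<open>The counterpart of \<open>cocycle_holonomy_seq\<close> in abstract charts.\<close>

definition Hseq :: "'a \<Rightarrow> 'a \<Rightarrow> nat \<Rightarrow> 'e \<Rightarrow> 'e" where
  "Hseq x y n v = inv_into (E y) (u.iter n y) (Id ((f ^^ n) x) ((f ^^ n) y) (u.iter n x v))"

text \<open>The rate at which the approximations converge. Successive ones differ by a multiple of
  \<open>(\<gamma> g \<nu>'\<^sup>\<beta>)\<^sup>n\<close> only, by \<open>q_ge\<close>; the slower rate \<open>q\<close> is that of the comparison with the
  displacements in \<open>main_estimate\<close>.\<close>

definition q :: real where "q = g' * \<gamma>' * \<nu>' powr (\<beta> / (1 + \<beta>))"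

lemma q0: "0 < q" "q < 1"
  using bunch \<gamma>'0 g'0 nu by (auto simp: q_def)

lemma q_ge: "\<gamma> * g * \<nu>' powr \<beta> \<le> q"
proof -
  have "\<nu>' powr \<beta> \<le> \<nu>' powr (\<beta> / (1 + \<beta>))"
    using nu \<beta>0 by (intro powr_mono') (auto simp: divide_le_eq algebra_simps)
  moreover have "\<gamma> * g \<le> g' * \<gamma>'" using gam gup slack by (subst mult.commute) (intro mult_mono, auto)
  ultimately show ?thesis unfolding q_def using g'0 \<gamma>'0
    by (intro mult_mono [of "\<gamma> * g" "g' * \<gamma>'"]) auto
qed

context
  fixes x y :: 'a and L :: nat
  assumes x: "x \<in> X" and xy: "(x, y) \<in> near ^^ L"
begin

lemma y: "y \<in> X" by (rule near_X [OF xy x])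

lemma pair_close:
  assumes n: "0 < n" "L * \<nu>' ^ n \<le> \<rho> / 2" and i: "i \<in> J" "(f ^^ n) x \<in> K1 i"
  shows "(f ^^ n) y \<in> K2 i" "norm (\<phi> i ((f ^^ n) y) - \<phi> i ((f ^^ n) x)) \<le> L * \<nu>' ^ n"
    "norm (\<phi> i ((f ^^ n) y) - \<phi> i ((f ^^ n) x)) < \<rho>"
  using near_chain [OF xy n(1) i _ _ n(2)] u.K1_K2 u.K2_dom i \<rho>0 n(2) by force+

lemma Id_pair:
  assumes n: "0 < n" "L * \<nu>' ^ n \<le> \<rho> / 2" and i: "i \<in> J" "(f ^^ n) x \<in> K1 i"
  shows "linear (Id ((f ^^ n) x) ((f ^^ n) y))"
    "Id ((f ^^ n) x) ((f ^^ n) y) ` E ((f ^^ n) x) = E ((f ^^ n) y)"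
    "v \<in> E ((f ^^ n) x) \<Longrightarrow> norm (\<tau> i ((f ^^ n) y) (Id ((f ^^ n) x) ((f ^^ n) y) v) - \<tau> i ((f ^^ n) x) v)
      \<le> K * (1 + real L) * (\<nu>' ^ n) powr \<beta> * norm (\<tau> i ((f ^^ n) x) v)"
proof -
  note c = pair_close [OF n i]
  have id: "linear (Id ((f ^^ n) x) ((f ^^ n) y)) \<and> Id ((f ^^ n) x) ((f ^^ n) y) ` E ((f ^^ n) x) = E ((f ^^ n) y) \<and>
      (\<forall>v\<in>E ((f ^^ n) x). norm (\<tau> i ((f ^^ n) y) (Id ((f ^^ n) x) ((f ^^ n) y) v) - \<tau> i ((f ^^ n) x) v)
        \<le> K * norm (\<phi> i ((f ^^ n) y) - \<phi> i ((f ^^ n) x)) powr \<beta> * norm (\<tau> i ((f ^^ n) x) v))"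
    using ident [OF i(1) u.K1_K2 [OF i] u.K2_dom [OF i(1) c(1)] c(3)] .
  then show "linear (Id ((f ^^ n) x) ((f ^^ n) y))"
    "Id ((f ^^ n) x) ((f ^^ n) y) ` E ((f ^^ n) x) = E ((f ^^ n) y)" by auto
  assume v: "v \<in> E ((f ^^ n) x)"
  have "norm (\<phi> i ((f ^^ n) y) - \<phi> i ((f ^^ n) x)) powr \<beta> \<le> (L * \<nu>' ^ n) powr \<beta>"
    using c(2) \<beta>0 by (intro powr_mono2) auto
  also have "\<dots> \<le> (1 + real L) * (\<nu>' ^ n) powr \<beta>" using nu \<beta>0 \<beta>1 by (intro powr_scale_le) auto
  finally have "K * norm (\<phi> i ((f ^^ n) y) - \<phi> i ((f ^^ n) x)) powr \<beta> * norm (\<tau> i ((f ^^ n) x) v)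
      \<le> K * ((1 + real L) * (\<nu>' ^ n) powr \<beta>) * norm (\<tau> i ((f ^^ n) x) v)"
    using K0 by (intro mult_right_mono mult_left_mono) auto
  then show "norm (\<tau> i ((f ^^ n) y) (Id ((f ^^ n) x) ((f ^^ n) y) v) - \<tau> i ((f ^^ n) x) v)
      \<le> K * (1 + real L) * (\<nu>' ^ n) powr \<beta> * norm (\<tau> i ((f ^^ n) x) v)"
    using bspec [OF conjunct2 [OF conjunct2 [OF id]] v] by (simp add: mult.assoc)
qed

lemma Hseq_spec:
  assumes n: "0 < n" "L * \<nu>' ^ n \<le> \<rho> / 2" and v: "v \<in> E x"
  shows "Hseq x y n v \<in> E y" "u.iter n y (Hseq x y n v) = Id ((f ^^ n) x) ((f ^^ n) y) (u.iter n x v)"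
proof -
  obtain i where i: "i \<in> J" "(f ^^ n) x \<in> K1 i" using u.core [OF u.orbit_X [OF x]] by blast
  have "Id ((f ^^ n) x) ((f ^^ n) y) (u.iter n x v) \<in> u.iter n y ` E y"
    using Id_pair(2) [OF n i] u.iter_E [OF x v] iter_onto [OF y] by blast
  then show "Hseq x y n v \<in> E y" "u.iter n y (Hseq x y n v) = Id ((f ^^ n) x) ((f ^^ n) y) (u.iter n x v)"
    unfolding Hseq_def by (simp_all add: inv_into_into f_inv_into_f)
qed

lemma Hseq_linear:
  assumes n: "0 < n" "L * \<nu>' ^ n \<le> \<rho> / 2" and v: "v \<in> E x" "w \<in> E x"
  shows "Hseq x y n (a *\<^sub>R v + b *\<^sub>R w) = a *\<^sub>R Hseq x y n v + b *\<^sub>R Hseq x y n w"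
proof -
  obtain i where i: "i \<in> J" "(f ^^ n) x \<in> K1 i" using u.core [OF u.orbit_X [OF x]] by blast
  have vw: "a *\<^sub>R v + b *\<^sub>R w \<in> E x" using v x u.E_add u.E_scale by simp
  note S = Hseq_spec [OF n]
  have *: "h (a *\<^sub>R s + b *\<^sub>R t) = a *\<^sub>R h s + b *\<^sub>R h t" if "linear h" for h :: "'e \<Rightarrow> 'e" and s t
    using that by (simp add: linear_add linear_scale)
  have "u.iter n y (a *\<^sub>R Hseq x y n v + b *\<^sub>R Hseq x y n w) = u.iter n y (Hseq x y n (a *\<^sub>R v + b *\<^sub>R w))"
    unfolding S(2) [OF vw] * [OF u.linear_iter [OF y]] S(2) [OF v(1)] S(2) [OF v(2)]
      * [OF u.linear_iter [OF x]] * [OF Id_pair(1) [OF n i]] ..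
  moreover have "a *\<^sub>R Hseq x y n v + b *\<^sub>R Hseq x y n w \<in> E y"
    using S(1) v u.E_add [OF y] u.E_scale [OF y] by blast
  ultimately show ?thesis using inj_onD [OF iter_inj [OF y]] S(1) [OF vw] by metis
qed

text \<open>Carried to time \<open>n + 1\<close>, two successive approximations differ by the failure of the
  identifications to commute with the derivatives at \<open>f\<^sup>n x\<close> and \<open>f\<^sup>n y\<close>. By Hoelder continuity this is
  at most a multiple of \<open>\<nu>'\<^bsup>n\<beta>\<^esup>\<close>; the iterates along \<open>x\<close> and back along \<open>y\<close> multiply it by \<open>g\<^sup>n\<close>
  and \<open>\<gamma>\<^sup>n\<close>.\<close>

lemma Hseq_step:
  assumes n: "0 < n" "L * \<nu>' ^ n \<le> \<rho> / 2" and v: "v \<in> E x"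
  shows "nrm y (Hseq x y (Suc n) v - Hseq x y n v) \<le> 3 * K ^ 4 * (1 + real L) * q ^ n * nrm x v"
proof -
  have Sn: "0 < Suc n" "L * \<nu>' ^ Suc n \<le> \<rho> / 2"
  proof -
    have "L * \<nu>' ^ Suc n \<le> L * \<nu>' ^ n" using nu by (intro mult_left_mono power_decreasing) auto
    then show "L * \<nu>' ^ Suc n \<le> \<rho> / 2" using n by linarith
  qed simp
  let ?x = "(f ^^ n) x" and ?y = "(f ^^ n) y" and ?w = "u.iter n x v"
  obtain i where i: "i \<in> J" "?x \<in> K1 i" using u.core [OF u.orbit_X [OF x]] by blast
  obtain j where j: "j \<in> J" "f ?x \<in> K1 j" using u.core [OF u.orbit_X [OF x, of "Suc n"]] by auto
  have yi: "?y \<in> K2 i" "norm (\<phi> i ?y - \<phi> i ?x) \<le> L * \<nu>' ^ n" "norm (\<phi> i ?y - \<phi> i ?x) < \<rho>"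
    using pair_close [OF n i] by auto
  have yj: "f ?y \<in> K2 j" using pair_close(1) [OF Sn j(1)] j by simp
  have wE: "?w \<in> E ?x" "A ?x ?w \<in> E (f ?x)" using u.iter_E [OF x v, of n] u.iter_E [OF x v, of "Suc n"] by auto
  let ?h = "u.iter n y (Hseq x y n v)" and ?h' = "u.iter (Suc n) y (Hseq x y (Suc n) v)"
  have h: "?h = Id ?x ?y ?w" "?h' = Id (f ?x) (f ?y) (A ?x ?w)"
    using Hseq_spec(2) [OF n v] Hseq_spec(2) [OF Sn v] by simp_all
  let ?e = "K * (1 + real L) * (\<nu>' ^ n) powr \<beta>" and ?t = "norm (\<tau> i ?x ?w)"
  have dm: "?x \<in> dom i" "f ?x \<in> dom j" "?y \<in> dom i" "f ?y \<in> dom j"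
    using i j yi yj u.K1_K2 u.K2_dom by blast+
  note st = u.step [OF i(1) j(1) u.K1_K2 [OF i] u.K1_K2 [OF j] dm(3) yi(3)]
  have e0: "0 \<le> ?e" using K0 by simp
  have tA: "\<tau> j (f ?x) (A ?x ?w) = D i j ?x (\<tau> i ?x ?w)" "\<tau> j (f ?y) (A ?y ?h) = D i j ?y (\<tau> i ?y ?h)"
    using u.intertwine i j dm by auto
  have Dle: "norm (D i j ?x v) \<le> K * norm v" for v using st by blast
  have a1: "norm (\<tau> j (f ?y) ?h' - D i j ?x (\<tau> i ?x ?w)) \<le> ?e * (K * ?t)"
  proof -
    have "norm (\<tau> j (f ?y) ?h' - \<tau> j (f ?x) (A ?x ?w))
        \<le> K * (1 + real L) * (\<nu>' ^ Suc n) powr \<beta> * norm (\<tau> j (f ?x) (A ?x ?w))"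
      using Id_pair(3) [OF Sn j(1), of "A ?x ?w"] j wE h(2) by simp
    also have "\<dots> \<le> ?e * norm (\<tau> j (f ?x) (A ?x ?w))"
    proof -
      have "(\<nu>' ^ Suc n) powr \<beta> \<le> (\<nu>' ^ n) powr \<beta>"
        using nu \<beta>0 by (intro powr_mono2 power_decreasing) auto
      then show ?thesis using K0 by (intro mult_right_mono mult_left_mono) auto
    qed
    also have "\<dots> \<le> ?e * (K * ?t)" unfolding tA using Dle e0 by (intro mult_left_mono) auto
    finally show ?thesis unfolding tA .
  qed
  have a2: "norm (D i j ?x (\<tau> i ?x ?w) - D i j ?y (\<tau> i ?x ?w)) \<le> ?e * ?t"
  proof -
    have "norm (D i j ?y (\<tau> i ?x ?w) - D i j ?x (\<tau> i ?x ?w)) \<le> K * norm (\<phi> i ?y - \<phi> i ?x) powr \<beta> * ?t"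
      using st by blast
    also have "\<dots> \<le> K * ((1 + real L) * (\<nu>' ^ n) powr \<beta>) * ?t"
    proof -
      have "norm (\<phi> i ?y - \<phi> i ?x) powr \<beta> \<le> (L * \<nu>' ^ n) powr \<beta>"
        using yi(2) \<beta>0 by (intro powr_mono2) auto
      also have "\<dots> \<le> (1 + real L) * (\<nu>' ^ n) powr \<beta>" using nu \<beta>0 \<beta>1 by (intro powr_scale_le) auto
      finally show ?thesis using K0 by (intro mult_right_mono mult_left_mono) auto
    qed
    finally show ?thesis by (simp add: norm_minus_commute mult.assoc)
  qed
  have a3: "norm (D i j ?y (\<tau> i ?x ?w) - D i j ?y (\<tau> i ?y ?h)) \<le> K * (?e * ?t)"
  proof -
    have "norm (\<phi> i ?y - \<phi> i ?y) < \<rho>" using \<rho>0 by simp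
    then have "norm (D i j ?y z) \<le> K * norm z" for z
      using u.step [OF i(1) j(1) yi(1) yj dm(3)] by blast
    then have "norm (D i j ?y (\<tau> i ?x ?w - \<tau> i ?y ?h)) \<le> K * norm (\<tau> i ?x ?w - \<tau> i ?y ?h)" .
    also have "\<dots> \<le> K * (?e * ?t)"
      using Id_pair(3) [OF n i wE(1)] K0 unfolding h(1) by (intro mult_left_mono) (auto simp: norm_minus_commute)
    finally show ?thesis using linear_diff [OF u.linear_D [OF i(1) j(1) dm(3,4)]] by simp
  qed
  have lin: "\<tau> j (f ?y) (?h' - A ?y ?h) = \<tau> j (f ?y) ?h' - D i j ?y (\<tau> i ?y ?h)"
    using linear_diff [OF u.linear_\<tau> [OF j(1) dm(4)]] tA by simp
  have "norm (\<tau> j (f ?y) (?h' - A ?y ?h)) \<le> ?e * (K * ?t) + ?e * ?t + K * (?e * ?t)"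
  proof -
    have "\<tau> j (f ?y) (?h' - A ?y ?h) = (\<tau> j (f ?y) ?h' - D i j ?x (\<tau> i ?x ?w)) +
        (D i j ?x (\<tau> i ?x ?w) - D i j ?y (\<tau> i ?x ?w)) + (D i j ?y (\<tau> i ?x ?w) - D i j ?y (\<tau> i ?y ?h))"
    proof -
      have "a - d = (a - b) + (b - c) + (c - d)" for a b c d :: 'e by simp
      then show ?thesis unfolding lin .
    qed
    then show ?thesis using a1 a2 a3 by (metis add_mono norm_triangle_le)
  qed
  also have "\<dots> = (2 * K + 1) * (?e * ?t)" by (simp add: algebra_simps)
  also have "\<dots> \<le> (3 * K) * (?e * ?t)" using K1' e0 by (intro mult_right_mono mult_nonneg_nonneg) auto
  also have "\<dots> \<le> (3 * K) * (?e * (K * nrm ?x ?w))"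
    using u.nrm_equiv [OF i(1) u.K1_K2 [OF i] wE(1)] e0 K0 by (intro mult_left_mono) auto
  also have "\<dots> \<le> (3 * K) * (?e * (K * (g ^ n * nrm x v)))"
    using iter_growth(2) [OF x v, of n] e0 K0 by (intro mult_left_mono) auto
  finally have b: "norm (\<tau> j (f ?y) (?h' - A ?y ?h)) \<le> (3 * K) * (?e * (K * (g ^ n * nrm x v)))" .
  have hE: "Hseq x y n v \<in> E y" "Hseq x y (Suc n) v \<in> E y" using Hseq_spec(1) n Sn v by auto
  have it: "u.iter (Suc n) y (Hseq x y (Suc n) v - Hseq x y n v) = ?h' - A ?y ?h"
    using linear_diff [OF u.linear_iter [OF y, of "Suc n"]] by simp
  have "nrm y (Hseq x y (Suc n) v - Hseq x y n v) \<le> \<gamma> ^ Suc n * nrm (f ?y) (?h' - A ?y ?h)"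
    using iter_growth(1) [OF y u.E_diff [OF y hE(2,1)], of "Suc n"] it by simp
  also have "\<dots> \<le> \<gamma> ^ Suc n * (K * ((3 * K) * (?e * (K * (g ^ n * nrm x v)))))"
  proof -
    have "?h' - A ?y ?h \<in> E (f ?y)"
      using u.iter_E [OF y u.E_diff [OF y hE(2,1)], of "Suc n"] it by simp
    then have "nrm (f ?y) (?h' - A ?y ?h) \<le> K * norm (\<tau> j (f ?y) (?h' - A ?y ?h))"
      using u.nrm_equiv [OF j(1) yj] by blast
    also have "\<dots> \<le> K * ((3 * K) * (?e * (K * (g ^ n * nrm x v))))" using b K0 by (intro mult_left_mono) auto
    finally show ?thesis using gam by (intro mult_left_mono) auto
  qed
  also have "\<dots> \<le> \<gamma> ^ n * (K * ((3 * K) * (?e * (K * (g ^ n * nrm x v)))))"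
    using gam gup K0 e0 u.nrm_pos [OF x v]
    by (intro mult_right_mono power_decreasing mult_nonneg_nonneg) auto
  also have "\<dots> = 3 * K ^ 4 * (1 + real L) * (\<gamma> * g * \<nu>' powr \<beta>) ^ n * nrm x v"
  proof -
    have "(\<nu>' ^ n) powr \<beta> = (\<nu>' powr \<beta>) ^ n"
      using nu by (simp add: powr_realpow [symmetric] powr_powr mult.commute)
    then show ?thesis by (simp add: power_mult_distrib power_numeral_reduce mult_ac)
  qed
  also have "\<dots> \<le> 3 * K ^ 4 * (1 + real L) * q ^ n * nrm x v"
    using q_ge K0 gam gup u.nrm_pos [OF x v] by (intro mult_right_mono mult_left_mono power_mono) auto
  finally show ?thesis .
qed

end

end

context bunched begin

lemma M0: "0 \<le> 48 * K ^ 8 / (1 - \<gamma>' powr \<beta>)"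
proof -
  have "\<gamma>' powr \<beta> < 1" using \<gamma>'0 gam(4) \<beta>0 powr_less_mono2 [of \<beta> \<gamma>' 1] by auto
  then show ?thesis using K0 by simp
qed

lemma norm_le_nrm:
  assumes "p \<in> X" obtains c where "0 \<le> c" "\<And>v. v \<in> E p \<Longrightarrow> norm v \<le> c * nrm p v"
proof -
  obtain i where i: "i \<in> J" "p \<in> K2 i" using u.core [OF assms] u.K1_K2 by blast
  obtain B where B: "B > 0" "\<And>v. B * norm v \<le> norm (\<tau> i p v)"
    using linear_inj_bounded_below_pos u.linear_\<tau> u.inj_\<tau> i u.K2_dom by metis
  have "norm v \<le> K / B * nrm p v" if "v \<in> E p" for v
  proof -
    have "B * norm v \<le> K * nrm p v" using B(2) [of v] u.nrm_equiv [OF i that] by linarith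
    then show ?thesis using B(1) by (simp add: field_simps)
  qed
  moreover have "0 \<le> K / B" using B K0 by simp
  ultimately show ?thesis using that by blast
qed

lemma eventually_small: "\<exists>n1>0. \<forall>n\<ge>n1. real L * \<nu>' ^ n \<le> e" if "0 < e"
proof -
  have "(\<lambda>n. real L * \<nu>' ^ n) \<longlonglongrightarrow> real L * 0"
    using nu by (intro tendsto_mult tendsto_const LIMSEQ_realpow_zero) auto
  then have "\<forall>\<^sub>F n in sequentially. real L * \<nu>' ^ n < e" using that by (intro order_tendstoD(2)) auto
  then obtain N where "\<forall>n\<ge>N. real L * \<nu>' ^ n < e" by (auto simp: eventually_sequentially)
  then show ?thesis by (intro exI [of _ "Suc N"]) (auto intro: less_imp_le)
qed

definition Hol :: "'a \<Rightarrow> 'a \<Rightarrow> 'e \<Rightarrow> 'e" where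
  "Hol x y v = lim (\<lambda>n. Hseq x y n v)"

context
  fixes x y :: 'a and L :: nat
  assumes x: "x \<in> X" and xy: "(x, y) \<in> near ^^ L"
begin

private lemma yX: "y \<in> X" by (rule near_X [OF xy x])

lemma Hseq_diff:
  assumes n: "0 < n" "\<And>k. n \<le> k \<Longrightarrow> L * \<nu>' ^ k \<le> \<rho> / 2" and v: "v \<in> E x" and "n \<le> m"
  shows "nrm y (Hseq x y m v - Hseq x y n v) \<le> 3 * K ^ 4 * (1 + real L) / (1 - q) * q ^ n * nrm x v"
proof -
  let ?C = "3 * K ^ 4 * (1 + real L)"
  have E: "Hseq x y k v \<in> E y" if "n \<le> k" for k
    using Hseq_spec(1) [OF x xy _ n(2) v] n(1) that by simp
  have "nrm y (Hseq x y (n + k) v - Hseq x y n v) \<le> ?C * nrm x v * q ^ n * (\<Sum>i<k. q ^ i)" for k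
  proof (induction k)
    case 0
    then show ?case using u.nrm_zero [OF yX] by simp
  next
    case (Suc k)
    have "nrm y (Hseq x y (n + Suc k) v - Hseq x y n v)
        \<le> nrm y (Hseq x y (Suc (n + k)) v - Hseq x y (n + k) v) + nrm y (Hseq x y (n + k) v - Hseq x y n v)"
      using u.nrm_diff_triangle [OF yX E E E, of "n + Suc k" "n + k" n] by simp
    also have "\<dots> \<le> ?C * q ^ (n + k) * nrm x v + ?C * nrm x v * q ^ n * (\<Sum>i<k. q ^ i)"
      using Hseq_step [OF x xy _ n(2) v, of "n + k"] n(1) Suc by (intro add_mono) auto
    also have "\<dots> = ?C * nrm x v * q ^ n * (\<Sum>i<Suc k. q ^ i)" by (simp add: algebra_simps power_add)
    finally show ?case .
  qed
  from this [of "m - n"] have "nrm y (Hseq x y m v - Hseq x y n v)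
      \<le> ?C * nrm x v * q ^ n * (\<Sum>i<m - n. q ^ i)" using \<open>n \<le> m\<close> by simp
  also have "\<dots> \<le> ?C * nrm x v * q ^ n * (1 / (1 - q))"
  proof (intro mult_left_mono mult_nonneg_nonneg)
    have "(\<Sum>i<m - n. q ^ i) = (1 - q ^ (m - n)) / (1 - q)" using q0 by (subst sum_gp_strict) auto
    also have "\<dots> \<le> 1 / (1 - q)" using q0 by (intro divide_right_mono) auto
    finally show "(\<Sum>i<m - n. q ^ i) \<le> 1 / (1 - q)" .
  qed (use K0 q0 u.nrm_pos [OF x v] in auto)
  finally show ?thesis by (simp add: mult_ac)
qed

text \<open>The limit exists by the geometric rate, and the estimates pass to it. The uniform bound on
  \<open>Hseq\<close> is needed because \<open>main_estimate\<close> applies it to tangent vectors that depend on \<open>n\<close>.\<close>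

theorem Hol_limit:
  obtains n1 C where "0 < n1" "\<And>n. n1 \<le> n \<Longrightarrow> L * \<nu>' ^ n \<le> \<rho> / 2"
    "\<And>v. v \<in> E x \<Longrightarrow> (\<lambda>n. Hseq x y n v) \<longlonglongrightarrow> Hol x y v" "0 \<le> C"
    "\<And>v n. v \<in> E x \<Longrightarrow> n1 \<le> n \<Longrightarrow> norm (Hol x y v - Hseq x y n v) \<le> C * q ^ n * nrm x v"
    "\<And>v n. v \<in> E x \<Longrightarrow> n1 \<le> n \<Longrightarrow> nrm y (Hseq x y n v) \<le> C * nrm x v"
proof -
  obtain n1 where n1: "0 < n1" "\<And>n. n1 \<le> n \<Longrightarrow> L * \<nu>' ^ n \<le> \<rho> / 2"
    using eventually_small [of "\<rho> / 2" L] \<rho>0 by auto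
  obtain c where c: "0 \<le> c" "\<And>v. v \<in> E y \<Longrightarrow> norm v \<le> c * nrm y v" using norm_le_nrm [OF yX] by blast
  define C1 where "C1 = 3 * K ^ 4 * (1 + real L) / (1 - q)"
  have C1: "0 \<le> C1" using K0 q0 by (simp add: C1_def)
  have E: "Hseq x y k v \<in> E y" if "n1 \<le> k" "v \<in> E x" for k v
    using Hseq_spec(1) [OF x xy _ n1(2) that(2)] n1(1) that by simp
  have df: "nrm y (Hseq x y m v - Hseq x y n v) \<le> C1 * q ^ n * nrm x v" if "n1 \<le> n" "n \<le> m" "v \<in> E x" for m n v
    using Hseq_diff [OF _ _ that(3,2)] n1 that by (simp add: C1_def)
  have nd: "norm (Hseq x y m v - Hseq x y n v) \<le> c * C1 * q ^ n * nrm x v" if "n1 \<le> n" "n \<le> m" "v \<in> E x" for m n v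
  proof -
    have "norm (Hseq x y m v - Hseq x y n v) \<le> c * nrm y (Hseq x y m v - Hseq x y n v)"
      using c(2) u.E_diff [OF yX E E, of m v n v] that by simp
    also have "\<dots> \<le> c * (C1 * q ^ n * nrm x v)" using df [OF that] c(1) by (rule mult_left_mono)
    finally show ?thesis by simp
  qed
  have conv: "(\<lambda>n. Hseq x y n v) \<longlonglongrightarrow> Hol x y v" if v: "v \<in> E x" for v
  proof -
    have "Cauchy (\<lambda>n. Hseq x y n v)"
    proof (rule CauchyI')
      fix e :: real assume e: "0 < e"
      have "(\<lambda>n. c * C1 * q ^ n * nrm x v) \<longlonglongrightarrow> c * C1 * 0 * nrm x v"
        using q0 by (intro tendsto_intros LIMSEQ_realpow_zero) auto
      then have "\<forall>\<^sub>F n in sequentially. c * C1 * q ^ n * nrm x v < e"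
        using e by (intro order_tendstoD(2)) auto
      then obtain N where N: "\<And>n. N \<le> n \<Longrightarrow> c * C1 * q ^ n * nrm x v < e"
        by (auto simp: eventually_sequentially)
      have "norm (Hseq x y m v - Hseq x y n v) < e" if "max N n1 \<le> m" "m < n" for m n
      proof -
        have "norm (Hseq x y n v - Hseq x y m v) \<le> c * C1 * q ^ m * nrm x v" using nd [OF _ _ v] that by simp
        also have "\<dots> < e" using N that by simp
        finally show ?thesis by (simp add: norm_minus_commute)
      qed
      then show "\<exists>M. \<forall>m\<ge>M. \<forall>n>m. dist (Hseq x y m v) (Hseq x y n v) < e"
        unfolding dist_norm by blast
    qed
    then show ?thesis unfolding Hol_def by (simp add: Cauchy_convergent convergent_LIMSEQ_iff [symmetric])
  qed
  have lim: "norm (Hol x y v - Hseq x y n v) \<le> c * C1 * q ^ n * nrm x v" if "v \<in> E x" "n1 \<le> n" for v n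
  proof (rule Lim_norm_ubound [OF _ tendsto_diff [OF conv [OF that(1)] tendsto_const]])
    show "\<forall>\<^sub>F m in sequentially. norm (Hseq x y m v - Hseq x y n v) \<le> c * C1 * q ^ n * nrm x v"
      using nd that by (auto simp: eventually_sequentially)
  qed simp
  let ?K = "\<gamma> ^ n1 * (K * ((1 + K * (1 + real L)) * (K * g ^ n1)))"
  have K': "0 \<le> ?K" using gam gup K0 by simp
  have first: "nrm y (Hseq x y n1 v) \<le> ?K * nrm x v" if v: "v \<in> E x" for v
  proof -
    let ?x = "(f ^^ n1) x" and ?y = "(f ^^ n1) y" and ?w = "u.iter n1 x v"
    obtain i where i: "i \<in> J" "?x \<in> K1 i" using u.core [OF u.orbit_X [OF x]] by blast
    note nn = n1(1) n1(2) [OF order_refl]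
    have wE: "?w \<in> E ?x" using u.iter_E [OF x v] .
    have IE: "Id ?x ?y ?w \<in> E ?y" using Id_pair(2) [OF x xy nn i] wE by blast
    have le1: "(\<nu>' ^ n1) powr \<beta> \<le> 1" using nu \<beta>0 by (intro powr_le1) (auto intro: power_le_one)
    have "norm (\<tau> i ?y (Id ?x ?y ?w) - \<tau> i ?x ?w) \<le> K * (1 + real L) * (\<nu>' ^ n1) powr \<beta> * norm (\<tau> i ?x ?w)"
      by (rule Id_pair(3) [OF x xy nn i wE])
    also have "\<dots> \<le> K * (1 + real L) * 1 * norm (\<tau> i ?x ?w)"
      using K0 le1 by (intro mult_right_mono mult_left_mono) auto
    finally have "norm (\<tau> i ?y (Id ?x ?y ?w)) \<le> norm (\<tau> i ?x ?w) + K * (1 + real L) * 1 * norm (\<tau> i ?x ?w)"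
      using norm_triangle_sub [of "\<tau> i ?y (Id ?x ?y ?w)" "\<tau> i ?x ?w"] by linarith
    also have "\<dots> = (1 + K * (1 + real L)) * norm (\<tau> i ?x ?w)" by (simp add: algebra_simps)
    also have "\<dots> \<le> (1 + K * (1 + real L)) * (K * (g ^ n1 * nrm x v))"
    proof (rule mult_left_mono)
      have "norm (\<tau> i ?x ?w) \<le> K * nrm ?x ?w" using u.nrm_equiv [OF i(1) u.K1_K2 [OF i] wE] by blast
      also have "\<dots> \<le> K * (g ^ n1 * nrm x v)" using iter_growth(2) [OF x v] K0 by (intro mult_left_mono) auto
      finally show "norm (\<tau> i ?x ?w) \<le> K * (g ^ n1 * nrm x v)" .
    qed (use K0 in simp)
    finally have *: "norm (\<tau> i ?y (Id ?x ?y ?w)) \<le> (1 + K * (1 + real L)) * (K * (g ^ n1 * nrm x v))" .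
    have "nrm y (Hseq x y n1 v) \<le> \<gamma> ^ n1 * nrm ?y (Id ?x ?y ?w)"
      using iter_growth(1) [OF yX E [OF order_refl v], of n1] Hseq_spec(2) [OF x xy nn v] by simp
    also have "\<dots> \<le> \<gamma> ^ n1 * (K * ((1 + K * (1 + real L)) * (K * (g ^ n1 * nrm x v))))"
    proof (rule mult_left_mono)
      have "nrm ?y (Id ?x ?y ?w) \<le> K * norm (\<tau> i ?y (Id ?x ?y ?w))"
        using u.nrm_equiv [OF i(1) pair_close(1) [OF x xy nn i] IE] by blast
      also have "\<dots> \<le> K * ((1 + K * (1 + real L)) * (K * (g ^ n1 * nrm x v)))"
        using * K0 by (intro mult_left_mono) auto
      finally show "nrm ?y (Id ?x ?y ?w) \<le> \<dots>" .
    qed (use gam in simp)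
    finally show ?thesis by (simp add: mult_ac)
  qed
  have bnd: "nrm y (Hseq x y n v) \<le> (?K + C1) * nrm x v" if v: "v \<in> E x" and n: "n1 \<le> n" for v n
  proof -
    have "C1 * q ^ n1 * nrm x v \<le> C1 * 1 * nrm x v"
      using C1 q0 u.nrm_pos [OF x v] by (intro mult_right_mono mult_left_mono power_le_one) auto
    then have "nrm y (Hseq x y n v) \<le> ?K * nrm x v + C1 * nrm x v"
      using u.nrm_le_diff [OF yX E [OF n v] E [OF order_refl v]] first [OF v] df [OF order_refl n v] by simp
    then show ?thesis by (simp add: algebra_simps)
  qed
  define C where "C = max (c * C1) (?K + C1)"
  have C: "c * C1 \<le> C" "?K + C1 \<le> C" by (auto simp: C_def)
  show ?thesis
  proof (rule that [OF n1 conv])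
    show "0 \<le> C" using C(2) K' C1 by linarith
    fix v n assume v: "v \<in> E x" and n: "n1 \<le> n"
    show "norm (Hol x y v - Hseq x y n v) \<le> C * q ^ n * nrm x v"
    proof -
      have "c * C1 * (q ^ n * nrm x v) \<le> C * (q ^ n * nrm x v)"
        using C(1) q0 u.nrm_pos [OF x v] by (intro mult_right_mono) auto
      then show ?thesis using lim [OF v n] by (simp add: mult.assoc)
    qed
    show "nrm y (Hseq x y n v) \<le> C * nrm x v"
      using bnd [OF v n] mult_right_mono [OF C(2) u.nrm_pos [OF x v]] by linarith
  qed
qed

lemma Hol_in: "v \<in> E x \<Longrightarrow> Hol x y v \<in> E y"
proof -
  assume v: "v \<in> E x"
  obtain n1 C where H: "0 < n1" "\<And>n. n1 \<le> n \<Longrightarrow> L * \<nu>' ^ n \<le> \<rho> / 2"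
      "(\<lambda>n. Hseq x y n v) \<longlonglongrightarrow> Hol x y v"
    using Hol_limit v by metis
  have "\<forall>\<^sub>F n in sequentially. Hseq x y n v \<in> E y"
    using Hseq_spec(1) [OF x xy _ H(2) v] H(1) by (auto simp: eventually_sequentially intro: exI [of _ n1])
  then show ?thesis
    using Lim_in_closed_set [OF closed_subspace [OF u.subspace_E [OF yX]] _ _ H(3)] by simp
qed

lemma Hol_linear:
  assumes v: "v \<in> E x" "w \<in> E x"
  shows "Hol x y (a *\<^sub>R v + b *\<^sub>R w) = a *\<^sub>R Hol x y v + b *\<^sub>R Hol x y w"
proof -
  obtain n1 C where H: "0 < n1" "\<And>n. n1 \<le> n \<Longrightarrow> L * \<nu>' ^ n \<le> \<rho> / 2"
      "\<And>v. v \<in> E x \<Longrightarrow> (\<lambda>n. Hseq x y n v) \<longlonglongrightarrow> Hol x y v"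
    using Hol_limit by metis
  have vw: "a *\<^sub>R v + b *\<^sub>R w \<in> E x" using v x u.E_add u.E_scale by simp
  have "(\<lambda>n. a *\<^sub>R Hseq x y n v + b *\<^sub>R Hseq x y n w) \<longlonglongrightarrow> a *\<^sub>R Hol x y v + b *\<^sub>R Hol x y w"
    by (intro tendsto_intros H(3) v)
  moreover have "\<forall>\<^sub>F n in sequentially. Hseq x y n (a *\<^sub>R v + b *\<^sub>R w) = a *\<^sub>R Hseq x y n v + b *\<^sub>R Hseq x y n w"
    using Hseq_linear [OF x xy _ H(2) v] H(1) by (auto simp: eventually_sequentially intro: exI [of _ n1])
  ultimately have "(\<lambda>n. Hseq x y n (a *\<^sub>R v + b *\<^sub>R w)) \<longlonglongrightarrow> a *\<^sub>R Hol x y v + b *\<^sub>R Hol x y w"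
    by (simp add: tendsto_cong)
  then show ?thesis using H(3) [OF vw] LIMSEQ_unique by blast
qed

text \<open>The two displacements at time \<open>n\<close> differ by \<open>O(\<nu>'\<^sup>n)\<close>. If they are of size \<open>s\<close> with
  \<open>s\<^sup>1\<^sup>+\<^sup>\<beta> = \<nu>'\<^sup>n\<close>, then this error and the nonlinearity of \<open>f\<close> are of the same order, and pulling
  back to time \<open>0\<close> costs the factor \<open>\<gamma>'\<^sup>n\<close>, while the displacement there is at least of order
  \<open>s / g'\<^sup>n\<close>.\<close>

lemma main_estimate:
  assumes jx: "u.charts jx x n" and jy: "u.charts jy y n" and jn: "jx n = i" "jy n = i" "(f ^^ n) x \<in> K1 i"
    and n: "0 < n" "L * \<nu>' ^ n \<le> \<rho> / 2"
    and z: "z \<in> dom (jx 0)" "P (jx 0) x z" and z': "z' \<in> dom (jy 0)" "P (jy 0) y z'"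
    and dle: "\<And>k. k \<le> n \<Longrightarrow> norm (u.disp jx x z k) \<le> r"
    and ele: "\<And>k. k \<le> n \<Longrightarrow> norm (u.disp jy y z' k) \<le> r"
    and cl: "norm (\<phi> i ((f ^^ n) z') - \<phi> i ((f ^^ n) z)) \<le> L * \<nu>' ^ n"
    and s: "norm (u.disp jx x z n) \<le> s" "s \<le> 1" "0 < s" "\<nu>' ^ n = s powr (1 + \<beta>)"
    and sc: "s \<le> c * norm (u.disp jx x z n)" "0 \<le> c"
    and v0: "u.approx (jx 0) x z v0" and u0: "u.approx (jy 0) y z' u0"
    and CH: "\<And>v. v \<in> E x \<Longrightarrow> nrm y (Hseq x y n v) \<le> CH * nrm x v" "0 \<le> CH"
    and M: "M = 48 * K ^ 8 / (1 - \<gamma>' powr \<beta>)"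
  shows "nrm y (u0 - Hseq x y n v0) \<le>
    (M * (1 + 2 * real L)\<^sup>2 + CH * M + K * (K * (1 + 2 * real L)\<^sup>2 + 2 * L + K + 2 * K * (1 + real L)))
      * (4 * K\<^sup>2 * c) * ((g' * \<gamma>') ^ n * s powr \<beta>) * norm (u.disp jx x z 0)"
proof -
  let ?x = "(f ^^ n) x" and ?y = "(f ^^ n) y"
  let ?d = "u.disp jx x z n" and ?e = "u.disp jy y z' n"
  let ?S = "s powr (1 + \<beta>)" and ?L = "1 + 2 * real L"
  have i: "i \<in> J" using jx jn by (auto simp: u.charts_def)
  note pc = pair_close [OF x xy n i jn(3)] and id = Id_pair [OF x xy n i jn(3)]
  have S: "0 \<le> ?S" "?S \<le> s"
    using s powr_mono' [of 1 "1 + \<beta>" s] \<beta>0 by auto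
  have r\<rho>': "norm (u.disp jx x z k) < \<rho>" "norm (u.disp jy y z' k) < \<rho>" if "k \<le> n" for k
    using dle [OF that] ele [OF that] r\<rho> by auto
  have fz: "(f ^^ n) z \<in> dom i" "P i ?x ((f ^^ n) z)"
    using u.follow [OF jx z _ order_refl] r\<rho>'(1) jn by (auto simp: less_imp_le_nat)
  have fz': "(f ^^ n) z' \<in> dom i" "P i ?y ((f ^^ n) z')"
    using u.follow [OF jy z' _ order_refl] r\<rho>'(2) jn by (auto simp: less_imp_le_nat)
  obtain vn where vn: "u.approx i ?x ((f ^^ n) z) vn"
    using u.approx_exists [OF jx order_refl] fz r\<rho>'(1) jn by auto
  obtain un where un: "u.approx i ?y ((f ^^ n) z') un"
    using u.approx_exists [OF jy order_refl] fz' r\<rho>'(2) jn by auto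
  have E: "vn \<in> E ?x" "un \<in> E ?y" "v0 \<in> E x" "u0 \<in> E y"
    using vn un v0 u0 by (auto simp: u.approx_def)
  obtain w where w: "w \<in> E x" "u.iter n x w = vn" using iter_onto [OF x, of n] E(1) by (metis imageE)
  obtain w' where w': "w' \<in> E y" "u.iter n y w' = un" using iter_onto [OF yX, of n] E(2) by (metis imageE)
  have M0': "0 \<le> M" using M0 M by simp
  have el: "norm ?e \<le> ?L * s"
  proof -
    have "?e = ?d + (\<phi> i ((f ^^ n) z') - \<phi> i ((f ^^ n) z)) - (\<phi> i ?y - \<phi> i ?x)"
      by (simp add: u.disp_def jn)
    then have "norm ?e \<le> norm ?d + norm (\<phi> i ((f ^^ n) z') - \<phi> i ((f ^^ n) z)) + norm (\<phi> i ?y - \<phi> i ?x)"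
      by (simp only:) (rule order_trans [OF norm_triangle_ineq4 add_right_mono [OF norm_triangle_ineq]])
    also have "\<dots> \<le> s + L * ?S + L * ?S" using cl pc(2) s by auto
    also have "\<dots> \<le> s + L * s + L * s" using S by (intro add_mono mult_left_mono) auto
    finally show ?thesis by (simp add: algebra_simps)
  qed
  have ep: "norm ?e powr (1 + \<beta>) \<le> ?L\<^sup>2 * ?S"
  proof -
    have "norm ?e powr (1 + \<beta>) \<le> (?L * s) powr (1 + \<beta>)" using el \<beta>0 by (intro powr_mono2) auto
    also have "\<dots> \<le> ?L\<^sup>2 * ?S" using s \<beta>0 \<beta>1 by (intro powr_one_plus_scale) auto
    finally show ?thesis .
  qed
  have dp: "norm ?d powr (1 + \<beta>) \<le> ?S" using s \<beta>0 by (intro powr_mono2) auto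
  have x1: "nrm x (v0 - w) \<le> M * \<gamma>' ^ n * ?S"
  proof -
    have "nrm x (v0 - w) \<le> M * \<gamma>' ^ n * norm ?d powr (1 + \<beta>)"
      unfolding M
      by (rule u.expansion(3) [OF rate_low rate_up slack(2) gam gup(2) less_imp_le [OF g'0] slack(1) jx z n(1) dle v0 _ w])
        (use vn jn in auto)
    also have "\<dots> \<le> M * \<gamma>' ^ n * ?S" using dp M0' \<gamma>'0 by (intro mult_left_mono) auto
    finally show ?thesis .
  qed
  have x2: "nrm y (u0 - w') \<le> M * ?L\<^sup>2 * \<gamma>' ^ n * ?S"
  proof -
    have "nrm y (u0 - w') \<le> M * \<gamma>' ^ n * norm ?e powr (1 + \<beta>)"
      unfolding M
      by (rule u.expansion(3) [OF rate_low rate_up slack(2) gam gup(2) less_imp_le [OF g'0] slack(1) jy z' n(1) ele u0 _ w'])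
        (use un jn in auto)
    also have "\<dots> \<le> M * \<gamma>' ^ n * (?L\<^sup>2 * ?S)" using ep M0' \<gamma>'0 by (intro mult_left_mono) auto
    finally show ?thesis by (simp add: mult_ac)
  qed
  have d0: "norm ?d \<le> 4 * K\<^sup>2 * g' ^ n * norm (u.disp jx x z 0)"
    by (rule u.expansion(2) [OF rate_low rate_up slack(2) gam gup(2) less_imp_le [OF g'0] slack(1) jx z n(1) dle v0])
      (use vn jn in auto)
  let ?C5 = "K * (K * ?L\<^sup>2 + 2 * L + K + 2 * K * (1 + real L))"
  have x3: "nrm y (w' - Hseq x y n w) \<le> \<gamma>' ^ n * (?C5 * ?S)"
  proof -
    let ?I = "Id ?x ?y vn"
    have HE: "Hseq x y n w \<in> E y" "u.iter n y (Hseq x y n w) = ?I" using Hseq_spec [OF x xy n w(1)] w by auto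
    have IE: "?I \<in> E ?y" using id(2) E(1) by blast
    have b1: "norm (?e - \<tau> i ?y un) \<le> K * (?L\<^sup>2 * ?S)"
    proof -
      have "norm (?e - \<tau> i ?y un) \<le> K * norm ?e powr (1 + \<beta>)"
        using un by (simp add: u.approx_def u.disp_def jn)
      also have "\<dots> \<le> K * (?L\<^sup>2 * ?S)" using ep K0 by (intro mult_left_mono) auto
      finally show ?thesis .
    qed
    have b2: "norm (?d - \<tau> i ?x vn) \<le> K * ?S"
    proof -
      have "norm (?d - \<tau> i ?x vn) \<le> K * norm ?d powr (1 + \<beta>)"
        using vn by (simp add: u.approx_def u.disp_def jn)
      also have "\<dots> \<le> K * ?S" using dp K0 by (intro mult_left_mono) auto
      finally show ?thesis .
    qed
    have b3: "norm (?e - ?d) \<le> 2 * L * ?S"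
    proof -
      have "?e - ?d = (\<phi> i ((f ^^ n) z') - \<phi> i ((f ^^ n) z)) - (\<phi> i ?y - \<phi> i ?x)"
        by (simp add: u.disp_def jn)
      then have "norm (?e - ?d) \<le> norm (\<phi> i ((f ^^ n) z') - \<phi> i ((f ^^ n) z)) + norm (\<phi> i ?y - \<phi> i ?x)"
        by (simp only:) (rule norm_triangle_ineq4)
      also have "\<dots> \<le> L * ?S + L * ?S" using cl pc(2) s(4) by simp
      finally have "norm (?e - ?d) \<le> L * ?S + L * ?S" .
      then show ?thesis by simp
    qed
    have b4: "norm (\<tau> i ?y ?I - \<tau> i ?x vn) \<le> 2 * K * (1 + real L) * ?S"
    proof -
      have tv: "norm (\<tau> i ?x vn) \<le> 2 * s"
        using u.approx_bounds(1) [OF i u.K1_K2 [OF i jn(3)] vn slack(2)] dle [OF order_refl] s(1)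
        by (simp add: u.disp_def jn)
      have "(\<nu>' ^ n) powr \<beta> \<le> s powr \<beta>" unfolding s(4) using S \<beta>0 by (intro powr_mono2) auto
      then have "K * (1 + real L) * (\<nu>' ^ n) powr \<beta> * norm (\<tau> i ?x vn) \<le> K * (1 + real L) * s powr \<beta> * (2 * s)"
        using tv K0 by (intro mult_mono mult_left_mono) auto
      also have "\<dots> = 2 * K * (1 + real L) * ?S" using s(3) by (simp add: powr_one_plus)
      finally show ?thesis using id(3) [OF E(1)] by linarith
    qed
    have "\<tau> i ?y (un - ?I) = (?e - ?d) - (?e - \<tau> i ?y un) + (?d - \<tau> i ?x vn) - (\<tau> i ?y ?I - \<tau> i ?x vn)"
      using linear_diff [OF u.linear_\<tau> [OF i u.K2_dom [OF i pc(1)]]] by simp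
    then have "norm (\<tau> i ?y (un - ?I)) \<le> norm (?e - ?d) + norm (?e - \<tau> i ?y un)
        + norm (?d - \<tau> i ?x vn) + norm (\<tau> i ?y ?I - \<tau> i ?x vn)"
      by (simp only:) (rule order_trans [OF norm_triangle_ineq4 add_right_mono
        [OF order_trans [OF norm_triangle_ineq add_right_mono [OF norm_triangle_ineq4]]]])
    also have "\<dots> \<le> 2 * L * ?S + K * (?L\<^sup>2 * ?S) + K * ?S + 2 * K * (1 + real L) * ?S"
      using b1 b2 b3 b4 by (intro add_mono)
    also have "\<dots> = (K * ?L\<^sup>2 + 2 * L + K + 2 * K * (1 + real L)) * ?S" by (simp add: algebra_simps)
    finally have tt: "norm (\<tau> i ?y (un - ?I)) \<le> \<dots>" .
    have "nrm y (w' - Hseq x y n w) \<le> \<gamma> ^ n * nrm ?y (un - ?I)"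
      using iter_growth(1) [OF yX u.E_diff [OF yX w'(1) HE(1)], of n]
        linear_diff [OF u.linear_iter [OF yX]] w'(2) HE(2) by simp
    also have "\<dots> \<le> \<gamma>' ^ n * (K * ((K * ?L\<^sup>2 + 2 * L + K + 2 * K * (1 + real L)) * ?S))"
    proof (rule mult_mono)
      have "nrm ?y (un - ?I) \<le> K * norm (\<tau> i ?y (un - ?I))"
        using u.nrm_equiv [OF i pc(1) u.E_diff [OF u.orbit_X [OF yX] E(2) IE]] by blast
      also have "\<dots> \<le> K * ((K * ?L\<^sup>2 + 2 * L + K + 2 * K * (1 + real L)) * ?S)"
        using tt K0 by (intro mult_left_mono) auto
      finally show "nrm ?y (un - ?I) \<le> \<dots>" .
      show "\<gamma> ^ n \<le> \<gamma>' ^ n" using gam by (intro power_mono) auto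
      show "0 \<le> nrm ?y (un - ?I)" using u.nrm_pos [OF u.orbit_X [OF yX] u.E_diff [OF u.orbit_X [OF yX] E(2) IE]] .
    qed (use \<gamma>'0 in simp)
    finally show ?thesis by (simp add: mult.assoc)
  qed
  have HE: "Hseq x y n w \<in> E y" "Hseq x y n v0 \<in> E y" using Hseq_spec(1) [OF x xy n] w E by auto
  have x4: "nrm y (Hseq x y n w - Hseq x y n v0) \<le> CH * (M * \<gamma>' ^ n * ?S)"
  proof -
    have "Hseq x y n w - Hseq x y n v0 = Hseq x y n (w - v0)"
      using Hseq_linear [OF x xy n w(1) E(3), of 1 "-1"] by simp
    then have "nrm y (Hseq x y n w - Hseq x y n v0) \<le> CH * nrm x (v0 - w)"
      using CH(1) [OF u.E_diff [OF x w(1) E(3)]] u.nrm_commute [OF x w(1) E(3)] by simp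
    also have "\<dots> \<le> CH * (M * \<gamma>' ^ n * ?S)" using x1 CH(2) by (intro mult_left_mono) auto
    finally show ?thesis .
  qed
  let ?T = "M * ?L\<^sup>2 + CH * M + ?C5"
  have T0: "0 \<le> ?T" using M0' CH(2) K0 by simp
  have "nrm y (u0 - Hseq x y n v0) \<le> nrm y (u0 - w') + (nrm y (w' - Hseq x y n w) + nrm y (Hseq x y n w - Hseq x y n v0))"
    using u.nrm_diff_triangle [OF yX E(4) w'(1) HE(2)] u.nrm_diff_triangle [OF yX w'(1) HE] by linarith
  also have "\<dots> \<le> M * ?L\<^sup>2 * \<gamma>' ^ n * ?S + (\<gamma>' ^ n * (?C5 * ?S) + CH * (M * \<gamma>' ^ n * ?S))"
    using x2 x3 x4 by (intro add_mono)
  also have "\<dots> = ?T * \<gamma>' ^ n * ?S" by (simp add: algebra_simps)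
  also have "?S = s * s powr \<beta>" using s by (simp add: powr_one_plus)
  also have "?T * \<gamma>' ^ n * (s * s powr \<beta>) \<le> ?T * \<gamma>' ^ n * ((c * (4 * K\<^sup>2 * g' ^ n * norm (u.disp jx x z 0))) * s powr \<beta>)"
  proof -
    have "s \<le> c * (4 * K\<^sup>2 * g' ^ n * norm (u.disp jx x z 0))"
      using sc mult_left_mono [OF d0 sc(2)] by linarith
    then show ?thesis using T0 \<gamma>'0 by (intro mult_left_mono mult_right_mono) auto
  qed
  also have "\<dots> = ?T * (4 * K\<^sup>2 * c) * ((g' * \<gamma>') ^ n * s powr \<beta>) * norm (u.disp jx x z 0)"
    by (simp add: power_mult_distrib mult_ac)
  finally show ?thesis .
qed

text \<open>Nearby points \<open>z\<close> of the leaf of \<open>x\<close> are followed as long as the displacement stays below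
  \<open>s\<^sub>n = \<nu>'\<^bsup>n/(1+\<beta>)\<^esup>\<close>, up to a constant factor. The last such time \<open>n\<close> tends to infinity
  as \<open>z\<close> tends to \<open>x\<close>, and at that time the displacement is comparable with \<open>s\<^sub>n\<close>.\<close>

theorem holonomy_derivative:
  assumes ix: "ix \<in> J" "x \<in> K2 ix" and iy: "iy \<in> J" "y \<in> K2 iy" and e: "0 < e"
  shows "\<exists>\<delta>>0. \<forall>z z' v w. z \<in> dom ix \<and> P ix x z \<and> norm (\<phi> ix z - \<phi> ix x) < \<delta> \<and> \<phi> ix z \<noteq> \<phi> ix x \<and>
      z' \<in> dom iy \<and> P iy y z' \<and> norm (\<phi> iy z' - \<phi> iy y) < \<delta> \<and> (z, z') \<in> near ^^ L \<and>
      u.approx ix x z v \<and> u.approx iy y z' w \<longrightarrow>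
      norm (w - Hol x y v) \<le> e * norm (\<phi> ix z - \<phi> ix x)"
proof -
  obtain n0 C where n0: "0 < n0" "\<And>n. n0 \<le> n \<Longrightarrow> L * \<nu>' ^ n \<le> \<rho> / 2" and C: "0 \<le> C"
    "\<And>v n. v \<in> E x \<Longrightarrow> n0 \<le> n \<Longrightarrow> norm (Hol x y v - Hseq x y n v) \<le> C * q ^ n * nrm x v"
    "\<And>v n. v \<in> E x \<Longrightarrow> n0 \<le> n \<Longrightarrow> nrm y (Hseq x y n v) \<le> C * nrm x v"
    using Hol_limit by metis
  obtain n0' where n0': "\<And>n. n0' \<le> n \<Longrightarrow> L * \<nu>' ^ n \<le> r / 4"
    using eventually_small [of "r / 4" L] r0 by auto
  define n1 where "n1 = max n0 n0'"
  have n1: "0 < n1" "n0 \<le> n1" "n0' \<le> n1" using n0 by (auto simp: n1_def)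
  obtain cy where cy: "0 \<le> cy" "\<And>v. v \<in> E y \<Longrightarrow> norm v \<le> cy * nrm y v" using norm_le_nrm [OF yX] by blast
  have "\<forall>p\<in>X. \<exists>c. c \<in> J \<and> p \<in> K1 c" using u.core by blast
  then obtain ch where ch: "\<And>p. p \<in> X \<Longrightarrow> ch p \<in> J \<and> p \<in> K1 (ch p)" by metis
  \<comment> \<open>The orbits of \<open>x\<close> and \<open>y\<close> use the same charts from time \<open>n1\<close> on, when they are close; the
    chart of \<open>x\<close> is taken with \<open>f\<^sup>k x\<close> in the core \<open>K1\<close>, so that \<open>f\<^sup>k y\<close> lies in \<open>K2\<close> of the same chart.\<close>
  define jx where "jx k = (if k = 0 then ix else ch ((f ^^ k) x))" for k
  define jy where "jy k = (if k = 0 then iy else if k < n1 then ch ((f ^^ k) y) else jx k)" for k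
  have jx0: "jx 0 = ix" and jy0: "jy 0 = iy" by (simp_all add: jx_def jy_def)
  have jxK: "jx k \<in> J" "(f ^^ k) x \<in> K1 (jx k)" if "0 < k" for k
    using ch [OF u.orbit_X [OF x]] that by (auto simp: jx_def)
  have chx: "u.charts jx x n" for n
    using jxK u.K1_K2 ix jx0 unfolding u.charts_def by (metis funpow_0 gr0I)
  have big: "0 < k" "L * \<nu>' ^ k \<le> \<rho> / 2" "L * \<nu>' ^ k \<le> r / 4" if "n1 \<le> k" for k
    using n0 n0' n1 that by auto
  have chy: "u.charts jy y n" for n
    unfolding u.charts_def
  proof (intro allI impI)
    fix k
    consider "k = 0" | "0 < k" "k < n1" | "n1 \<le> k" by linarith
    then show "jy k \<in> J \<and> (f ^^ k) y \<in> K2 (jy k)"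
    proof cases
      case 2
      then have "jy k = ch ((f ^^ k) y)" by (simp add: jy_def)
      then show ?thesis using ch [OF u.orbit_X [OF yX, of k]] u.K1_K2 by auto
    next
      case 3
      then have "jy k = jx k" using n1 by (simp add: jy_def)
      then show ?thesis using pair_close(1) [OF x xy big(1,2) [OF 3] jxK [OF big(1) [OF 3]]] jxK [OF big(1) [OF 3]] by simp
    qed (use iy jy0 in simp)
  qed
  \<comment> \<open>\<open>\<eta>\<^sup>n\<close> is the size \<open>s\<close> with \<open>s\<^bsup>1+\<beta>\<^esup> = \<nu>'\<^sup>n\<close>. The threshold for displacements has in addition
    the factor \<open>r / 2\<close>, which leaves \<open>r / 2\<close> for the distance between the orbits.\<close>
  define \<eta> where "\<eta> = \<nu>' powr (1 / (1 + \<beta>))"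
  have \<eta>: "0 < \<eta>" "\<eta> \<le> 1" using nu \<beta>0 by (auto simp: \<eta>_def intro: powr_le1)
  have \<eta>pow: "(\<eta> ^ n) powr b = (\<nu>' powr (b / (1 + \<beta>))) ^ n" for n b
    using nu by (simp add: \<eta>_def powr_realpow [symmetric] powr_powr mult_ac)
  have \<eta>1: "\<nu>' ^ n = (\<eta> ^ n) powr (1 + \<beta>)" for n
    using \<eta>pow [of n "1 + \<beta>"] nu \<beta>0 by simp
  define thr where "thr k = r / 2 * \<eta> ^ k" for k
  have thr_le: "thr k \<le> r / 2" "thr k \<le> \<eta> ^ k" "0 < thr k" for k
  proof -
    have "r / 2 * \<eta> ^ k \<le> r / 2 * 1" using r0 \<eta> by (intro mult_left_mono power_le_one) auto
    then show "thr k \<le> r / 2" by (simp add: thr_def)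
    have "r / 2 * \<eta> ^ k \<le> 1 * \<eta> ^ k" using r1 \<eta> by (intro mult_right_mono) auto
    then show "thr k \<le> \<eta> ^ k" by (simp add: thr_def)
    show "0 < thr k" using r0 \<eta> by (simp add: thr_def)
  qed
  define c where "c = K / (r / 2 * \<eta>)"
  have c: "0 \<le> c" using K0 r0 \<eta> by (simp add: c_def)
  define M where "M = 48 * K ^ 8 / (1 - \<gamma>' powr \<beta>)"
  define T where "T = (M * (1 + 2 * real L)\<^sup>2 + C * M + K * (K * (1 + 2 * real L)\<^sup>2 + 2 * L + K + 2 * K * (1 + real L)))
      * (4 * K\<^sup>2 * c)"
  have M: "0 \<le> M" using M0 by (simp add: M_def)
  have T: "0 \<le> T"
    unfolding T_def using M C(1) K0 c by (intro mult_nonneg_nonneg add_nonneg_nonneg) auto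
  define B where "B = cy * T + C * (2 * K)"
  have B: "0 \<le> B" using cy T C K0 by (simp add: B_def)
  obtain N where N: "n1 \<le> N" "B * q ^ N \<le> e"
  proof -
    have "(\<lambda>n. B * q ^ n) \<longlonglongrightarrow> B * 0" using q0 by (intro tendsto_intros LIMSEQ_realpow_zero) auto
    then have "\<forall>\<^sub>F n in sequentially. B * q ^ n < e" using e by (intro order_tendstoD(2)) auto
    then obtain N where "\<And>n. N \<le> n \<Longrightarrow> B * q ^ n < e" by (auto simp: eventually_sequentially)
    then show ?thesis using that [of "max N n1"] by (simp add: less_imp_le)
  qed
  \<comment> \<open>Displacements grow at most by \<open>K\<close> in one step, so initially smaller ones stay below the
    threshold up to time \<open>N\<close>.\<close>
  define \<delta> where "\<delta> = thr N / K ^ N"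
  have \<delta>: "0 < \<delta>" using thr_le K0 by (simp add: \<delta>_def)
  have growth: "norm (u.disp j p p' k) \<le> thr k"
    if cj: "\<And>n. u.charts j p n" and p': "p' \<in> dom (j 0)" "P (j 0) p p'" and lt: "norm (u.disp j p p' 0) < \<delta>" and "k \<le> N" for j p p' k
  proof -
    have thrN: "K ^ k * \<delta> \<le> thr k" if "k \<le> N" for k
    proof -
      have "K ^ k \<le> K ^ N" using K1' that by (intro power_increasing)
      then have "K ^ k * \<delta> \<le> K ^ N * \<delta>" using \<delta> by (intro mult_right_mono) auto
      also have "\<dots> = thr N" using K0 by (simp add: \<delta>_def)
      also have "\<dots> \<le> thr k" unfolding thr_def using r0 \<eta> that by (intro mult_left_mono power_decreasing) auto
      finally show ?thesis .
    qed
    have "\<forall>i\<le>k. norm (u.disp j p p' i) \<le> K ^ i * norm (u.disp j p p' 0)" using \<open>k \<le> N\<close>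
    proof (induction k)
      case (Suc k)
      have small: "norm (u.disp j p p' i) < \<rho>" if "i \<le> k" for i
      proof -
        have "norm (u.disp j p p' i) \<le> K ^ i * norm (u.disp j p p' 0)" using Suc that by simp
        also have "\<dots> \<le> K ^ i * \<delta>" using lt K0 by (intro mult_left_mono) auto
        also have "\<dots> \<le> thr i" using thrN [of i] Suc.prems that by simp
        finally show ?thesis using thr_le(1) [of i] r0 r\<rho> by linarith
      qed
      have "(f ^^ k) p' \<in> dom (j k)" using u.follow [OF cj p' small, of k k] by simp
      then have "norm (u.disp j p p' (Suc k)) \<le> K * norm (u.disp j p p' k)"
        by (rule u.disp_Suc [OF cj _ small [OF order_refl]])
      also have "\<dots> \<le> K * (K ^ k * norm (u.disp j p p' 0))" using Suc K0 by (intro mult_left_mono) auto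
      finally show ?case using Suc by (auto simp: le_Suc_eq)
    qed simp
    then have "norm (u.disp j p p' k) \<le> K ^ k * norm (u.disp j p p' 0)" by simp
    also have "\<dots> \<le> K ^ k * \<delta>" using lt K0 by (intro mult_left_mono) auto
    finally show ?thesis using thrN [OF \<open>k \<le> N\<close>] by linarith
  qed
  show ?thesis
  proof (intro exI [of _ \<delta>] conjI allI impI \<delta>)
    fix z z' v w
    assume "z \<in> dom ix \<and> P ix x z \<and> norm (\<phi> ix z - \<phi> ix x) < \<delta> \<and> \<phi> ix z \<noteq> \<phi> ix x \<and>
      z' \<in> dom iy \<and> P iy y z' \<and> norm (\<phi> iy z' - \<phi> iy y) < \<delta> \<and> (z, z') \<in> near ^^ L \<and>
      u.approx ix x z v \<and> u.approx iy y z' w"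
    then have z: "z \<in> dom (jx 0)" "P (jx 0) x z" and z': "z' \<in> dom (jy 0)" "P (jy 0) y z'"
      and zz: "(z, z') \<in> near ^^ L" and v: "u.approx (jx 0) x z v" and w: "u.approx (jy 0) y z' w"
      and d0: "norm (u.disp jx x z 0) < \<delta>" "u.disp jx x z 0 \<noteq> 0" and e0: "norm (u.disp jy y z' 0) < \<delta>"
      by (auto simp: jx0 jy0 u.disp_def)
    let ?d = "\<lambda>k. norm (u.disp jx x z k)"
    have fol: "(f ^^ n) z \<in> dom (jx n) \<and> P (jx n) ((f ^^ n) x) ((f ^^ n) z)" if "\<And>k. k < n \<Longrightarrow> ?d k \<le> thr k" for n
    proof (rule u.follow [OF chx z _ order_refl])
      fix k assume "k < n"
      then show "norm (u.disp jx x z k) < \<rho>" using that [of k] thr_le(1) [of k] r0 r\<rho> by linarith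
    qed
    \<comment> \<open>Otherwise the displacements would stay small forever, which expansion excludes.\<close>
    have "\<exists>m. \<not> ?d m \<le> thr m"
    proof (rule ccontr)
      assume "\<nexists>m. \<not> ?d m \<le> thr m"
      then have all: "?d m \<le> thr m" for m by blast
      have le: "?d m \<le> r" for m using all [of m] thr_le(1) [of m] r0 by linarith
      have "?d 0 \<le> 4 * K\<^sup>2 * \<gamma>' ^ n" if n: "0 < n" for n
      proof -
        obtain vn where vn: "u.approx (jx n) ((f ^^ n) x) ((f ^^ n) z) vn"
          using u.approx_exists [OF chx order_refl] fol [of n] all le [of n] r\<rho> by (meson order_le_less_trans)
        have "?d 0 \<le> 4 * K\<^sup>2 * \<gamma>' ^ n * ?d n"
          by (rule u.expansion(1) [OF rate_low rate_up slack(2) gam gup(2) less_imp_le [OF g'0] slack(1) chx z n le v vn])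
        also have "\<dots> \<le> 4 * K\<^sup>2 * \<gamma>' ^ n * 1"
          using le [of n] r1 \<gamma>'0 by (intro mult_left_mono) auto
        finally show ?thesis by simp
      qed
      moreover have "(\<lambda>n. 4 * K\<^sup>2 * \<gamma>' ^ n) \<longlonglongrightarrow> 4 * K\<^sup>2 * 0"
        using \<gamma>'0 gam by (intro tendsto_intros LIMSEQ_realpow_zero) auto
      ultimately have "?d 0 \<le> 4 * K\<^sup>2 * 0"
        by (intro tendsto_lowerbound [where F = sequentially]) (auto simp: eventually_sequentially intro: exI [of _ 1])
      then show False using d0 by simp
    qed
    define m where "m = (LEAST m. \<not> ?d m \<le> thr m)"
    have m: "\<not> ?d m \<le> thr m" "\<And>k. k < m \<Longrightarrow> ?d k \<le> thr k"
      using LeastI_ex [OF \<open>\<exists>m. _\<close>] not_less_Least unfolding m_def by blast+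
    have "N < m"
    proof (rule ccontr)
      assume "\<not> N < m"
      then show False using growth [OF chx z d0(1), of m] m(1) by simp
    qed
    define n where "n = m - 1"
    have n: "N \<le> n" "m = Suc n" using \<open>N < m\<close> by (auto simp: n_def)
    have dthr: "?d k \<le> thr k" if "k \<le> n" for k using m(2) n that by simp
    have dle: "?d k \<le> r / 2" if "k \<le> n" for k using dthr [OF that] thr_le(1) [of k] by linarith
    have n1n: "n1 \<le> n" using N n by linarith
    let ?s = "\<eta> ^ n"
    have s: "?d n \<le> ?s" "?s \<le> 1" "0 < ?s" "\<nu>' ^ n = ?s powr (1 + \<beta>)"
      using dthr [of n] thr_le(2) [of n] \<eta> \<eta>1 by (auto intro: power_le_one)
    have sc: "?s \<le> c * ?d n"
    proof -
      have "(f ^^ n) z \<in> dom (jx n)" using fol [of n] dthr by simp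
      moreover have "?d n < \<rho>" using dle [of n] r0 r\<rho> by simp
      ultimately have "?d m \<le> K * ?d n" unfolding n(2) by (rule u.disp_Suc [OF chx])
      then have "thr m \<le> K * ?d n" using m(1) by linarith
      then have "r / 2 * \<eta> * ?s \<le> K * ?d n" by (simp add: thr_def n(2) mult_ac)
      then show ?thesis using r0 \<eta> by (simp add: c_def field_simps)
    qed
    have close: "norm (\<phi> (jx k) ((f ^^ k) z') - \<phi> (jx k) ((f ^^ k) z)) \<le> L * \<nu>' ^ k" if k: "n1 \<le> k" "k \<le> n" for k
    proof -
      have "norm (\<phi> (jx k) ((f ^^ k) z) - \<phi> (jx k) ((f ^^ k) x)) \<le> \<rho> / 2"
        using dle [OF k(2)] r\<rho> by (simp add: u.disp_def)
      moreover have "(f ^^ k) z \<in> dom (jx k)" using fol [of k] dthr k by simp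
      ultimately show ?thesis
        using near_chain [OF zz big(1) [OF k(1)] jxK [OF big(1) [OF k(1)]] _ _ big(2) [OF k(1)]] by blast
    qed
    have ele: "norm (u.disp jy y z' k) \<le> r" if "k \<le> n" for k
    proof (cases "k < n1")
      case True
      then have "norm (u.disp jy y z' k) \<le> thr k" using growth [OF chy z' e0, of k] N by simp
      then show ?thesis using thr_le(1) [of k] r0 by linarith
    next
      case False
      then have k: "n1 \<le> k" by simp
      then have j: "jy k = jx k" using n1 by (simp add: jy_def)
      have pc: "norm (\<phi> (jx k) ((f ^^ k) y) - \<phi> (jx k) ((f ^^ k) x)) \<le> L * \<nu>' ^ k"
        using pair_close(2) [OF x xy big(1,2) [OF k] jxK [OF big(1) [OF k]]] .
      have "u.disp jy y z' k = u.disp jx x z k + (\<phi> (jx k) ((f ^^ k) z') - \<phi> (jx k) ((f ^^ k) z))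
          - (\<phi> (jx k) ((f ^^ k) y) - \<phi> (jx k) ((f ^^ k) x))"
        by (simp add: u.disp_def j)
      also have "norm \<dots> \<le> ?d k + L * \<nu>' ^ k + L * \<nu>' ^ k"
        by (rule order_trans [OF norm_triangle_ineq4 add_mono [OF order_trans [OF norm_triangle_ineq add_mono]]])
          (use close [OF k that] pc in auto)
      finally show ?thesis using dle [OF that] big(3) [OF k] by linarith
    qed
    have jn: "jy n = jx n" using n1n n1 by (simp add: jy_def)
    have main: "nrm y (w - Hseq x y n v) \<le> T * ((g' * \<gamma>') ^ n * ?s powr \<beta>) * ?d 0"
      unfolding T_def
    proof (rule main_estimate [OF chx chy refl jn jxK(2) big(1,2) [OF n1n] z z' _ ele close [OF n1n order_refl] s sc c v w _ C(1) M_def])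
      show "0 < n" using big(1) [OF n1n] .
      show "?d k \<le> r" if "k \<le> n" for k using dle [OF that] r0 by linarith
      show "nrm y (Hseq x y n v) \<le> C * nrm x v" if "v \<in> E x" for v using C(3) [OF that] n1 n1n by simp
    qed
    have qn: "(g' * \<gamma>') ^ n * ?s powr \<beta> = q ^ n"
      by (simp add: \<eta>pow q_def power_mult_distrib)
    have vE: "v \<in> E x" "w \<in> E y" using v w by (auto simp: u.approx_def)
    have HE: "Hseq x y n v \<in> E y" using Hseq_spec(1) [OF x xy big(1,2) [OF n1n] vE(1)] .
    have "norm (w - Hseq x y n v) \<le> cy * (T * q ^ n * ?d 0)"
      using cy(2) [OF u.E_diff [OF yX vE(2) HE]] mult_left_mono [OF main cy(1)] unfolding qn by linarith
    moreover have "norm (Hol x y v - Hseq x y n v) \<le> C * q ^ n * (2 * K * ?d 0)"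
    proof -
      have "nrm x v \<le> 2 * K * ?d 0"
        using u.approx_bounds(3) [OF ix v [unfolded jx0] slack(2)] dle [of 0] r0 by (simp add: u.disp_def jx0)
      then have "C * q ^ n * nrm x v \<le> C * q ^ n * (2 * K * ?d 0)" using C(1) q0 by (intro mult_left_mono) auto
      then show ?thesis using C(2) [OF vE(1), of n] n1 n1n by linarith
    qed
    moreover have "norm (w - Hol x y v) \<le> norm (w - Hseq x y n v) + norm (Hol x y v - Hseq x y n v)"
      using norm_triangle_ineq4 [of "w - Hseq x y n v" "Hol x y v - Hseq x y n v"] by simp
    ultimately have "norm (w - Hol x y v) \<le> cy * (T * q ^ n * ?d 0) + C * q ^ n * (2 * K * ?d 0)" by linarith
    also have "\<dots> = B * q ^ n * ?d 0" by (simp add: B_def algebra_simps)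
    also have "\<dots> \<le> B * q ^ N * ?d 0"
      using B q0 n(1) by (intro mult_right_mono mult_left_mono power_decreasing) auto
    also have "\<dots> \<le> e * ?d 0" using N(2) by (intro mult_right_mono) auto
    finally show "norm (w - Hol x y v) \<le> e * norm (\<phi> ix z - \<phi> ix x)" by (simp add: u.disp_def jx0)
  qed
qed

end

end

section \<open>Tangent coordinates\<close>

locale manifold =
  fixes X :: "'a::t2_space set" and \<A> :: "('a, 'e::euclidean_space) chart set"
  assumes compact_manifold: "compact_manifold X \<A>"
begin

lemma compact_X: "compact X"
  using compact_manifold by (simp add: compact_manifold_def)

lemma atlas: "smooth_atlas X \<A>"
  using compact_manifold by (simp add: compact_manifold_def)

lemma openin_cdom: "c \<in> \<A> \<Longrightarrow> openin (top_of_set X) (cdom c)"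
  and open_cmap: "c \<in> \<A> \<Longrightarrow> open (cmap c ` cdom c)"
  and chom: "c \<in> \<A> \<Longrightarrow> homeomorphism (cdom c) (cmap c ` cdom c) (cmap c) (cinv c)"
  and cover_cdom: "(\<Union>c\<in>\<A>. cdom c) = X"
  using atlas unfolding smooth_atlas_def by blast+

lemma cdom_X: "c \<in> \<A> \<Longrightarrow> p \<in> cdom c \<Longrightarrow> p \<in> X"
  using cover_cdom by blast

lemma cinv_cmap [simp]: "c \<in> \<A> \<Longrightarrow> p \<in> cdom c \<Longrightarrow> cinv c (cmap c p) = p"
  using homeomorphism_apply1 [OF chom] .

lemma cmap_inj: "c \<in> \<A> \<Longrightarrow> p \<in> cdom c \<Longrightarrow> q \<in> cdom c \<Longrightarrow> cmap c p = cmap c q \<Longrightarrow> p = q"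
  by (metis cinv_cmap)

lemma open_cmap_Int:
  assumes "c \<in> \<A>" "openin (top_of_set X) N" shows "open (cmap c ` (cdom c \<inter> N))"
proof -
  have "openin (top_of_set (cdom c)) (cdom c \<inter> N)"
    using assms(2) openin_imp_subset [OF openin_cdom [OF assms(1)]] by (auto simp: openin_open)
  then have "openin (top_of_set (cmap c ` cdom c)) (cmap c ` (cdom c \<inter> N))"
    using chom [OF assms(1)] homeomorphism_imp_open_map by blast
  then show ?thesis using open_cmap [OF assms(1)] openin_open_trans by blast
qed

lemma openin_cinv_image:
  assumes "c \<in> \<A>" "open O'" "O' \<subseteq> cmap c ` cdom c"
  shows "openin (top_of_set X) (cinv c ` O')"
proof -
  have "openin (top_of_set (cmap c ` cdom c)) O'" using assms(2,3) by (simp add: open_subset)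
  then have "openin (top_of_set (cdom c)) (cinv c ` O')"
    using chom [OF assms(1)] homeomorphism_imp_open_map homeomorphism_sym by blast
  then show ?thesis using openin_cdom [OF assms(1)] openin_trans by blast
qed

lemma chart_at: "p \<in> X \<Longrightarrow> chart_at \<A> p \<in> \<A>" "p \<in> X \<Longrightarrow> p \<in> cdom (chart_at \<A> p)"
proof -
  have "p \<in> X \<Longrightarrow> \<exists>c. c \<in> \<A> \<and> p \<in> cdom c" using cover_cdom by blast
  then show "p \<in> X \<Longrightarrow> chart_at \<A> p \<in> \<A>" "p \<in> X \<Longrightarrow> p \<in> cdom (chart_at \<A> p)"
    unfolding chart_at_def using someI_ex [of "\<lambda>c. c \<in> \<A> \<and> p \<in> cdom c"] by blast+
qed

lemma transition_derivative:
  assumes c: "c \<in> \<A>" "p \<in> cdom c" and c': "c' \<in> \<A>" "p \<in> cdom c'"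
  shows "((cmap c' \<circ> cinv c) has_derivative frechet_derivative (cmap c' \<circ> cinv c) (at (cmap c p))) (at (cmap c p))"
proof -
  have "smooth_on (cmap c' \<circ> cinv c) (cmap c ` (cdom c \<inter> cdom c'))"
    using atlas c c' unfolding smooth_atlas_def by blast
  then have "Ck_on (Suc 0) (cmap c' \<circ> cinv c) (cmap c ` (cdom c \<inter> cdom c'))"
    unfolding smooth_on_def by blast
  then obtain g' where "\<forall>u\<in>cmap c ` (cdom c \<inter> cdom c'). ((cmap c' \<circ> cinv c) has_derivative g' u) (at u)"
    by auto
  then have "(cmap c' \<circ> cinv c) differentiable (at (cmap c p))"
    unfolding differentiable_def using c c' by blast
  then show ?thesis using frechet_derivative_works by blast
qed

lemma eventually_cinv:
  assumes c: "c \<in> \<A>" "p \<in> cdom c" and N: "openin (top_of_set X) N" "p \<in> N"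
  shows "\<forall>\<^sub>F u in nhds (cmap c p). u \<in> cmap c ` cdom c \<and> cinv c u \<in> N"
proof -
  have "\<forall>\<^sub>F u in nhds (cmap c p). u \<in> cmap c ` (cdom c \<inter> N)"
    using open_cmap_Int [OF c(1) N(1)] c N by (intro eventually_nhds_in_open) auto
  then show ?thesis by eventually_elim (use c in auto)
qed

lemma tcoord_derivative:
  assumes "c \<in> \<A>" "p \<in> cdom c"
  shows "((cmap c \<circ> cinv (chart_at \<A> p)) has_derivative tcoord \<A> c p) (at (cmap (chart_at \<A> p) p))"
  unfolding tcoord_def using chart_at [OF cdom_X [OF assms]] assms by (intro transition_derivative)

text \<open>The chain rule in the form used below: a map into the manifold may be differentiated in any
  chart.\<close>

lemma derivative_change_chart:
  assumes c: "c \<in> \<A>" "p \<in> cdom c" and h: "h s = p" "s \<in> S"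
    and d: "((\<lambda>s. cmap (chart_at \<A> p) (h s)) has_derivative d) (at s within S)"
    and ev: "\<forall>\<^sub>F t in at s within S. h t \<in> cdom (chart_at \<A> p)"
  shows "((\<lambda>s. cmap c (h s)) has_derivative (\<lambda>v. tcoord \<A> c p (d v))) (at s within S)"
proof -
  let ?c = "chart_at \<A> p"
  have p: "?c \<in> \<A>" "p \<in> cdom ?c" using chart_at [OF cdom_X [OF c]] by auto
  have "((\<lambda>s. (cmap c \<circ> cinv ?c) (cmap ?c (h s))) has_derivative (\<lambda>v. tcoord \<A> c p (d v))) (at s within S)"
    by (rule has_derivative_compose [OF d]) (use tcoord_derivative [OF c] h in \<open>simp add: o_def\<close>)
  then show ?thesis
  proof (rule has_derivative_transform_eventually)
    show "\<forall>\<^sub>F t in at s within S. (cmap c \<circ> cinv ?c) (cmap ?c (h t)) = cmap c (h t)"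
      using ev by eventually_elim (use p in simp)
  qed (use p h in auto)
qed

lemma tcoord_inverse:
  assumes c: "c \<in> \<A>" "p \<in> cdom c"
  defines "S \<equiv> frechet_derivative (cmap (chart_at \<A> p) \<circ> cinv c) (at (cmap c p))"
  shows "S (tcoord \<A> c p v) = v" "tcoord \<A> c p (S w) = w"
proof -
  let ?c = "chart_at \<A> p"
  have p: "?c \<in> \<A>" "p \<in> cdom ?c" using chart_at [OF cdom_X [OF c]] by auto
  have gen: "(\<lambda>v. T' (T v)) = (\<lambda>v. v)"
    if ab: "a \<in> \<A>" "p \<in> cdom a" "b \<in> \<A>" "p \<in> cdom b"
      and T: "((cmap b \<circ> cinv a) has_derivative T) (at (cmap a p))"
      and T': "((cmap a \<circ> cinv b) has_derivative T') (at (cmap b p))" for a b T T'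
  proof -
    have "((\<lambda>u. (cmap a \<circ> cinv b) ((cmap b \<circ> cinv a) u)) has_derivative (\<lambda>v. T' (T v))) (at (cmap a p))"
      by (rule has_derivative_compose [OF T]) (use T' ab in \<open>simp add: o_def\<close>)
    moreover have "((\<lambda>u. (cmap a \<circ> cinv b) ((cmap b \<circ> cinv a) u)) has_derivative (\<lambda>v. v)) (at (cmap a p))"
    proof (rule has_derivative_transform_eventually [OF has_derivative_ident])
      have "\<forall>\<^sub>F u in nhds (cmap a p). u \<in> cmap a ` cdom a \<and> cinv a u \<in> cdom b"
        by (rule eventually_cinv [OF ab(1,2) openin_cdom [OF ab(3)] ab(4)])
      then show "\<forall>\<^sub>F u in at (cmap a p). u = (cmap a \<circ> cinv b) ((cmap b \<circ> cinv a) u)"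
        unfolding eventually_at_filter by eventually_elim (use ab in auto)
    qed (use ab in auto)
    ultimately show ?thesis using has_derivative_unique by blast
  qed
  have S: "((cmap ?c \<circ> cinv c) has_derivative S) (at (cmap c p))"
    unfolding S_def by (rule transition_derivative [OF c p])
  show "S (tcoord \<A> c p v) = v" "tcoord \<A> c p (S w) = w"
    using fun_cong [OF gen [OF p c tcoord_derivative [OF c] S], of v]
      fun_cong [OF gen [OF c p S tcoord_derivative [OF c]], of w] by auto
qed

lemma linear_tcoord: "c \<in> \<A> \<Longrightarrow> p \<in> cdom c \<Longrightarrow> linear (tcoord \<A> c p)"
  using has_derivative_linear [OF tcoord_derivative] .

lemma inj_tcoord: "c \<in> \<A> \<Longrightarrow> p \<in> cdom c \<Longrightarrow> inj (tcoord \<A> c p)"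
  using tcoord_inverse(1) by (metis injI)

lemma inv_tcoord [simp]: "c \<in> \<A> \<Longrightarrow> p \<in> cdom c \<Longrightarrow> inv (tcoord \<A> c p) (tcoord \<A> c p v) = v"
  using inj_tcoord by (simp add: inv_f_f)

end

locale holder_map = manifold X \<A> for X :: "'a::t2_space set" and \<A> :: "('a, 'e::euclidean_space) chart set" +
  fixes \<beta> :: real and f :: "'a \<Rightarrow> 'a"
  assumes C1: "C1_holder_map \<beta> X \<A> f" and \<beta>: "0 < \<beta>"
begin

lemma f_X: "p \<in> X \<Longrightarrow> f p \<in> X" and f_cont: "continuous_on X f"
  using C1 unfolding C1_holder_map_def by auto

text \<open>The derivative in arbitrary charts; \<open>mderiv\<close> is the one in the preferred charts, by which tangent
  vectors are represented.\<close>

definition fder :: "('a, 'e) chart \<Rightarrow> ('a, 'e) chart \<Rightarrow> 'a \<Rightarrow> 'e \<Rightarrow> 'e" where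
  "fder c c' p = frechet_derivative (cmap c' \<circ> f \<circ> cinv c) (at (cmap c p))"

lemma openin_f_preimage: "openin (top_of_set X) N \<Longrightarrow> openin (top_of_set X) (X \<inter> f -` N)"
  using continuous_openin_preimage [OF f_cont] f_X by blast

text \<open>Hoelder continuity of the derivative bounds the error of the linearization by integration
  along segments. The constant is uniform near \<open>p0\<close>, at all pairs of points.\<close>

lemma fder_local:
  assumes c: "c \<in> \<A>" "p0 \<in> cdom c" and c': "c' \<in> \<A>" "f p0 \<in> cdom c'"
  shows "((cmap c' \<circ> f \<circ> cinv c) has_derivative fder c c' p0) (at (cmap c p0))"
    "\<exists>N K. openin (top_of_set X) N \<and> p0 \<in> N \<and> N \<subseteq> cdom c \<and> f ` N \<subseteq> cdom c' \<and> 0 \<le> K \<and>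
      (\<forall>q\<in>N. \<forall>q'\<in>N. norm (cmap c' (f q') - cmap c' (f q)) \<le> K * norm (cmap c q' - cmap c q) \<and>
        norm (cmap c' (f q') - cmap c' (f q) - fder c c' q (cmap c q' - cmap c q))
          \<le> K * norm (cmap c q' - cmap c q) powr (1 + \<beta>) \<and>
        (\<forall>v. norm (fder c c' q' v - fder c c' q v) \<le> K * norm (cmap c q' - cmap c q) powr \<beta> * norm v) \<and>
        (\<forall>v. norm (fder c c' q v) \<le> K * norm v))"
proof -
  define F where "F = cmap c' \<circ> f \<circ> cinv c"
  define U where "U = cmap c ` {x \<in> cdom c. f x \<in> cdom c'}"
  have "{x \<in> cdom c. f x \<in> cdom c'} = cdom c \<inter> (X \<inter> f -` cdom c')"
    using cdom_X [OF c(1)] by auto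
  then have U: "open U" "cmap c p0 \<in> U"
    using open_cmap_Int [OF c(1) openin_f_preimage [OF openin_cdom [OF c'(1)]]] c c' by (auto simp: U_def)
  have "C1_holder_on \<beta> F U" using C1 c c' unfolding C1_holder_map_def F_def U_def by blast
  then obtain g' where g': "\<And>u. u \<in> U \<Longrightarrow> (F has_derivative g' u) (at u)"
      and hol: "\<forall>u\<in>U. \<exists>\<delta>>0. \<exists>K. \<forall>p\<in>U \<inter> ball u \<delta>. \<forall>q\<in>U \<inter> ball u \<delta>.
          onorm (\<lambda>v. g' p v - g' q v) \<le> K * dist p q powr \<beta>"
    unfolding C1_holder_on_def by blast
  have fd: "fder c c' p = g' (cmap c p)" if "cmap c p \<in> U" for p
    unfolding fder_def using frechet_derivative_at [OF g' [OF that]] by (simp add: F_def)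
  show "((cmap c' \<circ> f \<circ> cinv c) has_derivative fder c c' p0) (at (cmap c p0))"
    using g' [OF U(2)] fd [OF U(2)] by (simp add: F_def)
  let ?u = "cmap c p0"
  obtain d K where d: "0 < d" "\<forall>p\<in>U \<inter> ball ?u d. \<forall>q\<in>U \<inter> ball ?u d.
      onorm (\<lambda>v. g' p v - g' q v) \<le> K * dist p q powr \<beta>" using hol U(2) by blast
  obtain e where e: "0 < e" "ball ?u e \<subseteq> U" using U open_contains_ball by blast
  \<comment> \<open>Diameter at most \<open>1\<close> makes \<open>norm (p - q) powr \<beta>\<close> at most \<open>1\<close>.\<close>
  define b where "b = ball ?u (min (min d e) (1/2))"
  define K' where "K' = max K 0"
  have b: "b \<subseteq> U" "b \<subseteq> ball ?u d" "convex b" "open b" "?u \<in> b" using d e by (auto simp: b_def)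
  have diam: "norm (v - u) \<le> 1" if "u \<in> b" "v \<in> b" for u v
  proof -
    have "dist u v \<le> dist ?u u + dist ?u v" by (metis dist_commute dist_triangle)
    then show ?thesis using that by (auto simp: b_def dist_norm norm_minus_commute)
  qed
  have bl: "bounded_linear (g' u)" if "u \<in> U" for u using g' [OF that] has_derivative_bounded_linear by blast
  have on: "onorm (\<lambda>v. g' p v - g' q v) \<le> K' * norm (p - q) powr \<beta>" if "p \<in> b" "q \<in> b" for p q
  proof -
    have "onorm (\<lambda>v. g' p v - g' q v) \<le> K * dist p q powr \<beta>" using d(2) that b by blast
    also have "\<dots> \<le> K' * norm (p - q) powr \<beta>" by (simp add: K'_def dist_norm mult_right_mono)
    finally show ?thesis .
  qed
  have hd: "norm (g' p v - g' q v) \<le> K' * norm (p - q) powr \<beta> * norm v" if "p \<in> b" "q \<in> b" for p q v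
  proof -
    have "bounded_linear (\<lambda>v. g' p v - g' q v)" using bl b(1) that by (intro bounded_linear_sub) auto
    then have "norm (g' p v - g' q v) \<le> onorm (\<lambda>v. g' p v - g' q v) * norm v" by (rule onorm)
    also have "\<dots> \<le> K' * norm (p - q) powr \<beta> * norm v" using on [OF that] by (rule mult_right_mono) simp
    finally show ?thesis .
  qed
  define K2 where "K2 = onorm (g' ?u) + K'"
  have bd: "norm (g' p v) \<le> K2 * norm v" if "p \<in> b" for p v
  proof -
    have "norm (g' p v - g' ?u v) \<le> K' * norm (p - ?u) powr \<beta> * norm v" by (rule hd [OF that b(5)])
    also have "\<dots> \<le> K' * 1 * norm v"
      using diam [OF b(5) that] \<beta> by (intro mult_right_mono mult_left_mono powr_le1) (auto simp: K'_def)
    finally have "norm (g' p v) \<le> norm (g' ?u v) + K' * 1 * norm v"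
      using norm_triangle_sub [of "g' p v" "g' ?u v"] by linarith
    also have "norm (g' ?u v) \<le> onorm (g' ?u) * norm v" using onorm [OF bl [OF U(2)]] .
    finally show ?thesis by (simp add: K2_def algebra_simps)
  qed
  have K2: "0 \<le> K2" using onorm_pos_le [OF bl [OF U(2)]] by (simp add: K2_def K'_def)
  have taylor: "norm (F v - F u - g' u (v - u)) \<le> K' * norm (v - u) powr \<beta> * norm (v - u)" if uv: "u \<in> b" "v \<in> b" for u v
  proof -
    let ?s = "closed_segment u v"
    have sb: "?s \<subseteq> b" using uv b(3) by (simp add: closed_segment_subset)
    have "norm ((F v - g' u v) - (F u - g' u u)) \<le> K' * norm (v - u) powr \<beta> * norm (v - u)"
    proof (rule differentiable_bound [where S = ?s and f' = "\<lambda>w v. g' w v - g' u v"])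
      fix w assume w: "w \<in> ?s"
      show "((\<lambda>w. F w - g' u w) has_derivative (\<lambda>v. g' w v - g' u v)) (at w within ?s)"
        using g' [of w] bl [of u] w sb uv b(1)
        by (intro has_derivative_diff has_derivative_at_withinI [OF g'] bounded_linear_imp_has_derivative) auto
      have "onorm (\<lambda>v. g' w v - g' u v) \<le> K' * norm (w - u) powr \<beta>" using on w sb uv by blast
      also have "\<dots> \<le> K' * norm (v - u) powr \<beta>"
        using segment_bound(1) [OF w] \<beta> by (intro mult_left_mono powr_mono2) (auto simp: K'_def)
      finally show "onorm (\<lambda>v. g' w v - g' u v) \<le> K' * norm (v - u) powr \<beta>" .
    qed auto
    moreover have "g' u (v - u) = g' u v - g' u u"
      using linear_diff [OF bounded_linear.linear [OF bl]] uv b(1) by blast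
    then have "F v - F u - g' u (v - u) = (F v - g' u v) - (F u - g' u u)" by simp
    ultimately show ?thesis by (simp only:)
  qed
  have lip: "norm (F v - F u) \<le> K2 * norm (v - u)" if uv: "u \<in> b" "v \<in> b" for u v
  proof (rule differentiable_bound [OF b(3) _ _ uv(2) uv(1)])
    fix w assume w: "w \<in> b"
    show "(F has_derivative g' w) (at w within b)" using g' w b(1) has_derivative_at_withinI by blast
    show "onorm (g' w) \<le> K2" using bd [OF w] K2 by (intro onorm_bound)
  qed
  define N where "N = cinv c ` b"
  have bc: "b \<subseteq> cmap c ` cdom c" using b(1) by (auto simp: U_def)
  have N: "openin (top_of_set X) N" unfolding N_def by (rule openin_cinv_image [OF c(1) b(4) bc])
  have "p0 \<in> N" unfolding N_def using b(5) c by (metis cinv_cmap imageI)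
  moreover have Nq: "q \<in> cdom c" "f q \<in> cdom c'" "cmap c q \<in> b" "F (cmap c q) = cmap c' (f q)" "fder c c' q = g' (cmap c q)" if q: "q \<in> N" for q
  proof -
    obtain u where u: "u \<in> b" "q = cinv c u" using q by (auto simp: N_def)
    then obtain x where x: "x \<in> cdom c" "f x \<in> cdom c'" "u = cmap c x" using b(1) by (auto simp: U_def)
    then have "q = x" using u c by simp
    then show 1: "q \<in> cdom c" "f q \<in> cdom c'" "cmap c q \<in> b" using u x by auto
    then show "F (cmap c q) = cmap c' (f q)" using c by (simp add: F_def)
    show "fder c c' q = g' (cmap c q)" using fd 1 b(1) by blast
  qed
  ultimately show "\<exists>N K. openin (top_of_set X) N \<and> p0 \<in> N \<and> N \<subseteq> cdom c \<and> f ` N \<subseteq> cdom c' \<and> 0 \<le> K \<and>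
      (\<forall>q\<in>N. \<forall>q'\<in>N. norm (cmap c' (f q') - cmap c' (f q)) \<le> K * norm (cmap c q' - cmap c q) \<and>
        norm (cmap c' (f q') - cmap c' (f q) - fder c c' q (cmap c q' - cmap c q))
          \<le> K * norm (cmap c q' - cmap c q) powr (1 + \<beta>) \<and>
        (\<forall>v. norm (fder c c' q' v - fder c c' q v) \<le> K * norm (cmap c q' - cmap c q) powr \<beta> * norm v) \<and>
        (\<forall>v. norm (fder c c' q v) \<le> K * norm v))"
  proof (intro exI [of _ N] exI [of _ K2] conjI ballI allI N K2)
    have KK: "K' \<le> K2" using onorm_pos_le [OF bl [OF U(2)]] by (simp add: K2_def)
    fix q q' v assume q: "q \<in> N" and q': "q' \<in> N"
    let ?d = "norm (cmap c q' - cmap c q)"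
    show "norm (cmap c' (f q') - cmap c' (f q)) \<le> K2 * ?d"
      using lip [OF Nq(3) [OF q] Nq(3) [OF q']] Nq q q' by simp
    have "norm (cmap c' (f q') - cmap c' (f q) - fder c c' q (cmap c q' - cmap c q)) \<le> K' * ?d powr \<beta> * ?d"
      using taylor [OF Nq(3) [OF q] Nq(3) [OF q']] Nq q q' by simp
    also have "\<dots> = K' * ?d powr (1 + \<beta>)" by (simp add: powr_mult_base [symmetric] mult_ac)
    also have "\<dots> \<le> K2 * ?d powr (1 + \<beta>)" using KK by (intro mult_right_mono) auto
    finally show "norm (cmap c' (f q') - cmap c' (f q) - fder c c' q (cmap c q' - cmap c q)) \<le> K2 * ?d powr (1 + \<beta>)" .
    have "norm (fder c c' q' v - fder c c' q v) \<le> K' * ?d powr \<beta> * norm v"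
      using hd [OF Nq(3) [OF q'] Nq(3) [OF q]] Nq q q' by simp
    also have "\<dots> \<le> K2 * ?d powr \<beta> * norm v" using KK by (intro mult_right_mono) auto
    finally show "norm (fder c c' q' v - fder c c' q v) \<le> K2 * ?d powr \<beta> * norm v" .
    show "norm (fder c c' q v) \<le> K2 * norm v" using bd [OF Nq(3) [OF q]] Nq q by simp
  qed (use Nq in auto)
qed

lemma linear_fder:
  "c \<in> \<A> \<Longrightarrow> p \<in> cdom c \<Longrightarrow> c' \<in> \<A> \<Longrightarrow> f p \<in> cdom c' \<Longrightarrow> linear (fder c c' p)"
  using has_derivative_linear [OF fder_local(1)] .

lemma mderiv_fder: "mderiv \<A> f p = fder (chart_at \<A> p) (chart_at \<A> (f p)) p"
  by (simp add: mderiv_def fder_def)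

lemma linear_mderiv: "p \<in> X \<Longrightarrow> linear (mderiv \<A> f p)"
  unfolding mderiv_fder using chart_at [of p] chart_at [OF f_X, of p] by (intro linear_fder)

lemma derivative_f:
  assumes c: "c \<in> \<A>" "p \<in> cdom c" and c': "c' \<in> \<A>" "f p \<in> cdom c'" and h: "h s = p" "s \<in> S"
    and d: "((\<lambda>s. cmap c (h s)) has_derivative d) (at s within S)"
    and ev: "\<forall>\<^sub>F t in at s within S. h t \<in> cdom c"
  shows "((\<lambda>s. cmap c' (f (h s))) has_derivative (\<lambda>v. fder c c' p (d v))) (at s within S)"
proof -
  have "((\<lambda>s. (cmap c' \<circ> f \<circ> cinv c) (cmap c (h s))) has_derivative (\<lambda>v. fder c c' p (d v))) (at s within S)"
    by (rule has_derivative_compose [OF d]) (use fder_local(1) [OF c c'] h in \<open>simp add: o_def\<close>)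
  then show ?thesis
  proof (rule has_derivative_transform_eventually)
    show "\<forall>\<^sub>F t in at s within S. (cmap c' \<circ> f \<circ> cinv c) (cmap c (h t)) = cmap c' (f (h t))"
      using ev by eventually_elim (use c in simp)
  qed (use c h in auto)
qed

lemma fder_tcoord:
  assumes c: "c \<in> \<A>" "p \<in> cdom c" and c': "c' \<in> \<A>" "f p \<in> cdom c'"
  shows "fder c c' p (tcoord \<A> c p v) = tcoord \<A> c' (f p) (mderiv \<A> f p v)"
proof -
  let ?c = "chart_at \<A> p" and ?c' = "chart_at \<A> (f p)"
  have pX: "p \<in> X" "f p \<in> X" using cdom_X c c' by auto
  note p = chart_at [OF pX(1)] and fp = chart_at [OF pX(2)]
  define h where "h u = cinv ?c u" for u
  let ?u = "cmap ?c p"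
  have h: "h ?u = p" using p by (simp add: h_def)
  have near: "\<forall>\<^sub>F u in at ?u. u \<in> cmap ?c ` cdom ?c \<and> h u \<in> N" if "openin (top_of_set X) N" "p \<in> N" for N
    using eventually_cinv [OF p that] unfolding h_def eventually_at_filter by eventually_elim simp
  have d0: "((\<lambda>u. cmap ?c (h u)) has_derivative (\<lambda>v. v)) (at ?u)"
  proof (rule has_derivative_transform_eventually [OF has_derivative_ident])
    show "\<forall>\<^sub>F u in at ?u. u = cmap ?c (h u)"
      using near [OF openin_cdom [OF p(1)] p(2)] by eventually_elim (use p in \<open>auto simp: h_def\<close>)
  qed (use p in \<open>auto simp: h_def\<close>)
  have ev: "\<forall>\<^sub>F u in at ?u. h u \<in> cdom ?c" "\<forall>\<^sub>F u in at ?u. h u \<in> cdom c"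
    using near [OF openin_cdom [OF p(1)] p(2)] near [OF openin_cdom [OF c(1)] c(2)]
    by (auto elim: eventually_mono)
  have "\<forall>\<^sub>F u in at ?u. h u \<in> X \<inter> f -` cdom ?c'"
    using near [OF openin_f_preimage [OF openin_cdom [OF fp(1)]]] fp pX by (auto elim: eventually_mono)
  then have ev': "\<forall>\<^sub>F u in at ?u. f (h u) \<in> cdom ?c'" by eventually_elim simp
  have "((\<lambda>u. cmap c (h u)) has_derivative (\<lambda>v. tcoord \<A> c p v)) (at ?u)"
    by (rule derivative_change_chart [OF c h UNIV_I d0 ev(1)])
  from derivative_f [OF c c' h UNIV_I this ev(2)]
  have 1: "((\<lambda>u. cmap c' (f (h u))) has_derivative (\<lambda>v. fder c c' p (tcoord \<A> c p v))) (at ?u)" .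
  have "((\<lambda>u. cmap ?c' (f (h u))) has_derivative (\<lambda>v. mderiv \<A> f p v)) (at ?u)"
    using derivative_f [OF p fp h UNIV_I d0 ev(1)] by (simp add: mderiv_fder)
  from derivative_change_chart [OF c' _ UNIV_I this ev']
  have 2: "((\<lambda>u. cmap c' (f (h u))) has_derivative (\<lambda>v. tcoord \<A> c' (f p) (mderiv \<A> f p v))) (at ?u)"
    using h by simp
  show ?thesis using has_derivative_unique [OF 1 2] by (rule fun_cong)
qed

end

section \<open>Leaves as submanifolds\<close>

lemma vector_mvt_bound:
  fixes h :: "real \<Rightarrow> 'b::real_normed_vector"
  assumes "\<And>t. t \<in> {0..1} \<Longrightarrow> (h has_vector_derivative h' t) (at t)" "\<And>t. t \<in> {0..1} \<Longrightarrow> norm (h' t) \<le> B"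
  shows "norm (h 1 - h 0) \<le> B"
proof -
  have "norm (h 1 - h 0) \<le> B * norm (1 - 0 :: real)"
  proof (rule differentiable_bound [where S = "{0..1}" and f' = "\<lambda>t x. x *\<^sub>R h' t"])
    fix t :: real assume t: "t \<in> {0..1}"
    show "(h has_derivative (\<lambda>x. x *\<^sub>R h' t)) (at t within {0..1})"
      using assms(1) [OF t] by (simp add: has_vector_derivative_def has_derivative_at_withinI)
    show "onorm (\<lambda>x. x *\<^sub>R h' t) \<le> B"
    proof (rule onorm_bound)
      show "0 \<le> B" using assms(2) [OF t] norm_ge_zero order_trans by blast
      show "norm (x *\<^sub>R h' t) \<le> B * norm x" for x :: real
        using mult_left_mono [OF assms(2) [OF t], of "norm x"] by (simp add: mult.commute)
    qed
  qed auto
  then show ?thesis by simp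
qed

locale leaf_structure = manifold X \<A> + foliation X k \<F>
  for X :: "'a::t2_space set" and \<A> :: "('a, 'e::euclidean_space) chart set" and k
    and \<F> :: "('a, 'e) fbox set" +
  fixes \<beta> :: real
  assumes leaves: "uniformly_C1_holder_leaves \<beta> X \<A> \<F>" and \<beta>: "0 < \<beta>"
begin

abbreviation "TB \<equiv> tangent_bundle \<A> \<F>"

lemma holder_TB: "holder_subbundle \<beta> X \<A> TB"
  using leaves by (simp add: uniformly_C1_holder_leaves_def)

lemma subspace_TB: "p \<in> X \<Longrightarrow> subspace (TB p)"
  using holder_TB by (simp add: holder_subbundle_def)

text \<open>The derivative of the leaf chart given by \<open>B\<close>, read in the chart \<open>c\<close>, at the point with box
  coordinate \<open>u\<close>.\<close>

definition lder :: "('a, 'e) fbox \<Rightarrow> ('a, 'e) chart \<Rightarrow> 'e \<Rightarrow> 'e \<Rightarrow> 'e" where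
  "lder B c = (SOME D.
     (\<forall>u\<in>bmap B ` (bdom B \<inter> cdom c).
        ((\<lambda>a. cmap c (binv B (u + a))) has_derivative D u) (at 0 within bdir B) \<and> inj_on (D u) (bdir B)) \<and>
     (\<forall>a\<in>bdir B. continuous_on (bmap B ` (bdom B \<inter> cdom c)) (\<lambda>u. D u a)))"

lemma lder_props:
  assumes "B \<in> \<F>" "c \<in> \<A>"
  shows "u \<in> bmap B ` (bdom B \<inter> cdom c) \<Longrightarrow>
      ((\<lambda>a. cmap c (binv B (u + a))) has_derivative lder B c u) (at 0 within bdir B)"
    "u \<in> bmap B ` (bdom B \<inter> cdom c) \<Longrightarrow> inj_on (lder B c u) (bdir B)"
    "a \<in> bdir B \<Longrightarrow> continuous_on (bmap B ` (bdom B \<inter> cdom c)) (\<lambda>u. lder B c u a)"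
proof -
  have "\<exists>D. (\<forall>u\<in>bmap B ` (bdom B \<inter> cdom c).
        ((\<lambda>a. cmap c (binv B (u + a))) has_derivative D u) (at 0 within bdir B) \<and> inj_on (D u) (bdir B)) \<and>
     (\<forall>a\<in>bdir B. continuous_on (bmap B ` (bdom B \<inter> cdom c)) (\<lambda>u. D u a))"
    using leaves assms unfolding uniformly_C1_holder_leaves_def Let_def by meson
  from someI_ex [OF this] show
    "u \<in> bmap B ` (bdom B \<inter> cdom c) \<Longrightarrow>
      ((\<lambda>a. cmap c (binv B (u + a))) has_derivative lder B c u) (at 0 within bdir B)"
    "u \<in> bmap B ` (bdom B \<inter> cdom c) \<Longrightarrow> inj_on (lder B c u) (bdir B)"
    "a \<in> bdir B \<Longrightarrow> continuous_on (bmap B ` (bdom B \<inter> cdom c)) (\<lambda>u. lder B c u a)"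
    unfolding lder_def by blast+
qed

lemma linear_lder: "B \<in> \<F> \<Longrightarrow> c \<in> \<A> \<Longrightarrow> u \<in> bmap B ` (bdom B \<inter> cdom c) \<Longrightarrow> linear (lder B c u)"
  using has_derivative_linear [OF lder_props(1)] .

lemma lder_lower:
  assumes "B \<in> \<F>" "c \<in> \<A>" "u \<in> bmap B ` (bdom B \<inter> cdom c)"
  obtains m where "0 < m" "\<And>a. a \<in> bdir B \<Longrightarrow> m * norm a \<le> norm (lder B c u a)"
proof -
  have lin: "linear (lder B c u)" using linear_lder assms by blast
  have "\<forall>a\<in>bdir B. lder B c u a = 0 \<longrightarrow> a = 0"
    using lder_props(2) [OF assms] linear_0 [OF lin] subspace_0 [OF subspace_bdir [OF assms(1)]]
    by (metis inj_onD)
  then show ?thesis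
    using injective_imp_isometric [OF closed_subspace subspace_bdir, of B "lder B c u"] assms(1)
      subspace_bdir lin that by (metis linear_conv_bounded_linear)
qed

lemma seg_deriv:
  assumes "B \<in> \<F>" "c \<in> \<A>" "u + t *\<^sub>R a \<in> bmap B ` (bdom B \<inter> cdom c)" "a \<in> bdir B"
  shows "((\<lambda>s. cmap c (binv B (u + s *\<^sub>R a))) has_vector_derivative lder B c (u + t *\<^sub>R a) a) (at t)"
proof -
  let ?v = "u + t *\<^sub>R a" and ?h = "\<lambda>s. (s - t) *\<^sub>R a"
  have hL: "range ?h \<subseteq> bdir B" using assms(4) subspace_bdir [OF assms(1)] by (auto intro: subspace_scale)
  have "((\<lambda>b. cmap c (binv B (?v + b))) has_derivative lder B c ?v) (at (?h t) within range ?h)"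
    using has_derivative_subset [OF lder_props(1) [OF assms(1-3)] hL] by simp
  moreover have "(?h has_derivative (\<lambda>x. x *\<^sub>R a)) (at t)" by (auto intro!: derivative_eq_intros)
  ultimately have "((\<lambda>s. cmap c (binv B (?v + ?h s))) has_derivative (\<lambda>x. lder B c ?v (x *\<^sub>R a))) (at t)"
    using has_derivative_in_compose [of ?h "\<lambda>x. x *\<^sub>R a" t UNIV] by blast
  moreover have "?v + ?h s = u + s *\<^sub>R a" for s by (simp add: algebra_simps)
  moreover have "lder B c ?v (x *\<^sub>R a) = x *\<^sub>R lder B c ?v a" for x
    using linear_scale [OF linear_lder [OF assms(1-3)]] .
  ultimately show ?thesis by (simp add: has_vector_derivative_def)
qed

lemma eventually_ray:
  assumes B: "B \<in> \<F>" "p \<in> bdom B" and a: "a \<in> bdir B" and N: "openin (top_of_set X) N" "p \<in> N"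
  shows "\<forall>\<^sub>F t in at 0. binv B (bmap B p + t *\<^sub>R a) \<in> N \<inter> plaque B p"
proof -
  have "open (bmap B ` (bdom B \<inter> N))" by (rule open_image_Int [OF B(1) N(1)])
  moreover have "((\<lambda>t. bmap B p + t *\<^sub>R a) \<longlongrightarrow> bmap B p + 0 *\<^sub>R a) (at 0)"
    by (intro tendsto_intros)
  ultimately have "\<forall>\<^sub>F t in at 0. bmap B p + t *\<^sub>R a \<in> bmap B ` (bdom B \<inter> N)"
    using B N by (intro topological_tendstoD) auto
  then show ?thesis
  proof eventually_elim
    case (elim t)
    then obtain q where q: "q \<in> bdom B" "q \<in> N" "bmap B q = bmap B p + t *\<^sub>R a" by fastforce
    then have "bmap B q - bmap B p \<in> bdir B" using a subspace_bdir [OF B(1)] by (simp add: subspace_scale)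
    moreover have "binv B (bmap B p + t *\<^sub>R a) = q" using q B(1) by (metis binv_bmap)
    ultimately show ?case using q by (simp add: plaque_iff)
  qed
qed

lemma continuous_bmap_chart:
  assumes "B \<in> \<F>" "c \<in> \<A>" "p \<in> bdom B \<inter> cdom c"
  shows "isCont (\<lambda>x. bmap B (cinv c x)) (cmap c p)"
proof -
  let ?U = "cmap c ` (cdom c \<inter> bdom B)"
  have "continuous_on ?U (\<lambda>x. bmap B (cinv c x))"
  proof (rule continuous_on_compose2 [OF homeomorphism_cont1 [OF hom [OF assms(1)]]])
    show "continuous_on ?U (cinv c)"
      using homeomorphism_cont2 [OF chom [OF assms(2)]] by (rule continuous_on_subset) auto
  qed (use assms(2) in auto)
  moreover have "open ?U" using open_cmap_Int [OF assms(2) openin_bdom [OF assms(1)]] .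
  ultimately show ?thesis using assms(3) by (simp add: continuous_on_eq_continuous_at)
qed

lemma first_order:
  assumes "B \<in> \<F>" "c \<in> \<A>" "p \<in> bdom B \<inter> cdom c" "0 < e"
  shows "\<exists>\<delta>>0. \<forall>q\<in>plaque B p. norm (bmap B q - bmap B p) < \<delta> \<longrightarrow>
    norm (cmap c q - cmap c p - lder B c (bmap B p) (bmap B q - bmap B p)) \<le> e * norm (bmap B q - bmap B p)"
proof -
  have "((\<lambda>a. cmap c (binv B (bmap B p + a))) has_derivative lder B c (bmap B p)) (at 0 within bdir B)"
    using assms(3) by (intro lder_props(1) [OF assms(1,2)]) auto
  then obtain d where d: "0 < d" "\<forall>a\<in>bdir B. norm (a - 0) < d \<longrightarrow>
      norm (cmap c (binv B (bmap B p + a)) - cmap c (binv B (bmap B p + 0)) - lder B c (bmap B p) (a - 0)) \<le> e * norm (a - 0)"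
    using assms(4) unfolding has_derivative_within_alt by blast
  show ?thesis
  proof (intro exI [of _ d] conjI ballI impI d(1))
    fix q assume q: "q \<in> plaque B p" "norm (bmap B q - bmap B p) < d"
    then have "bmap B q - bmap B p \<in> bdir B" "q \<in> bdom B" by (auto simp: plaque_iff)
    then show "norm (cmap c q - cmap c p - lder B c (bmap B p) (bmap B q - bmap B p)) \<le> e * norm (bmap B q - bmap B p)"
      using d(2) q(2) assms by (auto dest!: bspec)
  qed
qed

text \<open>A curve that runs in a plaque and is differentiable in the manifold is tangent to the plaque.
  Its expression in the leaf chart is only continuous; but the difference quotients of the curve are, to first order, images of displacements in the leaf chart, so their components orthogonal to
  the tangent plane tend to \<open>0\<close>.\<close>

lemma tangent_curve:
  assumes B: "B \<in> \<F>" and c: "c \<in> \<A>" and p: "p \<in> bdom B \<inter> cdom c" and h0: "h 0 = p"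
    and d: "((\<lambda>t. cmap c (h t)) has_vector_derivative w) (at 0)"
    and ev: "\<forall>\<^sub>F t in at 0. h t \<in> plaque B p \<inter> cdom c"
  shows "w \<in> lder B c (bmap B p) ` bdir B"
proof -
  let ?D = "lder B c (bmap B p)" and ?L = "bdir B"
  have pS: "bmap B p \<in> bmap B ` (bdom B \<inter> cdom c)" using p by auto
  have lin: "linear ?D" by (rule linear_lder [OF B c pS])
  have DL: "subspace (?D ` ?L)" using lin subspace_bdir [OF B] by (rule linear_subspace_image)
  obtain m where m: "0 < m" "\<And>a. a \<in> ?L \<Longrightarrow> m * norm a \<le> norm (?D a)"
    using lder_lower [OF B c pS] by blast
  let ?h = "\<lambda>x. x - proj (?D ` ?L) x"
  have linh: "linear ?h" by (intro linear_compose_sub linear_ident proj_props [OF DL])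
  have slope: "((\<lambda>t. (cmap c (h t) - cmap c p) /\<^sub>R t) \<longlongrightarrow> w) (at 0)"
  proof (rule LIM_zero_cancel, rule tendsto_norm_zero_cancel)
    have "((\<lambda>t. norm (cmap c (h (0 + t)) - cmap c (h 0) - t *\<^sub>R w) / norm t) \<longlongrightarrow> 0) (at 0)"
      using d unfolding has_vector_derivative_def has_derivative_at by blast
    moreover have "norm (cmap c (h (0 + t)) - cmap c (h 0) - t *\<^sub>R w) / norm t =
        norm ((cmap c (h t) - cmap c p) /\<^sub>R t - w)" if "t \<noteq> 0" for t
    proof -
      have "(cmap c (h t) - cmap c p) /\<^sub>R t - w = (cmap c (h t) - cmap c p - t *\<^sub>R w) /\<^sub>R t"
        using that by (simp add: scaleR_diff_right)
      then show ?thesis using h0 by (simp add: divide_inverse mult.commute)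
    qed
    then have "\<forall>\<^sub>F t in at 0. norm (cmap c (h (0 + t)) - cmap c (h 0) - t *\<^sub>R w) / norm t =
        norm ((cmap c (h t) - cmap c p) /\<^sub>R t - w)" unfolding eventually_at_filter by (auto intro: always_eventually)
    ultimately show "((\<lambda>t. norm ((cmap c (h t) - cmap c p) /\<^sub>R t - w)) \<longlongrightarrow> 0) (at 0)"
      by (rule Lim_transform_eventually)
  qed
  have "isCont (\<lambda>t. cmap c (h t)) 0" using has_vector_derivative_continuous [OF d] .
  then have ch: "((\<lambda>t. cmap c (h t)) \<longlongrightarrow> cmap c p) (at 0)" using h0 by (simp add: isCont_def)
  have "((\<lambda>t. bmap B (cinv c (cmap c (h t)))) \<longlongrightarrow> bmap B (cinv c (cmap c p))) (at 0)"
    using isCont_tendsto_compose [OF continuous_bmap_chart [OF B c p] ch] .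
  then have "((\<lambda>t. bmap B (h t)) \<longlongrightarrow> bmap B p) (at 0)"
  proof (rule Lim_transform_eventually [THEN tendsto_eq_rhs])
    show "\<forall>\<^sub>F t in at 0. bmap B (cinv c (cmap c (h t))) = bmap B (h t)"
      using ev by eventually_elim (use c in auto)
  qed (use c p in auto)
  then have bm: "((\<lambda>t. norm (bmap B (h t) - bmap B p)) \<longlongrightarrow> 0) (at 0)"
    by (simp add: LIM_zero tendsto_norm_zero)
  have small: "norm (?h w) \<le> e * norm w" if e: "0 < e" for e
  proof -
    let ?e = "min (m / 2) (e * m / 2)"
    have e': "0 < ?e" using m e by simp
    obtain \<delta> where \<delta>: "0 < \<delta>" "\<forall>q\<in>plaque B p. norm (bmap B q - bmap B p) < \<delta> \<longrightarrow>
        norm (cmap c q - cmap c p - ?D (bmap B q - bmap B p)) \<le> ?e * norm (bmap B q - bmap B p)"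
      using first_order [OF B c p e'] by blast
    have "\<forall>\<^sub>F t in at 0. norm (?h ((cmap c (h t) - cmap c p) /\<^sub>R t)) \<le> e * norm ((cmap c (h t) - cmap c p) /\<^sub>R t)"
      using ev order_tendstoD(2) [OF bm \<delta>(1)]
    proof eventually_elim
      case (elim t)
      let ?d = "cmap c (h t) - cmap c p" and ?a = "bmap B (h t) - bmap B p"
      have a: "?a \<in> ?L" using elim by (simp add: plaque_iff)
      have "norm (?d - ?D ?a) \<le> ?e * norm ?a" using \<delta>(2) elim by blast
      moreover have "?e * norm ?a \<le> m / 2 * norm ?a" "?e * norm ?a \<le> e * m / 2 * norm ?a"
        by (intro mult_right_mono; simp)+
      ultimately have 1: "norm (?d - ?D ?a) \<le> m / 2 * norm ?a" "norm (?d - ?D ?a) \<le> e * m / 2 * norm ?a"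
        by linarith+
      have "m * norm ?a \<le> norm (?D ?a)" by (rule m(2) [OF a])
      also have "\<dots> \<le> norm ?d + norm (?d - ?D ?a)" by (metis norm_minus_commute norm_triangle_sub)
      also have "\<dots> \<le> norm ?d + m / 2 * norm ?a" using 1(1) by simp
      finally have 2: "m / 2 * norm ?a \<le> norm ?d" by (simp add: field_simps)
      have "norm (?h ?d) \<le> norm (?d - ?D ?a)" using norm_diff_proj_le [OF DL, of "?D ?a" ?d] a by (simp add: dist_norm)
      also have "\<dots> \<le> e * m / 2 * norm ?a" by (rule 1(2))
      also have "\<dots> = e * (m / 2 * norm ?a)" by simp
      also have "\<dots> \<le> e * norm ?d" using 2 e by (intro mult_left_mono) auto
      finally have 3: "norm (?h ?d) \<le> e * norm ?d" .
      have "?h (?d /\<^sub>R t) = ?h ?d /\<^sub>R t" using linear_scale [OF linh, of "inverse t" ?d] by simp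
      then show ?case using 3 mult_left_mono [OF 3, of "\<bar>inverse t\<bar>"] by (simp add: mult.left_commute)
    qed
    moreover have "((\<lambda>t. norm (?h ((cmap c (h t) - cmap c p) /\<^sub>R t))) \<longlongrightarrow> norm (?h w)) (at 0)"
      by (intro tendsto_norm isCont_tendsto_compose [OF linear_continuous_at slope])
        (use linh in \<open>simp add: linear_conv_bounded_linear\<close>)
    moreover have "((\<lambda>t. e * norm ((cmap c (h t) - cmap c p) /\<^sub>R t)) \<longlongrightarrow> e * norm w) (at 0)"
      by (intro tendsto_intros slope)
    ultimately show ?thesis by (intro tendsto_le) auto
  qed
  have "norm (?h w) \<le> 0"
  proof (cases "norm w = 0")
    case False
    show ?thesis
    proof (rule field_le_epsilon)
      fix e :: real assume "0 < e"
      then show "norm (?h w) \<le> 0 + e" using small [of "e / norm w"] False by simp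
    qed
  qed (use small [of 1] in simp)
  then have "w = proj (?D ` ?L) w" by simp
  then show ?thesis using proj_props(2) [OF DL] by metis
qed

lemma leaf_tangent_coord:
  assumes "B \<in> \<F>" "c \<in> \<A>" "p \<in> bdom B \<inter> cdom c" "a \<in> bdir B"
  shows "tcoord \<A> c p (leaf_tangent \<A> B p a) = lder B c (bmap B p) a"
proof -
  let ?c = "chart_at \<A> p" and ?h = "\<lambda>t. binv B (bmap B p + t *\<^sub>R a)"
  have pX: "p \<in> X" using cdom_X assms by blast
  note p = chart_at [OF pX]
  have h0: "?h 0 = p" using assms by simp
  have d: "((\<lambda>t. cmap b (?h t)) has_vector_derivative lder B b (bmap B p) a) (at 0)" if "b \<in> \<A>" "p \<in> cdom b" for b
    using seg_deriv [OF assms(1) that(1), of "bmap B p" 0 a] that assms by auto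
  have "leaf_tangent \<A> B p a = lder B ?c (bmap B p) a"
    unfolding leaf_tangent_def by (rule vector_derivative_at [OF d [OF p]])
  then have dc: "((\<lambda>t. cmap ?c (?h t)) has_derivative (\<lambda>x. x *\<^sub>R leaf_tangent \<A> B p a)) (at 0)"
    using d [OF p] by (simp add: has_vector_derivative_def)
  have "\<forall>\<^sub>F t in at 0. ?h t \<in> cdom ?c"
    using eventually_ray [OF assms(1) _ assms(4) openin_cdom [OF p(1)] p(2)] assms(3) by (auto elim: eventually_mono)
  with dc have "((\<lambda>t. cmap c (?h t)) has_derivative (\<lambda>x. tcoord \<A> c p (x *\<^sub>R leaf_tangent \<A> B p a))) (at 0)"
    using assms by (intro derivative_change_chart [where h = ?h]) auto
  moreover have "tcoord \<A> c p (x *\<^sub>R leaf_tangent \<A> B p a) = x *\<^sub>R tcoord \<A> c p (leaf_tangent \<A> B p a)" for x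
    using assms by (intro linear_scale linear_tcoord) auto
  ultimately have "((\<lambda>t. cmap c (?h t)) has_vector_derivative tcoord \<A> c p (leaf_tangent \<A> B p a)) (at 0)"
    by (simp add: has_vector_derivative_def)
  then show ?thesis using d assms vector_derivative_unique_at by blast
qed

text \<open>In coordinates, the tangent space is spanned by the leaf chart of any one box: a plaque of
  another box agrees with its plaque near \<open>p\<close>.\<close>

lemma TB_coord:
  assumes B: "B \<in> \<F>" and c: "c \<in> \<A>" and p: "p \<in> bdom B \<inter> cdom c"
  shows "tcoord \<A> c p ` TB p = lder B c (bmap B p) ` bdir B"
proof
  show "lder B c (bmap B p) ` bdir B \<subseteq> tcoord \<A> c p ` TB p"
  proof (intro image_subsetI)
    fix a assume a: "a \<in> bdir B"
    have "leaf_tangent \<A> B p a \<in> TB p" using a B p by (auto simp: tangent_bundle_def)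
    then show "lder B c (bmap B p) a \<in> tcoord \<A> c p ` TB p"
      using leaf_tangent_coord [OF B c p a] by (metis imageI)
  qed
  show "tcoord \<A> c p ` TB p \<subseteq> lder B c (bmap B p) ` bdir B"
  proof (intro image_subsetI)
    fix v assume "v \<in> TB p"
    then obtain B' a where B': "B' \<in> \<F>" "p \<in> bdom B'" "a \<in> bdir B'" and v: "v = leaf_tangent \<A> B' p a"
      by (auto simp: tangent_bundle_def)
    obtain N where N: "openin (top_of_set X) N" "p \<in> N" "N \<subseteq> bdom B' \<inter> bdom B"
        "\<forall>q\<in>N. \<forall>r\<in>N. r \<in> plaque B' q \<longleftrightarrow> r \<in> plaque B q"
      using coherent [OF B'(1) B B'(2)] p by blast
    let ?h = "\<lambda>t. binv B' (bmap B' p + t *\<^sub>R a)"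
    have "lder B' c (bmap B' p) a \<in> lder B c (bmap B p) ` bdir B"
    proof (rule tangent_curve [OF B c p])
      show "?h 0 = p" using B' by simp
      show "((\<lambda>t. cmap c (?h t)) has_vector_derivative lder B' c (bmap B' p) a) (at 0)"
        using seg_deriv [OF B'(1) c, of "bmap B' p" 0 a] B' p by auto
      show "\<forall>\<^sub>F t in at 0. ?h t \<in> plaque B p \<inter> cdom c"
        using eventually_ray [OF B' N(1,2)] eventually_ray [OF B' openin_cdom [OF c] IntD2 [OF p]]
      proof eventually_elim
        case (elim t)
        then have "?h t \<in> plaque B p" using N(2,4) by blast
        then show ?case using elim by blast
      qed
    qed
    then show "tcoord \<A> c p v \<in> lder B c (bmap B p) ` bdir B"
      using leaf_tangent_coord [OF B'(1) c _ B'(3)] B' p v by auto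
  qed
qed

lemma dim_TB: assumes p: "p \<in> X" shows "dim (TB p) = k"
proof -
  obtain B where B: "B \<in> \<F>" "p \<in> bdom B" using cover p by blast
  note c = chart_at [OF p]
  let ?c = "chart_at \<A> p"
  have pS: "bmap B p \<in> bmap B ` (bdom B \<inter> cdom ?c)" using B c by auto
  have "dim (tcoord \<A> ?c p ` TB p) = dim (TB p)"
    by (intro dim_image_eq linear_tcoord c inj_on_subset [OF inj_tcoord [OF c]]) auto
  moreover have "dim (lder B ?c (bmap B p) ` bdir B) = dim (bdir B)"
  proof (rule dim_image_eq)
    have sp: "span (bdir B) = bdir B" using subspace_bdir [OF B(1)] by simp
    show "inj_on (lder B ?c (bmap B p)) (span (bdir B))"
      unfolding sp by (rule lder_props(2) [OF B(1) c(1) pS])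
  qed (rule linear_lder [OF B(1) c(1) pS])
  ultimately show ?thesis using TB_coord [OF B(1) c(1), of p] dim_bdir [OF B(1)] B c by simp
qed

text \<open>The derivative of a leaf chart depends continuously on the point for each fixed vector; the
  expansion in a basis turns this into continuity that is uniform on bounded sets of vectors.\<close>

lemma lder_sum:
  assumes "B \<in> \<F>" "c \<in> \<A>" "u \<in> bmap B ` (bdom B \<inter> cdom c)" "a \<in> bdir B"
  shows "lder B c u a = (\<Sum>b\<in>Basis. (a \<bullet> b) *\<^sub>R lder B c u (proj (bdir B) b))"
proof -
  have L: "subspace (bdir B)" by (rule subspace_bdir [OF assms(1)])
  have lin: "linear (lder B c u \<circ> proj (bdir B))"
    by (intro linear_compose proj_props [OF L] linear_lder assms(1-3))
  have "lder B c u a = (lder B c u \<circ> proj (bdir B)) (\<Sum>b\<in>Basis. (a \<bullet> b) *\<^sub>R b)"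
    using proj_id [OF L assms(4)] by (simp add: euclidean_representation)
  also have "\<dots> = (\<Sum>b\<in>Basis. (a \<bullet> b) *\<^sub>R (lder B c u \<circ> proj (bdir B)) b)"
    by (simp only: linear_sum [OF lin] linear_scale [OF lin])
  finally show ?thesis by (simp only: o_apply)
qed

text \<open>Near a point, leaf charts are uniformly bi-Lipschitz on plaques: on a small enough ball of box
  coordinates the derivative differs from the one at the centre by at most half of its lower
  bound.\<close>

lemma box_bounds:
  assumes B: "B \<in> \<F>" and c: "c \<in> \<A>" and p: "p \<in> bdom B \<inter> cdom c" and N: "openin (top_of_set X) N" "p \<in> N"
  obtains e m M where "0 < e" "0 < m" "0 < M" "ball (bmap B p) e \<subseteq> bmap B ` (bdom B \<inter> (cdom c \<inter> N))"
    "\<And>u a. u \<in> ball (bmap B p) e \<Longrightarrow> a \<in> bdir B \<Longrightarrow> m * norm a \<le> norm (lder B c u a)"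
    "\<And>u a. u \<in> ball (bmap B p) e \<Longrightarrow> a \<in> bdir B \<Longrightarrow> norm (lder B c u a) \<le> M * norm a"
    "\<And>u a. u \<in> ball (bmap B p) e \<Longrightarrow> u + a \<in> ball (bmap B p) e \<Longrightarrow> a \<in> bdir B \<Longrightarrow>
      m * norm a \<le> norm (cmap c (binv B (u + a)) - cmap c (binv B u))"
    "\<And>u a. u \<in> ball (bmap B p) e \<Longrightarrow> u + a \<in> ball (bmap B p) e \<Longrightarrow> a \<in> bdir B \<Longrightarrow>
      norm (cmap c (binv B (u + a)) - cmap c (binv B u)) \<le> M * norm a"
proof -
  let ?u = "bmap B p" and ?L = "bdir B" and ?S = "bmap B ` (bdom B \<inter> cdom c)"
  have L: "subspace ?L" by (rule subspace_bdir [OF B])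
  have pS: "?u \<in> ?S" using p by auto
  obtain m where m: "0 < m" "\<And>a. a \<in> ?L \<Longrightarrow> m * norm a \<le> norm (lder B c ?u a)"
    using lder_lower [OF B c pS] by blast
  obtain M where M: "0 < M" "\<And>a. norm (lder B c ?u a) \<le> M * norm a"
    using linear_bounded_pos [OF linear_lder [OF B c pS]] by blast
  let ?\<Delta> = "\<lambda>u. \<Sum>b\<in>Basis. norm (lder B c u (proj ?L b) - lder B c ?u (proj ?L b))"
  have openS: "open ?S" by (rule open_image_Int [OF B openin_cdom [OF c]])
  have "isCont ?\<Delta> ?u"
  proof (intro continuous_intros)
    fix b :: 'e
    have "continuous_on ?S (\<lambda>u. lder B c u (proj ?L b))" by (rule lder_props(3) [OF B c proj_props(2) [OF L]])
    then show "isCont (\<lambda>u. lder B c u (proj ?L b)) ?u"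
      using openS pS continuous_on_eq_continuous_at by blast
  qed
  then have "(?\<Delta> \<longlongrightarrow> ?\<Delta> ?u) (at ?u)" by (simp add: isCont_def)
  then have "\<forall>\<^sub>F u in at ?u. ?\<Delta> u < m / 2" using m(1) by (intro order_tendstoD(2)) auto
  then obtain e1 where e1: "0 < e1" "\<And>u. u \<noteq> ?u \<Longrightarrow> dist u ?u < e1 \<Longrightarrow> ?\<Delta> u < m / 2"
    unfolding eventually_at by auto
  have "open (bmap B ` (bdom B \<inter> (cdom c \<inter> N)))" "?u \<in> bmap B ` (bdom B \<inter> (cdom c \<inter> N))"
    using open_image_Int [OF B openin_Int [OF openin_cdom [OF c] N(1)]] p N(2) by auto
  then obtain e2 where e2: "0 < e2" "ball ?u e2 \<subseteq> bmap B ` (bdom B \<inter> (cdom c \<inter> N))"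
    by (meson open_contains_ball)
  define e where "e = min e1 e2"
  have eS: "ball ?u e \<subseteq> bmap B ` (bdom B \<inter> (cdom c \<inter> N))" "ball ?u e \<subseteq> ?S" using e2 by (auto simp: e_def)
  have diff: "norm (lder B c u a - lder B c ?u a) \<le> m / 2 * norm a" if u: "u \<in> ball ?u e" and a: "a \<in> ?L" for u a
  proof -
    have uS: "u \<in> ?S" using u eS by blast
    have "lder B c u a - lder B c ?u a = (\<Sum>b\<in>Basis. (a \<bullet> b) *\<^sub>R (lder B c u (proj ?L b) - lder B c ?u (proj ?L b)))"
      unfolding lder_sum [OF B c uS a] lder_sum [OF B c pS a] by (simp add: sum_subtractf scaleR_diff_right)
    also have "norm \<dots> \<le> (\<Sum>b\<in>Basis. norm a * norm (lder B c u (proj ?L b) - lder B c ?u (proj ?L b)))"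
      by (intro sum_norm_le) (simp add: mult_right_mono Basis_le_norm)
    also have "\<dots> = norm a * ?\<Delta> u" by (simp add: sum_distrib_left)
    also have "\<dots> \<le> norm a * (m / 2)"
    proof (rule mult_left_mono)
      show "?\<Delta> u \<le> m / 2" using e1(2) [of u] u m(1) by (cases "u = ?u") (auto simp: e_def dist_commute less_imp_le)
    qed simp
    finally show ?thesis by (simp add: mult.commute)
  qed
  have low: "m / 2 * norm a \<le> norm (lder B c u a)" and upp: "norm (lder B c u a) \<le> (M + m) * norm a"
    if "u \<in> ball ?u e" "a \<in> ?L" for u a
  proof -
    have "norm (lder B c ?u a) \<le> norm (lder B c u a) + norm (lder B c u a - lder B c ?u a)"
      by (metis norm_minus_commute norm_triangle_sub)
    then show "m / 2 * norm a \<le> norm (lder B c u a)"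
      using diff [OF that] m(2) [OF that(2)] by linarith
    have "norm (lder B c u a) \<le> norm (lder B c ?u a) + norm (lder B c u a - lder B c ?u a)"
      by (rule norm_triangle_sub)
    then have "norm (lder B c u a) \<le> M * norm a + m / 2 * norm a" using diff [OF that] M(2) [of a] by linarith
    also have "\<dots> \<le> (M + m) * norm a" using m(1) by (simp add: algebra_simps)
    finally show "norm (lder B c u a) \<le> (M + m) * norm a" .
  qed
  have seg: "u + t *\<^sub>R a \<in> ball ?u e" if "u \<in> ball ?u e" "u + a \<in> ball ?u e" "t \<in> {0..1}" for u a and t :: real
  proof -
    have "(1 - t) *\<^sub>R u + t *\<^sub>R (u + a) \<in> ball ?u e" using that by (intro convexD_alt) auto
    then show ?thesis by (simp add: algebra_simps)
  qed
  have lip: "norm (cmap c (binv B (u + a)) - cmap c (binv B u)) \<le> (M + m) * norm a"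
    "norm (cmap c (binv B (u + a)) - cmap c (binv B u) - lder B c ?u a) \<le> m / 2 * norm a"
    if u: "u \<in> ball ?u e" and ua: "u + a \<in> ball ?u e" and a: "a \<in> ?L" for u a
  proof -
    let ?h = "\<lambda>t. cmap c (binv B (u + t *\<^sub>R a))"
    have d: "(?h has_vector_derivative lder B c (u + t *\<^sub>R a) a) (at t)" if "t \<in> {0..1}" for t
      using seg [OF u ua that] eS by (intro seg_deriv [OF B c _ a]) blast
    have "norm (?h 1 - ?h 0) \<le> (M + m) * norm a"
      by (rule vector_mvt_bound [OF d]) (use upp seg [OF u ua] a in auto)
    then show "norm (cmap c (binv B (u + a)) - cmap c (binv B u)) \<le> (M + m) * norm a" by simp
    have "norm ((?h 1 - 1 *\<^sub>R lder B c ?u a) - (?h 0 - 0 *\<^sub>R lder B c ?u a)) \<le> m / 2 * norm a"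
    proof (rule vector_mvt_bound)
      show "((\<lambda>t. ?h t - t *\<^sub>R lder B c ?u a) has_vector_derivative lder B c (u + t *\<^sub>R a) a - lder B c ?u a) (at t)"
        if "t \<in> {0..1}" for t
        by (rule has_vector_derivative_diff [OF d [OF that]]) (auto intro!: derivative_eq_intros)
      show "norm (lder B c (u + t *\<^sub>R a) a - lder B c ?u a) \<le> m / 2 * norm a" if "t \<in> {0..1}" for t
        using diff [OF seg [OF u ua that] a] .
    qed
    then show "norm (cmap c (binv B (u + a)) - cmap c (binv B u) - lder B c ?u a) \<le> m / 2 * norm a"
      by (simp add: algebra_simps)
  qed
  show ?thesis
  proof (rule that [OF _ _ _ eS(1)])
    show "0 < e" "0 < m / 2" "0 < M + m" using e1 e2 m M by (auto simp: e_def)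
    fix u a assume u: "u \<in> ball ?u e" and a: "a \<in> ?L"
    show "m / 2 * norm a \<le> norm (lder B c u a)" "norm (lder B c u a) \<le> (M + m) * norm a"
      using low upp u a by auto
    assume ua: "u + a \<in> ball ?u e"
    show "norm (cmap c (binv B (u + a)) - cmap c (binv B u)) \<le> (M + m) * norm a" by (rule lip(1) [OF u ua a])
    have "norm (lder B c ?u a) \<le> norm (cmap c (binv B (u + a)) - cmap c (binv B u))
        + norm (cmap c (binv B (u + a)) - cmap c (binv B u) - lder B c ?u a)"
      by (metis norm_minus_commute norm_triangle_sub)
    then show "m / 2 * norm a \<le> norm (cmap c (binv B (u + a)) - cmap c (binv B u))"
      using lip(2) [OF u ua a] m(2) [OF a] by linarith
  qed
qed

text \<open>The tangent spaces along the plaque through \<open>q\<close> are within \<open>O(d\<^sup>\<beta>)\<close> of the one at \<open>q\<close>, so the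
  plaque leaves its tangent plane only to order \<open>1 + \<beta>\<close>. The constant is uniform in \<open>q\<close>, also
  across plaques, because it comes from the Hoelder constant of the tangent bundle.\<close>

lemma leaf_taylor_local:
  assumes B: "B \<in> \<F>" and c: "c \<in> \<A>" and p: "p \<in> bdom B \<inter> cdom c"
  shows "\<exists>N K. openin (top_of_set X) N \<and> p \<in> N \<and> N \<subseteq> bdom B \<inter> cdom c \<and> 0 \<le> K \<and>
    (\<forall>q\<in>N. \<forall>q'\<in>N. q' \<in> plaque B q \<longrightarrow> (\<exists>v\<in>TB q.
      norm (cmap c q' - cmap c q - tcoord \<A> c q v) \<le> K * norm (cmap c q' - cmap c q) powr (1 + \<beta>)))"
proof -
  obtain N K where N: "openin (top_of_set X) N" "p \<in> N" "N \<subseteq> cdom c"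
      and hol: "\<forall>y\<in>N. \<forall>z\<in>N. \<forall>v\<in>tcoord \<A> c y ` TB y.
           infdist v (tcoord \<A> c z ` TB z) \<le> K * dist (cmap c y) (cmap c z) powr \<beta> * norm v"
    using holder_TB c p unfolding holder_subbundle_def by blast
  obtain e m M where e: "0 < e" "0 < m" "0 < M" "ball (bmap B p) e \<subseteq> bmap B ` (bdom B \<inter> (cdom c \<inter> N))"
    and up: "\<And>u a. u \<in> ball (bmap B p) e \<Longrightarrow> a \<in> bdir B \<Longrightarrow> norm (lder B c u a) \<le> M * norm a"
    and lo: "\<And>u a. u \<in> ball (bmap B p) e \<Longrightarrow> u + a \<in> ball (bmap B p) e \<Longrightarrow> a \<in> bdir B \<Longrightarrow>
      m * norm a \<le> norm (cmap c (binv B (u + a)) - cmap c (binv B u))"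
    and lip: "\<And>u a. u \<in> ball (bmap B p) e \<Longrightarrow> u + a \<in> ball (bmap B p) e \<Longrightarrow> a \<in> bdir B \<Longrightarrow>
      norm (cmap c (binv B (u + a)) - cmap c (binv B u)) \<le> M * norm a"
    using box_bounds [OF B c p N(1,2)] by metis
  let ?b = "ball (bmap B p) e"
  define K' where "K' = max K 0"
  define C where "C = K' * (M / m) powr (1 + \<beta>)"
  have K': "0 \<le> K'" by (simp add: K'_def)
  have bs: "binv B u \<in> bdom B" "binv B u \<in> cdom c" "binv B u \<in> N" "bmap B (binv B u) = u" if "u \<in> ?b" for u
    using that e(4) B by auto
  show ?thesis
  proof (intro exI [of _ "binv B ` ?b"] exI [of _ C] conjI ballI impI)
    show "openin (top_of_set X) (binv B ` ?b)" using e(4) by (intro openin_binv_image [OF B]) auto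
    show "p \<in> binv B ` ?b" using p B e(1) by (intro image_eqI [of _ _ "bmap B p"]) auto
    show "binv B ` ?b \<subseteq> bdom B \<inter> cdom c" using bs by blast
    show "0 \<le> C" using K' by (simp add: C_def)
    fix q q' assume q: "q \<in> binv B ` ?b" and q': "q' \<in> binv B ` ?b" and qq: "q' \<in> plaque B q"
    let ?u = "bmap B q" and ?a = "bmap B q' - bmap B q" and ?d = "cmap c q' - cmap c q"
    have u: "?u \<in> ?b" "?u + ?a \<in> ?b" "q = binv B ?u" "q' = binv B (?u + ?a)" using q q' bs by auto
    have a: "?a \<in> bdir B" using qq by (simp add: plaque_iff)
    have qd: "q \<in> cdom c" "q \<in> X" "q \<in> N" using bs u(1,3) cdom_X [OF c] by metis+
    let ?T = "tcoord \<A> c q ` TB q"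
    have T: "subspace ?T" by (intro linear_subspace_image linear_tcoord c qd subspace_TB)
    let ?h = "\<lambda>x. x - proj ?T x"
    have linh: "linear ?h" by (intro linear_compose_sub linear_ident proj_props [OF T])
    have blh: "bounded_linear ?h" using linh by (simp add: linear_conv_bounded_linear)
    have seg: "?u + t *\<^sub>R ?a \<in> ?b" if "t \<in> {0..1}" for t
    proof -
      have "(1 - t) *\<^sub>R ?u + t *\<^sub>R (?u + ?a) \<in> ?b" using that u by (intro convexD_alt) auto
      then show ?thesis by (simp add: algebra_simps)
    qed
    let ?g = "\<lambda>t. cmap c (binv B (?u + t *\<^sub>R ?a))" and ?w = "\<lambda>t. lder B c (?u + t *\<^sub>R ?a) ?a"
    have d: "(?g has_vector_derivative ?w t) (at t)" if "t \<in> {0..1}" for t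
      using seg [OF that] e(4) by (intro seg_deriv [OF B c _ a]) blast
    have "norm (?h (?g 1) - ?h (?g 0)) \<le> K' * (M * norm ?a) powr \<beta> * (M * norm ?a)"
    proof (rule vector_mvt_bound)
      fix t :: real assume t: "t \<in> {0..1}"
      show "((\<lambda>t. ?h (?g t)) has_vector_derivative ?h (?w t)) (at t)"
        by (rule bounded_linear.has_vector_derivative [OF blh d [OF t]])
      let ?x = "binv B (?u + t *\<^sub>R ?a)"
      have x: "?x \<in> N" "?x \<in> bdom B \<inter> cdom c" "bmap B ?x = ?u + t *\<^sub>R ?a" using bs [OF seg [OF t]] by auto
      have "?w t \<in> tcoord \<A> c ?x ` TB ?x" unfolding TB_coord [OF B c x(2)] x(3) using a by blast
      then have "infdist (?w t) ?T \<le> K * dist (cmap c ?x) (cmap c q) powr \<beta> * norm (?w t)"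
        using hol x(1) qd(3) by blast
      also have "\<dots> \<le> K' * dist (cmap c ?x) (cmap c q) powr \<beta> * norm (?w t)"
        by (intro mult_right_mono) (auto simp: K'_def)
      also have "\<dots> \<le> K' * (M * norm ?a) powr \<beta> * (M * norm ?a)"
      proof (intro mult_mono mult_left_mono powr_mono2 K' mult_nonneg_nonneg)
        have "t *\<^sub>R ?a \<in> bdir B" using a subspace_bdir [OF B] by (simp add: subspace_scale)
        then have "norm (cmap c ?x - cmap c q) \<le> M * norm (t *\<^sub>R ?a)" using lip [OF u(1) seg [OF t]] u(3) by simp
        also have "\<dots> \<le> M * norm ?a" using t e(3) by (intro mult_left_mono) (auto intro: mult_left_le_one_le)
        finally show "dist (cmap c ?x) (cmap c q) \<le> M * norm ?a" by (simp add: dist_norm)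
        show "norm (?w t) \<le> M * norm ?a" by (rule up [OF seg [OF t] a])
      qed (use \<beta> in auto)
      finally show "norm (?h (?w t)) \<le> K' * (M * norm ?a) powr \<beta> * (M * norm ?a)"
        by (simp add: infdist_subspace [OF T])
    qed
    also have "\<dots> = K' * (M * norm ?a) powr (1 + \<beta>)" using e(3) by (simp add: powr_mult_base [symmetric] mult_ac)
    also have "\<dots> \<le> K' * (M / m * norm ?d) powr (1 + \<beta>)"
    proof (intro mult_left_mono powr_mono2 K')
      have "M * (m * norm ?a) \<le> M * norm ?d" using lo [OF u(1,2) a] u(3,4) e(3) by simp
      then show "M * norm ?a \<le> M / m * norm ?d" using e(2) by (simp add: field_simps)
    qed (use \<beta> e(3) in auto)
    also have "\<dots> = C * norm ?d powr (1 + \<beta>)"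
      using powr_mult [of "M / m" "norm ?d" "1 + \<beta>"] e by (simp add: C_def)
    finally have "norm (?h (?g 1) - ?h (?g 0)) \<le> C * norm ?d powr (1 + \<beta>)" .
    moreover have "?h (?g 1) - ?h (?g 0) = ?h ?d" using linear_diff [OF linh] u(3,4) by simp
    ultimately have le: "norm (?d - proj ?T ?d) \<le> C * norm ?d powr (1 + \<beta>)" by simp
    obtain v where "v \<in> TB q" "proj ?T ?d = tcoord \<A> c q v" using proj_props(2) [OF T, of ?d] by blast
    then show "\<exists>v\<in>TB q. norm (?d - tcoord \<A> c q v) \<le> C * norm ?d powr (1 + \<beta>)" using le by (intro bexI [of _ v]) auto
  qed
qed

text \<open>A continuous metric has positive bounds, above and below, on the unit vectors in box coordinates
  over a closed ball, as these form a compact set.\<close>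

lemma metric_local:
  assumes g: "continuous_metric X \<A> TB g" and c: "c \<in> \<A>" "p \<in> cdom c"
  shows "\<exists>N K. openin (top_of_set X) N \<and> p \<in> N \<and> N \<subseteq> cdom c \<and> 0 \<le> K \<and>
    (\<forall>q\<in>N. \<forall>v\<in>TB q. norm (tcoord \<A> c q v) \<le> K * metric_norm g q v \<and>
      metric_norm g q v \<le> K * norm (tcoord \<A> c q v))"
proof -
  have pX: "p \<in> X" using cdom_X c by blast
  obtain B where B: "B \<in> \<F>" "p \<in> bdom B" using cover pX by blast
  let ?L = "bdir B"
  have L: "subspace ?L" by (rule subspace_bdir [OF B(1)])
  obtain e m M where e: "0 < e" "0 < m" "0 < M" "ball (bmap B p) e \<subseteq> bmap B ` (bdom B \<inter> (cdom c \<inter> X))"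
    and lo: "\<And>u a. u \<in> ball (bmap B p) e \<Longrightarrow> a \<in> bdir B \<Longrightarrow> m * norm a \<le> norm (lder B c u a)"
    and up: "\<And>u a. u \<in> ball (bmap B p) e \<Longrightarrow> a \<in> bdir B \<Longrightarrow> norm (lder B c u a) \<le> M * norm a"
    using box_bounds [OF B(1) c(1) _ openin_subtopology_self pX] B(2) c(2) by (metis IntI)
  define Q where "Q = cball (bmap B p) (e / 2) \<times> (sphere 0 1 \<inter> ?L)"
  have "compact Q" unfolding Q_def using closed_subspace [OF L] by (intro compact_Times compact_Int_closed) auto
  have QS: "u \<in> bmap B ` (bdom B \<inter> cdom c)" "u \<in> ball (bmap B p) e" if "u \<in> cball (bmap B p) (e / 2)" for u
  proof -
    show "u \<in> ball (bmap B p) e" using that e(1) by auto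
    then have "u \<in> bmap B ` (bdom B \<inter> (cdom c \<inter> X))" using e(4) by (rule subsetD [rotated])
    then show "u \<in> bmap B ` (bdom B \<inter> cdom c)" by auto
  qed
  have bs: "binv B u \<in> bdom B \<inter> cdom c" "bmap B (binv B u) = u" if "u \<in> cball (bmap B p) (e / 2)" for u
    using QS(1) [OF that] B(1) by auto
  let ?D = "\<lambda>(u, a). (binv B u, lder B c u a, lder B c u a)"
  let ?G = "\<lambda>(x, v, w). g x (inv (tcoord \<A> c x) v) (inv (tcoord \<A> c x) w)"
  have contD: "continuous_on Q (\<lambda>(u, a). lder B c u a)"
  proof -
    have "continuous_on Q (\<lambda>z. \<Sum>b\<in>Basis. (snd z \<bullet> b) *\<^sub>R lder B c (fst z) (proj ?L b))"
    proof (intro continuous_intros)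
      fix b :: 'e
      show "continuous_on Q (\<lambda>z. lder B c (fst z) (proj ?L b))"
        by (rule continuous_on_compose2 [OF lder_props(3) [OF B(1) c(1) proj_props(2) [OF L]] continuous_on_fst])
          (use QS(1) in \<open>auto simp: Q_def intro: continuous_on_id\<close>)
    qed
    then show ?thesis
      by (rule continuous_on_eq) (use QS(1) lder_sum [OF B(1) c(1)] in \<open>auto simp: Q_def\<close>)
  qed
  have contB: "continuous_on Q (\<lambda>z. binv B (fst z))"
  proof -
    have "continuous_on Q fst" by (intro continuous_intros)
    moreover have "fst ` Q \<subseteq> bmap B ` bdom B" using QS(1) unfolding Q_def by fastforce
    ultimately show ?thesis by (rule continuous_on_compose2 [OF homeomorphism_cont2 [OF hom [OF B(1)]]])
  qed
  have TBu: "lder B c u a \<in> tcoord \<A> c (binv B u) ` TB (binv B u)" if "u \<in> cball (bmap B p) (e / 2)" "a \<in> ?L" for u a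
    using TB_coord [OF B(1) c(1) bs(1) [OF that(1)]] bs(2) [OF that(1)] that(2) by auto
  have contG: "continuous_on Q (\<lambda>z. ?G (?D z))"
  proof -
    have 1: "continuous_on {(x, v, w). x \<in> cdom c \<and> v \<in> tcoord \<A> c x ` TB x \<and> w \<in> tcoord \<A> c x ` TB x} ?G"
      using g c unfolding continuous_metric_def by blast
    have 2: "continuous_on Q ?D"
      using continuous_on_Pair [OF contB continuous_on_Pair [OF contD contD]] by (simp add: split_def)
    have 3: "?D ` Q \<subseteq> {(x, v, w). x \<in> cdom c \<and> v \<in> tcoord \<A> c x ` TB x \<and> w \<in> tcoord \<A> c x ` TB x}"
      using bs TBu by (auto simp: Q_def)
    show ?thesis by (rule continuous_on_compose2 [OF 1 2 3])
  qed
  have ip: "inner_product_on (TB q) (g q)" if "q \<in> X" for q using g that by (simp add: continuous_metric_def)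
  have Gval: "?G (?D (bmap B q, a)) = g q v v"
    if "q \<in> cdom c" "q \<in> bdom B" "tcoord \<A> c q v = lder B c (bmap B q) a" for q a v
    using that c B(1) by (simp flip: that(3))
  have pos: "0 < ?G (?D z)" if zQ: "z \<in> Q" for z
  proof -
    obtain u a where z: "z = (u, a)" "u \<in> cball (bmap B p) (e / 2)" "a \<in> ?L" "norm a = 1"
      using zQ by (auto simp: Q_def)
    obtain v where v: "v \<in> TB (binv B u)" "lder B c u a = tcoord \<A> c (binv B u) v" using TBu [OF z(2,3)] by blast
    have x: "binv B u \<in> cdom c" "binv B u \<in> bdom B" "binv B u \<in> X" using bs(1) [OF z(2)] cdom_X [OF c(1)] by auto
    have "m * 1 \<le> norm (lder B c u a)" using lo [OF QS(2) [OF z(2)] z(3)] z(4) by simp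
    then have "v \<noteq> 0" using v(2) e(2) linear_0 [OF linear_tcoord [OF c(1) x(1)]] by auto
    then have "0 < g (binv B u) v v" using ip [OF x(3)] v(1) by (simp add: inner_product_on_def)
    then show ?thesis using Gval [OF x(1,2), of v a] v(2) bs(2) [OF z(2)] z(1) by simp
  qed
  obtain c1 c2 where c12: "0 < c1" "0 < c2" "\<And>z. z \<in> Q \<Longrightarrow> c1 \<le> ?G (?D z) \<and> ?G (?D z) \<le> c2"
  proof (cases "Q = {}")
    case True
    then show ?thesis using that [of 1 1] by auto
  next
    case False
    obtain z1 where z1: "z1 \<in> Q" "\<And>z. z \<in> Q \<Longrightarrow> ?G (?D z1) \<le> ?G (?D z)"
      using continuous_attains_inf [OF \<open>compact Q\<close> False contG] by blast
    obtain z2 where z2: "z2 \<in> Q" "\<And>z. z \<in> Q \<Longrightarrow> ?G (?D z) \<le> ?G (?D z2)"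
      using continuous_attains_sup [OF \<open>compact Q\<close> False contG] by blast
    show ?thesis using that [OF pos [OF z1(1)] pos [OF z2(1)]] z1(2) z2(2) by blast
  qed
  define N where "N = binv B ` ball (bmap B p) (e / 2)"
  have est: "sqrt c1 * norm a \<le> metric_norm g q v \<and> metric_norm g q v \<le> sqrt c2 * norm a \<and>
      m * norm a \<le> norm (tcoord \<A> c q v) \<and> norm (tcoord \<A> c q v) \<le> M * norm a"
    if q: "q \<in> bdom B \<inter> cdom c" "bmap B q \<in> cball (bmap B p) (e / 2)" and v: "v \<in> TB q"
      and a: "a \<in> ?L" "tcoord \<A> c q v = lder B c (bmap B q) a" for q v a
  proof -
    have qX: "q \<in> X" using q cdom_X c by blast
    have lin: "g q (r *\<^sub>R s + t *\<^sub>R w) x = r * g q s x + t * g q w x" and sym: "g q s w = g q w s"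
      if "s \<in> TB q" "w \<in> TB q" "x \<in> TB q" for s w x r t
      using ip [OF qX] that unfolding inner_product_on_def by blast+
    have sc: "g q (r *\<^sub>R w) (r *\<^sub>R w) = r\<^sup>2 * g q w w" if w: "w \<in> TB q" for r w
    proof -
      have rw: "r *\<^sub>R w \<in> TB q" using w subspace_TB [OF qX] by (simp add: subspace_scale)
      have "g q (r *\<^sub>R w) (r *\<^sub>R w) = r * g q w (r *\<^sub>R w)" using lin [OF w w rw, of r 0] by simp
      also have "g q w (r *\<^sub>R w) = g q (r *\<^sub>R w) w" by (rule sym [OF w rw w])
      also have "\<dots> = r * g q w w" using lin [OF w w w, of r 0] by simp
      finally show ?thesis by (simp add: power2_eq_square)
    qed
    have "sqrt c1 * norm a \<le> sqrt (g q v v) \<and> sqrt (g q v v) \<le> sqrt c2 * norm a"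
    proof (cases "a = 0")
      case True
      have "tcoord \<A> c q v = tcoord \<A> c q 0"
        using a(2) True linear_0 [OF linear_lder [OF B(1) c(1)]] linear_0 [OF linear_tcoord [OF c(1)]] q by simp
      then have "v = 0" using inj_tcoord [OF c(1)] q by (auto dest: injD)
      then have "g q v v = 0" using sc [OF v, of 0] by simp
      then show ?thesis using True by simp
    next
      case False
      define a1 where "a1 = a /\<^sub>R norm a"
      define v1 where "v1 = v /\<^sub>R norm a"
      have a1: "a1 \<in> ?L" "norm a1 = 1" using False a(1) L by (auto simp: a1_def subspace_scale)
      have v1: "v1 \<in> TB q" using v subspace_TB [OF qX] by (simp add: v1_def subspace_scale)
      have "bmap B q \<in> bmap B ` (bdom B \<inter> cdom c)" using q by blast
      then have "tcoord \<A> c q v1 = lder B c (bmap B q) a1"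
        unfolding v1_def a1_def using a(2) q
        by (simp add: linear_scale [OF linear_tcoord [OF c(1)]] linear_scale [OF linear_lder [OF B(1) c(1)]])
      then have "c1 \<le> g q v1 v1" "g q v1 v1 \<le> c2"
        using Gval [of q v1 a1] c12(3) [of "(bmap B q, a1)"] q a1 by (auto simp: Q_def)
      moreover have "v = norm a *\<^sub>R v1" using False by (simp add: v1_def)
      then have "g q v v = (norm a)\<^sup>2 * g q v1 v1" using sc [OF v1] by simp
      ultimately show ?thesis by (auto simp: real_sqrt_mult mult.commute [of "norm a"] intro: mult_right_mono)
    qed
    then show ?thesis using lo [OF QS(2) [OF q(2)] a(1)] up [OF QS(2) [OF q(2)] a(1)] a(2) by (simp add: metric_norm_def)
  qed
  define K where "K = M / sqrt c1 + sqrt c2 / m"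
  show ?thesis
  proof (intro exI [of _ N] exI [of _ K] conjI ballI)
    show "openin (top_of_set X) N" 
    proof -
      have "ball (bmap B p) (e / 2) \<subseteq> bmap B ` bdom B"
      proof
        fix u assume "u \<in> ball (bmap B p) (e / 2)"
        then have "u \<in> cball (bmap B p) (e / 2)" by auto
        from QS(1) [OF this] show "u \<in> bmap B ` bdom B" by blast
      qed
      then show ?thesis unfolding N_def by (intro openin_binv_image [OF B(1)]) auto
    qed
    show "p \<in> N" unfolding N_def using B e(1) by (intro image_eqI [of _ _ "bmap B p"]) auto
    have Nb: "q \<in> bdom B \<inter> cdom c \<and> bmap B q \<in> cball (bmap B p) (e / 2)" if qN: "q \<in> N" for q
    proof -
      obtain u where "u \<in> ball (bmap B p) (e / 2)" "q = binv B u" using qN by (auto simp: N_def)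
      then show ?thesis using bs [of u] by auto
    qed
    then show "N \<subseteq> cdom c" by blast
    show "0 \<le> K" using e c12 by (simp add: K_def)
    fix q v assume "q \<in> N" and v: "v \<in> TB q"
    then have q: "q \<in> bdom B \<inter> cdom c" "bmap B q \<in> cball (bmap B p) (e / 2)" using Nb by auto
    have "tcoord \<A> c q v \<in> lder B c (bmap B q) ` ?L" using TB_coord [OF B(1) c(1) q(1)] v by blast
    then obtain a where a: "a \<in> ?L" "tcoord \<A> c q v = lder B c (bmap B q) a" by blast
    note E = est [OF q v a]
    have s: "0 < sqrt c1" "0 < sqrt c2" using c12 by auto
    have mn: "0 \<le> metric_norm g q v" using E mult_nonneg_nonneg [OF less_imp_le [OF s(1)] norm_ge_zero [of a]] by linarith
    have "norm (tcoord \<A> c q v) \<le> M / sqrt c1 * (sqrt c1 * norm a)" using E s by simp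
    also have "\<dots> \<le> M / sqrt c1 * metric_norm g q v" using E s e by (intro mult_left_mono) auto
    also have "\<dots> \<le> K * metric_norm g q v" using s e mn by (intro mult_right_mono) (auto simp: K_def)
    finally show "norm (tcoord \<A> c q v) \<le> K * metric_norm g q v" .
    have "metric_norm g q v \<le> sqrt c2 / m * (m * norm a)" using E e by simp
    also have "\<dots> \<le> sqrt c2 / m * norm (tcoord \<A> c q v)" using E s e by (intro mult_left_mono) auto
    also have "\<dots> \<le> K * norm (tcoord \<A> c q v)" using s e by (intro mult_right_mono) (auto simp: K_def)
    finally show "metric_norm g q v \<le> K * norm (tcoord \<A> c q v)" .
  qed
qed

text \<open>The triangle inequality, from the Cauchy--Schwarz inequality of an inner product on a subspace.\<close>

lemma metric_norm_triangle:
  assumes g: "continuous_metric X \<A> TB g" and p: "p \<in> X" and uv: "u \<in> TB p" "v \<in> TB p"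
  shows "metric_norm g p (u + v) \<le> metric_norm g p u + metric_norm g p v"
    "metric_norm g p (c *\<^sub>R v) = \<bar>c\<bar> * metric_norm g p v"
proof -
  have ip: "inner_product_on (TB p) (g p)" using g p by (simp add: continuous_metric_def)
  have S: "subspace (TB p)" by (rule subspace_TB [OF p])
  let ?g = "g p"
  have lin: "?g (r *\<^sub>R s + t *\<^sub>R w) x = r * ?g s x + t * ?g w x" and sym: "?g s w = ?g w s"
    if "s \<in> TB p" "w \<in> TB p" "x \<in> TB p" for s w x r t
    using ip that unfolding inner_product_on_def by blast+
  have quad: "?g (r *\<^sub>R u + t *\<^sub>R v) (r *\<^sub>R u + t *\<^sub>R v) = r\<^sup>2 * ?g u u + 2 * r * t * ?g u v + t\<^sup>2 * ?g v v" for r t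
  proof -
    let ?w = "r *\<^sub>R u + t *\<^sub>R v"
    have w: "?w \<in> TB p" using uv S by (simp add: subspace_add subspace_scale)
    have "?g ?w ?w = r * ?g u ?w + t * ?g v ?w" by (rule lin [OF uv w])
    also have "?g u ?w = r * ?g u u + t * ?g v u" unfolding sym [OF uv(1) w uv(1)] by (rule lin [OF uv uv(1)])
    also have "?g v ?w = r * ?g u v + t * ?g v v" unfolding sym [OF uv(2) w uv(1)] by (rule lin [OF uv uv(2)])
    also have "?g v u = ?g u v" by (rule sym [OF uv(2,1,1)])
    finally show ?thesis by (simp add: algebra_simps power2_eq_square)
  qed
  have nn: "0 \<le> ?g w w" if "w \<in> TB p" for w
  proof (cases "w = 0")
    case True
    then show ?thesis using lin [OF that that that, of 0 0] by simp
  next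
    case False
    then show ?thesis using ip that by (simp add: inner_product_on_def less_imp_le)
  qed
  have cs: "(?g u v)\<^sup>2 \<le> ?g u u * ?g v v"
  proof (cases "v = 0")
    case True
    have "?g v u = 0" using True lin [OF uv(2) uv(2) uv(1), of 0 0] by simp
    then show ?thesis using sym [OF uv uv(1)] nn [OF uv(1)] nn [OF uv(2)] by simp
  next
    case False
    then have pos: "0 < ?g v v" using ip uv by (simp add: inner_product_on_def)
    have "0 \<le> ?g (?g v v *\<^sub>R u + (- ?g u v) *\<^sub>R v) (?g v v *\<^sub>R u + (- ?g u v) *\<^sub>R v)"
      using uv S by (intro nn) (simp add: subspace_add subspace_scale subspace_neg subspace_diff)
    also have "\<dots> = ?g v v * (?g u u * ?g v v - (?g u v)\<^sup>2)"
      unfolding quad by (simp add: algebra_simps power2_eq_square)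
    finally show ?thesis using pos by (simp add: zero_le_mult_iff)
  qed
  have "?g (u + v) (u + v) = ?g u u + 2 * ?g u v + ?g v v" using quad [of 1 1] by simp
  also have "\<dots> \<le> ?g u u + 2 * (sqrt (?g u u) * sqrt (?g v v)) + ?g v v"
    using real_le_rsqrt [OF cs] by (simp add: real_sqrt_mult)
  also have "\<dots> = (sqrt (?g u u) + sqrt (?g v v))\<^sup>2" using nn uv by (simp add: power2_sum)
  finally show "metric_norm g p (u + v) \<le> metric_norm g p u + metric_norm g p v"
    unfolding metric_norm_def using nn uv by (intro real_le_lsqrt) auto
  show "metric_norm g p (c *\<^sub>R v) = \<bar>c\<bar> * metric_norm g p v"
    using quad [of 0 c] by (simp add: metric_norm_def real_sqrt_mult)
qed

end

text \<open>Along the leaves the map \<open>f\<close> respects plaques, so its derivative respects their tangent spaces,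
  by \<open>tangent_curve\<close>.\<close>

locale leaf_dynamics = holder_map X \<A> \<beta> f + leaf_structure X \<A> k \<F> \<beta>
  for X :: "'a::t2_space set" and \<A> :: "('a, 'e::euclidean_space) chart set" and \<beta> f k
    and \<F> :: "('a, 'e) fbox set" +
  assumes leaf_invariant: "p \<in> X \<Longrightarrow> f ` leaf \<F> p \<subseteq> leaf \<F> (f p)"
begin

lemma plaque_f_local:
  assumes "B \<in> \<F>" "p \<in> bdom B" "B' \<in> \<F>" "f p \<in> bdom B'"
  obtains N where "openin (top_of_set X) N" "p \<in> N" "N \<subseteq> bdom B" "f ` N \<subseteq> bdom B'"
    "\<And>q r. q \<in> N \<Longrightarrow> r \<in> N \<Longrightarrow> r \<in> plaque B q \<Longrightarrow> f r \<in> plaque B' (f q)"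
  using plaque_image_local [OF compact_X f_cont _ leaf_invariant assms] f_X by blast

lemma mderiv_TB:
  assumes p: "p \<in> X" and v: "v \<in> TB p"
  shows "mderiv \<A> f p v \<in> TB (f p)"
proof -
  obtain B a where B: "B \<in> \<F>" "p \<in> bdom B" "a \<in> bdir B" and va: "v = leaf_tangent \<A> B p a"
    using v by (auto simp: tangent_bundle_def)
  obtain B' where B': "B' \<in> \<F>" "f p \<in> bdom B'" using cover [OF f_X [OF p]] by blast
  let ?c = "chart_at \<A> p" and ?c' = "chart_at \<A> (f p)"
  note c = chart_at [OF p] and c' = chart_at [OF f_X [OF p]]
  obtain N where N: "openin (top_of_set X) N" "p \<in> N" "N \<subseteq> bdom B" "f ` N \<subseteq> bdom B'"
    "\<And>q r. q \<in> N \<Longrightarrow> r \<in> N \<Longrightarrow> r \<in> plaque B q \<Longrightarrow> f r \<in> plaque B' (f q)"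
    using plaque_f_local [OF B(1,2) B'] by blast
  let ?h = "\<lambda>t. binv B (bmap B p + t *\<^sub>R a)"
  have h0: "?h 0 = p" using B by simp
  have ev: "\<forall>\<^sub>F t in at 0. ?h t \<in> N \<inter> plaque B p" by (rule eventually_ray [OF B N(1,2)])
  have evc: "\<forall>\<^sub>F t in at 0. ?h t \<in> cdom ?c"
    using eventually_ray [OF B openin_cdom [OF c(1)] c(2)] by eventually_elim simp
  have "\<forall>\<^sub>F t in at 0. ?h t \<in> (X \<inter> f -` cdom ?c') \<inter> plaque B p"
    by (rule eventually_ray [OF B openin_f_preimage [OF openin_cdom [OF c'(1)]]]) (use c' p in simp)
  with ev have "\<forall>\<^sub>F t in at 0. f (?h t) \<in> plaque B' (f p) \<inter> cdom ?c'"
  proof eventually_elim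
    case (elim t)
    then show ?case using N(5) [OF N(2), of "?h t"] by blast
  qed
  moreover have "((\<lambda>t. cmap ?c (?h t)) has_derivative (\<lambda>x. x *\<^sub>R lder B ?c (bmap B p) a)) (at 0)"
    using seg_deriv [OF B(1) c(1), of "bmap B p" 0 a] B c by (auto simp: has_vector_derivative_def)
  from derivative_f [OF c c' h0 UNIV_I this evc]
  have "((\<lambda>t. cmap ?c' (f (?h t))) has_vector_derivative fder ?c ?c' p (lder B ?c (bmap B p) a)) (at 0)"
    using linear_scale [OF linear_fder [OF c c']] by (simp add: has_vector_derivative_def)
  ultimately have "fder ?c ?c' p (lder B ?c (bmap B p) a) \<in> lder B' ?c' (bmap B' (f p)) ` bdir B'"
    using B' c' h0 by (intro tangent_curve [where h = "\<lambda>t. f (?h t)"]) auto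
  moreover have "fder ?c ?c' p (lder B ?c (bmap B p) a) = tcoord \<A> ?c' (f p) (mderiv \<A> f p v)"
    using leaf_tangent_coord [OF B(1) c(1) _ B(3), of p] fder_tcoord [OF c c', of v] B c va by simp
  ultimately have "tcoord \<A> ?c' (f p) (mderiv \<A> f p v) \<in> tcoord \<A> ?c' (f p) ` TB (f p)"
    using TB_coord [OF B'(1) c'(1)] B' c' by simp
  then show ?thesis using inj_tcoord [OF c'] by (auto dest: injD)
qed

lemma mderiv_onto:
  assumes p: "p \<in> X" and inj: "\<And>v. v \<in> TB p \<Longrightarrow> mderiv \<A> f p v = 0 \<Longrightarrow> v = 0"
  shows "TB (f p) \<subseteq> mderiv \<A> f p ` TB p"
proof -
  let ?A = "mderiv \<A> f p"
  have lin: "linear ?A" by (rule linear_mderiv [OF p])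
  have S: "subspace (TB p)" by (rule subspace_TB [OF p])
  have "inj_on ?A (span (TB p))"
    using S linear_injective_on_subspace_0 [OF lin, of "TB p"] inj by (simp add: span_eq_iff [THEN iffD2])
  then have "dim (?A ` TB p) = dim (TB (f p))"
    using dim_image_eq [OF lin] dim_TB p f_X by simp
  moreover have "?A ` TB p \<subseteq> TB (f p)" using mderiv_TB [OF p] by blast
  ultimately have "?A ` TB p = TB (f p)"
    by (intro subspace_dim_equal linear_subspace_image lin S subspace_TB f_X p) auto
  then show ?thesis by simp
qed

end

section \<open>Uniform constants\<close>

text \<open>A Lebesgue number argument: a property of pairs of points that holds near each point of the
  diagonal with some constant holds for all pairs of distance less than \<open>r\<close>, with one constant.\<close>

lemma (in manifold) uniform_over_compact:
  assumes c: "c \<in> \<A>" and C: "C \<subseteq> cdom c" "compact (cmap c ` C)"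
    and loc: "\<And>p. p \<in> C \<Longrightarrow> \<exists>N K. openin (top_of_set X) N \<and> p \<in> N \<and> (\<forall>q\<in>N. \<forall>q'\<in>N. Q q q' K)"
    and mono: "\<And>q q' K K'. q \<in> C \<Longrightarrow> K \<le> K' \<Longrightarrow> Q q q' K \<Longrightarrow> Q q q' K'"
  shows "\<exists>r>0. \<exists>K\<ge>1. \<forall>q\<in>C. \<forall>q'\<in>cdom c. norm (cmap c q' - cmap c q) < r \<longrightarrow> Q q q' (K::real)"
proof -
  from loc obtain N Kf where N: "\<And>p. p \<in> C \<Longrightarrow> openin (top_of_set X) (N p)" "\<And>p. p \<in> C \<Longrightarrow> p \<in> N p"
      "\<And>p q q'. p \<in> C \<Longrightarrow> q \<in> N p \<Longrightarrow> q' \<in> N p \<Longrightarrow> Q q q' (Kf p)"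
    by metis
  let ?O = "\<lambda>p. cmap c ` (cdom c \<inter> N p)"
  have op: "open (?O p)" if "p \<in> C" for p using open_cmap_Int [OF c N(1) [OF that]] .
  have "cmap c ` C \<subseteq> (\<Union>p\<in>C. ?O p)" using N(2) C(1) by blast
  then obtain F where F: "F \<subseteq> C" "finite F" "cmap c ` C \<subseteq> (\<Union>p\<in>F. ?O p)"
    using compactE_image [OF C(2), of C ?O] op by metis
  obtain e where e: "0 < e" "\<And>x. x \<in> cmap c ` C \<Longrightarrow> \<exists>G\<in>?O ` F. ball x e \<subseteq> G"
    using Heine_Borel_lemma [OF C(2), of "?O ` F"] F(3) op F(1) by blast
  define K where "K = Max (insert 1 (Kf ` F))"
  have K: "1 \<le> K" "\<And>p. p \<in> F \<Longrightarrow> Kf p \<le> K" using F(2) by (auto simp: K_def)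
  have "Q q q' K" if q: "q \<in> C" "q' \<in> cdom c" "norm (cmap c q' - cmap c q) < e" for q q'
  proof -
    obtain p where p: "p \<in> F" "ball (cmap c q) e \<subseteq> ?O p" using e(2) q(1) by blast
    have mem: "s \<in> N p" if "s \<in> cdom c" "norm (cmap c s - cmap c q) < e" for s
    proof -
      have "cmap c s \<in> ball (cmap c q) e" using that(2) by (simp add: dist_norm norm_minus_commute)
      then obtain s' where "s' \<in> cdom c" "s' \<in> N p" "cmap c s = cmap c s'" using p(2) by blast
      then show ?thesis using cmap_inj [OF c that(1), of s'] by simp
    qed
    have "q \<in> N p" "q' \<in> N p" using mem [of q] mem [of q'] e(1) q C(1) by auto
    then have "Q q q' (Kf p)" using N(3) p(1) F(1) by blast
    then show ?thesis using mono [OF q(1) K(2) [OF p(1)]] by blast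
  qed
  then show ?thesis using e(1) K(1) by blast
qed

lemma uniform_over_finite:
  fixes Q :: "'s \<Rightarrow> real \<Rightarrow> real \<Rightarrow> bool"
  assumes "finite S" and ex: "\<And>s. s \<in> S \<Longrightarrow> \<exists>r>0. \<exists>K\<ge>1. Q s r K"
    and mono: "\<And>s r r' K K'. s \<in> S \<Longrightarrow> Q s r K \<Longrightarrow> r' \<le> r \<Longrightarrow> K \<le> K' \<Longrightarrow> Q s r' K'"
  shows "\<exists>r>0. \<exists>K\<ge>1. \<forall>s\<in>S. Q s r K"
proof -
  from ex obtain r K where rK: "\<And>s. s \<in> S \<Longrightarrow> 0 < r s \<and> 1 \<le> K s \<and> Q s (r s) (K s)" by metis
  let ?r = "Min (insert 1 (r ` S))" and ?K = "Max (insert 1 (K ` S))"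
  have "0 < ?r" "1 \<le> ?K" using assms(1) rK by (auto simp: Min_gr_iff)
  moreover have "Q s ?r ?K" if "s \<in> S" for s
    using mono [OF that, of "r s" "K s" ?r ?K] rK [OF that] that assms(1) by simp
  ultimately show ?thesis by blast
qed

text \<open>The bunching condition is strict and continuous in the rates, so it survives a small loss. The
  form of the condition on \<open>\<gamma>'\<close> is the one in which \<open>expansion\<close> uses it.\<close>

lemma bunching_slack:
  fixes \<nu> \<gamma> g \<beta> :: real
  assumes "0 < \<beta>" "0 < \<nu>" "\<nu> < 1" "0 < \<gamma>" "\<gamma> < 1" "0 \<le> g" "g * \<gamma> * \<nu> powr (\<beta> / (1 + \<beta>)) < 1"
  obtains \<kappa> \<gamma>' where "0 < \<kappa>" "\<nu> + \<kappa> < 1" "\<gamma> \<le> \<gamma>' * (1 - \<gamma> * \<kappa>)" "\<gamma> \<le> \<gamma>'" "\<gamma>' < 1"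
    "(g + \<kappa>) * \<gamma>' * (\<nu> + \<kappa>) powr (\<beta> / (1 + \<beta>)) < 1"
proof -
  let ?b = "\<beta> / (1 + \<beta>)" and ?F = "at_right (0::real)"
  have id: "((\<lambda>k. k) \<longlongrightarrow> 0) ?F" by (rule tendsto_ident_at)
  have den: "((\<lambda>k. \<gamma> / (1 - \<gamma> * k)) \<longlongrightarrow> \<gamma> / (1 - \<gamma> * 0)) ?F" by (intro tendsto_intros id) simp
  have nu: "((\<lambda>k. \<nu> + k) \<longlongrightarrow> \<nu> + 0) ?F" by (intro tendsto_intros id)
  have "((\<lambda>k. (g + k) * (\<gamma> / (1 - \<gamma> * k)) * (\<nu> + k) powr ?b) \<longlongrightarrow>
      (g + 0) * (\<gamma> / (1 - \<gamma> * 0)) * (\<nu> + 0) powr ?b) ?F"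
    by (intro tendsto_mult tendsto_add tendsto_powr tendsto_const den id) (use assms in auto)
  then have "\<forall>\<^sub>F k in ?F. (g + k) * (\<gamma> / (1 - \<gamma> * k)) * (\<nu> + k) powr ?b < 1"
    by (rule order_tendstoD(2)) (use assms in simp)
  moreover have "\<forall>\<^sub>F k in ?F. \<gamma> / (1 - \<gamma> * k) < 1" using order_tendstoD(2) [OF den, of 1] assms by simp
  moreover have "\<forall>\<^sub>F k in ?F. \<nu> + k < 1" using order_tendstoD(2) [OF nu, of 1] assms by simp
  moreover have "\<forall>\<^sub>F k in ?F. k < 1" using order_tendstoD(2) [OF id, of 1] by simp
  moreover have "\<forall>\<^sub>F k in ?F. 0 < k" by (simp add: eventually_at_right_less)
  ultimately have "\<forall>\<^sub>F k in ?F. 0 < k \<and> k < 1 \<and> \<nu> + k < 1 \<and> \<gamma> / (1 - \<gamma> * k) < 1 \<and>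
      (g + k) * (\<gamma> / (1 - \<gamma> * k)) * (\<nu> + k) powr ?b < 1"
    by eventually_elim simp
  then obtain k where k: "0 < k" "k < 1" "\<nu> + k < 1" "\<gamma> / (1 - \<gamma> * k) < 1"
      "(g + k) * (\<gamma> / (1 - \<gamma> * k)) * (\<nu> + k) powr ?b < 1"
    using eventually_happens' [OF trivial_limit_at_right_real] by blast
  have "\<gamma> * k < 1 * 1" using assms k by (intro mult_strict_mono) auto
  then have pos: "0 < 1 - \<gamma> * k" by simp
  show ?thesis
  proof (rule that [of k "\<gamma> / (1 - \<gamma> * k)"])
    show "\<gamma> \<le> \<gamma> / (1 - \<gamma> * k) * (1 - \<gamma> * k)" using pos by simp
    show "\<gamma> \<le> \<gamma> / (1 - \<gamma> * k)" using pos assms k by (simp add: field_simps)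
  qed (use k in auto)
qed

lemma (in leaf_structure) metric_norm_pos:
  assumes "continuous_metric X \<A> TB g" "p \<in> X" "v \<in> TB p" "v \<noteq> 0"
  shows "0 < metric_norm g p v"
  using assms by (auto simp: continuous_metric_def inner_product_on_def metric_norm_def)

lemma (in leaf_structure) metric_norm_nonneg:
  assumes "continuous_metric X \<A> TB g" "p \<in> X" "v \<in> TB p"
  shows "0 \<le> metric_norm g p v"
  using metric_norm_pos [OF assms] metric_norm_triangle(2) [OF assms(1,2) assms(3,3), of 0]
  by (cases "v = 0") (auto simp: less_imp_le)

text \<open>The rates are stated for all vectors and as weak inequalities, with positive \<open>\<nu>\<close> and
  nonnegative \<open>g\<close>, so that vanishing bundles are included.\<close>

locale partially_hyperbolic =
  W: leaf_dynamics X \<A> \<beta> f k \<W> + Ws: leaf_dynamics X \<A> \<beta> f l \<W>s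
  for X :: "'a::t2_space set" and \<A> :: "('a, 'e::euclidean_space) chart set" and \<beta> :: real and f :: "'a \<Rightarrow> 'a"
    and k l :: nat and \<W> \<W>s :: "('a, 'e) fbox set" +
  fixes gE gEs :: "'a \<Rightarrow> 'e \<Rightarrow> 'e \<Rightarrow> real" and I :: "'a \<Rightarrow> 'a \<Rightarrow> 'e \<Rightarrow> 'e" and \<nu> \<gamma> g :: real
  assumes metric: "continuous_metric X \<A> (tangent_bundle \<A> \<W>) gE"
    and metrics: "continuous_metric X \<A> (tangent_bundle \<A> \<W>s) gEs"
    and ident: "holder_identifications \<beta> X \<A> (tangent_bundle \<A> \<W>) I"
    and rate_s: "p \<in> X \<Longrightarrow> v \<in> tangent_bundle \<A> \<W>s p \<Longrightarrow>
      metric_norm gEs (f p) (mderiv \<A> f p v) \<le> \<nu> * metric_norm gEs p v"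
    and rate_low: "p \<in> X \<Longrightarrow> v \<in> tangent_bundle \<A> \<W> p \<Longrightarrow>
      metric_norm gE p v \<le> \<gamma> * metric_norm gE (f p) (mderiv \<A> f p v)"
    and rate_up: "p \<in> X \<Longrightarrow> v \<in> tangent_bundle \<A> \<W> p \<Longrightarrow>
      metric_norm gE (f p) (mderiv \<A> f p v) \<le> g * metric_norm gE p v"
    and rates: "0 < \<nu>" "\<nu> < 1" "0 < \<gamma>" "\<gamma> < 1" "0 \<le> g" "g * \<gamma> * \<nu> powr (\<beta> / (1 + \<beta>)) < 1"
    and \<beta>1: "\<beta> \<le> 1"
begin

abbreviation "E \<equiv> tangent_bundle \<A> \<W>"
abbreviation "Es \<equiv> tangent_bundle \<A> \<W>s"

text \<open>A site at \<open>i\<close> consists of a chart and a box of either foliation around \<open>i\<close>, on their common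
  domain. The closed coordinate balls \<open>site1\<close> and \<open>site2\<close> of radius \<open>rad i\<close> and \<open>2 * rad i\<close> are the
  sets \<open>K1\<close> and \<open>K2\<close> of the abstract charts, and finitely many sites will serve for all of \<open>X\<close>.\<close>

abbreviation ch :: "'a \<Rightarrow> ('a, 'e) chart" where "ch i \<equiv> chart_at \<A> i"
definition bw :: "'a \<Rightarrow> ('a, 'e) fbox" where "bw i = (SOME B. B \<in> \<W> \<and> i \<in> bdom B)"
definition bs :: "'a \<Rightarrow> ('a, 'e) fbox" where "bs i = (SOME B. B \<in> \<W>s \<and> i \<in> bdom B)"
definition site :: "'a \<Rightarrow> 'a set" where "site i = cdom (ch i) \<inter> (bdom (bw i) \<inter> bdom (bs i))"
definition rad :: "'a \<Rightarrow> real" where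
  "rad i = (SOME r. 0 < r \<and> cball (cmap (ch i) i) (2 * r) \<subseteq> cmap (ch i) ` site i)"
definition site1 :: "'a \<Rightarrow> 'a set" where "site1 i = {q \<in> site i. dist (cmap (ch i) i) (cmap (ch i) q) \<le> rad i}"
definition site2 :: "'a \<Rightarrow> 'a set" where "site2 i = {q \<in> site i. dist (cmap (ch i) i) (cmap (ch i) q) \<le> 2 * rad i}"
definition samew :: "'a \<Rightarrow> 'a \<Rightarrow> 'a \<Rightarrow> bool" where "samew i q q' \<longleftrightarrow> q' \<in> plaque (bw i) q"
definition sames :: "'a \<Rightarrow> 'a \<Rightarrow> 'a \<Rightarrow> bool" where "sames i q q' \<longleftrightarrow> q' \<in> plaque (bs i) q"

lemma bw: "i \<in> X \<Longrightarrow> bw i \<in> \<W>" "i \<in> X \<Longrightarrow> i \<in> bdom (bw i)"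
  unfolding bw_def using someI_ex [of "\<lambda>B. B \<in> \<W> \<and> i \<in> bdom B"] W.cover by blast+

lemma bs: "i \<in> X \<Longrightarrow> bs i \<in> \<W>s" "i \<in> X \<Longrightarrow> i \<in> bdom (bs i)"
  unfolding bs_def using someI_ex [of "\<lambda>B. B \<in> \<W>s \<and> i \<in> bdom B"] Ws.cover by blast+

lemma chi: "i \<in> X \<Longrightarrow> ch i \<in> \<A>" "i \<in> X \<Longrightarrow> i \<in> cdom (ch i)"
  using W.chart_at by auto

lemma openin_site: "i \<in> X \<Longrightarrow> openin (top_of_set X) (site i)"
  unfolding site_def by (intro openin_Int W.openin_cdom W.openin_bdom Ws.openin_bdom chi bw bs)

lemma site_cdom: "site i \<subseteq> cdom (ch i)" and site_bw: "site i \<subseteq> bdom (bw i)" and site_bs: "site i \<subseteq> bdom (bs i)"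
  by (auto simp: site_def)

lemma i_site: "i \<in> X \<Longrightarrow> i \<in> site i"
  unfolding site_def by (intro IntI chi(2) bw(2) bs(2))

lemma site_X: "i \<in> X \<Longrightarrow> site i \<subseteq> X"
  by (rule openin_imp_subset [OF openin_site])

lemma rad: assumes "i \<in> X" shows "0 < rad i" "cball (cmap (ch i) i) (2 * rad i) \<subseteq> cmap (ch i) ` site i"
proof -
  have "open (cmap (ch i) ` site i)"
    using W.open_cmap_Int [OF chi(1) [OF assms] openin_site [OF assms]] site_cdom [of i] by (simp add: Int_absorb1)
  then obtain e where e: "0 < e" "cball (cmap (ch i) i) e \<subseteq> cmap (ch i) ` site i"
    using i_site [OF assms] open_contains_cball by (metis imageI)
  then have "0 < e / 2 \<and> cball (cmap (ch i) i) (2 * (e / 2)) \<subseteq> cmap (ch i) ` site i" by simp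
  then have "\<exists>r. 0 < r \<and> cball (cmap (ch i) i) (2 * r) \<subseteq> cmap (ch i) ` site i" by blast
  from someI_ex [OF this] show "0 < rad i" "cball (cmap (ch i) i) (2 * rad i) \<subseteq> cmap (ch i) ` site i"
    unfolding rad_def by blast+
qed

lemma site2_sub: "site2 i \<subseteq> site i" and site12: "i \<in> X \<Longrightarrow> site1 i \<subseteq> site2 i"
  using rad by (auto simp: site1_def site2_def intro: order_trans)

lemma openin_near: "i \<in> X \<Longrightarrow> p \<in> site i \<Longrightarrow> openin (top_of_set X) {q \<in> site i. dist (cmap (ch i) p) (cmap (ch i) q) < d}"
proof -
  assume i: "i \<in> X" "p \<in> site i"
  have "continuous_on (site i) (cmap (ch i))"
    using homeomorphism_cont1 [OF W.chom [OF chi(1) [OF i(1)]]] continuous_on_subset site_cdom by blast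
  then have "openin (top_of_set (site i)) (site i \<inter> cmap (ch i) -` ball (cmap (ch i) p) d)"
    by (rule continuous_openin_preimage_gen) simp
  moreover have "site i \<inter> cmap (ch i) -` ball (cmap (ch i) p) d = {q \<in> site i. dist (cmap (ch i) p) (cmap (ch i) q) < d}"
    by auto
  ultimately show ?thesis using openin_trans [OF _ openin_site [OF i(1)]] by simp
qed

lemma finite_sites: obtains J where "finite J" "J \<subseteq> X" "\<And>p. p \<in> X \<Longrightarrow> \<exists>i\<in>J. p \<in> site1 i"
proof -
  let ?V = "\<lambda>i. {q \<in> site i. dist (cmap (ch i) i) (cmap (ch i) q) < rad i}"
  have "\<exists>T. open T \<and> ?V i = X \<inter> T" if "i \<in> X" for i
    using openin_near [OF that i_site [OF that], of "rad i"] unfolding openin_open by blast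
  then have "\<forall>i\<in>X. \<exists>T. open T \<and> ?V i = X \<inter> T" ..
  from bchoice [OF this] obtain T where "\<forall>i\<in>X. open (T i) \<and> ?V i = X \<inter> T i" ..
  then have T: "open (T i)" "?V i = X \<inter> T i" if "i \<in> X" for i using that by auto
  have mem: "i \<in> ?V i" if "i \<in> X" for i using i_site [OF that] rad(1) [OF that] by simp
  have cov: "X \<subseteq> (\<Union>i\<in>X. T i)"
  proof
    fix i assume "i \<in> X"
    then have "i \<in> X \<inter> T i" using mem [of i] T(2) [of i] by (simp only:)
    then show "i \<in> (\<Union>i\<in>X. T i)" by blast
  qed
  obtain J where J: "J \<subseteq> X" "finite J" "X \<subseteq> (\<Union>i\<in>J. T i)"
    by (rule compactE_image [OF W.compact_X T(1) cov])
  have "\<exists>i\<in>J. p \<in> site1 i" if p: "p \<in> X" for p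
  proof -
    obtain i where i: "i \<in> J" "p \<in> T i" using J(3) p by blast
    then have "p \<in> X \<inter> T i" "i \<in> X" using J(1) p by auto
    then have "p \<in> ?V i" using T(2) [of i] by (simp only:)
    then show ?thesis using i(1) by (auto simp: site1_def)
  qed
  then show ?thesis using that J by blast
qed

text \<open>All estimates that the locale \<open>bunched\<close> demands of a pair of points \<open>q\<close>, \<open>q'\<close> in the site \<open>i\<close> with
  images in the site \<open>j\<close>. Collecting them allows to choose the constants once.\<close>

definition good :: "'a \<Rightarrow> 'a \<Rightarrow> 'a \<Rightarrow> 'a \<Rightarrow> real \<Rightarrow> bool" where
  "good i j q q' K \<longleftrightarrow> (let d = cmap (ch i) q' - cmap (ch i) q; D = W.fder (ch i) (ch j) in
    f q' \<in> site j \<and>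
    norm (cmap (ch j) (f q') - cmap (ch j) (f q)) \<le> K * norm d \<and>
    norm (cmap (ch j) (f q') - cmap (ch j) (f q) - D q d) \<le> K * norm d powr (1 + \<beta>) \<and>
    (\<forall>v. norm (D q' v - D q v) \<le> K * norm d powr \<beta> * norm v) \<and>
    (\<forall>v. norm (D q v) \<le> K * norm v) \<and>
    (samew i q q' \<longrightarrow> samew j (f q) (f q') \<and>
      (\<exists>v\<in>E q. norm (d - tcoord \<A> (ch i) q v) \<le> K * norm d powr (1 + \<beta>))) \<and>
    (sames i q q' \<longrightarrow> sames j (f q) (f q') \<and>
      (\<exists>v\<in>Es q. norm (d - tcoord \<A> (ch i) q v) \<le> K * norm d powr (1 + \<beta>))) \<and>
    (\<forall>v\<in>E q. norm (tcoord \<A> (ch i) q v) \<le> K * metric_norm gE q v \<and>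
      metric_norm gE q v \<le> K * norm (tcoord \<A> (ch i) q v)) \<and>
    (\<forall>v\<in>Es q. norm (tcoord \<A> (ch i) q v) \<le> K * metric_norm gEs q v \<and>
      metric_norm gEs q v \<le> K * norm (tcoord \<A> (ch i) q v)) \<and>
    linear (I q q') \<and> I q q' ` E q = E q' \<and>
    (\<forall>v\<in>E q. norm (tcoord \<A> (ch i) q' (I q q' v) - tcoord \<A> (ch i) q v)
        \<le> K * norm d powr \<beta> * norm (tcoord \<A> (ch i) q v)))"

lemma good_mono:
  assumes "q \<in> X" "K \<le> K'" "good i j q q' K" shows "good i j q q' K'"
proof -
  have le: "a \<le> K' * b" if "a \<le> K * b" "0 \<le> b" for a b
    using that mult_right_mono [OF assms(2) that(2)] by linarith
  have le2: "a \<le> K' * b * c" if "a \<le> K * b * c" "0 \<le> b" "0 \<le> c" for a b c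
    using le [of a "b * c"] that by (simp add: mult.assoc)
  note good = assms(3) [unfolded good_def Let_def]
  show ?thesis
    unfolding good_def Let_def
  proof (intro conjI allI ballI impI)
    fix v
    show "norm (W.fder (ch i) (ch j) q' v - W.fder (ch i) (ch j) q v) \<le> K' * norm (cmap (ch i) q' - cmap (ch i) q) powr \<beta> * norm v"
      "norm (W.fder (ch i) (ch j) q v) \<le> K' * norm v"
      using good by (auto intro: le le2)
  next
    assume "samew i q q'"
    then obtain v where "v \<in> E q" "norm (cmap (ch i) q' - cmap (ch i) q - tcoord \<A> (ch i) q v)
        \<le> K * norm (cmap (ch i) q' - cmap (ch i) q) powr (1 + \<beta>)" using good by blast
    then show "\<exists>v\<in>E q. norm (cmap (ch i) q' - cmap (ch i) q - tcoord \<A> (ch i) q v)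
        \<le> K' * norm (cmap (ch i) q' - cmap (ch i) q) powr (1 + \<beta>)" by (intro bexI [of _ v] le) auto
  next
    assume "sames i q q'"
    then obtain v where "v \<in> Es q" "norm (cmap (ch i) q' - cmap (ch i) q - tcoord \<A> (ch i) q v)
        \<le> K * norm (cmap (ch i) q' - cmap (ch i) q) powr (1 + \<beta>)" using good by blast
    then show "\<exists>v\<in>Es q. norm (cmap (ch i) q' - cmap (ch i) q - tcoord \<A> (ch i) q v)
        \<le> K' * norm (cmap (ch i) q' - cmap (ch i) q) powr (1 + \<beta>)" by (intro bexI [of _ v] le) auto
  qed (use good in \<open>auto intro: le le2 W.metric_norm_nonneg [OF metric assms(1)] Ws.metric_norm_nonneg [OF metrics assms(1)]\<close>)
qed

lemma good_local:
  assumes i: "i \<in> X" "p \<in> site i" and j: "j \<in> X" "f p \<in> site j"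
  shows "\<exists>N K. openin (top_of_set X) N \<and> p \<in> N \<and> (\<forall>q\<in>N. \<forall>q'\<in>N. good i j q q' K)"
proof -
  note c = chi(1) [OF i(1)] chi(1) [OF j(1)]
  have p: "p \<in> X" "p \<in> cdom (ch i)" "p \<in> bdom (bw i)" "p \<in> bdom (bs i)"
      "f p \<in> cdom (ch j)" "f p \<in> bdom (bw j)" "f p \<in> bdom (bs j)"
    using i j site_X [OF i(1)] site_cdom site_bw site_bs by (auto simp: subset_iff)
  define N0 where "N0 = X \<inter> f -` site j"
  have N0: "openin (top_of_set X) N0" "p \<in> N0"
    using W.openin_f_preimage [OF openin_site [OF j(1)]] p(1) j(2) by (auto simp: N0_def)
  obtain N1 K1 where N1: "openin (top_of_set X) N1" "p \<in> N1" "0 \<le> K1"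
    "\<forall>q\<in>N1. \<forall>q'\<in>N1. norm (cmap (ch j) (f q') - cmap (ch j) (f q)) \<le> K1 * norm (cmap (ch i) q' - cmap (ch i) q) \<and>
        norm (cmap (ch j) (f q') - cmap (ch j) (f q) - W.fder (ch i) (ch j) q (cmap (ch i) q' - cmap (ch i) q))
          \<le> K1 * norm (cmap (ch i) q' - cmap (ch i) q) powr (1 + \<beta>) \<and>
        (\<forall>v. norm (W.fder (ch i) (ch j) q' v - W.fder (ch i) (ch j) q v) \<le> K1 * norm (cmap (ch i) q' - cmap (ch i) q) powr \<beta> * norm v) \<and>
        (\<forall>v. norm (W.fder (ch i) (ch j) q v) \<le> K1 * norm v)"
    using W.fder_local(2) [OF c(1) p(2) c(2) p(5)] by blast
  obtain N2 where N2: "openin (top_of_set X) N2" "p \<in> N2"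
    "\<And>q r. q \<in> N2 \<Longrightarrow> r \<in> N2 \<Longrightarrow> r \<in> plaque (bw i) q \<Longrightarrow> f r \<in> plaque (bw j) (f q)"
    using W.plaque_f_local [OF bw(1) [OF i(1)] p(3) bw(1) [OF j(1)] p(6)] by metis
  obtain N3 where N3: "openin (top_of_set X) N3" "p \<in> N3"
    "\<And>q r. q \<in> N3 \<Longrightarrow> r \<in> N3 \<Longrightarrow> r \<in> plaque (bs i) q \<Longrightarrow> f r \<in> plaque (bs j) (f q)"
    using Ws.plaque_f_local [OF bs(1) [OF i(1)] p(4) bs(1) [OF j(1)] p(7)] by metis
  obtain N4 K4 where N4: "openin (top_of_set X) N4" "p \<in> N4" "0 \<le> K4"
    "\<forall>q\<in>N4. \<forall>q'\<in>N4. q' \<in> plaque (bw i) q \<longrightarrow> (\<exists>v\<in>E q.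
      norm (cmap (ch i) q' - cmap (ch i) q - tcoord \<A> (ch i) q v) \<le> K4 * norm (cmap (ch i) q' - cmap (ch i) q) powr (1 + \<beta>))"
    using W.leaf_taylor_local [OF bw(1) [OF i(1)] c(1), of p] p by blast
  obtain N5 K5 where N5: "openin (top_of_set X) N5" "p \<in> N5" "0 \<le> K5"
    "\<forall>q\<in>N5. \<forall>q'\<in>N5. q' \<in> plaque (bs i) q \<longrightarrow> (\<exists>v\<in>Es q.
      norm (cmap (ch i) q' - cmap (ch i) q - tcoord \<A> (ch i) q v) \<le> K5 * norm (cmap (ch i) q' - cmap (ch i) q) powr (1 + \<beta>))"
    using Ws.leaf_taylor_local [OF bs(1) [OF i(1)] c(1), of p] p by blast
  obtain N6 K6 where N6: "openin (top_of_set X) N6" "p \<in> N6" "0 \<le> K6"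
    "\<forall>q\<in>N6. \<forall>v\<in>E q. norm (tcoord \<A> (ch i) q v) \<le> K6 * metric_norm gE q v \<and>
      metric_norm gE q v \<le> K6 * norm (tcoord \<A> (ch i) q v)"
    using W.metric_local [OF metric c(1) p(2)] by blast
  obtain N7 K7 where N7: "openin (top_of_set X) N7" "p \<in> N7" "0 \<le> K7"
    "\<forall>q\<in>N7. \<forall>v\<in>Es q. norm (tcoord \<A> (ch i) q v) \<le> K7 * metric_norm gEs q v \<and>
      metric_norm gEs q v \<le> K7 * norm (tcoord \<A> (ch i) q v)"
    using Ws.metric_local [OF metrics c(1) p(2)] by blast
  obtain N8 K8 where N8: "openin (top_of_set X) N8" "p \<in> N8"
    "\<forall>z\<in>N8. \<forall>w\<in>N8. linear (I z w) \<and> bij_betw (I z w) (E z) (E w) \<and>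
           (\<forall>v\<in>E z. norm (tcoord \<A> (ch i) w (I z w v) - tcoord \<A> (ch i) z v)
              \<le> K8 * dist (cmap (ch i) z) (cmap (ch i) w) powr \<beta> * norm (tcoord \<A> (ch i) z v))"
    using ident c(1) p(2) unfolding holder_identifications_def by blast
  define K where "K = K1 + K4 + K5 + K6 + K7 + \<bar>K8\<bar>"
  define N where "N = N0 \<inter> N1 \<inter> N2 \<inter> N3 \<inter> N4 \<inter> N5 \<inter> N6 \<inter> N7 \<inter> N8"
  have Kle: "K1 \<le> K" "K4 \<le> K" "K5 \<le> K" "K6 \<le> K" "K7 \<le> K" "K8 \<le> K"
    using N1(3) N4(3) N5(3) N6(3) N7(3) by (auto simp: K_def)
  have le: "a \<le> K * b" if "a \<le> K' * b" "K' \<le> K" "0 \<le> b" for a b K'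
    using that mult_right_mono [OF that(2,3)] by linarith
  have le2: "a \<le> K * b * c" if "a \<le> K' * b * c" "K' \<le> K" "0 \<le> b" "0 \<le> c" for a b c K'
    using le [of a K' "b * c"] that by (simp add: mult.assoc)
  have "openin (top_of_set X) N"
    unfolding N_def by (intro openin_Int N0(1) N1(1) N2(1) N3(1) N4(1) N5(1) N6(1) N7(1) N8(1))
  moreover have "p \<in> N" using N0 N1 N2 N3 N4 N5 N6 N7 N8 by (simp add: N_def)
  moreover have "good i j q q' K" if q: "q \<in> N" and q': "q' \<in> N" for q q'
  proof -
    let ?d = "cmap (ch i) q' - cmap (ch i) q"
    have mem: "q' \<in> N0" "q \<in> N1" "q' \<in> N1" "q \<in> N2" "q' \<in> N2" "q \<in> N3" "q' \<in> N3" "q \<in> N4" "q' \<in> N4"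
      "q \<in> N5" "q' \<in> N5" "q \<in> N6" "q \<in> N7" "q \<in> N8" "q' \<in> N8" using q q' by (auto simp: N_def)
    have qX: "q \<in> X" using q by (auto simp: N_def N0_def)
    note a1 = bspec [OF bspec [OF N1(4) mem(2)] mem(3)]
    note a8 = bspec [OF bspec [OF N8(3) mem(14)] mem(15)]
    show ?thesis
      unfolding good_def Let_def
    proof (intro conjI allI ballI impI)
      show "f q' \<in> site j" using mem(1) by (simp add: N0_def)
      show "norm (cmap (ch j) (f q') - cmap (ch j) (f q)) \<le> K * norm ?d"
        using conjunct1 [OF a1] Kle(1) by (rule le) simp
      show "norm (cmap (ch j) (f q') - cmap (ch j) (f q) - W.fder (ch i) (ch j) q ?d) \<le> K * norm ?d powr (1 + \<beta>)"
        using conjunct1 [OF conjunct2 [OF a1]] Kle(1) by (rule le) simp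
      show "norm (W.fder (ch i) (ch j) q' v - W.fder (ch i) (ch j) q v) \<le> K * norm ?d powr \<beta> * norm v" for v
        using a1 Kle(1) by (intro le2 [of _ K1]) auto
      show "norm (W.fder (ch i) (ch j) q v) \<le> K * norm v" for v
        using a1 Kle(1) by (intro le [of _ K1]) auto
      show "samew j (f q) (f q')" if "samew i q q'" using N2(3) mem that by (simp add: samew_def)
      show "sames j (f q) (f q')" if "sames i q q'" using N3(3) mem that by (simp add: sames_def)
      show "\<exists>v\<in>E q. norm (?d - tcoord \<A> (ch i) q v) \<le> K * norm ?d powr (1 + \<beta>)" if "samew i q q'"
      proof -
        obtain v where "v \<in> E q" "norm (?d - tcoord \<A> (ch i) q v) \<le> K4 * norm ?d powr (1 + \<beta>)"
          using N4(4) mem \<open>samew i q q'\<close> by (auto simp: samew_def)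
        then show ?thesis using le [OF _ Kle(2)] by (intro bexI [of _ v]) auto
      qed
      show "\<exists>v\<in>Es q. norm (?d - tcoord \<A> (ch i) q v) \<le> K * norm ?d powr (1 + \<beta>)" if "sames i q q'"
      proof -
        obtain v where "v \<in> Es q" "norm (?d - tcoord \<A> (ch i) q v) \<le> K5 * norm ?d powr (1 + \<beta>)"
          using N5(4) mem \<open>sames i q q'\<close> by (auto simp: sames_def)
        then show ?thesis using le [OF _ Kle(3)] by (intro bexI [of _ v]) auto
      qed
      fix v assume v: "v \<in> E q"
      show "norm (tcoord \<A> (ch i) q v) \<le> K * metric_norm gE q v" "metric_norm gE q v \<le> K * norm (tcoord \<A> (ch i) q v)"
        using bspec [OF bspec [OF N6(4) mem(12)] v] W.metric_norm_nonneg [OF metric qX v]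
        by (auto intro: le [OF _ Kle(4)])
      have "norm (tcoord \<A> (ch i) q' (I q q' v) - tcoord \<A> (ch i) q v)
          \<le> K8 * norm ?d powr \<beta> * norm (tcoord \<A> (ch i) q v)"
        using a8 v by (simp add: dist_norm norm_minus_commute)
      then show "norm (tcoord \<A> (ch i) q' (I q q' v) - tcoord \<A> (ch i) q v)
          \<le> K * norm ?d powr \<beta> * norm (tcoord \<A> (ch i) q v)"
        using Kle(6) by (rule le2) auto
    next
      fix v assume v: "v \<in> Es q"
      show "norm (tcoord \<A> (ch i) q v) \<le> K * metric_norm gEs q v" "metric_norm gEs q v \<le> K * norm (tcoord \<A> (ch i) q v)"
        using bspec [OF bspec [OF N7(4) mem(13)] v] Ws.metric_norm_nonneg [OF metrics qX v]
        by (auto intro: le [OF _ Kle(5)])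
    next
      show "linear (I q q')" "I q q' ` E q = E q'" using a8 by (auto simp: bij_betw_def)
    qed
  qed
  ultimately show ?thesis by blast
qed

lemma compact_site2:
  assumes "i \<in> X"
  shows "cmap (ch i) ` site2 i = cball (cmap (ch i) i) (2 * rad i)" "compact (site2 i)"
proof -
  let ?b = "cball (cmap (ch i) i) (2 * rad i)"
  show im: "cmap (ch i) ` site2 i = ?b" using rad(2) [OF assms] by (auto simp: site2_def)
  have "cinv (ch i) ` ?b = site2 i"
  proof -
    have "cinv (ch i) ` cmap (ch i) ` site2 i = (\<lambda>q. q) ` site2 i"
      unfolding image_image using chi(1) [OF assms] site2_sub [of i] site_cdom [of i]
      by (intro image_cong) auto
    then show ?thesis using im by simp
  qed
  moreover have "continuous_on ?b (cinv (ch i))"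
    using homeomorphism_cont2 [OF W.chom [OF chi(1) [OF assms]]]
    by (rule continuous_on_subset) (use rad(2) [OF assms] site_cdom in blast)
  ultimately show "compact (site2 i)" using compact_continuous_image compact_cball by metis
qed

lemma good_uniform:
  assumes J: "finite J" "J \<subseteq> X"
  obtains \<rho> K where "0 < \<rho>" "1 \<le> K" "\<And>i. i \<in> J \<Longrightarrow> \<rho> \<le> rad i"
    "\<And>i j q q'. i \<in> J \<Longrightarrow> j \<in> J \<Longrightarrow> q \<in> site2 i \<Longrightarrow> f q \<in> site2 j \<Longrightarrow> q' \<in> site i \<Longrightarrow>
      norm (cmap (ch i) q' - cmap (ch i) q) < \<rho> \<Longrightarrow> good i j q q' K"
proof -
  define Q where "Q = (\<lambda>(i, j) r K. r \<le> rad i \<and> (\<forall>q q'. q \<in> site2 i \<and> f q \<in> site2 j \<and> q' \<in> site i \<and>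
      norm (cmap (ch i) q' - cmap (ch i) q) < r \<longrightarrow> good i j q q' K))"
  have "\<exists>r>0. \<exists>K\<ge>1. \<forall>s\<in>J \<times> J. Q s r K"
  proof (rule uniform_over_finite)
    show "finite (J \<times> J)" using J(1) by simp
    fix s assume "s \<in> J \<times> J"
    then obtain i j where s: "s = (i, j)" "i \<in> J" "j \<in> J" by blast
    have ij: "i \<in> X" "j \<in> X" using s J(2) by auto
    let ?C = "{q \<in> site2 i. f q \<in> site2 j}"
    have "\<exists>r>0. \<exists>K\<ge>1. \<forall>q\<in>?C. \<forall>q'\<in>cdom (ch i). norm (cmap (ch i) q' - cmap (ch i) q) < r \<longrightarrow> good i j q q' K"
    proof (rule W.uniform_over_compact)
      show "ch i \<in> \<A>" by (rule chi(1) [OF ij(1)])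
      show "?C \<subseteq> cdom (ch i)" using site2_sub site_cdom by blast
      show "compact (cmap (ch i) ` ?C)"
      proof -
        have "continuous_on (site2 i) f"
          using W.f_cont site2_sub site_X [OF ij(1)] continuous_on_subset by (metis subset_trans)
        then have "closedin (top_of_set (site2 i)) (site2 i \<inter> f -` site2 j)"
          using compact_imp_closed [OF compact_site2(2) [OF ij(2)]] by (rule continuous_closedin_preimage)
        then have "compact ?C"
          using closedin_compact [OF compact_site2(2) [OF ij(1)]] by (simp add: vimage_def Int_def)
        moreover have "continuous_on ?C (cmap (ch i))"
          using homeomorphism_cont1 [OF W.chom [OF chi(1) [OF ij(1)]]]
          by (rule continuous_on_subset) (use site2_sub site_cdom in blast)
        ultimately show ?thesis using compact_continuous_image by blast
      qed
      show "\<exists>N K. openin (top_of_set X) N \<and> p \<in> N \<and> (\<forall>q\<in>N. \<forall>q'\<in>N. good i j q q' K)" if "p \<in> ?C" for p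
        using that site2_sub by (intro good_local ij) auto
      show "good i j q q' K'" if "q \<in> ?C" "K \<le> K'" "good i j q q' K" for q q' K K'
        using that site2_sub site_X [OF ij(1)] by (intro good_mono [OF _ that(2,3)]) blast
    qed
    then obtain r K where r: "0 < r" "1 \<le> K"
      "\<forall>q\<in>?C. \<forall>q'\<in>cdom (ch i). norm (cmap (ch i) q' - cmap (ch i) q) < r \<longrightarrow> good i j q q' K" by blast
    have "Q s (min r (rad i)) K" using r(3) site_cdom [of i] s(1) by (auto simp: Q_def)
    then show "\<exists>r>0. \<exists>K\<ge>1. Q s r K" using r rad(1) [OF ij(1)] by (intro exI [of _ "min r (rad i)"]) auto
  next
    fix s r r' K K' assume "s \<in> J \<times> J" and Q: "Q s r K" "r' \<le> r" "K \<le> K'"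
    then obtain i j where s: "s = (i, j)" "i \<in> X" using J(2) by blast
    have "good i j q q' K'" if q: "q \<in> site2 i" "good i j q q' K" for q q'
      using q site2_sub site_X [OF s(2)] by (intro good_mono [OF _ Q(3) q(2)]) blast
    then show "Q s r' K'" using Q s(1) unfolding Q_def by fastforce
  qed
  then obtain \<rho> K where \<rho>: "0 < \<rho>" "1 \<le> K" "\<And>i j. i \<in> J \<Longrightarrow> j \<in> J \<Longrightarrow> Q (i, j) \<rho> K" by blast
  show ?thesis
  proof (rule that [OF \<rho>(1,2)])
    show "\<rho> \<le> rad i" if "i \<in> J" for i using \<rho>(3) [OF that that] by (simp add: Q_def)
    show "good i j q q' K" if "i \<in> J" "j \<in> J" "q \<in> site2 i" "f q \<in> site2 j" "q' \<in> site i"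
      "norm (cmap (ch i) q' - cmap (ch i) q) < \<rho>" for i j q q'
      using \<rho>(3) [OF that(1,2)] that by (simp add: Q_def)
  qed
qed

lemma bunched_exists:
  obtains J \<rho> K \<nu>' \<gamma>' g' \<kappa> r where "J \<subseteq> X"
    "bunched X f J site site1 site2 (\<lambda>i. cmap (ch i)) (\<lambda>i. tcoord \<A> (ch i)) (mderiv \<A> f) (\<lambda>i j. W.fder (ch i) (ch j))
      \<rho> K \<beta> E (metric_norm gE) samew Es (metric_norm gEs) sames I \<nu> \<gamma> g \<nu>' \<gamma>' g' \<kappa> r"
proof -
  obtain J where J: "finite J" "J \<subseteq> X" "\<And>p. p \<in> X \<Longrightarrow> \<exists>i\<in>J. p \<in> site1 i" using finite_sites by blast
  obtain \<rho> K where \<rho>: "0 < \<rho>" "1 \<le> K" "\<And>i. i \<in> J \<Longrightarrow> \<rho> \<le> rad i"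
    and G: "\<And>i j q q'. i \<in> J \<Longrightarrow> j \<in> J \<Longrightarrow> q \<in> site2 i \<Longrightarrow> f q \<in> site2 j \<Longrightarrow> q' \<in> site i \<Longrightarrow>
      norm (cmap (ch i) q' - cmap (ch i) q) < \<rho> \<Longrightarrow> good i j q q' K"
    using good_uniform [OF J(1,2)] by metis
  have JX: "i \<in> X" if "i \<in> J" for i using that J(2) by blast
  have G1: "\<exists>j. good i j q q' K" if "i \<in> J" "q \<in> site2 i" "q' \<in> site i"
      "norm (cmap (ch i) q' - cmap (ch i) q) < \<rho>" for i q q'
  proof -
    have "f q \<in> X" using W.f_X site_X [OF JX [OF that(1)]] site2_sub that(2) by blast
    then obtain j where "j \<in> J" "f q \<in> site2 j" using J(3) site12 JX by blast
    then show ?thesis using G that by blast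
  qed
  interpret cd: chart_dynamics X f J site site1 site2 "\<lambda>i. cmap (ch i)" "\<lambda>i. tcoord \<A> (ch i)" "mderiv \<A> f"
    "\<lambda>i j. W.fder (ch i) (ch j)" \<rho> K \<beta>
  proof (rule chart_dynamics.intro)
    show "0 < \<rho>" "1 \<le> K" "0 < \<beta>" "\<beta> \<le> 1" using \<rho> W.\<beta> \<beta>1 by auto
    show "f p \<in> X" if "p \<in> X" for p using W.f_X [OF that] .
    show "\<exists>i\<in>J. p \<in> site1 i" if "p \<in> X" for p using J(3) [OF that] .
    show "site1 i \<subseteq> site2 i" "site2 i \<subseteq> site i" "site i \<subseteq> X" if "i \<in> J" for i
      using site12 site2_sub site_X JX [OF that] by auto
    show "q \<in> site2 i" if "i \<in> J" "p \<in> site1 i" "q \<in> site i" "norm (cmap (ch i) q - cmap (ch i) p) \<le> \<rho>" for i p q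
    proof -
      have "dist (cmap (ch i) i) (cmap (ch i) q) \<le> dist (cmap (ch i) i) (cmap (ch i) p) + dist (cmap (ch i) p) (cmap (ch i) q)"
        by (rule dist_triangle)
      also have "\<dots> \<le> rad i + \<rho>" using that by (intro add_mono) (auto simp: site1_def dist_norm norm_minus_commute)
      finally show ?thesis using \<rho>(3) [OF that(1)] that(3) by (simp add: site2_def)
    qed
    show "linear (W.fder (ch i) (ch j) q)" if "i \<in> J" "j \<in> J" "q \<in> site i" "f q \<in> site j" for i j q
      by (intro W.linear_fder chi(1) JX that subsetD [OF site_cdom])
    show "linear (tcoord \<A> (ch i) q)" if "i \<in> J" "q \<in> site i" for i q
      by (intro W.linear_tcoord chi(1) JX that subsetD [OF site_cdom])
    show "inj (tcoord \<A> (ch i) q)" if "i \<in> J" "q \<in> site i" for i q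
      by (intro W.inj_tcoord chi(1) JX that subsetD [OF site_cdom])
    show "linear (mderiv \<A> f p)" if "p \<in> X" for p using W.linear_mderiv [OF that] .
    show "W.fder (ch i) (ch j) q (tcoord \<A> (ch i) q v) = tcoord \<A> (ch j) (f q) (mderiv \<A> f q v)"
      if "i \<in> J" "j \<in> J" "q \<in> site i" "f q \<in> site j" for i j q v
      by (intro W.fder_tcoord chi(1) JX that subsetD [OF site_cdom])
    fix i j q q' assume "i \<in> J" "j \<in> J" "q \<in> site2 i" "f q \<in> site2 j" "q' \<in> site i" "norm (cmap (ch i) q' - cmap (ch i) q) < \<rho>"
    from G [OF this]
    show "f q' \<in> site j \<and>
      norm (cmap (ch j) (f q') - cmap (ch j) (f q)) \<le> K * norm (cmap (ch i) q' - cmap (ch i) q) \<and>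
      norm (cmap (ch j) (f q') - cmap (ch j) (f q) - W.fder (ch i) (ch j) q (cmap (ch i) q' - cmap (ch i) q))
        \<le> K * norm (cmap (ch i) q' - cmap (ch i) q) powr (1 + \<beta>) \<and>
      (\<forall>v. norm (W.fder (ch i) (ch j) q' v - W.fder (ch i) (ch j) q v) \<le> K * norm (cmap (ch i) q' - cmap (ch i) q) powr \<beta> * norm v) \<and>
      (\<forall>v. norm (W.fder (ch i) (ch j) q v) \<le> K * norm v)"
      unfolding good_def Let_def by (elim conjE) (intro conjI; assumption)
  qed
  interpret lw: leafwise X f J site site1 site2 "\<lambda>i. cmap (ch i)" "\<lambda>i. tcoord \<A> (ch i)" "mderiv \<A> f"
    "\<lambda>i j. W.fder (ch i) (ch j)" \<rho> K \<beta> E "metric_norm gE" samew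
  proof
    show "subspace (E p)" if "p \<in> X" for p using W.subspace_TB [OF that] .
    show "mderiv \<A> f p v \<in> E (f p)" if "p \<in> X" "v \<in> E p" for p v using W.mderiv_TB [OF that] .
    show "metric_norm gE p (u + v) \<le> metric_norm gE p u + metric_norm gE p v" if "p \<in> X" "u \<in> E p" "v \<in> E p" for p u v
      using W.metric_norm_triangle(1) [OF metric that] .
    show "metric_norm gE p (- v) = metric_norm gE p v" if "p \<in> X" "v \<in> E p" for p v
      using W.metric_norm_triangle(2) [OF metric that that(2), of "-1"] by simp
    show "norm (tcoord \<A> (ch i) q v) \<le> K * metric_norm gE q v \<and> metric_norm gE q v \<le> K * norm (tcoord \<A> (ch i) q v)"
      if "i \<in> J" "q \<in> site2 i" "v \<in> E q" for i q v
      using G1 [OF that(1,2), of q] that site2_sub \<rho>(1) unfolding good_def Let_def by auto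
    show "samew j (f q) (f q')" if "i \<in> J" "j \<in> J" "q \<in> site2 i" "f q \<in> site2 j" "q' \<in> site i"
      "norm (cmap (ch i) q' - cmap (ch i) q) < \<rho>" "samew i q q'" for i j q q'
      using G [OF that(1-6)] that(7) unfolding good_def Let_def by blast
    show "\<exists>v\<in>E q. norm (cmap (ch i) q' - cmap (ch i) q - tcoord \<A> (ch i) q v) \<le> K * norm (cmap (ch i) q' - cmap (ch i) q) powr (1 + \<beta>)"
      if "i \<in> J" "q \<in> site2 i" "q' \<in> site i" "norm (cmap (ch i) q' - cmap (ch i) q) < \<rho>" "samew i q q'" for i q q'
      using G1 [OF that(1-4)] that(5) unfolding good_def Let_def by blast
  qed
  interpret ls: leafwise X f J site site1 site2 "\<lambda>i. cmap (ch i)" "\<lambda>i. tcoord \<A> (ch i)" "mderiv \<A> f"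
    "\<lambda>i j. W.fder (ch i) (ch j)" \<rho> K \<beta> Es "metric_norm gEs" sames
  proof
    show "subspace (Es p)" if "p \<in> X" for p using Ws.subspace_TB [OF that] .
    show "mderiv \<A> f p v \<in> Es (f p)" if "p \<in> X" "v \<in> Es p" for p v using Ws.mderiv_TB [OF that] .
    show "metric_norm gEs p (u + v) \<le> metric_norm gEs p u + metric_norm gEs p v" if "p \<in> X" "u \<in> Es p" "v \<in> Es p" for p u v
      using Ws.metric_norm_triangle(1) [OF metrics that] .
    show "metric_norm gEs p (- v) = metric_norm gEs p v" if "p \<in> X" "v \<in> Es p" for p v
      using Ws.metric_norm_triangle(2) [OF metrics that that(2), of "-1"] by simp
    show "norm (tcoord \<A> (ch i) q v) \<le> K * metric_norm gEs q v \<and> metric_norm gEs q v \<le> K * norm (tcoord \<A> (ch i) q v)"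
      if "i \<in> J" "q \<in> site2 i" "v \<in> Es q" for i q v
      using G1 [OF that(1,2), of q] that site2_sub \<rho>(1) unfolding good_def Let_def by auto
    show "sames j (f q) (f q')" if "i \<in> J" "j \<in> J" "q \<in> site2 i" "f q \<in> site2 j" "q' \<in> site i"
      "norm (cmap (ch i) q' - cmap (ch i) q) < \<rho>" "sames i q q'" for i j q q'
      using G [OF that(1-6)] that(7) unfolding good_def Let_def by blast
    show "\<exists>v\<in>Es q. norm (cmap (ch i) q' - cmap (ch i) q - tcoord \<A> (ch i) q v) \<le> K * norm (cmap (ch i) q' - cmap (ch i) q) powr (1 + \<beta>)"
      if "i \<in> J" "q \<in> site2 i" "q' \<in> site i" "norm (cmap (ch i) q' - cmap (ch i) q) < \<rho>" "sames i q q'" for i q q'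
      using G1 [OF that(1-4)] that(5) unfolding good_def Let_def by blast
  qed
  obtain \<kappa> \<gamma>' where \<kappa>: "0 < \<kappa>" "\<nu> + \<kappa> < 1" "\<gamma> \<le> \<gamma>' * (1 - \<gamma> * \<kappa>)" "\<gamma> \<le> \<gamma>'" "\<gamma>' < 1"
    "(g + \<kappa>) * \<gamma>' * (\<nu> + \<kappa>) powr (\<beta> / (1 + \<beta>)) < 1"
    using bunching_slack [OF W.\<beta> rates] by blast
  obtain r where r: "cd.small \<kappa> r" using cd.small_exists [OF \<kappa>(1)] by blast
  have "bunched X f J site site1 site2 (\<lambda>i. cmap (ch i)) (\<lambda>i. tcoord \<A> (ch i)) (mderiv \<A> f) (\<lambda>i j. W.fder (ch i) (ch j))
      \<rho> K \<beta> E (metric_norm gE) samew Es (metric_norm gEs) sames I \<nu> \<gamma> g (\<nu> + \<kappa>) \<gamma>' (g + \<kappa>) \<kappa> r"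
  proof
    show "E (f p) \<subseteq> mderiv \<A> f p ` E p" if p: "p \<in> X" for p
    proof (rule W.mderiv_onto [OF p])
      fix v assume v: "v \<in> E p" "mderiv \<A> f p v = 0"
      have "metric_norm gE p v \<le> \<gamma> * metric_norm gE (f p) 0" using rate_low [OF p v(1)] v(2) by simp
      then have "metric_norm gE p v \<le> 0" using lw.nrm_zero [OF W.f_X [OF p]] by simp
      then show "v = 0" using lw.nrm_eq_0 p v(1) by blast
    qed
    show "linear (I q q') \<and> I q q' ` E q = E q' \<and> (\<forall>v\<in>E q. norm (tcoord \<A> (ch i) q' (I q q' v) - tcoord \<A> (ch i) q v)
        \<le> K * norm (cmap (ch i) q' - cmap (ch i) q) powr \<beta> * norm (tcoord \<A> (ch i) q v))"
      if "i \<in> J" "q \<in> site2 i" "q' \<in> site i" "norm (cmap (ch i) q' - cmap (ch i) q) < \<rho>" for i q q'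
      using G1 [OF that] unfolding good_def Let_def by blast
  qed (use rate_s rate_low rate_up rates \<kappa> r in auto)
  then show ?thesis using that J(2) by blast
qed

end

section \<open>The foliation holonomy and the cocycle holonomy\<close>

lemma relpow_sym:
  assumes "sym R" shows "(a, b) \<in> R ^^ n \<Longrightarrow> (b, a) \<in> R ^^ n"
proof (induction n arbitrary: b)
  case (Suc n)
  then obtain c where "(a, c) \<in> R ^^ n" "(c, b) \<in> R" by auto
  then have "(c, a) \<in> R ^^ n" "(b, c) \<in> R" using Suc.IH symD [OF assms] by auto
  then show ?case by (rule relpow_Suc_I2 [rotated])
qed auto

text \<open>The bookkeeping of the final comparison, for one small displacement \<open>a\<close> from \<open>x\<close> in a leaf
  chart and the corresponding displacement \<open>b\<close> from \<open>y\<close>. In the charts of \<open>X\<close> the displacements are \<open>\<xi>\<close> at \<open>x\<close> and \<open>\<eta>\<close> at \<open>y\<close>; they are approximated to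
  first order by the images \<open>\<alpha>\<close> and \<open>B\<close> of \<open>a\<close> and \<open>b\<close> under the derivatives of the leaf charts, and
  by the images \<open>V\<close> and \<open>Wv\<close> of the tangent vectors \<open>v\<close> and \<open>w\<close>. The tangent vector of \<open>a\<close> is \<open>va\<close>;
  \<open>Tv\<close> and \<open>Ta\<close> are the images of \<open>v\<close> and \<open>va\<close> under the cocycle holonomy and \<open>G\<close> is that of \<open>Ta\<close> in
  the chart at \<open>y\<close>. So the conclusion says that \<open>B\<close> is given by the cocycle holonomy to first order.\<close>

lemma first_order_comparison:
  fixes \<xi> \<alpha> \<eta> B V Wv G :: "'e::real_normed_vector" and a b v va w Tv Ta :: "'e"
  assumes C: "1 \<le> C" and e: "0 < e" "4 * C * e \<le> 1"
    and source: "norm (\<xi> - \<alpha>) \<le> e * norm a" "norm \<alpha> \<le> C * norm a"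
      "norm (\<xi> - V) \<le> e * norm \<xi>" "norm v \<le> C * norm V" "norm (v - va) \<le> C * norm (V - \<alpha>)"
    and target: "norm (\<eta> - B) \<le> e * norm b" "norm b \<le> C * norm B"
      "norm (\<eta> - Wv) \<le> e * norm \<eta>" "norm Wv \<le> C * norm w" "norm (Wv - G) \<le> C * norm (w - Ta)"
    and holonomy: "norm (w - Tv) \<le> e * norm \<xi>" "norm Tv \<le> C * norm v" "norm (Tv - Ta) \<le> C * norm (v - va)"
  shows "norm (B - G) \<le> 50 * C ^ 5 * e * norm a"
proof -
  have C0: "0 \<le> C" using C by simp
  have "e \<le> C * e" using mult_right_mono [OF C, of e] e(1) by simp
  then have eC: "e \<le> 1/4" using e(2) by linarith
  have mul: "C * s \<le> C * t" if "s \<le> t" for s t using mult_left_mono [OF that C0] .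
  have n0: "0 \<le> norm a" "0 \<le> norm b" "0 \<le> norm \<xi>" "0 \<le> norm \<eta>" by auto
  have ge: "s \<le> C * s" if "0 \<le> s" for s using mult_right_mono [OF C that] by simp
  have esm: "e * s \<le> s / 4" if "0 \<le> s" for s using mult_right_mono [OF eC that] by simp
  have \<xi>: "norm \<xi> \<le> 2 * C * norm a"
  proof -
    have "norm \<xi> \<le> norm \<alpha> + norm (\<xi> - \<alpha>)" using norm_triangle_ineq [of \<alpha> "\<xi> - \<alpha>"] by simp
    also have "\<dots> \<le> C * norm a + norm a" using source(1,2) esm [OF n0(1)] n0(1) by linarith
    finally show ?thesis using ge [OF n0(1)] by simp
  qed
  have v: "norm v \<le> 2 * C * norm \<xi>"
  proof -
    have "norm V \<le> norm \<xi> + norm (\<xi> - V)" using norm_triangle_ineq4 [of \<xi> "\<xi> - V"] by simp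
    also have "\<dots> \<le> 2 * norm \<xi>" using source(3) esm [OF n0(3)] n0(3) by linarith
    finally show ?thesis using source(4) mul [of "norm V" "2 * norm \<xi>"] by linarith
  qed
  have w: "norm w \<le> 3 * C\<^sup>2 * norm \<xi>"
  proof -
    have "norm w \<le> norm Tv + norm (w - Tv)" using norm_triangle_ineq [of Tv "w - Tv"] by simp
    also have "\<dots> \<le> C * (2 * C * norm \<xi>) + norm \<xi>" using holonomy(1,2) mul [OF v] esm [OF n0(3)] n0(3) by linarith
    also have "\<dots> \<le> C * (2 * C * norm \<xi>) + C * (C * norm \<xi>)" using ge [OF n0(3)] ge [of "C * norm \<xi>"] C0 n0(3) by simp
    finally show ?thesis by (simp add: power2_eq_square algebra_simps)
  qed
  have \<eta>: "norm \<eta> \<le> 6 * C ^ 3 * norm \<xi>"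
  proof -
    have "norm \<eta> \<le> norm Wv + norm (\<eta> - Wv)" using norm_triangle_ineq [of Wv "\<eta> - Wv"] by simp
    also have "\<dots> \<le> C * (3 * C\<^sup>2 * norm \<xi>) + norm \<eta> / 2" using target(3,4) mul [OF w] esm [OF n0(4)] n0(4) by linarith
    finally show ?thesis by (simp add: power2_eq_square power3_eq_cube algebra_simps)
  qed
  have b: "norm b \<le> 12 * C ^ 4 * norm \<xi>"
  proof -
    have "norm B \<le> norm \<eta> + norm (\<eta> - B)" using norm_triangle_ineq4 [of \<eta> "\<eta> - B"] by simp
    also have "\<dots> \<le> norm \<eta> + e * norm b" using target(1) by simp
    finally have "norm b \<le> C * (norm \<eta> + e * norm b)" using target(2) mul order_trans by blast
    also have "\<dots> = C * norm \<eta> + (4 * C * e) * norm b / 4" by (simp add: algebra_simps)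
    also have "\<dots> \<le> C * norm \<eta> + norm b / 4" using mult_right_mono [OF e(2) n0(2)] by simp
    also have "\<dots> \<le> C * norm \<eta> + norm b / 2" using n0 by simp
    finally have "norm b \<le> 2 * (C * norm \<eta>)" by simp
    also have "\<dots> \<le> 2 * (C * (6 * C ^ 3 * norm \<xi>))" by (rule mult_left_mono [OF mul [OF \<eta>]]) simp
    finally show ?thesis by (simp add: eval_nat_numeral algebra_simps)
  qed
  have vv: "norm (v - va) \<le> C * (3 * C * e * norm a)"
  proof -
    have "norm (V - \<alpha>) \<le> norm (\<xi> - \<alpha>) + norm (\<xi> - V)" using norm_triangle_ineq4 [of "\<xi> - \<alpha>" "\<xi> - V"] by simp
    also have "\<dots> \<le> e * norm a + e * (2 * C * norm a)"
      using source(1,3) mult_left_mono [OF \<xi> less_imp_le [OF e(1)]] by linarith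
    also have "\<dots> \<le> C * (e * norm a) + e * (2 * C * norm a)" using ge [of "e * norm a"] e(1) by simp
    finally have "norm (V - \<alpha>) \<le> 3 * C * e * norm a" by (simp add: algebra_simps)
    then show ?thesis using source(5) mul order_trans by blast
  qed
  have wT: "norm (w - Ta) \<le> e * norm \<xi> + C * (C * (3 * C * e * norm a))"
    using norm_triangle_ineq [of "w - Tv" "Tv - Ta"] holonomy(1,3) mul [OF vv] by auto
  have pw: "C ^ i * norm a \<le> C ^ 5 * norm a" if "i \<le> 5" for i
    using power_increasing [OF that C] by (simp add: mult_right_mono)
  have "norm (B - G) \<le> norm (\<eta> - B) + norm (\<eta> - Wv) + norm (Wv - G)"
    using norm_triangle_ineq4 [of "\<eta> - Wv + (Wv - G)" "\<eta> - B"] norm_triangle_ineq [of "\<eta> - Wv" "Wv - G"] by simp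
  also have "\<dots> \<le> e * (12 * C ^ 4 * norm \<xi>) + e * (6 * C ^ 3 * norm \<xi>) + C * (e * norm \<xi> + C * (C * (3 * C * e * norm a)))"
    using target(1,3,5) mult_left_mono [OF b less_imp_le [OF e(1)]] mult_left_mono [OF \<eta> less_imp_le [OF e(1)]]
      mul [OF wT] by linarith
  also have "\<dots> = e * ((12 * C ^ 4 + 6 * C ^ 3 + C) * norm \<xi> + 3 * (C ^ 4 * norm a))"
    by (simp add: eval_nat_numeral algebra_simps)
  also have "\<dots> \<le> e * ((12 * C ^ 4 + 6 * C ^ 3 + C) * (2 * C * norm a) + 3 * (C ^ 4 * norm a))"
    using e(1) C0 by (intro mult_left_mono add_right_mono \<xi>) auto
  also have "\<dots> = e * (24 * (C ^ 5 * norm a) + 12 * (C ^ 4 * norm a) + 2 * (C ^ 2 * norm a) + 3 * (C ^ 4 * norm a))"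
    by (simp add: eval_nat_numeral algebra_simps)
  also have "\<dots> \<le> e * (50 * (C ^ 5 * norm a))"
  proof (rule mult_left_mono [OF _ less_imp_le [OF e(1)]])
    have "0 \<le> C ^ 5 * norm a" using C0 by simp
    then show "24 * (C ^ 5 * norm a) + 12 * (C ^ 4 * norm a) + 2 * (C ^ 2 * norm a) + 3 * (C ^ 4 * norm a)
        \<le> 50 * (C ^ 5 * norm a)"
      using pw [of 4] pw [of 2] by linarith
  qed
  finally show ?thesis by (simp add: algebra_simps)
qed

lemma local_holonomyE:
  fixes \<W> \<W>s \<V> :: "('a::t2_space, 'e::euclidean_space) fbox set"
  assumes h: "local_holonomy \<W> \<W>s \<V> x y N H"
  obtains \<sigma> where "openin (leaf_topology \<W>) N" "x \<in> N" "N \<subseteq> leaf \<W> x" "H x = y"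
    "\<forall>z\<in>N. \<sigma> 0 z = z \<and> \<sigma> 1 z = H z"
    "\<forall>t\<in>{0..1}. \<forall>z\<in>N. \<sigma> t z \<in> leaf \<W>s z \<inter> leaf \<W> (\<sigma> t x)"
    "\<forall>z\<in>N. continuous_map (top_of_set {0..1}) (leaf_topology \<W>s) (\<lambda>t. \<sigma> t z)"
    "\<forall>t\<in>{0..1}. continuous_map (subtopology (leaf_topology \<W>) N) (leaf_topology \<W>) (\<sigma> (t::real))"
    "continuous_map (prod_topology (top_of_set {0..1}) (subtopology (leaf_topology \<W>) N)) (leaf_topology \<V>) (\<lambda>(t, z). \<sigma> t z)"
proof -
  note h' = h [unfolded local_holonomy_def]
  note c = conjunct1 [OF h'] conjunct1 [OF conjunct2 [OF h']] conjunct1 [OF conjunct2 [OF conjunct2 [OF h']]]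
    conjunct1 [OF conjunct2 [OF conjunct2 [OF conjunct2 [OF h']]]]
  from conjunct2 [OF conjunct2 [OF conjunct2 [OF conjunct2 [OF h']]]]
  show ?thesis
  proof (elim exE conjE)
    fix \<sigma>
    assume s: "\<forall>z\<in>N. \<sigma> 0 z = z \<and> \<sigma> 1 z = H z"
      "\<forall>t\<in>{0..1}. \<forall>z\<in>N. \<sigma> t z \<in> leaf \<W>s z \<inter> leaf \<W> (\<sigma> t x)"
      "\<forall>z\<in>N. continuous_map (top_of_set {0..1}) (leaf_topology \<W>s) (\<lambda>t. \<sigma> t z)"
      "\<forall>t\<in>{0..1}. continuous_map (subtopology (leaf_topology \<W>) N) (leaf_topology \<W>) (\<sigma> (t::real))"
      "continuous_map (prod_topology (top_of_set {0..1}) (subtopology (leaf_topology \<W>) N)) (leaf_topology \<V>) (\<lambda>(t, z). \<sigma> t z)"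
    show ?thesis by (rule that [of \<sigma>, OF c s])
  qed
qed

text \<open>The constants and the finite set of sites of \<open>bunched_exists\<close> are fixed.\<close>

locale hyperbolic_holonomy =
  partially_hyperbolic X \<A> \<beta> f k l \<W> \<W>s gE gEs I \<nu> \<gamma> g + joint_foliation X k l m \<W> \<W>s \<V>
  for X :: "'a::t2_space set" and \<A> :: "('a, 'e::euclidean_space) chart set" and \<beta> :: real and f :: "'a \<Rightarrow> 'a"
    and k l m :: nat and \<W> \<W>s \<V> :: "('a, 'e) fbox set"
    and gE gEs :: "'a \<Rightarrow> 'e \<Rightarrow> 'e \<Rightarrow> real" and I :: "'a \<Rightarrow> 'a \<Rightarrow> 'e \<Rightarrow> 'e" and \<nu> \<gamma> g :: real +
  fixes J :: "'a set" and \<rho> K \<nu>' \<gamma>' g' \<kappa> r :: real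
  assumes J_X: "J \<subseteq> X"
    and bunched: "bunched X f J site site1 site2 (\<lambda>i. cmap (ch i)) (\<lambda>i. tcoord \<A> (ch i)) (mderiv \<A> f)
      (\<lambda>i j. W.fder (ch i) (ch j)) \<rho> K \<beta> E (metric_norm gE) samew Es (metric_norm gEs) sames I \<nu> \<gamma> g \<nu>' \<gamma>' g' \<kappa> r"
begin

sublocale b: bunched X f J site site1 site2 "\<lambda>i. cmap (ch i)" "\<lambda>i. tcoord \<A> (ch i)" "mderiv \<A> f"
  "\<lambda>i j. W.fder (ch i) (ch j)" \<rho> K \<beta> E "metric_norm gE" samew Es "metric_norm gEs" sames I \<nu> \<gamma> g \<nu>' \<gamma>' g' \<kappa> r
  by (rule bunched)

lemma near_local:
  assumes p: "p \<in> X"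
  obtains U B where "openin (top_of_set X) U" "p \<in> U" "B \<in> \<W>s" "U \<subseteq> bdom B"
    "\<And>q q'. q \<in> U \<Longrightarrow> q' \<in> U \<Longrightarrow> q' \<in> plaque B q \<Longrightarrow> (q, q') \<in> b.near"
proof -
  obtain i where i: "i \<in> J" "p \<in> site1 i" using b.u.core [OF p] by blast
  have iX: "i \<in> X" using i J_X by blast
  \<comment> \<open>Two points within \<open>d\<close> of \<open>p\<close> have distance at most \<open>2 * d\<close>, and \<open>4 * K ^ 3 * (2 * d) \<le> r\<close>.\<close>
  define d where "d = min \<rho> (r / (8 * K ^ 3))"
  have d: "0 < d" "d \<le> \<rho>" "d \<le> r / (8 * K ^ 3)" using b.\<rho>0 b.r0 b.K0 by (auto simp: d_def)
  let ?\<phi> = "cmap (ch i)"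
  let ?U = "{q \<in> site i. dist (?\<phi> p) (?\<phi> q) < d}"
  have ps: "p \<in> site i" using i(2) by (simp add: site1_def)
  show ?thesis
  proof (rule that [of ?U "bs i"])
    show "openin (top_of_set X) ?U" by (rule openin_near [OF iX ps])
    show "p \<in> ?U" using ps d by simp
    show "bs i \<in> \<W>s" by (rule bs(1) [OF iX])
    show "?U \<subseteq> bdom (bs i)" using site_bs by blast
    fix q q' assume q: "q \<in> ?U" "q' \<in> ?U" "q' \<in> plaque (bs i) q"
    have K2: "s \<in> site2 i" if "s \<in> ?U" for s
      using b.u.margin [OF i(1,2)] that d(2) by (simp add: dist_norm norm_minus_commute)
    have "dist (?\<phi> q') (?\<phi> q) \<le> 2 * d" using q(1,2) dist_triangle3 [of "?\<phi> q'" "?\<phi> q" "?\<phi> p"] by auto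
    then have "norm (?\<phi> q' - ?\<phi> q) \<le> r / (4 * K ^ 3)" using d(3) by (simp add: dist_norm)
    then have "4 * K ^ 3 * norm (?\<phi> q' - ?\<phi> q) \<le> r" using b.K0 by (simp add: field_simps)
    moreover have "q \<in> plaque (bs i) q'"
      using Ws.plaque_sym [OF bs(1) [OF iX] _ q(3)] q(1) site_bs by blast
    ultimately show "(q, q') \<in> b.near" using K2 [OF q(1)] K2 [OF q(2)] i(1) q(3) by (auto simp: b.near_def sames_def)
  qed
qed

text \<open>Over a short interval of times the points of a neighbourhood of \<open>x\<close> move within a small set as in
  \<open>near_local\<close>; moving continuously in its leaf, each of them stays in one plaque there, near its
  former position. So, that the positions at two times are joined by chains of some common length is
  an equivalence relation on \<open>{0..1}\<close> with open classes, and \<open>{0..1}\<close> is connected.\<close>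

lemma sliding_chain:
  assumes N: "openin TW N" "x \<in> N"
    and path: "\<And>z. z \<in> N \<Longrightarrow> continuous_map TI TWs (\<lambda>t. \<sigma> t z)"
    and cont: "continuous_map (prod_topology TI (subtopology TW N)) TV (\<lambda>(t, z). \<sigma> t z)"
  shows "\<exists>L N'. openin TW N' \<and> x \<in> N' \<and> N' \<subseteq> N \<and> (\<forall>z\<in>N'. (\<sigma> 0 z, \<sigma> 1 z) \<in> b.near ^^ L)"
proof -
  define R where "R t t' \<longleftrightarrow> (\<exists>L N'. openin TW N' \<and> x \<in> N' \<and> N' \<subseteq> N \<and> (\<forall>z\<in>N'. (\<sigma> t z, \<sigma> t' z) \<in> b.near ^^ L))" for t t'
  have NX: "N \<subseteq> X" using openin_subset [OF N(1)] by simp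
  have "R 0 1"
  proof (rule connected_equivalence_relation [of "{0..1::real}"])
    show "connected {0..1::real}" "0 \<in> {0..1::real}" "1 \<in> {0..1::real}" by auto
    show "R t' t" if "R t t'" for t t'
    proof -
      obtain L N' where "openin TW N'" "x \<in> N'" "N' \<subseteq> N" "\<forall>z\<in>N'. (\<sigma> t z, \<sigma> t' z) \<in> b.near ^^ L"
        using \<open>R t t'\<close> unfolding R_def by blast
      moreover have "\<forall>z\<in>N'. (\<sigma> t' z, \<sigma> t z) \<in> b.near ^^ L"
      proof
        fix z assume "z \<in> N'"
        then have "(\<sigma> t z, \<sigma> t' z) \<in> b.near ^^ L" using calculation by simp
        then show "(\<sigma> t' z, \<sigma> t z) \<in> b.near ^^ L" by (rule relpow_sym [OF b.sym_near])
      qed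
      ultimately show ?thesis unfolding R_def by (intro exI [of _ L] exI [of _ N'] conjI)
    qed
    show "R t t''" if "R t t'" "R t' t''" for t t' t''
    proof -
      obtain L N' where 1: "openin TW N'" "x \<in> N'" "N' \<subseteq> N" "\<forall>z\<in>N'. (\<sigma> t z, \<sigma> t' z) \<in> b.near ^^ L"
        using \<open>R t t'\<close> unfolding R_def by blast
      obtain L' N'' where 2: "openin TW N''" "x \<in> N''" "N'' \<subseteq> N" "\<forall>z\<in>N''. (\<sigma> t' z, \<sigma> t'' z) \<in> b.near ^^ L'"
        using \<open>R t' t''\<close> unfolding R_def by blast
      have "\<forall>z\<in>N' \<inter> N''. (\<sigma> t z, \<sigma> t'' z) \<in> b.near ^^ (L + L')"
        using 1(4) 2(4) by (auto simp: relpow_add)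
      then show ?thesis
        unfolding R_def using openin_Int [OF 1(1) 2(1)] 1(2,3) 2(2)
        by (intro exI [of _ "L + L'"] exI [of _ "N' \<inter> N''"]) auto
    qed
    fix t0 :: real assume t0: "t0 \<in> {0..1}"
    let ?h = "\<lambda>(t, z). \<sigma> t z"
    have conth: "continuous_map (prod_topology TI (subtopology TW N)) (top_of_set X) ?h"
      by (rule V.continuous_map_leaf_finer [OF cont])
    have top: "topspace (prod_topology TI (subtopology TW N)) = {0..1} \<times> N"
      using NX by (auto simp: topspace_subtopology)
    have sX: "\<sigma> t z \<in> X" if "t \<in> {0..1}" "z \<in> N" for t z
    proof -
      have "(t, z) \<in> topspace (prod_topology TI (subtopology TW N))" unfolding top using that by simp
      then have "?h (t, z) \<in> topspace (top_of_set X)"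
        using continuous_map_image_subset_topspace [OF conth] by blast
      then show ?thesis by simp
    qed
    obtain U B where U: "openin (top_of_set X) U" "\<sigma> t0 x \<in> U" "B \<in> \<W>s" "U \<subseteq> bdom B"
      "\<And>q q'. q \<in> U \<Longrightarrow> q' \<in> U \<Longrightarrow> q' \<in> plaque B q \<Longrightarrow> (q, q') \<in> b.near"
      using near_local [OF sX [OF t0 N(2)]] by metis
    let ?P = "{u \<in> {0..1} \<times> N. ?h u \<in> U}"
    have "openin (prod_topology TI (subtopology TW N)) ?P"
      using openin_continuous_map_preimage [OF conth U(1)] unfolding top .
    moreover have "(t0, x) \<in> ?P" using t0 N(2) U(2) by simp
    ultimately obtain T0 N0 where T0: "openin TI T0" "openin (subtopology TW N) N0" "t0 \<in> T0" "x \<in> N0" "T0 \<times> N0 \<subseteq> ?P"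
      unfolding openin_prod_topology_alt by meson
    have N0: "openin TW N0" "N0 \<subseteq> N"
      using T0(2) N(1) by (auto simp: openin_open_subtopology)
    obtain d where d: "0 < d" "ball t0 d \<inter> {0..1} \<subseteq> T0"
      using T0(1,3) by (auto simp: openin_contains_ball)
    let ?T = "{0..1} \<inter> ball t0 d"
    have "(\<sigma> t0 z, \<sigma> t z) \<in> b.near" if t: "t \<in> ?T" and z: "z \<in> N0" for t z
    proof -
      have tT: "t \<in> T0" using t d(2) by blast
      have mem: "\<sigma> s z \<in> U" if "s \<in> ?T" for s
      proof -
        have "(s, z) \<in> T0 \<times> N0" using that d(2) z by blast
        then have "(s, z) \<in> ?P" by (rule subsetD [OF T0(5)])
        then show ?thesis by simp
      qed
      have conn: "connectedin TI ?T"
        by (auto simp: connectedin_subtopology intro!: convex_connected convex_Int)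
      have zN: "z \<in> N" using z N0(2) by (rule subsetD [rotated])
      have "connectedin TWs ((\<lambda>s. \<sigma> s z) ` ?T)"
        by (rule connectedin_continuous_map_image [OF path [OF zN] conn])
      moreover have "(\<lambda>s. \<sigma> s z) ` ?T \<subseteq> bdom B" using mem U(4) by blast
      moreover have t0T: "t0 \<in> ?T" using t0 d(1) by simp
      then have "\<sigma> t0 z \<in> (\<lambda>s. \<sigma> s z) ` ?T" by (rule imageI)
      ultimately have "(\<lambda>s. \<sigma> s z) ` ?T \<subseteq> plaque B (\<sigma> t0 z)"
        using Ws.connected_in_plaque U(3) by blast
      then have "\<sigma> t z \<in> plaque B (\<sigma> t0 z)" using t by blast
      then show ?thesis using U(5) mem t t0T by blast
    qed
    then have "R t0 t" if "t \<in> ?T" for t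
      unfolding R_def using N0 T0(4) that by (intro exI [of _ "1::nat"] exI [of _ N0]) auto
    moreover have "openin TI ?T" by (auto simp: openin_open)
    ultimately show "\<exists>T. openin TI T \<and> t0 \<in> T \<and> (\<forall>t\<in>T. R t0 t)"
      using t0 d(1) by (intro exI [of _ ?T]) auto
  qed
  then show ?thesis by (simp add: R_def)
qed

lemma holonomy_chain:
  assumes "local_holonomy \<W> \<W>s \<V> x y N H"
  obtains L N' where "openin TW N'" "x \<in> N'" "N' \<subseteq> N" "\<And>z. z \<in> N' \<Longrightarrow> (z, H z) \<in> b.near ^^ L"
proof -
  obtain \<sigma> where N: "openin TW N" "x \<in> N" and s: "\<forall>z\<in>N. \<sigma> 0 z = z \<and> \<sigma> 1 z = H z"
      "\<forall>z\<in>N. continuous_map TI TWs (\<lambda>t. \<sigma> t z)"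
      "continuous_map (prod_topology TI (subtopology TW N)) TV (\<lambda>(t, z). \<sigma> t z)"
    using assms unfolding local_holonomy_def by blast
  obtain L N' where "openin TW N'" "x \<in> N'" "N' \<subseteq> N" "\<forall>z\<in>N'. (\<sigma> 0 z, \<sigma> 1 z) \<in> b.near ^^ L"
    using sliding_chain [OF N bspec [OF s(2)] s(3)] by blast
  moreover have "(z, H z) \<in> b.near ^^ L" if "z \<in> N'" for z
    using bspec [OF calculation(4) that] bspec [OF s(1) subsetD [OF calculation(3) that]] by simp
  ultimately show ?thesis by (intro that [of N' L])
qed

text \<open>Points of a leaf are joined by chains, as the leaf is traversed by holonomies.\<close>

lemma leaf_chain:
  assumes "x \<in> X" "y \<in> leaf \<W>s x" obtains L where "(x, y) \<in> b.near ^^ L"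
proof -
  obtain N H where h: "local_holonomy \<W> \<W>s \<V> x y N H" using local_holonomy_exists [OF assms] by blast
  moreover have "H x = y" using h by (simp add: local_holonomy_def)
  ultimately show ?thesis using that holonomy_chain [OF h] by metis
qed

lemma cocycle_holonomy_Hol:
  "cocycle_holonomy_seq \<A> E f I x y v = (\<lambda>n. b.Hseq x y n v)" "cocycle_holonomy \<A> E f I x y = b.Hol x y"
proof -
  have it: "cocycle_iter \<A> f n p = b.u.iter n p" for n p by (induction n) simp_all
  have seq: "cocycle_holonomy_seq \<A> E f I x y v = (\<lambda>n. b.Hseq x y n v)" for v
    by (simp add: fun_eq_iff cocycle_holonomy_seq_def b.Hseq_def it)
  then show "cocycle_holonomy_seq \<A> E f I x y v = (\<lambda>n. b.Hseq x y n v)" .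
  show "cocycle_holonomy \<A> E f I x y = b.Hol x y"
    by (rule ext) (simp add: cocycle_holonomy_def b.Hol_def seq)
qed

text \<open>Let \<open>z\<close> be a point near \<open>x\<close> in its plaque. By \<open>holonomy_derivative\<close>, tangent vectors at \<open>x\<close> and
  \<open>y\<close> that represent the displacements to \<open>z\<close> and \<open>H z\<close> are related by the cocycle holonomy up to a
  small relative error. The rest passes from displacements to leaf charts.\<close>

theorem holonomy_has_derivative:
  assumes x: "x \<in> X" and h: "local_holonomy \<W> \<W>s \<V> x y N H"
  shows "leaf_has_derivative \<A> \<W> H x (b.Hol x y)"
  unfolding leaf_has_derivative_def
proof (intro ballI impI)
  fix B B' assume B: "B \<in> \<W>" and B': "B' \<in> \<W>" and "x \<in> bdom B \<and> H x \<in> bdom B'"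
  from h obtain \<sigma> where N: "openin TW N" "x \<in> N" "N \<subseteq> leaf \<W> x" and Hx: "H x = y"
    and s: "\<forall>z\<in>N. \<sigma> 0 z = z \<and> \<sigma> 1 z = H z"
      "\<forall>t\<in>{0..1}. \<forall>z\<in>N. \<sigma> t z \<in> leaf \<W>s z \<inter> leaf \<W> (\<sigma> t x)"
      "\<forall>z\<in>N. continuous_map TI TWs (\<lambda>t. \<sigma> t z)"
      "\<forall>t\<in>{0..1}. continuous_map (subtopology TW N) TW (\<sigma> t)"
      "continuous_map (prod_topology TI (subtopology TW N)) TV (\<lambda>(t, z). \<sigma> t z)"
    by (rule local_holonomyE)
  have xB: "x \<in> bdom B" and yB': "y \<in> bdom B'" using \<open>x \<in> bdom B \<and> H x \<in> bdom B'\<close> Hx by auto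
  have y: "y \<in> X" using W.bdom_subset [OF B'] yB' by blast
  obtain n N' where N': "openin TW N'" "x \<in> N'" "N' \<subseteq> N" "\<And>z. z \<in> N' \<Longrightarrow> (z, H z) \<in> b.near ^^ n"
    using holonomy_chain [OF h] by metis
  have xy: "(x, y) \<in> b.near ^^ n" using N'(4) [OF N'(2)] Hx by simp
  obtain ix where ix: "ix \<in> J" "x \<in> site1 ix" using b.u.core [OF x] by blast
  obtain iy where iy: "iy \<in> J" "y \<in> site1 iy" using b.u.core [OF y] by blast
  have iX: "ix \<in> X" "iy \<in> X" using ix iy J_X by auto
  have K2: "x \<in> site2 ix" "y \<in> site2 iy" using b.u.K1_K2 ix iy by auto
  have st: "x \<in> site ix" "y \<in> site iy" using K2 site2_sub by auto
  let ?cx = "ch ix" and ?cy = "ch iy" and ?u = "bmap B x" and ?u' = "bmap B' y" and ?L = "bdir B" and ?L' = "bdir B'"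
  let ?\<phi> = "cmap ?cx" and ?\<psi> = "cmap ?cy" and ?tx = "tcoord \<A> ?cx x" and ?ty = "tcoord \<A> ?cy y" and ?T = "b.Hol x y"
  let ?Dx = "W.lder B ?cx ?u" and ?Dy = "W.lder B' ?cy ?u'"
  have cx: "?cx \<in> \<A>" "x \<in> cdom ?cx" and cy: "?cy \<in> \<A>" "y \<in> cdom ?cy"
    using chi(1) [OF iX(1)] chi(1) [OF iX(2)] st site_cdom by auto
  have xBc: "x \<in> bdom B \<inter> cdom ?cx" and yBc: "y \<in> bdom B' \<inter> cdom ?cy" using xB yB' cx cy by auto
  have uS: "?u \<in> bmap B ` (bdom B \<inter> cdom ?cx)" and u'S: "?u' \<in> bmap B' ` (bdom B' \<inter> cdom ?cy)"
    using xBc yBc by auto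
  note L = W.subspace_bdir [OF B] and L' = W.subspace_bdir [OF B']
  note tx = W.linear_tcoord [OF cx] W.inj_tcoord [OF cx] and ty = W.linear_tcoord [OF cy] W.inj_tcoord [OF cy]
  note Dx = W.linear_lder [OF B cx(1) uS] and Dy = W.linear_lder [OF B' cy(1) u'S]
  note Ex = W.subspace_TB [OF x] and Ey = W.subspace_TB [OF y]
  have Tin: "?T v \<in> E y" if "v \<in> E x" for v using b.Hol_in [OF x xy that] .
  have Tadd: "?T (v + w) = ?T v + ?T w" if "v \<in> E x" "w \<in> E x" for v w
    using b.Hol_linear [OF x xy that, of 1 1] by simp
  have Tscale: "?T (c *\<^sub>R v) = c *\<^sub>R ?T v" if "v \<in> E x" for c v
    using b.Hol_linear [OF x xy that that, of c 0] by simp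
  have Tdiff: "?T (v - w) = ?T v - ?T w" if "v \<in> E x" "w \<in> E x" for v w
    using b.Hol_linear [OF x xy that, of 1 "-1"] by simp
  \<comment> \<open>The derivative \<open>M\<close> is the cocycle holonomy in leaf charts. The projection extends it linearly
    to the whole space, as required of a derivative within a subspace.\<close>
  define va where "va a = leaf_tangent \<A> B x (proj ?L a)" for a
  have va: "va a \<in> E x" "?tx (va a) = ?Dx (proj ?L a)" for a
    using B xB proj_props(2) [OF L] W.leaf_tangent_coord [OF B cx(1) xBc] by (auto simp: va_def tangent_bundle_def)
  have va_lin: "va (a + b) = va a + va b" "va (c *\<^sub>R a) = c *\<^sub>R va a" for a b c
    by (rule injD [OF tx(2)]; simp add: va linear_add [OF tx(1)] linear_scale [OF tx(1)]
        linear_add [OF Dx] linear_scale [OF Dx] linear_add [OF proj_props(1) [OF L]] linear_scale [OF proj_props(1) [OF L]])+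
  define G where "G a = ?ty (?T (va a))" for a
  have G_lin: "G (a + b) = G a + G b" "G (c *\<^sub>R a) = c *\<^sub>R G a" for a b c
    by (simp_all add: G_def va va_lin Tadd Tscale linear_add [OF ty(1)] linear_scale [OF ty(1)])
  have G_in: "G a \<in> ?Dy ` ?L'" for a
    unfolding W.TB_coord [OF B' cy(1) yBc, symmetric] G_def by (intro imageI Tin va)
  define M where "M a = inv_into ?L' ?Dy (G a)" for a
  have M: "M a \<in> ?L'" "?Dy (M a) = G a" for a
    using inv_into_into [OF G_in] f_inv_into_f [OF G_in] by (auto simp: M_def)
  note Dy_inj = inj_onD [OF W.lder_props(2) [OF B' cy(1) u'S]]
  have M_lin: "linear M"
  proof (rule linearI)
    show "M (a + b) = M a + M b" for a b
      by (rule Dy_inj) (simp_all add: M G_lin linear_add [OF Dy] subspace_add [OF L'])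
    show "M (c *\<^sub>R a) = c *\<^sub>R M a" for c a
      by (rule Dy_inj) (simp_all add: M G_lin linear_scale [OF Dy] subspace_scale [OF L'])
  qed
  have tangent: "?T (leaf_tangent \<A> B x a) = leaf_tangent \<A> B' (H x) (M a)" if "a \<in> ?L" for a
  proof (rule injD [OF ty(2)])
    show "?ty (?T (leaf_tangent \<A> B x a)) = ?ty (leaf_tangent \<A> B' (H x) (M a))"
      using W.leaf_tangent_coord [OF B' cy(1) yBc M(1) [of a]] M(2) [of a] proj_id [OF L that]
      by (simp add: Hx G_def va_def)
  qed
  obtain c1 where c1: "0 < c1" "\<And>a. norm (?Dx a) \<le> c1 * norm a"
    using linear_bounded_pos [OF Dx] by (metis mult.commute)
  obtain c2 where c2: "0 < c2" "\<And>v. c2 * norm v \<le> norm (?tx v)"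
    using linear_inj_bounded_below_pos [OF tx] by (metis mult.commute)
  obtain c3 where c3: "0 < c3" "\<And>a. a \<in> ?L' \<Longrightarrow> c3 * norm a \<le> norm (?Dy a)"
    using W.lder_lower [OF B' cy(1) u'S] by metis
  obtain c4 where c4: "0 < c4" "\<And>w. norm (?ty w) \<le> c4 * norm w"
    using linear_bounded_pos [OF ty(1)] by (metis mult.commute)
  obtain c5 where c5: "0 < c5" "\<And>v. v \<in> E x \<Longrightarrow> norm (?T v) \<le> c5 * norm v"
  proof -
    have "linear (\<lambda>v. ?T (proj (E x) v))"
      by (rule linearI) (simp_all add: linear_add [OF proj_props(1) [OF Ex]] linear_scale [OF proj_props(1) [OF Ex]]
          Tadd Tscale proj_props(2) [OF Ex])
    then obtain c where c: "0 < c" "\<And>v. norm (?T (proj (E x) v)) \<le> c * norm v"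
      by (rule linear_bounded_pos) blast
    have "norm (?T v) \<le> c * norm v" if "v \<in> E x" for v using c(2) [of v] proj_id [OF Ex that] by simp
    then show ?thesis using that c(1) by blast
  qed
  define C where "C = 1 + c1 + 1 / c2 + 1 / c3 + c4 + c5"
  have pos: "0 < 1 / c2" "0 < 1 / c3" using c2 c3 by auto
  have C: "1 \<le> C" "c1 \<le> C" "1 / c2 \<le> C" "1 / c3 \<le> C" "c4 \<le> C" "c5 \<le> C"
    using c1(1) c4(1) c5(1) pos unfolding C_def by linarith+
  have le: "s \<le> C * t" if "s \<le> c * t" "c \<le> C" "0 \<le> t" for s c t
    using that mult_right_mono [OF that(2,3)] by linarith
  have b2: "norm v \<le> C * norm (?tx v)" for v
    using c2(2) [of v] c2(1) by (intro le [OF _ C(3)]) (auto simp: field_simps)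
  have b3: "norm a \<le> C * norm (?Dy a)" if "a \<in> ?L'" for a
    using c3(2) [OF that] c3(1) by (intro le [OF _ C(4)]) (auto simp: field_simps)
  have "((\<lambda>a. bmap B' (H (binv B (?u + a)))) has_derivative M) (at 0 within ?L)"
    unfolding has_derivative_within_alt
  proof (intro conjI allI impI)
    show "bounded_linear M" using M_lin by (simp add: linear_conv_bounded_linear)
    fix e :: real assume e: "0 < e"
    define e1 where "e1 = min (1 / (4 * C)) (e / (50 * C ^ 6))"
    have e1: "0 < e1" "4 * C * e1 \<le> 1" "50 * C ^ 6 * e1 \<le> e"
    proof -
      have "e1 \<le> 1 / (4 * C)" "e1 \<le> e / (50 * C ^ 6)" by (auto simp: e1_def)
      then show "4 * C * e1 \<le> 1" "50 * C ^ 6 * e1 \<le> e" using C(1) by (simp_all add: field_simps)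
      show "0 < e1" using C(1) e by (simp add: e1_def)
    qed
    \<comment> \<open>Below \<open>\<delta>2\<close> the error of order \<open>1 + \<beta>\<close> in representing displacements by tangent vectors is at
      most \<open>e1\<close> times the displacement.\<close>
    define \<delta>2 where "\<delta>2 = (e1 / K) powr (1 / \<beta>)"
    have \<delta>2: "0 < \<delta>2" using e1(1) b.K0 by (simp add: \<delta>2_def)
    have sm: "K * t powr (1 + \<beta>) \<le> e1 * t" if "0 \<le> t" "t < \<delta>2" for t
    proof -
      have "t powr \<beta> \<le> \<delta>2 powr \<beta>" using that b.\<beta>0 by (intro powr_mono2) auto
      also have "\<dots> = e1 / K" using e1(1) b.K0 b.\<beta>0 by (simp add: \<delta>2_def powr_powr)
      finally have "K * t powr \<beta> \<le> e1" using b.K0 by (simp add: field_simps)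
      then have "t * (K * t powr \<beta>) \<le> t * e1" using that(1) by (rule mult_left_mono)
      then show ?thesis using that(1) by (simp add: powr_one_plus mult_ac)
    qed
    obtain \<delta> where \<delta>: "0 < \<delta>" and hol: "\<forall>z z' v w. z \<in> site ix \<and> samew ix x z \<and> norm (?\<phi> z - ?\<phi> x) < \<delta> \<and> ?\<phi> z \<noteq> ?\<phi> x \<and>
        z' \<in> site iy \<and> samew iy y z' \<and> norm (?\<psi> z' - ?\<psi> y) < \<delta> \<and> (z, z') \<in> b.near ^^ n \<and>
        b.u.approx ix x z v \<and> b.u.approx iy y z' w \<longrightarrow> norm (w - ?T v) \<le> e1 * norm (?\<phi> z - ?\<phi> x)"
      using b.holonomy_derivative [OF x xy ix(1) K2(1) iy(1) K2(2) e1(1)] by blast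
    obtain Nx where Nx: "openin (top_of_set X) Nx" "x \<in> Nx"
      "\<forall>q\<in>Nx. \<forall>s\<in>Nx. s \<in> plaque B q \<longleftrightarrow> s \<in> plaque (bw ix) q"
      using W.coherent [OF B bw(1) [OF iX(1)] xB subsetD [OF site_bw st(1)]] by metis
    obtain Ny where Ny: "openin (top_of_set X) Ny" "y \<in> Ny"
      "\<forall>q\<in>Ny. \<forall>s\<in>Ny. s \<in> plaque B' q \<longleftrightarrow> s \<in> plaque (bw iy) q"
      using W.coherent [OF B' bw(1) [OF iX(2)] yB' subsetD [OF site_bw st(2)]] by metis
    obtain \<delta>x where \<delta>x: "0 < \<delta>x" "\<forall>q\<in>plaque B x. norm (bmap B q - ?u) < \<delta>x \<longrightarrow>
        norm (?\<phi> q - ?\<phi> x - ?Dx (bmap B q - ?u)) \<le> e1 * norm (bmap B q - ?u)"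
      using W.first_order [OF B cx(1) xBc e1(1)] by blast
    obtain \<delta>y where \<delta>y: "0 < \<delta>y" "\<forall>q\<in>plaque B' y. norm (bmap B' q - ?u') < \<delta>y \<longrightarrow>
        norm (?\<psi> q - ?\<psi> y - ?Dy (bmap B' q - ?u')) \<le> e1 * norm (bmap B' q - ?u')"
      using W.first_order [OF B' cy(1) yBc e1(1)] by blast
    define d0 where "d0 = min (min \<delta> \<delta>2) \<rho>"
    have d0: "0 < d0" "d0 \<le> \<delta>" "d0 \<le> \<delta>2" "d0 \<le> \<rho>" using \<delta> \<delta>2 b.\<rho>0 by (auto simp: d0_def)
    \<comment> \<open>\<open>U0\<close> and \<open>U1\<close> are neighbourhoods in \<open>X\<close> in which all approximations hold. The continuity of the
      holonomy for the leaf topologies makes \<open>H z\<close> return to the plaque of \<open>y\<close>.\<close>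
    define U0 where "U0 = Nx \<inter> {q \<in> site ix. dist (?\<phi> x) (?\<phi> q) < d0}"
    define O' where "O' = ball ?u' \<delta>y \<inter> bmap B' ` bdom B'"
    define U1 where "U1 = (Ny \<inter> {q \<in> site iy. dist (?\<psi> y) (?\<psi> q) < d0}) \<inter> binv B' ` O'"
    have "openin (top_of_set X) (binv B' ` O')"
      by (rule W.openin_binv_image [OF B']) (auto simp: O'_def intro!: open_Int W.open_image [OF B'])
    then have U: "openin (top_of_set X) U0" "openin (top_of_set X) U1"
      unfolding U0_def U1_def by (intro openin_Int Nx(1) Ny(1) openin_near iX st; assumption)+
    have xU0: "x \<in> U0" using Nx(2) st(1) d0(1) by (simp add: U0_def)
    have "?u' \<in> O'" using \<delta>y(1) yB' by (simp add: O'_def)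
    then have "binv B' ?u' \<in> binv B' ` O'" by (rule imageI)
    then have yU1: "y \<in> U1" using Ny(2) st(2) d0(1) W.binv_bmap [OF B' yB'] by (simp add: U1_def)
    let ?Q = "U1 \<inter> plaque B' y"
    have Q: "openin TW ?Q" by (intro openin_Int W.openin_leaf_finer U(2) W.openin_plaque B' yB')
    have top: "topspace (subtopology TW N) = N" using openin_subset [OF N(1)] by auto
    have "continuous_map (subtopology TW N) TW (\<sigma> 1)" using s(4) by simp
    then have "openin (subtopology TW N) {z \<in> N. \<sigma> 1 z \<in> ?Q}"
      using openin_continuous_map_preimage [OF _ Q] top by metis
    then have pre: "openin TW {z \<in> N. \<sigma> 1 z \<in> ?Q}" using N(1) openin_trans_full by blast
    define S where "S = N' \<inter> U0 \<inter> {z \<in> N. \<sigma> 1 z \<in> ?Q}"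
    have "openin TW S" unfolding S_def by (intro openin_Int N'(1) W.openin_leaf_finer U(1) pre)
    then have "W.leaf_open S" by (simp add: W.openin_leaf_topology)
    moreover have "x \<in> S"
      using N'(2) xU0 N(2) s(1) Hx yU1 W.plaque_refl [OF B' yB'] by (simp add: S_def)
    ultimately obtain Ox where Ox: "open Ox" "x \<in> Ox" "plaque B x \<inter> Ox \<subseteq> S"
      using W.leaf_openD [OF _ _ B xB] by metis
    have "open (bmap B ` (bdom B \<inter> (X \<inter> Ox)))" by (intro W.open_image_Int [OF B] openin_open_Int Ox(1))
    moreover have "?u \<in> bmap B ` (bdom B \<inter> (X \<inter> Ox))" using xB x Ox(2) by blast
    ultimately obtain d1 where d1: "0 < d1" "ball ?u d1 \<subseteq> bmap B ` (bdom B \<inter> (X \<inter> Ox))"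
      using open_contains_ball by metis
    have est: "norm (bmap B' (H (binv B (?u + a))) - bmap B' (H (binv B (?u + 0))) - M (a - 0)) \<le> e * norm (a - 0)"
      if a: "a \<in> ?L" "norm a < min d1 \<delta>x" for a
    proof (cases "a = 0")
      case True then show ?thesis by (simp add: linear_0 [OF M_lin])
    next
      case False
      have "?u + a \<in> ball ?u d1" using a(2) by (simp add: dist_norm)
      then obtain z where z: "z \<in> bdom B" "z \<in> Ox" "?u + a = bmap B z" using d1(2) by blast
      have za: "bmap B z - ?u = a" using z(3) by (simp add: algebra_simps)
      have zp: "z \<in> plaque B x" using z(1) za a(1) by (simp add: W.plaque_iff)
      have zS: "z \<in> S" using Ox(3) zp z(2) by blast
      define z' where "z' = H z"
      define b where "b = bmap B' z' - ?u'"
      have z'Q: "z' \<in> U1" "z' \<in> plaque B' y" using zS s(1) by (auto simp: S_def z'_def)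
      have zU0: "z \<in> U0" using zS by (simp add: S_def)
      have bL: "b \<in> ?L'" using z'Q(2) by (simp add: b_def W.plaque_iff)
      have b\<delta>: "norm b < \<delta>y"
      proof -
        obtain o' where "o' \<in> O'" "z' = binv B' o'" using z'Q(1) by (auto simp: U1_def)
        then show ?thesis using W.bmap_binv [OF B'] by (auto simp: O'_def b_def dist_norm norm_minus_commute)
      qed
      have zs: "z \<in> site ix" "samew ix x z" "norm (?\<phi> z - ?\<phi> x) < d0"
        using zU0 zp Nx(2,3) by (auto simp: U0_def samew_def dist_norm norm_minus_commute)
      have z's: "z' \<in> site iy" "samew iy y z'" "norm (?\<psi> z' - ?\<psi> y) < d0"
        using z'Q Ny(2,3) by (auto simp: U1_def samew_def dist_norm norm_minus_commute)
      have "z \<noteq> x" using za False by auto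
      then have ne: "?\<phi> z \<noteq> ?\<phi> x" using W.cmap_inj [OF cx(1) _ cx(2)] zs(1) site_cdom by blast
      obtain v where v: "v \<in> E x" "norm (?\<phi> z - ?\<phi> x - ?tx v) \<le> K * norm (?\<phi> z - ?\<phi> x) powr (1 + \<beta>)"
        using b.u.plaque_taylor [OF ix(1) K2(1) zs(1) _ zs(2)] zs(3) d0(4) by auto
      obtain w where w: "w \<in> E y" "norm (?\<psi> z' - ?\<psi> y - ?ty w) \<le> K * norm (?\<psi> z' - ?\<psi> y) powr (1 + \<beta>)"
        using b.u.plaque_taylor [OF iy(1) K2(2) z's(1) _ z's(2)] z's(3) d0(4) by auto
      have wT: "norm (w - ?T v) \<le> e1 * norm (?\<phi> z - ?\<phi> x)"
      proof -
        have "b.u.approx ix x z v" "b.u.approx iy y z' w" using v w by (auto simp: b.u.approx_def)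
        moreover have "(z, z') \<in> b.near ^^ n" using N'(4) zS by (simp add: z'_def S_def)
        ultimately show ?thesis
          using zs z's ne d0(2)
          by (intro mp [OF hol [THEN spec [of _ z], THEN spec [of _ z'], THEN spec [of _ v], THEN spec [of _ w]]])
            simp
      qed
      have pa: "proj ?L a = a" by (rule proj_id [OF L a(1)])
      have "norm (?Dy b - G a) \<le> 50 * C ^ 5 * e1 * norm a"
      proof (rule first_order_comparison [OF C(1) e1(1,2)])
        show "norm (?\<phi> z - ?\<phi> x - ?Dx a) \<le> e1 * norm a" using \<delta>x(2) zp a(2) za by auto
        show "norm (?Dx a) \<le> C * norm a" using le [OF c1(2) C(2)] by simp
        show "norm (?\<phi> z - ?\<phi> x - ?tx v) \<le> e1 * norm (?\<phi> z - ?\<phi> x)"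
          using v(2) sm [of "norm (?\<phi> z - ?\<phi> x)"] zs(3) d0(3) by simp
        show "norm v \<le> C * norm (?tx v)" by (rule b2)
        show "norm (v - va a) \<le> C * norm (?tx v - ?Dx a)"
          using b2 [of "v - va a"] by (simp add: linear_diff [OF tx(1)] va pa)
        show "norm (?\<psi> z' - ?\<psi> y - ?Dy b) \<le> e1 * norm b" using \<delta>y(2) z'Q(2) b\<delta> by (simp add: b_def)
        show "norm b \<le> C * norm (?Dy b)" by (rule b3 [OF bL])
        show "norm (?\<psi> z' - ?\<psi> y - ?ty w) \<le> e1 * norm (?\<psi> z' - ?\<psi> y)"
          using w(2) sm [of "norm (?\<psi> z' - ?\<psi> y)"] z's(3) d0(3) by simp
        show "norm (?ty w) \<le> C * norm w" using le [OF c4(2) C(5)] by simp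
        show "norm (?ty w - G a) \<le> C * norm (w - ?T (va a))"
          using le [OF c4(2) C(5), of "w - ?T (va a)"] by (simp add: G_def linear_diff [OF ty(1)])
        show "norm (w - ?T v) \<le> e1 * norm (?\<phi> z - ?\<phi> x)" by (rule wT)
        show "norm (?T v) \<le> C * norm v" using le [OF c5(2) [OF v(1)] C(6)] by simp
        show "norm (?T v - ?T (va a)) \<le> C * norm (v - va a)"
          using le [OF c5(2) [OF subspace_diff [OF Ex v(1) va(1)]] C(6)] by (simp add: Tdiff v(1) va(1))
      qed
      then have "C * norm (?Dy (b - M a)) \<le> C * (50 * C ^ 5 * e1 * norm a)"
        using C(1) by (intro mult_left_mono) (auto simp: linear_diff [OF Dy] M)
      moreover have "norm (b - M a) \<le> C * norm (?Dy (b - M a))" by (rule b3 [OF subspace_diff [OF L' bL M(1)]])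
      moreover have "C * (50 * C ^ 5 * e1 * norm a) = 50 * C ^ 6 * e1 * norm a" by (simp add: eval_nat_numeral)
      moreover have "\<dots> \<le> e * norm a" using e1(3) by (rule mult_right_mono) simp
      ultimately have "norm (b - M a) \<le> e * norm a" by linarith
      moreover have "binv B (?u + a) = z" using z W.binv_bmap [OF B] by simp
      moreover have "binv B ?u = x" using W.binv_bmap [OF B xB] .
      ultimately show ?thesis by (simp add: b_def z'_def Hx)
    qed
    show "\<exists>d>0. \<forall>a\<in>?L. norm (a - 0) < d \<longrightarrow>
        norm (bmap B' (H (binv B (?u + a))) - bmap B' (H (binv B (?u + 0))) - M (a - 0)) \<le> e * norm (a - 0)"
      using est d1(1) \<delta>x(1) by (intro exI [of _ "min d1 \<delta>x"]) auto
  qed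
  then show "\<exists>M. ((\<lambda>a. bmap B' (H (binv B (bmap B x + a)))) has_derivative M) (at 0 within ?L) \<and>
      (\<forall>a\<in>?L. M a \<in> ?L' \<and> ?T (leaf_tangent \<A> B x a) = leaf_tangent \<A> B' (H x) (M a))"
    using M(1) tangent by blast
qed

text \<open>At other points of the domain of a holonomy the same germ of motion is a holonomy there, so
  differentiability at \<open>x\<close> gives it everywhere.\<close>

theorem holonomy_differentiable:
  assumes x: "x \<in> X" and y: "y \<in> leaf \<W>s x"
  shows "(\<forall>v\<in>E x. convergent (cocycle_holonomy_seq \<A> E f I x y v)) \<and>
    (\<exists>N H. local_holonomy \<W> \<W>s \<V> x y N H) \<and>
    (\<forall>N H. local_holonomy \<W> \<W>s \<V> x y N H \<longrightarrow>
      (\<forall>z\<in>N. \<exists>T. leaf_has_derivative \<A> \<W> H z T) \<and>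
      leaf_has_derivative \<A> \<W> H x (cocycle_holonomy \<A> E f I x y))"
proof (intro conjI ballI allI impI)
  fix v assume v: "v \<in> E x"
  obtain L where xy: "(x, y) \<in> b.near ^^ L" using leaf_chain [OF x y] .
  obtain n1 C where lim: "(\<lambda>n. b.Hseq x y n v) \<longlonglongrightarrow> b.Hol x y v"
    using b.Hol_limit [OF x xy] v by metis
  then show "convergent (cocycle_holonomy_seq \<A> E f I x y v)"
    unfolding cocycle_holonomy_Hol(1) by (rule convergentI)
next
  show "\<exists>N H. local_holonomy \<W> \<W>s \<V> x y N H" by (rule local_holonomy_exists [OF x y])
next
  fix N H assume h: "local_holonomy \<W> \<W>s \<V> x y N H"
  show "leaf_has_derivative \<A> \<W> H x (cocycle_holonomy \<A> E f I x y)"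
    unfolding cocycle_holonomy_Hol(2) by (rule holonomy_has_derivative [OF x h])
  fix z assume z: "z \<in> N"
  have "z \<in> leaf \<W> x" using h z by (auto simp: local_holonomy_def)
  then have zX: "z \<in> X" and eq: "leaf \<W> z = leaf \<W> x" using W.leaf_subset [OF x] W.leaf_eq by auto
  have "local_holonomy \<W> \<W>s \<V> z (H z) N H"
  proof -
    from h obtain \<sigma> where N: "openin TW N" "x \<in> N" "N \<subseteq> leaf \<W> x" and Hx: "H x = y"
      and s: "\<forall>z\<in>N. \<sigma> 0 z = z \<and> \<sigma> 1 z = H z"
        "\<forall>t\<in>{0..1}. \<forall>z\<in>N. \<sigma> t z \<in> leaf \<W>s z \<inter> leaf \<W> (\<sigma> t x)"
        "\<forall>z\<in>N. continuous_map TI TWs (\<lambda>t. \<sigma> t z)"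
        "\<forall>t\<in>{0..1}. continuous_map (subtopology TW N) TW (\<sigma> t)"
        "continuous_map (prod_topology TI (subtopology TW N)) TV (\<lambda>(t, z). \<sigma> t z)"
      by (rule local_holonomyE)
    have "leaf \<W> (\<sigma> t z) = leaf \<W> (\<sigma> t x)" if "t \<in> {0..1}" for t
      using W.leaf_eq s(2) that z by blast
    then have "\<forall>t\<in>{0..1}. \<forall>z'\<in>N. \<sigma> t z' \<in> leaf \<W>s z' \<inter> leaf \<W> (\<sigma> t z)" using s(2) by simp
    then show ?thesis
      unfolding local_holonomy_def using N z eq s(1,3-5) by (intro conjI exI [of _ \<sigma>]) simp_all
  qed
  then show "\<exists>T. leaf_has_derivative \<A> \<W> H z T" using holonomy_has_derivative [OF zX] by blast
qed

end

text \<open>Rates on unit vectors are rates on all nonzero vectors, by homogeneity.\<close>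

lemma (in leaf_dynamics) metric_normalize:
  assumes g: "continuous_metric X \<A> TB g" and p: "p \<in> X" and v: "v \<in> TB p" "v \<noteq> 0"
  obtains u where "u \<in> TB p" "metric_norm g p u = 1"
    "metric_norm g (f p) (mderiv \<A> f p v) = metric_norm g p v * metric_norm g (f p) (mderiv \<A> f p u)"
proof -
  let ?c = "metric_norm g p v" and ?u = "(1 / metric_norm g p v) *\<^sub>R v"
  have c: "0 < ?c" by (rule metric_norm_pos [OF g p v])
  have u: "?u \<in> TB p" using subspace_scale [OF subspace_TB [OF p] v(1)] .
  show ?thesis
  proof (rule that [OF u])
    show "metric_norm g p ?u = 1" using metric_norm_triangle(2) [OF g p v(1) v(1), of "1 / ?c"] c by simp
    have "mderiv \<A> f p v = ?c *\<^sub>R mderiv \<A> f p ?u"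
      using c linear_scale [OF linear_mderiv [OF p], of ?c ?u] by simp
    then show "metric_norm g (f p) (mderiv \<A> f p v) = ?c * metric_norm g (f p) (mderiv \<A> f p ?u)"
      using metric_norm_triangle(2) [OF g f_X [OF p] mderiv_TB [OF p u] mderiv_TB [OF p u], of ?c] c by simp
  qed
qed

lemma (in leaf_dynamics) metric_norm_zero:
  assumes g: "continuous_metric X \<A> TB g" and p: "p \<in> X"
  shows "metric_norm g p 0 = 0" "metric_norm g (f p) (mderiv \<A> f p 0) = 0"
proof -
  have z: "metric_norm g q 0 = 0" if "q \<in> X" for q
    using metric_norm_triangle(2) [OF g that subspace_0 [OF subspace_TB [OF that]] subspace_0 [OF subspace_TB [OF that]], of 0]
    by simp
  then show "metric_norm g p 0 = 0" "metric_norm g (f p) (mderiv \<A> f p 0) = 0"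
    using p f_X [OF p] linear_0 [OF linear_mderiv [OF p]] by simp_all
qed

theorem lemma4p3:
  fixes X :: "'a::t2_space set"
    and \<A> :: "('a, 'e::euclidean_space) chart set"
    and f :: "'a \<Rightarrow> 'a"
    and \<W> \<W>s \<V> :: "('a, 'e) fbox set"
    and k l :: nat
    and gE gEs :: "'a \<Rightarrow> 'e \<Rightarrow> 'e \<Rightarrow> real"
    and I :: "'a \<Rightarrow> 'a \<Rightarrow> 'e \<Rightarrow> 'e"
    and \<beta> \<nu> \<gamma> \<gamma>h :: real
    and x y :: 'a
  assumes beta: "0 < \<beta>" "\<beta> < 1"
    and X: "compact_manifold X \<A>"
    and f: "C1_holder_diffeo \<beta> X \<A> f"
    and W: "foliated_atlas X k \<W>" "uniformly_C1_holder_leaves \<beta> X \<A> \<W>"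
           "invariant_foliation X f \<W>"
    and Ws: "foliated_atlas X l \<W>s" "uniformly_C1_holder_leaves \<beta> X \<A> \<W>s"
            "invariant_foliation X f \<W>s"
    and transv: "transverse X \<A> \<W> \<W>s"
    and V: "foliated_atlas X (k + l) \<V>" "integrate_to X \<W> \<W>s \<V>"
    and metrics: "continuous_metric X \<A> (tangent_bundle \<A> \<W>) gE" "continuous_metric X \<A> (tangent_bundle \<A> \<W>s) gEs"
    and constants: "\<nu> < 1" "1 < inverse \<gamma>"
    and rate_s: "\<And>p v. p \<in> X \<Longrightarrow> v \<in> tangent_bundle \<A> \<W>s p \<Longrightarrow> metric_norm gEs p v = 1 \<Longrightarrow>
                   metric_norm gEs (f p) (mderiv \<A> f p v) < \<nu>"
    and rate_u: "\<And>p v. p \<in> X \<Longrightarrow> v \<in> tangent_bundle \<A> \<W> p \<Longrightarrow> metric_norm gE p v = 1 \<Longrightarrow>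
                   inverse \<gamma> < metric_norm gE (f p) (mderiv \<A> f p v) \<and>
                   metric_norm gE (f p) (mderiv \<A> f p v) < \<gamma>h"
    and E_holder: "holder_subbundle \<beta> X \<A> (tangent_bundle \<A> \<W>)"
    and bunching: "\<gamma>h * \<gamma> * \<nu> powr (\<beta> / (1 + \<beta>)) < 1" "\<gamma>h * \<gamma> powr (1 + \<beta>) < 1"
    and I: "holder_identifications \<beta> X \<A> (tangent_bundle \<A> \<W>) I"
    and xy: "x \<in> X" "y \<in> leaf \<W>s x"
  shows "(\<forall>v\<in>tangent_bundle \<A> \<W> x.
             convergent (cocycle_holonomy_seq \<A> (tangent_bundle \<A> \<W>) f I x y v)) \<and>
         (\<exists>N H. local_holonomy \<W> \<W>s \<V> x y N H) \<and>
         (\<forall>N H. local_holonomy \<W> \<W>s \<V> x y N H \<longrightarrow>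
           (\<forall>z\<in>N. \<exists>T. leaf_has_derivative \<A> \<W> H z T) \<and>
           leaf_has_derivative \<A> \<W> H x
             (cocycle_holonomy \<A> (tangent_bundle \<A> \<W>) f I x y))"
proof -
  have C1: "C1_holder_map \<beta> X \<A> f" using f by (simp add: C1_holder_diffeo_def)
  have inv: "f ` leaf \<W> p \<subseteq> leaf \<W> (f p)" "f ` leaf \<W>s p \<subseteq> leaf \<W>s (f p)" if "p \<in> X" for p
    using W(3) Ws(3) that by (auto simp: invariant_foliation_def)
  interpret W: leaf_dynamics X \<A> \<beta> f k \<W> by unfold_locales (fact X C1 beta(1) W(1,2) inv(1))+
  interpret Ws: leaf_dynamics X \<A> \<beta> f l \<W>s by unfold_locales (fact beta(1) Ws(1,2) inv(2))+
  let ?E = "tangent_bundle \<A> \<W>" and ?Es = "tangent_bundle \<A> \<W>s" and ?b = "\<beta> / (1 + \<beta>)"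
  have gamma: "0 < \<gamma>" "\<gamma> < 1" using constants(2) by (simp_all add: one_less_inverse_iff)
  have up: "metric_norm gE p v \<le> \<gamma> * metric_norm gE (f p) (mderiv \<A> f p v) \<and>
      metric_norm gE (f p) (mderiv \<A> f p v) \<le> \<gamma>h * metric_norm gE p v \<and> 0 < \<gamma>h"
    if p: "p \<in> X" and v: "v \<in> ?E p" "v \<noteq> 0" for p v
  proof -
    obtain u where u: "u \<in> ?E p" "metric_norm gE p u = 1"
      "metric_norm gE (f p) (mderiv \<A> f p v) = metric_norm gE p v * metric_norm gE (f p) (mderiv \<A> f p u)"
      using W.metric_normalize [OF metrics(1) p v] by metis
    note r = rate_u [OF p u(1,2)] and c = W.metric_norm_pos [OF metrics(1) p v]
    have "1 \<le> \<gamma> * metric_norm gE (f p) (mderiv \<A> f p u)" using r gamma by (simp add: field_simps)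
    then have "metric_norm gE p v * 1 \<le> metric_norm gE p v * (\<gamma> * metric_norm gE (f p) (mderiv \<A> f p u))"
      using c by (intro mult_left_mono) auto
    moreover have "metric_norm gE p v * metric_norm gE (f p) (mderiv \<A> f p u) \<le> metric_norm gE p v * \<gamma>h"
      using c r by (intro mult_left_mono) auto
    moreover have "0 < \<gamma>h" using r constants(2) by linarith
    ultimately show ?thesis using u(3) by (simp add: mult_ac)
  qed
  have down: "metric_norm gEs (f p) (mderiv \<A> f p v) \<le> \<nu> * metric_norm gEs p v \<and> 0 < \<nu>"
    if p: "p \<in> X" and v: "v \<in> ?Es p" "v \<noteq> 0" for p v
  proof -
    obtain u where u: "u \<in> ?Es p" "metric_norm gEs p u = 1"
      "metric_norm gEs (f p) (mderiv \<A> f p v) = metric_norm gEs p v * metric_norm gEs (f p) (mderiv \<A> f p u)"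
      using Ws.metric_normalize [OF metrics(2) p v] by metis
    note r = rate_s [OF p u(1,2)] and c = Ws.metric_norm_pos [OF metrics(2) p v]
    have "metric_norm gEs p v * metric_norm gEs (f p) (mderiv \<A> f p u) \<le> metric_norm gEs p v * \<nu>"
      using c r by (intro mult_left_mono) auto
    moreover have "0 < \<nu>"
      using r Ws.metric_norm_nonneg [OF metrics(2) W.f_X [OF p] Ws.mderiv_TB [OF p u(1)]] by linarith
    ultimately show ?thesis using u(3) by (simp add: mult_ac)
  qed
  \<comment> \<open>If \<open>\<W>\<close> or \<open>\<W>s\<close> has leaves of dimension \<open>0\<close>, the rates say nothing about \<open>\<gamma>h\<close> or \<open>\<nu>\<close>, which may
    then be negative. They are replaced by \<open>0\<close> and by a positive number that is small enough.\<close>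
  obtain g where g: "0 \<le> g" "g = \<gamma>h \<or> g = 0"
    "\<And>p v. p \<in> X \<Longrightarrow> v \<in> ?E p \<Longrightarrow> metric_norm gE (f p) (mderiv \<A> f p v) \<le> g * metric_norm gE p v"
  proof (cases "\<exists>p\<in>X. \<exists>v\<in>?E p. v \<noteq> 0")
    case True
    have "metric_norm gE (f p) (mderiv \<A> f p v) \<le> \<gamma>h * metric_norm gE p v" if "p \<in> X" "v \<in> ?E p" for p v
      using up [OF that] W.metric_norm_zero [OF metrics(1) that(1)] by (cases "v = 0") auto
    then show ?thesis using that [of \<gamma>h] True up by fastforce
  next
    case False
    have "metric_norm gE (f p) (mderiv \<A> f p v) \<le> 0 * metric_norm gE p v" if "p \<in> X" "v \<in> ?E p" for p v
      using False that W.metric_norm_zero [OF metrics(1) that(1)] by (cases "v = 0") auto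
    then show ?thesis using that [of 0] by simp
  qed
  obtain \<nu>0 where \<nu>0: "0 < \<nu>0" "\<nu>0 < 1" "g * \<gamma> * \<nu>0 powr ?b < 1"
    "\<And>p v. p \<in> X \<Longrightarrow> v \<in> ?Es p \<Longrightarrow> metric_norm gEs (f p) (mderiv \<A> f p v) \<le> \<nu>0 * metric_norm gEs p v"
  proof (cases "\<exists>p\<in>X. \<exists>v\<in>?Es p. v \<noteq> 0")
    case True
    have 1: "metric_norm gEs (f p) (mderiv \<A> f p v) \<le> \<nu> * metric_norm gEs p v" if "p \<in> X" "v \<in> ?Es p" for p v
      using down [OF that] Ws.metric_norm_zero [OF metrics(2) that(1)] by (cases "v = 0") auto
    have 2: "0 < \<nu>" using True down by blast
    have 3: "g * \<gamma> * \<nu> powr ?b < 1" using g(2) bunching(1) by auto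
    show ?thesis by (rule that [OF 2 constants(1) 3 1])
  next
    case False
    let ?c = "1 / (2 + g * \<gamma>)"
    have gg: "0 \<le> g * \<gamma>" using g(1) gamma by simp
    then have c: "0 < ?c" "?c < 1" by (auto simp: field_simps)
    show ?thesis
    proof (rule that [of "?c powr (1 / ?b)"])
      show "0 < ?c powr (1 / ?b)" using c by simp
      show "?c powr (1 / ?b) < 1" using powr_less_mono2 [of "1 / ?b" ?c 1] beta c by simp
      have "(?c powr (1 / ?b)) powr ?b = ?c" using beta c by (simp add: powr_powr)
      moreover have "g * \<gamma> * ?c < 1" using gg by (simp add: field_simps)
      ultimately show "g * \<gamma> * (?c powr (1 / ?b)) powr ?b < 1" by (simp only:)
      show "metric_norm gEs (f p) (mderiv \<A> f p v) \<le> ?c powr (1 / ?b) * metric_norm gEs p v" if "p \<in> X" "v \<in> ?Es p" for p v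
        using False that Ws.metric_norm_zero [OF metrics(2) that(1)] by (cases "v = 0") auto
    qed
  qed
  have low: "metric_norm gE p v \<le> \<gamma> * metric_norm gE (f p) (mderiv \<A> f p v)" if "p \<in> X" "v \<in> ?E p" for p v
    using up [OF that] W.metric_norm_zero [OF metrics(1) that(1)] by (cases "v = 0") auto
  interpret P: partially_hyperbolic X \<A> \<beta> f k l \<W> \<W>s gE gEs I \<nu>0 \<gamma> g
    by unfold_locales (fact metrics I \<nu>0 g(1,3) low gamma less_imp_le [OF beta(2)])+
  obtain J \<rho> K \<nu>' \<gamma>' g' \<kappa> r where J: "J \<subseteq> X" and bunched:
    "bunched X f J P.site P.site1 P.site2 (\<lambda>i. cmap (P.ch i)) (\<lambda>i. tcoord \<A> (P.ch i)) (mderiv \<A> f)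
      (\<lambda>i j. W.fder (P.ch i) (P.ch j)) \<rho> K \<beta> ?E (metric_norm gE) P.samew ?Es (metric_norm gEs) P.sames I
      \<nu>0 \<gamma> g \<nu>' \<gamma>' g' \<kappa> r"
    by (rule P.bunched_exists)
  have "foliation X (k + l) \<V>" by (rule foliation.intro [OF V(1)])
  then have "joint_foliation X k l (k + l) \<W> \<W>s \<V>"
    by (intro joint_foliation.intro joint_foliation_axioms.intro W.foliation_axioms Ws.foliation_axioms V(2))
  then have "hyperbolic_holonomy X \<A> \<beta> f k l (k + l) \<W> \<W>s \<V> gE gEs I \<nu>0 \<gamma> g J \<rho> K \<nu>' \<gamma>' g' \<kappa> r"
    by (intro hyperbolic_holonomy.intro hyperbolic_holonomy_axioms.intro P.partially_hyperbolic_axioms J bunched)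
  then show ?thesis by (rule hyperbolic_holonomy.holonomy_differentiable [OF _ xy])
qed

end
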